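(* Let $\mathbb{K}=\mathbb{R}$ or $\mathbb{C}$, and let $(X,\mathcal{O}_X)$ be an algebraic scheme over $\mathbb{K}$ with a Poisson bracket $q:\mathcal{O}_X\times\mathcal{O}_X\to\mathcal{O}_X$. Let an algebraic group $G$ with Lie algebra $\mathfrak{g}$ act algebraically on $X$ so that $q$ is $G$-covariant. Let $J:X\to\mathfrak{g}^{\ast}$ be an algebraic momentum map which is equivariant with respect to the coadjoint action of $G$ on $\mathfrak{g}^*$ and such that the action is hamiltonian, i.e. for every $v\in\mathfrak{g}$ and every $a\in\mathcal{O}_X$, $$q(\langle v,J\rangle,a)=\mathrm{d}_GA(v)(a).$$ Let $Y=J^{-1}(0)$ be the constraint locus. Then $q$ descends to a biderivation $q_{\mathrm{red}}$ on $X_{\mathrm{red}}=Y/G$, that is, there is a biderivation $q_{\mathrm{red}}:\mathcal{O}_{Y/G}\times\mathcal{O}_{Y/G}\to\mathcal{O}_{Y/G}$ satisfying $q_{\mathrm{red}}(a|_Y,b|_Y)=q(a,b)|_Y$ for all $a,b\in\mathcal{O}_{X/G}$, and $q_{\mathrm{red}}$ is a Poisson bracket.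
   Context: A biderivation is a $\mathbb{K}$-bilinear map that is a derivation in each argument. A Poisson bracket is a skew-symmetric biderivation satisfying the Jacobi identity. $G$-covariance of $q$ means that $q(g^*a,g^*b)=g^*q(a,b)$ for all $g\in G$. $\mathcal{O}_{X/G}$ denotes the subsheaf of $\mathcal{O}_X$ of $G$-invariant germs, regarded as a sheaf of algebras on the orbit space $X/G$; since $q$ is $G$-covariant it restricts to a bracket on $\mathcal{O}_{X/G}$. For $v\in\mathfrak{g}$, $\langle v,J\rangle\in\mathcal{O}_X$ is the corresponding component of $J$. $(J)\subset\mathcal{O}_X$ is the ideal generated by the coordinates of $J$; $Y=J^{-1}(0)$ is the closed subscheme with structure sheaf $\mathcal{O}_Y=\mathcal{O}_X/(J)$. By equivariance, $(J)$ is $G$-invariant. $A:X\times G\to X$ denotes the group action and $\mathrm{d}_GA:\mathfrak{g}\to\Gamma(T(X))$ its tangent map (infinitesimal action), so that $\mathrm{d}_GA(v)$ is a vector field tangent to the $G$-orbits. $\mathcal{O}_{Y/G}$ is the sheaf of algebras of $G$-invariant functions restricted to the constraint locus, i.e. the image of $\mathcal{O}_{X/G}$ in $\mathcal{O}_Y=\mathcal{O}_X/(J)$; $a|_Y$ denotes the image of $a$. *)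

theory Defs
  imports Complex_Main "HOL-Analysis.Abstract_Topology" "HOL-Algebra.Module"
    "HOL-Algebra.Ideal" "HOL-Algebra.Generated_Rings"
begin

section \<open>Algebras over the ground field\<close>

text \<open>
  The ground field is a set \<open>K\<close> of complex numbers, either \<open>\<real>\<close> or \<open>UNIV\<close>. Algebras are records of
  HOL-Algebra satisfying the locale predicate \<^locale>\<open>algebra\<close>; the zero algebra is allowed.
\<close>

definition scalars :: "complex set \<Rightarrow> complex ring" where
  "scalars K = \<lparr>carrier = K, mult = (*), one = 1, zero = 0, add = (+)\<rparr>"

definition alg_hom ::
  "complex set \<Rightarrow> (complex, 'a) module \<Rightarrow> (complex, 'b) module \<Rightarrow> ('a \<Rightarrow> 'b) \<Rightarrow> bool" where
  "alg_hom K A B h \<longleftrightarrow> h \<in> ring_hom A B \<and>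
     (\<forall>k\<in>K. \<forall>a\<in>carrier A. h (k \<odot>\<^bsub>A\<^esub> a) = k \<odot>\<^bsub>B\<^esub> h a)"

definition fin_gen_algebra :: "complex set \<Rightarrow> (complex, 'a) module \<Rightarrow> bool" where
  "fin_gen_algebra K A \<longleftrightarrow> (\<exists>S \<subseteq> carrier A. finite S \<and>
     carrier A = generate_ring A (S \<union> (\<lambda>k. k \<odot>\<^bsub>A\<^esub> \<one>\<^bsub>A\<^esub>) ` K))"

definition is_localization ::
  "(complex, 'a) module \<Rightarrow> 'a \<Rightarrow> (complex, 'b) module \<Rightarrow> ('a \<Rightarrow> 'b) \<Rightarrow> bool" where
  "is_localization A f B h \<longleftrightarrow> h \<in> ring_hom A B \<and> h f \<in> Units B \<and>
     (\<forall>b\<in>carrier B. \<exists>a\<in>carrier A. \<exists>n::nat. b \<otimes>\<^bsub>B\<^esub> (h f [^]\<^bsub>B\<^esub> n) = h a) \<and>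
     (\<forall>a\<in>carrier A. h a = \<zero>\<^bsub>B\<^esub> \<longrightarrow> (\<exists>n::nat. (f [^]\<^bsub>A\<^esub> n) \<otimes>\<^bsub>A\<^esub> a = \<zero>\<^bsub>A\<^esub>))"

definition lin_indep :: "complex set \<Rightarrow> (complex, 'a) module \<Rightarrow> 'a set \<Rightarrow> bool" where
  "lin_indep K M B \<longleftrightarrow> finite B \<and> B \<subseteq> carrier M \<and>
     (\<forall>c \<in> B \<rightarrow> K. (\<Oplus>\<^bsub>M\<^esub>b\<in>B. c b \<odot>\<^bsub>M\<^esub> b) = \<zero>\<^bsub>M\<^esub> \<longrightarrow> (\<forall>b\<in>B. c b = 0))"

text \<open>
  \<open>T\<close> is \<open>A \<otimes>\<^sub>K B\<close> with \<open>\<alpha> a = a \<otimes> 1\<close> and \<open>\<beta> b = 1 \<otimes> b\<close>: elements are sums \<open>\<Sum> \<alpha> a\<^sub>i \<cdot> \<beta> b\<^sub>i\<close>, and such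
  a sum with linearly independent \<open>a\<^sub>i\<close> vanishes only if all \<open>b\<^sub>i\<close> do.
\<close>

definition is_tensor_product ::
  "complex set \<Rightarrow> (complex, 'a) module \<Rightarrow> (complex, 'b) module \<Rightarrow> (complex, 't) module \<Rightarrow>
   ('a \<Rightarrow> 't) \<Rightarrow> ('b \<Rightarrow> 't) \<Rightarrow> bool" where
  "is_tensor_product K A B T \<alpha> \<beta> \<longleftrightarrow> alg_hom K A T \<alpha> \<and> alg_hom K B T \<beta> \<and>
     (\<forall>t\<in>carrier T. \<exists>S \<subseteq> carrier A. finite S \<and>
        (\<exists>c \<in> S \<rightarrow> carrier B. t = (\<Oplus>\<^bsub>T\<^esub>a\<in>S. \<alpha> a \<otimes>\<^bsub>T\<^esub> \<beta> (c a)))) \<and>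
     (\<forall>S. lin_indep K A S \<longrightarrow> (\<forall>c \<in> S \<rightarrow> carrier B.
        (\<Oplus>\<^bsub>T\<^esub>a\<in>S. \<alpha> a \<otimes>\<^bsub>T\<^esub> \<beta> (c a)) = \<zero>\<^bsub>T\<^esub> \<longrightarrow> (\<forall>a\<in>S. c a = \<zero>\<^bsub>B\<^esub>)))"

definition linear_on ::
  "complex set \<Rightarrow> (complex, 'a) module \<Rightarrow> (complex, 'b) module \<Rightarrow> ('a \<Rightarrow> 'b) \<Rightarrow> bool" where
  "linear_on K M N h \<longleftrightarrow> h \<in> carrier M \<rightarrow> carrier N \<and>
     (\<forall>v\<in>carrier M. \<forall>w\<in>carrier M. h (v \<oplus>\<^bsub>M\<^esub> w) = h v \<oplus>\<^bsub>N\<^esub> h w) \<and>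
     (\<forall>k\<in>K. \<forall>v\<in>carrier M. h (k \<odot>\<^bsub>M\<^esub> v) = k \<odot>\<^bsub>N\<^esub> h v)"

text \<open>
  \<open>S\<close> is the symmetric algebra of \<open>M\<close>: it is generated by the image of \<open>\<iota>\<close>, and \<open>\<iota>\<close> maps linearly
  independent families to algebraically independent ones.
\<close>

definition is_symmetric_algebra ::
  "complex set \<Rightarrow> (complex, 'v) module \<Rightarrow> (complex, 'a) module \<Rightarrow> ('v \<Rightarrow> 'a) \<Rightarrow> bool" where
  "is_symmetric_algebra K M S \<iota> \<longleftrightarrow> algebra (scalars K) S \<and> linear_on K M S \<iota> \<and>
     carrier S = generate_ring S (\<iota> ` carrier M \<union> (\<lambda>k. k \<odot>\<^bsub>S\<^esub> \<one>\<^bsub>S\<^esub>) ` K) \<and>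
     (\<forall>B N c. lin_indep K M B \<and> finite N \<and> N \<subseteq> (B \<rightarrow>\<^sub>E (UNIV :: nat set)) \<and> c \<in> N \<rightarrow> K \<and>
        (\<Oplus>\<^bsub>S\<^esub>n\<in>N. c n \<odot>\<^bsub>S\<^esub> (\<Otimes>\<^bsub>S\<^esub>b\<in>B. \<iota> b [^]\<^bsub>S\<^esub> n b)) = \<zero>\<^bsub>S\<^esub> \<longrightarrow> (\<forall>n\<in>N. c n = 0))"


section \<open>Schemes\<close>

text \<open>
  A space with a (pre)sheaf of algebras: \<open>sect X U\<close> is the algebra of sections over the open set \<open>U\<close>
  and \<open>restr X U V\<close> the restriction from \<open>U\<close> to \<open>V\<close>. Only open arguments are meaningful.
\<close>

record ('p, 's) kspace =
  ptop :: "'p topology"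
  sect :: "'p set \<Rightarrow> (complex, 's) module"
  restr :: "'p set \<Rightarrow> 'p set \<Rightarrow> 's \<Rightarrow> 's"

abbreviation pts :: "('p, 's) kspace \<Rightarrow> 'p set" where
  "pts X \<equiv> topspace (ptop X)"

abbreviation opn :: "('p, 's) kspace \<Rightarrow> 'p set \<Rightarrow> bool" where
  "opn X U \<equiv> openin (ptop X) U"

definition sheaf_of_algebras :: "complex set \<Rightarrow> ('p, 's) kspace \<Rightarrow> bool" where
  "sheaf_of_algebras K X \<longleftrightarrow>
     (\<forall>U. opn X U \<longrightarrow> algebra (scalars K) (sect X U)) \<and>
     (\<forall>U V. opn X U \<and> opn X V \<and> V \<subseteq> U \<longrightarrow> alg_hom K (sect X U) (sect X V) (restr X U V)) \<and>
     (\<forall>U. opn X U \<longrightarrow> (\<forall>s\<in>carrier (sect X U). restr X U U s = s)) \<and>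
     (\<forall>U V W. opn X U \<and> opn X V \<and> opn X W \<and> W \<subseteq> V \<and> V \<subseteq> U \<longrightarrow>
        (\<forall>s\<in>carrier (sect X U). restr X V W (restr X U V s) = restr X U W s)) \<and>
     (\<forall>\<U> s. (\<forall>V\<in>\<U>. opn X V \<and> s V \<in> carrier (sect X V)) \<and>
        (\<forall>V\<in>\<U>. \<forall>W\<in>\<U>. restr X V (V \<inter> W) (s V) = restr X W (V \<inter> W) (s W)) \<longrightarrow>
        (\<exists>!t. t \<in> carrier (sect X (\<Union>\<U>)) \<and> (\<forall>V\<in>\<U>. restr X (\<Union>\<U>) V t = s V)))"

text \<open>The germ at \<open>x\<close> of the section \<open>s\<close> over \<open>U\<close> is a unit of the stalk.\<close>

definition invertible_at :: "('p, 's) kspace \<Rightarrow> 'p \<Rightarrow> 'p set \<Rightarrow> 's \<Rightarrow> bool" where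
  "invertible_at X x U s \<longleftrightarrow>
     (\<exists>V. opn X V \<and> x \<in> V \<and> V \<subseteq> U \<and> restr X U V s \<in> Units (sect X V))"

definition zariski :: "(complex, 's) module \<Rightarrow> 's set topology" where
  "zariski A = topology (\<lambda>Z. \<exists>E \<subseteq> carrier A. Z = {P. primeideal P A \<and> \<not> E \<subseteq> P})"

lemma istopology_zariski:
  "istopology (\<lambda>Z. \<exists>E \<subseteq> carrier A. Z = {P. primeideal P A \<and> \<not> E \<subseteq> P})"
proof -
  let ?D = "\<lambda>E. {P. primeideal P A \<and> \<not> E \<subseteq> P}"
  have "\<exists>E \<subseteq> carrier A. ?D E1 \<inter> ?D E2 = ?D E"
    if E1: "E1 \<subseteq> carrier A" and E2: "E2 \<subseteq> carrier A" for E1 E2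
  proof (intro exI conjI)
    let ?E = "{a \<otimes>\<^bsub>A\<^esub> b | a b. a \<in> E1 \<and> b \<in> E2 \<and> a \<otimes>\<^bsub>A\<^esub> b \<in> carrier A}"
    show "?E \<subseteq> carrier A" by blast
    show "?D E1 \<inter> ?D E2 = ?D ?E"
    proof (intro Set.set_eqI iffI)
      fix P assume P: "P \<in> ?D E1 \<inter> ?D E2"
      then interpret primeideal P A by simp
      from P obtain a b where ab: "a \<in> E1" "a \<notin> P" "b \<in> E2" "b \<notin> P" by blast
      with E1 E2 have "a \<in> carrier A" "b \<in> carrier A" by auto
      with ab have "a \<otimes>\<^bsub>A\<^esub> b \<in> ?E" "a \<otimes>\<^bsub>A\<^esub> b \<notin> P" using I_prime by auto
      with P show "P \<in> ?D ?E" by blast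
    next
      fix P assume P: "P \<in> ?D ?E"
      then interpret primeideal P A by simp
      from P obtain a b where "a \<in> E1" "b \<in> E2" "a \<otimes>\<^bsub>A\<^esub> b \<notin> P" by blast
      with E1 E2 have "a \<notin> P" "b \<notin> P" by (auto intro: I_l_closed I_r_closed)
      with \<open>a \<in> E1\<close> \<open>b \<in> E2\<close> P show "P \<in> ?D E1 \<inter> ?D E2" by blast
    qed
  qed
  moreover have "\<exists>E \<subseteq> carrier A. \<Union>\<O> = ?D E"
    if "\<forall>Z\<in>\<O>. \<exists>E \<subseteq> carrier A. Z = ?D E" for \<O>
  proof -
    from that obtain e where e: "\<And>Z. Z \<in> \<O> \<Longrightarrow> e Z \<subseteq> carrier A \<and> Z = ?D (e Z)" by metis
    have "\<Union>\<O> = ?D (\<Union>(e ` \<O>))"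
    proof (intro Set.set_eqI iffI)
      fix P assume "P \<in> \<Union>\<O>"
      then obtain Z where "Z \<in> \<O>" "P \<in> ?D (e Z)" using e by blast
      then show "P \<in> ?D (\<Union>(e ` \<O>))" by blast
    next
      fix P assume "P \<in> ?D (\<Union>(e ` \<O>))"
      then obtain Z where "Z \<in> \<O>" "P \<in> ?D (e Z)" by blast
      then show "P \<in> \<Union>\<O>" using e by blast
    qed
    moreover have "\<Union>(e ` \<O>) \<subseteq> carrier A" using e by blast
    ultimately show ?thesis by blast
  qed
  ultimately show ?thesis unfolding istopology_def by force
qed

text \<open>
  \<open>X \<cong> Spec A\<close> for \<open>A = \<O>\<^sub>X(X)\<close>: sending a point to the prime ideal of the functions vanishing there
  is a homeomorphism onto the prime spectrum, and the sections over a basic open set \<open>D(f)\<close> are the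
  localization \<open>A\<^sub>f\<close>, which determines the structure sheaf.
\<close>

definition affine :: "('p, 's) kspace \<Rightarrow> bool" where
  "affine X \<longleftrightarrow>
     homeomorphic_map (ptop X) (zariski (sect X (pts X)))
       (\<lambda>x. {f \<in> carrier (sect X (pts X)). \<not> invertible_at X x (pts X) f}) \<and>
     (\<forall>f \<in> carrier (sect X (pts X)). let D = {x \<in> pts X. invertible_at X x (pts X) f} in
        is_localization (sect X (pts X)) f (sect X D) (restr X (pts X) D))"

definition open_sub :: "('p, 's) kspace \<Rightarrow> 'p set \<Rightarrow> ('p, 's) kspace" where
  "open_sub X U = X\<lparr>ptop := subtopology (ptop X) U\<rparr>"

definition affine_open :: "('p, 's) kspace \<Rightarrow> 'p set \<Rightarrow> bool" where
  "affine_open X U \<longleftrightarrow> opn X U \<and> affine (open_sub X U)"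

definition scheme :: "complex set \<Rightarrow> ('p, 's) kspace \<Rightarrow> bool" where
  "scheme K X \<longleftrightarrow> sheaf_of_algebras K X \<and> (\<forall>x\<in>pts X. \<exists>U. affine_open X U \<and> x \<in> U)"

text \<open>Algebraic means of finite type over \<open>K\<close>; no separatedness is required.\<close>

definition algebraic_scheme :: "complex set \<Rightarrow> ('p, 's) kspace \<Rightarrow> bool" where
  "algebraic_scheme K X \<longleftrightarrow> scheme K X \<and>
     (\<exists>\<U>. finite \<U> \<and> \<Union>\<U> = pts X \<and>
        (\<forall>U\<in>\<U>. affine_open X U \<and> fin_gen_algebra K (sect X U)))"


section \<open>Morphisms, products, points\<close>

text \<open>
  Morphisms are meaningful only on points of the source, open sets of the target and sections of the
  target, hence the equality relation \<open>mor_eq\<close> below.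
\<close>

record ('p, 's, 'q, 't) kmor =
  pmap :: "'p \<Rightarrow> 'q"
  pull :: "'q set \<Rightarrow> 't \<Rightarrow> 's"

definition pre :: "('p, 's) kspace \<Rightarrow> ('p, 's, 'q, 't) kmor \<Rightarrow> 'q set \<Rightarrow> 'p set" where
  "pre X f V = {x \<in> pts X. pmap f x \<in> V}"

definition morphism ::
  "complex set \<Rightarrow> ('p, 's) kspace \<Rightarrow> ('q, 't) kspace \<Rightarrow> ('p, 's, 'q, 't) kmor \<Rightarrow> bool" where
  "morphism K X Y f \<longleftrightarrow> continuous_map (ptop X) (ptop Y) (pmap f) \<and>
     (\<forall>V. opn Y V \<longrightarrow> alg_hom K (sect Y V) (sect X (pre X f V)) (pull f V)) \<and>
     (\<forall>V W. opn Y V \<and> opn Y W \<and> W \<subseteq> V \<longrightarrow> (\<forall>s\<in>carrier (sect Y V).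
        pull f W (restr Y V W s) = restr X (pre X f V) (pre X f W) (pull f V s))) \<and>
     (\<forall>V. opn Y V \<longrightarrow> (\<forall>s\<in>carrier (sect Y V). \<forall>x\<in>pre X f V.
        invertible_at X x (pre X f V) (pull f V s) \<longrightarrow> invertible_at Y (pmap f x) V s))"

definition mor_eq ::
  "('p, 's) kspace \<Rightarrow> ('q, 't) kspace \<Rightarrow> ('p, 's, 'q, 't) kmor \<Rightarrow> ('p, 's, 'q, 't) kmor \<Rightarrow> bool" where
  "mor_eq X Y f g \<longleftrightarrow> (\<forall>x\<in>pts X. pmap f x = pmap g x) \<and>
     (\<forall>V. opn Y V \<longrightarrow> (\<forall>s\<in>carrier (sect Y V). pull f V s = pull g V s))"

text \<open>\<open>mcomp Y g f\<close> is \<open>g \<circ> f\<close>, where \<open>Y\<close> is the target of \<open>f\<close> and source of \<open>g\<close>.\<close>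

definition mcomp ::
  "('q, 't) kspace \<Rightarrow> ('q, 't, 'r, 'u) kmor \<Rightarrow> ('p, 's, 'q, 't) kmor \<Rightarrow> ('p, 's, 'r, 'u) kmor" where
  "mcomp Y g f = \<lparr>pmap = pmap g \<circ> pmap f, pull = (\<lambda>V s. pull f (pre Y g V) (pull g V s))\<rparr>"

definition mid :: "('p, 's, 'p, 's) kmor" where
  "mid = \<lparr>pmap = id, pull = (\<lambda>V s. s)\<rparr>"

definition spec_field :: "complex set \<Rightarrow> (unit, complex) kspace" where
  "spec_field K = \<lparr>ptop = discrete_topology UNIV,
     sect = (\<lambda>U. if U = {}
       then \<lparr>carrier = {0}, mult = (*), one = 0, zero = 0, add = (+), smult = (*)\<rparr>
       else \<lparr>carrier = K, mult = (*), one = 1, zero = 0, add = (+), smult = (*)\<rparr>),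
     restr = (\<lambda>U V s. if V = {} then 0 else s)\<rparr>"

definition to_spec_field :: "('p, 's) kspace \<Rightarrow> ('p, 's, unit, complex) kmor" where
  "to_spec_field X = (let t = (\<lambda>V. if V = {} then {} else pts X) in
     \<lparr>pmap = (\<lambda>_. ()), pull = (\<lambda>V k. k \<odot>\<^bsub>sect X (t V)\<^esub> \<one>\<^bsub>sect X (t V)\<^esub>)\<rparr>)"

type_synonym ('g, 'a) kpoint = "(unit, complex, 'g, 'a) kmor"

text \<open>
  Group elements \<open>g \<in> G\<close> in covariance, equivariance, invariance and orbits are \<open>K\<close>-rational points; the group
  laws and the axioms of actions are imposed on the schemes themselves.
\<close>

definition K_points :: "complex set \<Rightarrow> ('g, 'a) kspace \<Rightarrow> ('g, 'a) kpoint set" where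
  "K_points K G = {g. morphism K (spec_field K) G g}"

definition const_mor ::
  "complex set \<Rightarrow> ('p, 's) kspace \<Rightarrow> ('g, 'a) kpoint \<Rightarrow> ('p, 's, 'g, 'a) kmor" where
  "const_mor K X g = mcomp (spec_field K) g (to_spec_field X)"

record ('p, 's, 'x, 'd, 'y, 'e) kprod =
  pobj :: "('p, 's) kspace"
  prl :: "('p, 's, 'x, 'd) kmor"
  prr :: "('p, 's, 'y, 'e) kmor"

text \<open>
  The fibre product over \<open>K\<close> by its usual construction: it is covered by the spectra of
  \<open>\<O>\<^sub>X(U) \<otimes>\<^sub>K \<O>\<^sub>Y(V)\<close> for affine open \<open>U\<close> and \<open>V\<close>. This determines it up to unique isomorphism. The universal
  property is not used as definition since HOL cannot quantify over schemes of all types.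
\<close>

definition fibre_product :: "complex set \<Rightarrow> ('x, 'd) kspace \<Rightarrow> ('y, 'e) kspace \<Rightarrow>
   ('p, 's, 'x, 'd, 'y, 'e) kprod \<Rightarrow> bool" where
  "fibre_product K X Y P \<longleftrightarrow> scheme K (pobj P) \<and>
     morphism K (pobj P) X (prl P) \<and> morphism K (pobj P) Y (prr P) \<and>
     (\<forall>U V. affine_open X U \<and> affine_open Y V \<longrightarrow>
        (let U' = pre (pobj P) (prl P) U; V' = pre (pobj P) (prr P) V; W = U' \<inter> V' in
           affine_open (pobj P) W \<and>
           is_tensor_product K (sect X U) (sect Y V) (sect (pobj P) W)
             (\<lambda>a. restr (pobj P) U' W (pull (prl P) U a))
             (\<lambda>b. restr (pobj P) V' W (pull (prr P) V b))))"

text \<open>The morphism \<open>(f\<^sub>1, f\<^sub>2) : T \<rightarrow> X \<times> Y\<close>; it exists and is unique up to \<open>mor_eq\<close>.\<close>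

definition pairing :: "complex set \<Rightarrow> ('q, 't) kspace \<Rightarrow> ('x, 'd) kspace \<Rightarrow> ('y, 'e) kspace \<Rightarrow>
   ('p, 's, 'x, 'd, 'y, 'e) kprod \<Rightarrow> ('q, 't, 'x, 'd) kmor \<Rightarrow> ('q, 't, 'y, 'e) kmor \<Rightarrow>
   ('q, 't, 'p, 's) kmor" where
  "pairing K T X Y P f1 f2 = (SOME h. morphism K T (pobj P) h \<and>
     mor_eq T X (mcomp (pobj P) (prl P) h) f1 \<and> mor_eq T Y (mcomp (pobj P) (prr P) h) f2)"


section \<open>Vector fields\<close>

definition on_sections ::
  "('p, 's) kspace \<Rightarrow> ('p set \<Rightarrow> 's \<Rightarrow> 's) \<Rightarrow> 'p set \<Rightarrow> 's \<Rightarrow> 's" where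
  "on_sections X F = (\<lambda>U s. if opn X U \<and> s \<in> carrier (sect X U) then F U s else undefined)"

text \<open>
  Vector fields are derivations of the structure sheaf. They are kept extensional, so that equality in
  HOL is equality of vector fields.
\<close>

definition vector_field ::
  "complex set \<Rightarrow> ('p, 's) kspace \<Rightarrow> ('p set \<Rightarrow> 's \<Rightarrow> 's) \<Rightarrow> bool" where
  "vector_field K X D \<longleftrightarrow> on_sections X D = D \<and>
     (\<forall>U. opn X U \<longrightarrow> linear_on K (sect X U) (sect X U) (D U) \<and>
        (\<forall>a\<in>carrier (sect X U). \<forall>b\<in>carrier (sect X U). D U (a \<otimes>\<^bsub>sect X U\<^esub> b) =
           (D U a \<otimes>\<^bsub>sect X U\<^esub> b) \<oplus>\<^bsub>sect X U\<^esub> (a \<otimes>\<^bsub>sect X U\<^esub> D U b))) \<and>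
     (\<forall>U V. opn X U \<and> opn X V \<and> V \<subseteq> U \<longrightarrow>
        (\<forall>a\<in>carrier (sect X U). D V (restr X U V a) = restr X U V (D U a)))"

text \<open>\<open>D'\<close> is the vector field \<open>(0, D)\<close> on the product \<open>X \<times> Y\<close>, for a vector field \<open>D\<close> on \<open>Y\<close>.\<close>

definition vertical_lift :: "complex set \<Rightarrow> ('x, 'd) kspace \<Rightarrow> ('y, 'e) kspace \<Rightarrow>
   ('p, 's, 'x, 'd, 'y, 'e) kprod \<Rightarrow> ('y set \<Rightarrow> 'e \<Rightarrow> 'e) \<Rightarrow> ('p set \<Rightarrow> 's \<Rightarrow> 's) \<Rightarrow> bool" where
  "vertical_lift K X Y P D D' \<longleftrightarrow> vector_field K (pobj P) D' \<and>
     (\<forall>U. opn X U \<longrightarrow> (\<forall>a\<in>carrier (sect X U).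
        D' (pre (pobj P) (prl P) U) (pull (prl P) U a) =
          \<zero>\<^bsub>sect (pobj P) (pre (pobj P) (prl P) U)\<^esub>)) \<and>
     (\<forall>V. opn Y V \<longrightarrow> (\<forall>b\<in>carrier (sect Y V).
        D' (pre (pobj P) (prr P) V) (pull (prr P) V b) = pull (prr P) V (D V b)))"


section \<open>Algebraic groups and their Lie algebras\<close>

text \<open>\<open>gsq\<close> is \<open>G \<times> G\<close> and \<open>gcube\<close> is \<open>(G \<times> G) \<times> G\<close>.\<close>

record ('g, 'a, 'm, 'b, 'n, 'c) kgroup =
  gspc :: "('g, 'a) kspace"
  gsq :: "('m, 'b, 'g, 'a, 'g, 'a) kprod"
  gcube :: "('n, 'c, 'm, 'b, 'g, 'a) kprod"
  gmul :: "('m, 'b, 'g, 'a) kmor"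
  gone :: "('g, 'a) kpoint"
  ginv :: "('g, 'a, 'g, 'a) kmor"

definition gpair :: "complex set \<Rightarrow> ('g, 'a, 'm, 'b, 'n, 'c) kgroup \<Rightarrow> ('q, 't) kspace \<Rightarrow>
   ('q, 't, 'g, 'a) kmor \<Rightarrow> ('q, 't, 'g, 'a) kmor \<Rightarrow> ('q, 't, 'm, 'b) kmor" where
  "gpair K G T = pairing K T (gspc G) (gspc G) (gsq G)"

text \<open>The product \<open>t \<mapsto> f\<^sub>1(t) f\<^sub>2(t)\<close> of two morphisms into \<open>G\<close>.\<close>

definition gprod :: "complex set \<Rightarrow> ('g, 'a, 'm, 'b, 'n, 'c) kgroup \<Rightarrow> ('q, 't) kspace \<Rightarrow>
   ('q, 't, 'g, 'a) kmor \<Rightarrow> ('q, 't, 'g, 'a) kmor \<Rightarrow> ('q, 't, 'g, 'a) kmor" where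
  "gprod K G T f1 f2 = mcomp (pobj (gsq G)) (gmul G) (gpair K G T f1 f2)"

definition algebraic_group :: "complex set \<Rightarrow> ('g, 'a, 'm, 'b, 'n, 'c) kgroup \<Rightarrow> bool" where
  "algebraic_group K G \<longleftrightarrow>
     algebraic_scheme K (gspc G) \<and>
     fibre_product K (gspc G) (gspc G) (gsq G) \<and>
     fibre_product K (pobj (gsq G)) (gspc G) (gcube G) \<and>
     morphism K (pobj (gsq G)) (gspc G) (gmul G) \<and>
     gone G \<in> K_points K (gspc G) \<and>
     morphism K (gspc G) (gspc G) (ginv G) \<and>
     (let T = pobj (gcube G);
          x = mcomp (pobj (gsq G)) (prl (gsq G)) (prl (gcube G));
          y = mcomp (pobj (gsq G)) (prr (gsq G)) (prl (gcube G));
          z = prr (gcube G)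
      in mor_eq T (gspc G) (gprod K G T (gprod K G T x y) z) (gprod K G T x (gprod K G T y z))) \<and>
     (let e = const_mor K (gspc G) (gone G) in
        mor_eq (gspc G) (gspc G) (gprod K G (gspc G) e mid) mid \<and>
        mor_eq (gspc G) (gspc G) (gprod K G (gspc G) mid e) mid \<and>
        mor_eq (gspc G) (gspc G) (gprod K G (gspc G) (ginv G) mid) e \<and>
        mor_eq (gspc G) (gspc G) (gprod K G (gspc G) mid (ginv G)) e)"

text \<open>
  The Lie algebra consists of the left invariant vector fields \<open>D\<close> on \<open>G\<close>, i.e. those for which
  \<open>\<mu>\<^sup>* \<circ> D = (0, D) \<circ> \<mu>\<^sup>*\<close> with the multiplication \<open>\<mu> : G \<times> G \<rightarrow> G\<close>; the field \<open>mult\<close> of the record is the Lie bracket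
  and the field \<open>one\<close> has no meaning.
\<close>

definition left_invariant ::
  "complex set \<Rightarrow> ('g, 'a, 'm, 'b, 'n, 'c) kgroup \<Rightarrow> ('g set \<Rightarrow> 'a \<Rightarrow> 'a) \<Rightarrow> bool" where
  "left_invariant K G D \<longleftrightarrow> (\<exists>D'. vertical_lift K (gspc G) (gspc G) (gsq G) D D' \<and>
     (\<forall>V. opn (gspc G) V \<longrightarrow> (\<forall>f\<in>carrier (sect (gspc G) V).
        D' (pre (pobj (gsq G)) (gmul G) V) (pull (gmul G) V f) = pull (gmul G) V (D V f))))"

definition lie_algebra :: "complex set \<Rightarrow> ('g, 'a, 'm, 'b, 'n, 'c) kgroup \<Rightarrow>
   (complex, 'g set \<Rightarrow> 'a \<Rightarrow> 'a) module" where
  "lie_algebra K G = (let S = sect (gspc G) in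
     \<lparr>carrier = {D. vector_field K (gspc G) D \<and> left_invariant K G D},
      mult = (\<lambda>D E. on_sections (gspc G) (\<lambda>U s. D U (E U s) \<ominus>\<^bsub>S U\<^esub> E U (D U s))),
      one = undefined,
      zero = on_sections (gspc G) (\<lambda>U s. \<zero>\<^bsub>S U\<^esub>),
      add = (\<lambda>D E. on_sections (gspc G) (\<lambda>U s. D U s \<oplus>\<^bsub>S U\<^esub> E U s)),
      smult = (\<lambda>k D. on_sections (gspc G) (\<lambda>U s. k \<odot>\<^bsub>S U\<^esub> D U s))\<rparr>)"

text \<open>\<open>conj_mor K G g\<close> is \<open>x \<mapsto> g x g\<^sup>-\<^sup>1\<close>, and \<open>Ad\<^sub>g\<close> is its differential, the push-forward of vector fields.\<close>

definition point_inv ::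
  "('g, 'a, 'm, 'b, 'n, 'c) kgroup \<Rightarrow> ('g, 'a) kpoint \<Rightarrow> ('g, 'a) kpoint" where
  "point_inv G g = mcomp (gspc G) (ginv G) g"

definition conj_mor :: "complex set \<Rightarrow> ('g, 'a, 'm, 'b, 'n, 'c) kgroup \<Rightarrow> ('g, 'a) kpoint \<Rightarrow>
   ('g, 'a, 'g, 'a) kmor" where
  "conj_mor K G g = gprod K G (gspc G) (const_mor K (gspc G) g)
     (gprod K G (gspc G) mid (const_mor K (gspc G) (point_inv G g)))"

definition Ad :: "complex set \<Rightarrow> ('g, 'a, 'm, 'b, 'n, 'c) kgroup \<Rightarrow> ('g, 'a) kpoint \<Rightarrow>
   ('g set \<Rightarrow> 'a \<Rightarrow> 'a) \<Rightarrow> ('g set \<Rightarrow> 'a \<Rightarrow> 'a)" where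
  "Ad K G g D = on_sections (gspc G) (\<lambda>V f.
     let V' = pre (gspc G) (conj_mor K G g) V
     in pull (conj_mor K G (point_inv G g)) V' (D V' (pull (conj_mor K G g) V f)))"

text \<open>
  \<open>\<gg>\<^sup>*\<close> as a scheme is \<open>Spec Sym \<gg>\<close>; \<open>\<iota> v\<close> is the linear function \<open>\<xi> \<mapsto> \<langle>v, \<xi>\<rangle>\<close> on it. The coadjoint action, written
  as a right action, is \<open>\<langle>v, \<xi>\<cdot>g\<rangle> = \<langle>Ad\<^sub>g v, \<xi>\<rangle>\<close>.
\<close>

definition dual_space :: "complex set \<Rightarrow> (complex, 'v) module \<Rightarrow> ('w, 'h) kspace \<Rightarrow>
   ('v \<Rightarrow> 'h) \<Rightarrow> bool" where
  "dual_space K L V \<iota> \<longleftrightarrow> scheme K V \<and> affine V \<and> is_symmetric_algebra K L (sect V (pts V)) \<iota>"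

definition coadjoint :: "complex set \<Rightarrow> ('g, 'a, 'm, 'b, 'n, 'c) kgroup \<Rightarrow> ('w, 'h) kspace \<Rightarrow>
   (('g set \<Rightarrow> 'a \<Rightarrow> 'a) \<Rightarrow> 'h) \<Rightarrow> ('g, 'a) kpoint \<Rightarrow> ('w, 'h, 'w, 'h) kmor" where
  "coadjoint K G V \<iota> g = (SOME c. morphism K V V c \<and>
     (\<forall>v\<in>carrier (lie_algebra K G). pull c (pts V) (\<iota> v) = \<iota> (Ad K G g v)))"


section \<open>Actions\<close>

text \<open>
  Right actions \<open>A : X \<times> G \<rightarrow> X\<close>. \<open>XG\<close> is \<open>X \<times> G\<close> and \<open>XGG\<close> is \<open>(X \<times> G) \<times> G\<close>. As for groups, \<open>aprod\<close> is
  \<open>t \<mapsto> f(t) \<cdot> g(t)\<close>.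
\<close>

definition aprod :: "complex set \<Rightarrow> ('x, 'd) kspace \<Rightarrow> ('g, 'a, 'm, 'b, 'n, 'c) kgroup \<Rightarrow>
   ('r, 'e, 'x, 'd, 'g, 'a) kprod \<Rightarrow> ('r, 'e, 'x, 'd) kmor \<Rightarrow> ('q, 't) kspace \<Rightarrow>
   ('q, 't, 'x, 'd) kmor \<Rightarrow> ('q, 't, 'g, 'a) kmor \<Rightarrow> ('q, 't, 'x, 'd) kmor" where
  "aprod K X G XG A T f g = mcomp (pobj XG) A (pairing K T X (gspc G) XG f g)"

definition algebraic_action :: "complex set \<Rightarrow> ('x, 'd) kspace \<Rightarrow>
   ('g, 'a, 'm, 'b, 'n, 'c) kgroup \<Rightarrow> ('r, 'e, 'x, 'd, 'g, 'a) kprod \<Rightarrow>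
   ('t, 'f, 'r, 'e, 'g, 'a) kprod \<Rightarrow> ('r, 'e, 'x, 'd) kmor \<Rightarrow> bool" where
  "algebraic_action K X G XG XGG A \<longleftrightarrow>
     fibre_product K X (gspc G) XG \<and>
     fibre_product K (pobj XG) (gspc G) XGG \<and>
     morphism K (pobj XG) X A \<and>
     mor_eq X X (aprod K X G XG A X mid (const_mor K X (gone G))) mid \<and>
     (let T = pobj XGG;
          x = mcomp (pobj XG) (prl XG) (prl XGG);
          g = mcomp (pobj XG) (prr XG) (prl XGG);
          h = prr XGG
      in mor_eq T X (aprod K X G XG A T (aprod K X G XG A T x g) h)
                    (aprod K X G XG A T x (gprod K G T g h)))"

text \<open>The automorphism of \<open>X\<close> given by a point \<open>g\<close>; its \<open>pull\<close> is \<open>g\<^sup>*\<close>.\<close>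

definition act_by :: "complex set \<Rightarrow> ('x, 'd) kspace \<Rightarrow> ('g, 'a, 'm, 'b, 'n, 'c) kgroup \<Rightarrow>
   ('r, 'e, 'x, 'd, 'g, 'a) kprod \<Rightarrow> ('r, 'e, 'x, 'd) kmor \<Rightarrow> ('g, 'a) kpoint \<Rightarrow>
   ('x, 'd, 'x, 'd) kmor" where
  "act_by K X G XG A g = aprod K X G XG A X mid (const_mor K X g)"

text \<open>
  \<open>\<xi> = d\<^sub>G A(v)\<close>: the tangent map of \<open>A\<close> applied to the tangent vectors \<open>(0, v\<^sub>e)\<close> at the points \<open>(x, e)\<close>.
  Only \<open>\<xi> U a\<close> for sections \<open>a\<close> over open \<open>U\<close> matters.
\<close>

definition infinitesimal_action :: "complex set \<Rightarrow> ('x, 'd) kspace \<Rightarrow>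
   ('g, 'a, 'm, 'b, 'n, 'c) kgroup \<Rightarrow> ('r, 'e, 'x, 'd, 'g, 'a) kprod \<Rightarrow> ('r, 'e, 'x, 'd) kmor \<Rightarrow>
   ('g set \<Rightarrow> 'a \<Rightarrow> 'a) \<Rightarrow> ('x set \<Rightarrow> 'd \<Rightarrow> 'd) \<Rightarrow> bool" where
  "infinitesimal_action K X G XG A v \<xi> \<longleftrightarrow>
     (\<exists>v'. vertical_lift K X (gspc G) XG v v' \<and>
        (\<forall>U. opn X U \<longrightarrow> (\<forall>a\<in>carrier (sect X U).
           \<xi> U a = pull (pairing K X X (gspc G) XG mid (const_mor K X (gone G)))
             (pre (pobj XG) A U) (v' (pre (pobj XG) A U) (pull A U a)))))"


section \<open>Brackets\<close>

definition biderivation ::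
  "complex set \<Rightarrow> ('p, 's) kspace \<Rightarrow> ('p set \<Rightarrow> 's \<Rightarrow> 's \<Rightarrow> 's) \<Rightarrow> bool" where
  "biderivation K X q \<longleftrightarrow>
     (\<forall>U. opn X U \<longrightarrow> (\<forall>a\<in>carrier (sect X U).
        linear_on K (sect X U) (sect X U) (\<lambda>b. q U a b) \<and>
        linear_on K (sect X U) (sect X U) (\<lambda>b. q U b a) \<and>
        (\<forall>b\<in>carrier (sect X U). \<forall>c\<in>carrier (sect X U).
           q U a (b \<otimes>\<^bsub>sect X U\<^esub> c) =
             (q U a b \<otimes>\<^bsub>sect X U\<^esub> c) \<oplus>\<^bsub>sect X U\<^esub> (b \<otimes>\<^bsub>sect X U\<^esub> q U a c) \<and>
           q U (b \<otimes>\<^bsub>sect X U\<^esub> c) a =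
             (q U b a \<otimes>\<^bsub>sect X U\<^esub> c) \<oplus>\<^bsub>sect X U\<^esub> (b \<otimes>\<^bsub>sect X U\<^esub> q U c a)))) \<and>
     (\<forall>U V. opn X U \<and> opn X V \<and> V \<subseteq> U \<longrightarrow>
        (\<forall>a\<in>carrier (sect X U). \<forall>b\<in>carrier (sect X U).
           q V (restr X U V a) (restr X U V b) = restr X U V (q U a b)))"

definition poisson_bracket ::
  "complex set \<Rightarrow> ('p, 's) kspace \<Rightarrow> ('p set \<Rightarrow> 's \<Rightarrow> 's \<Rightarrow> 's) \<Rightarrow> bool" where
  "poisson_bracket K X q \<longleftrightarrow> biderivation K X q \<and>
     (\<forall>U. opn X U \<longrightarrow> (\<forall>a\<in>carrier (sect X U). \<forall>b\<in>carrier (sect X U).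
        q U a b = \<ominus>\<^bsub>sect X U\<^esub> q U b a \<and>
        (\<forall>c\<in>carrier (sect X U).
           q U a (q U b c) \<oplus>\<^bsub>sect X U\<^esub> q U b (q U c a) \<oplus>\<^bsub>sect X U\<^esub> q U c (q U a b) =
             \<zero>\<^bsub>sect X U\<^esub>)))"

definition covariant_bracket :: "complex set \<Rightarrow> ('x, 'd) kspace \<Rightarrow>
   ('g, 'a, 'm, 'b, 'n, 'c) kgroup \<Rightarrow> ('r, 'e, 'x, 'd, 'g, 'a) kprod \<Rightarrow> ('r, 'e, 'x, 'd) kmor \<Rightarrow>
   ('x set \<Rightarrow> 'd \<Rightarrow> 'd \<Rightarrow> 'd) \<Rightarrow> bool" where
  "covariant_bracket K X G XG A q \<longleftrightarrow>
     (\<forall>g\<in>K_points K (gspc G). let \<rho> = act_by K X G XG A g in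
        \<forall>U. opn X U \<longrightarrow> (\<forall>a\<in>carrier (sect X U). \<forall>b\<in>carrier (sect X U).
          q (pre X \<rho> U) (pull \<rho> U a) (pull \<rho> U b) = pull \<rho> U (q U a b)))"


section \<open>Momentum maps\<close>

text \<open>The component \<open>\<langle>v, J\<rangle>\<close>, a global section of \<open>\<O>\<^sub>X\<close>.\<close>

definition component :: "('w, 'h) kspace \<Rightarrow> ('v \<Rightarrow> 'h) \<Rightarrow> ('x, 'd, 'w, 'h) kmor \<Rightarrow> 'v \<Rightarrow> 'd" where
  "component V \<iota> J v = pull J (pts V) (\<iota> v)"

definition equivariant_momentum :: "complex set \<Rightarrow> ('x, 'd) kspace \<Rightarrow>
   ('g, 'a, 'm, 'b, 'n, 'c) kgroup \<Rightarrow> ('r, 'e, 'x, 'd, 'g, 'a) kprod \<Rightarrow> ('r, 'e, 'x, 'd) kmor \<Rightarrow>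
   ('w, 'h) kspace \<Rightarrow> (('g set \<Rightarrow> 'a \<Rightarrow> 'a) \<Rightarrow> 'h) \<Rightarrow> ('x, 'd, 'w, 'h) kmor \<Rightarrow> bool" where
  "equivariant_momentum K X G XG A V \<iota> J \<longleftrightarrow>
     (\<forall>g\<in>K_points K (gspc G).
        mor_eq X V (mcomp X J (act_by K X G XG A g)) (mcomp V (coadjoint K G V \<iota> g) J))"

definition hamiltonian_action :: "complex set \<Rightarrow> ('x, 'd) kspace \<Rightarrow>
   ('g, 'a, 'm, 'b, 'n, 'c) kgroup \<Rightarrow> ('r, 'e, 'x, 'd, 'g, 'a) kprod \<Rightarrow> ('r, 'e, 'x, 'd) kmor \<Rightarrow>
   ('x set \<Rightarrow> 'd \<Rightarrow> 'd \<Rightarrow> 'd) \<Rightarrow> ('w, 'h) kspace \<Rightarrow> (('g set \<Rightarrow> 'a \<Rightarrow> 'a) \<Rightarrow> 'h) \<Rightarrow>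
   ('x, 'd, 'w, 'h) kmor \<Rightarrow> bool" where
  "hamiltonian_action K X G XG A q V \<iota> J \<longleftrightarrow>
     (\<forall>v\<in>carrier (lie_algebra K G). infinitesimal_action K X G XG A v
        (\<lambda>U a. q U (restr X (pts X) U (component V \<iota> J v)) a))"

text \<open>The ideal sheaf \<open>(J)\<close>.\<close>

definition momentum_ideal :: "('x, 'd) kspace \<Rightarrow> (complex, 'v) module \<Rightarrow> ('w, 'h) kspace \<Rightarrow>
   ('v \<Rightarrow> 'h) \<Rightarrow> ('x, 'd, 'w, 'h) kmor \<Rightarrow> 'x set \<Rightarrow> 'd set" where
  "momentum_ideal X L V \<iota> J U = {a \<in> carrier (sect X U). \<forall>x\<in>U. \<exists>W. opn X W \<and> x \<in> W \<and> W \<subseteq> U \<and>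
     restr X U W a \<in> genideal (sect X W)
       ((\<lambda>v. restr X (pts X) W (component V \<iota> J v)) ` carrier L)}"

text \<open>
  \<open>Y\<close> is the closed subscheme of \<open>X\<close> with \<open>\<O>\<^sub>Y = \<O>\<^sub>X/I\<close>, supported on the points where the stalk of \<open>I\<close> is proper;
  \<open>\<rho> U : \<O>\<^sub>X(U) \<rightarrow> \<O>\<^sub>Y(U \<inter> Y)\<close> is the restriction map \<open>a \<mapsto> a|\<^sub>Y\<close>.
\<close>

definition closed_subscheme :: "complex set \<Rightarrow> ('x, 'd) kspace \<Rightarrow> ('x set \<Rightarrow> 'd set) \<Rightarrow>
   ('x, 'k) kspace \<Rightarrow> ('x set \<Rightarrow> 'd \<Rightarrow> 'k) \<Rightarrow> bool" where
  "closed_subscheme K X I Y \<rho> \<longleftrightarrow> sheaf_of_algebras K Y \<and>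
     ptop Y = subtopology (ptop X)
       {x \<in> pts X. \<forall>U. opn X U \<and> x \<in> U \<longrightarrow> (\<forall>a\<in>I U. \<not> invertible_at X x U a)} \<and>
     (\<forall>U. opn X U \<longrightarrow> alg_hom K (sect X U) (sect Y (U \<inter> pts Y)) (\<rho> U)) \<and>
     (\<forall>U V. opn X U \<and> opn X V \<and> V \<subseteq> U \<longrightarrow> (\<forall>a\<in>carrier (sect X U).
        \<rho> V (restr X U V a) = restr Y (U \<inter> pts Y) (V \<inter> pts Y) (\<rho> U a))) \<and>
     (\<forall>U. opn X U \<longrightarrow>
        {a \<in> carrier (sect X U). \<rho> U a = \<zero>\<^bsub>sect Y (U \<inter> pts Y)\<^esub>} = I U) \<and>
     (\<forall>W s. opn Y W \<and> s \<in> carrier (sect Y W) \<longrightarrow> (\<forall>y\<in>W. \<exists>U a. opn X U \<and> y \<in> U \<and>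
        U \<inter> pts Y \<subseteq> W \<and> a \<in> carrier (sect X U) \<and> \<rho> U a = restr Y W (U \<inter> pts Y) s))"


section \<open>Orbit spaces\<close>

definition orbit :: "complex set \<Rightarrow> ('x, 'd) kspace \<Rightarrow> ('g, 'a, 'm, 'b, 'n, 'c) kgroup \<Rightarrow>
   ('r, 'e, 'x, 'd, 'g, 'a) kprod \<Rightarrow> ('r, 'e, 'x, 'd) kmor \<Rightarrow> 'x \<Rightarrow> 'x set" where
  "orbit K X G XG A x = {pmap (act_by K X G XG A g) x | g. g \<in> K_points K (gspc G)}"

definition quotient_topology :: "'p topology \<Rightarrow> ('p \<Rightarrow> 'q) \<Rightarrow> 'q topology" where
  "quotient_topology T \<pi> =
     topology (\<lambda>W. W \<subseteq> \<pi> ` topspace T \<and> openin T {x \<in> topspace T. \<pi> x \<in> W})"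

lemma istopology_quotient:
  "istopology (\<lambda>W. W \<subseteq> \<pi> ` topspace T \<and> openin T {x \<in> topspace T. \<pi> x \<in> W})"
  unfolding istopology_def
proof (intro conjI allI impI)
  fix V W
  assume V: "V \<subseteq> \<pi> ` topspace T \<and> openin T {x \<in> topspace T. \<pi> x \<in> V}"
    and W: "W \<subseteq> \<pi> ` topspace T \<and> openin T {x \<in> topspace T. \<pi> x \<in> W}"
  show "V \<inter> W \<subseteq> \<pi> ` topspace T" using V by blast
  have "{x \<in> topspace T. \<pi> x \<in> V \<inter> W} =
      {x \<in> topspace T. \<pi> x \<in> V} \<inter> {x \<in> topspace T. \<pi> x \<in> W}" by blast
  with V W show "openin T {x \<in> topspace T. \<pi> x \<in> V \<inter> W}" by (simp only: openin_Int)
next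
  fix \<W>
  assume \<W>: "\<forall>W\<in>\<W>. W \<subseteq> \<pi> ` topspace T \<and> openin T {x \<in> topspace T. \<pi> x \<in> W}"
  show "\<Union>\<W> \<subseteq> \<pi> ` topspace T" using \<W> by blast
  have "{x \<in> topspace T. \<pi> x \<in> \<Union>\<W>} = (\<Union>W\<in>\<W>. {x \<in> topspace T. \<pi> x \<in> W})" by blast
  moreover have "openin T (\<Union>W\<in>\<W>. {x \<in> topspace T. \<pi> x \<in> W})"
    by (rule openin_Union) (use \<W> in blast)
  ultimately show "openin T {x \<in> topspace T. \<pi> x \<in> \<Union>\<W>}" by (simp only:)
qed

text \<open>
  \<open>(X/G, \<O>\<^bsub>X/G\<^esub>)\<close>: the points are the orbits, and the sections over \<open>W\<close> are the invariant sections of \<open>\<O>\<^sub>X\<close>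
  over the preimage of \<open>W\<close>.
\<close>

definition orbit_space :: "complex set \<Rightarrow> ('x, 'd) kspace \<Rightarrow>
   ('g, 'a, 'm, 'b, 'n, 'c) kgroup \<Rightarrow> ('r, 'e, 'x, 'd, 'g, 'a) kprod \<Rightarrow> ('r, 'e, 'x, 'd) kmor \<Rightarrow>
   ('x set, 'd) kspace" where
  "orbit_space K X G XG A = (let \<pi> = orbit K X G XG A; U = (\<lambda>W. {x \<in> pts X. \<pi> x \<in> W}) in
     \<lparr>ptop = quotient_topology (ptop X) \<pi>,
      sect = (\<lambda>W. (sect X (U W))\<lparr>carrier := {a \<in> carrier (sect X (U W)).
        \<forall>g\<in>K_points K (gspc G). pull (act_by K X G XG A g) (U W) a = a}\<rparr>),
      restr = (\<lambda>W W'. restr X (U W) (U W'))\<rparr>)"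

text \<open>
  \<open>(Y/G, \<O>\<^bsub>Y/G\<^esub>)\<close> for an invariant closed subscheme \<open>Y\<close>: the sheaf is the image of \<open>\<O>\<^bsub>X/G\<^esub>\<close> in \<open>\<O>\<^sub>Y\<close>, so its sections
  are the sections of \<open>\<O>\<^sub>Y\<close> over saturated sets which near every orbit are of the form \<open>a|\<^sub>Y\<close>.
\<close>

definition reduced_space :: "complex set \<Rightarrow> ('x, 'd) kspace \<Rightarrow>
   ('g, 'a, 'm, 'b, 'n, 'c) kgroup \<Rightarrow> ('r, 'e, 'x, 'd, 'g, 'a) kprod \<Rightarrow> ('r, 'e, 'x, 'd) kmor \<Rightarrow>
   ('x, 'k) kspace \<Rightarrow> ('x set \<Rightarrow> 'd \<Rightarrow> 'k) \<Rightarrow> ('x set, 'k) kspace" where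
  "reduced_space K X G XG A Y \<rho> =
     (let \<pi> = orbit K X G XG A; Q = orbit_space K X G XG A;
          U = (\<lambda>W. {x \<in> pts X. \<pi> x \<in> W}); U\<^sub>Y = (\<lambda>W. {y \<in> pts Y. \<pi> y \<in> W}) in
     \<lparr>ptop = quotient_topology (ptop Y) \<pi>,
      sect = (\<lambda>W. (sect Y (U\<^sub>Y W))\<lparr>carrier := {s \<in> carrier (sect Y (U\<^sub>Y W)).
        \<forall>w\<in>W. \<exists>N a. opn Q N \<and> w \<in> N \<and> U\<^sub>Y N \<subseteq> U\<^sub>Y W \<and> a \<in> carrier (sect Q N) \<and>
          \<rho> (U N) a = restr Y (U\<^sub>Y W) (U\<^sub>Y N) s}\<rparr>),
      restr = (\<lambda>W W'. restr Y (U\<^sub>Y W) (U\<^sub>Y W'))\<rparr>)"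

end

theory Submission
  imports Defs
begin

text \<open>
  The crucial point is that a function \<open>a\<close> invariant under the \<open>K\<close>-points of \<open>G\<close> is annihilated by \<open>d\<^sub>G A(v)\<close>
  for every \<open>v \<in> \<gg>\<close>, although for \<open>K = \<real>\<close> the rational points of \<open>G\<close> need not be dense. On an affine neighbourhood of the unit element \<open>e\<close> the finitely generated coordinate ring carries the
  functionals \<open>f \<mapsto> \<Sum> t\<^sup>n / n! (v\<^sup>n f)(e)\<close>, which converge for small \<open>t\<close> and are multiplicative, so that they
  are \<open>K\<close>-points \<open>g\<^sub>t\<close> of \<open>G\<close>; differentiating \<open>g\<^sub>t\<^sup>* a = a\<close> at \<open>t = 0\<close> gives the claim.

  Hence \<open>q(\<langle>v, J\<rangle>, a) = 0\<close> for invariant \<open>a\<close>, and by the Leibniz rule \<open>q(a, \<cdot>)\<close> maps the ideal \<open>(J)\<close> to itself.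
  So \<open>q(a, b)|\<^sub>Y\<close> depends only on \<open>a|\<^sub>Y\<close> and \<open>b|\<^sub>Y\<close>, and the brackets of local representatives glue.
\<close>

section \<open>Commutative algebra over the ground field\<close>

text \<open>The hypotheses come without universal properties: products are known only through tensor
  product rings on affine boxes, \<open>pairing\<close> is a choice, and a K-point is a morphism of
  ringed spaces. Before a single point can act, or a functional can be read as a point, one needs
  that ring homomorphisms glue to morphisms and that pairings exist uniquely. Much of the
  development serves this purpose. The series converge because a derivation of a finitely generated
  algebra raises the degree in the generators by at most a fixed d; applying it n times costs n!
  times a geometric factor, and n! cancels. Sections of X carry no topology and a point x of X need
  not be rational, so the action of the flow cannot be differentiated in the sections directly. The
  pull-back of a to X x G is only a fraction near (x, e). Its numerator is a finite sum of tensors,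
  and after its left factors have been made linearly independent modulo a suitable subspace, limits
  and derivatives are taken only of the scalar functions of t given by the right factors.\<close>

locale kalgebra = cring A for A :: "(complex, 'a) module" (structure) +
  fixes K :: "complex set"
  assumes ground: "K = \<real> \<or> K = UNIV"
    and sm_closed [simp, intro]: "k \<in> K \<Longrightarrow> a \<in> carrier A \<Longrightarrow> k \<odot> a \<in> carrier A"
    and sm_l_distr: "k \<in> K \<Longrightarrow> l \<in> K \<Longrightarrow> a \<in> carrier A \<Longrightarrow> (k + l) \<odot> a = k \<odot> a \<oplus> l \<odot> a"
    and sm_r_distr: "k \<in> K \<Longrightarrow> a \<in> carrier A \<Longrightarrow> b \<in> carrier A \<Longrightarrow> k \<odot> (a \<oplus> b) = k \<odot> a \<oplus> k \<odot> b"
    and sm_assoc: "k \<in> K \<Longrightarrow> l \<in> K \<Longrightarrow> a \<in> carrier A \<Longrightarrow> (k * l) \<odot> a = k \<odot> (l \<odot> a)"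
    and sm_one [simp]: "a \<in> carrier A \<Longrightarrow> 1 \<odot> a = a"
    and sm_mult: "k \<in> K \<Longrightarrow> a \<in> carrier A \<Longrightarrow> b \<in> carrier A \<Longrightarrow> (k \<odot> a) \<otimes> b = k \<odot> (a \<otimes> b)"

text \<open>The axioms of \<open>algebra\<close> speak of the operations of the record
  \<open>scalars K\<close>. The locale states them with the arithmetic of complex numbers, so that
  scalars simplify directly.\<close>

lemma kalgebraI:
  assumes "K = \<real> \<or> K = UNIV" "algebra (scalars K) A"
  shows "kalgebra A K"
proof -
  interpret algebra "scalars K" A by fact
  show ?thesis
    using assms(1) smult_closed smult_l_distr smult_r_distr smult_assoc1 smult_one smult_assoc2
    by unfold_locales (auto simp: scalars_def)
qed

lemma ground_closed:
  assumes "K = \<real> \<or> K = UNIV"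
  shows "0 \<in> K" "1 \<in> K" "k \<in> K \<Longrightarrow> l \<in> K \<Longrightarrow> k + l \<in> K" "k \<in> K \<Longrightarrow> l \<in> K \<Longrightarrow> k * l \<in> K"
    "k \<in> K \<Longrightarrow> - k \<in> K" "k \<in> K \<Longrightarrow> inverse k \<in> K" "complex_of_real r \<in> K" "k \<in> K \<Longrightarrow> l \<in> K \<Longrightarrow> k - l \<in> K"
    "k \<in> K \<Longrightarrow> l \<in> K \<Longrightarrow> k / l \<in> K" "k \<in> K \<Longrightarrow> k ^ n \<in> K"
  using assms by (auto intro: Reals_inverse)

context kalgebra
begin

lemmas Kcl [simp, intro] = ground_closed(1-10)[OF ground]

lemma sm_zero [simp]:
  assumes "a \<in> carrier A" shows "0 \<odot> a = \<zero>"
proof -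
  have "0 \<odot> a \<oplus> 0 \<odot> a = 0 \<odot> a \<oplus> \<zero>" using sm_l_distr[of 0 0 a] assms by simp
  then show ?thesis using assms by (metis add.l_cancel_one r_zero sm_closed Kcl(1))
qed

lemma sm_rzero [simp]:
  assumes "k \<in> K" shows "k \<odot> \<zero> = \<zero>"
proof -
  have "k \<odot> \<zero> \<oplus> k \<odot> \<zero> = k \<odot> \<zero> \<oplus> \<zero>" using sm_r_distr[of k \<zero> \<zero>] assms by simp
  then show ?thesis using assms by (metis add.l_cancel_one r_zero sm_closed zero_closed)
qed

lemma sm_minus:
  assumes "k \<in> K" "a \<in> carrier A" shows "(- k) \<odot> a = \<ominus> (k \<odot> a)"
proof -
  have "(- k) \<odot> a \<oplus> k \<odot> a = \<zero>" using sm_l_distr[of "-k" k a] assms by simp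
  then show ?thesis using assms by (simp add: minus_equality)
qed

lemma sm_uminus1: "a \<in> carrier A \<Longrightarrow> (- 1) \<odot> a = \<ominus> a"
  using sm_minus[of 1 a] by simp

lemma sm_mult2:
  "k \<in> K \<Longrightarrow> a \<in> carrier A \<Longrightarrow> b \<in> carrier A \<Longrightarrow> a \<otimes> (k \<odot> b) = k \<odot> (a \<otimes> b)"
  using sm_mult[of k b a] by (simp add: m_comm)

lemma sm_eq_mult: "k \<in> K \<Longrightarrow> a \<in> carrier A \<Longrightarrow> k \<odot> a = (k \<odot> \<one>) \<otimes> a"
  by (simp add: sm_mult)

lemma unit_cancel:
  "u \<in> Units A \<Longrightarrow> x \<in> carrier A \<Longrightarrow> y \<in> carrier A \<Longrightarrow> x \<otimes> u = y \<otimes> u \<Longrightarrow> x = y"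
  by (metis Units_closed Units_l_cancel m_comm)

lemma prod_unit_l:
  assumes "x \<otimes> y \<in> Units A" "x \<in> carrier A" "y \<in> carrier A" shows "x \<in> Units A"
proof -
  obtain z where z: "z \<in> carrier A" "(x \<otimes> y) \<otimes> z = \<one>"
    using assms(1) Units_r_inv_ex by blast
  then have "x \<otimes> (y \<otimes> z) = \<one>" "(y \<otimes> z) \<otimes> x = \<one>"
    using assms by (simp_all add: m_ac)
  then show ?thesis using assms z unfolding Units_def by blast
qed

lemma prod_unit_r: "x \<otimes> y \<in> Units A \<Longrightarrow> x \<in> carrier A \<Longrightarrow> y \<in> carrier A \<Longrightarrow> y \<in> Units A"
  using prod_unit_l m_comm by metis

lemma unit_pow: "x \<in> Units A \<Longrightarrow> x [^] (n::nat) \<in> Units A"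
  using Units_pow_closed by blast

end

locale kalgebra_hom = A: kalgebra A K + B: kalgebra B K
  for A :: "(complex, 'a) module" and B :: "(complex, 'b) module" and K +
  fixes h
  assumes hom: "alg_hom K A B h"
begin

sublocale ring_hom_cring A B h
  using hom by unfold_locales (simp add: alg_hom_def)

lemma hom_smult [simp]: "k \<in> K \<Longrightarrow> a \<in> carrier A \<Longrightarrow> h (k \<odot>\<^bsub>A\<^esub> a) = k \<odot>\<^bsub>B\<^esub> h a"
  using hom by (simp add: alg_hom_def)

lemma hom_Units: "u \<in> Units A \<Longrightarrow> h u \<in> Units B"
proof -
  assume u: "u \<in> Units A"
  then obtain v where v: "v \<in> carrier A" "v \<otimes>\<^bsub>A\<^esub> u = \<one>\<^bsub>A\<^esub>" "u \<otimes>\<^bsub>A\<^esub> v = \<one>\<^bsub>A\<^esub>"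
    by (auto simp: Units_def)
  then have "h v \<otimes>\<^bsub>B\<^esub> h u = \<one>\<^bsub>B\<^esub>" "h u \<otimes>\<^bsub>B\<^esub> h v = \<one>\<^bsub>B\<^esub>"
    using A.Units_closed[OF u] by (metis hom_mult hom_one)+
  then show ?thesis using v A.Units_closed[OF u] unfolding Units_def by blast
qed

lemma hom_pow: "x \<in> carrier A \<Longrightarrow> h (x [^]\<^bsub>A\<^esub> (n::nat)) = h x [^]\<^bsub>B\<^esub> n"
  by (induction n) simp_all

end

lemma alg_homI:
  assumes "\<And>a. a \<in> carrier A \<Longrightarrow> h a \<in> carrier B"
    "\<And>a b. a \<in> carrier A \<Longrightarrow> b \<in> carrier A \<Longrightarrow> h (a \<otimes>\<^bsub>A\<^esub> b) = h a \<otimes>\<^bsub>B\<^esub> h b"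
    "\<And>a b. a \<in> carrier A \<Longrightarrow> b \<in> carrier A \<Longrightarrow> h (a \<oplus>\<^bsub>A\<^esub> b) = h a \<oplus>\<^bsub>B\<^esub> h b"
    "h \<one>\<^bsub>A\<^esub> = \<one>\<^bsub>B\<^esub>"
    "\<And>k a. k \<in> K \<Longrightarrow> a \<in> carrier A \<Longrightarrow> h (k \<odot>\<^bsub>A\<^esub> a) = k \<odot>\<^bsub>B\<^esub> h a"
  shows "alg_hom K A B h"
  using assms by (auto simp: alg_hom_def intro!: ring_hom_memI)

lemma alg_hom_closed: "alg_hom K A B h \<Longrightarrow> a \<in> carrier A \<Longrightarrow> h a \<in> carrier B"
  by (auto simp: alg_hom_def ring_hom_closed)

lemma alg_hom_compose:
  assumes "alg_hom K A B h" "alg_hom K B C k"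
  shows "alg_hom K A C (\<lambda>x. k (h x))"
  using assms ring_hom_trans[of h A B k C] by (auto simp: alg_hom_def comp_def ring_hom_closed)

subsection \<open>Localizations\<close>

text \<open>The definition of a localization describes fractions and the kernel of h; this recovers
  the universal property. The image of a / f^n can only be p a / (p f)^n, and it does not depend on
  the representation because f^n a = 0 forces p a = 0 when p f is a unit.\<close>

lemma localization_lift:
  assumes "kalgebra A K" "kalgebra B K" "kalgebra C K"
    and loc: "is_localization A f B h" and h: "alg_hom K A B h" and fA: "f \<in> carrier A"
    and p: "alg_hom K A C p" and pf: "p f \<in> Units C"
  obtains g where "alg_hom K B C g" "\<And>a. a \<in> carrier A \<Longrightarrow> g (h a) = p a"
proof -
  interpret A: kalgebra A K by fact
  interpret B: kalgebra B K by fact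
  interpret C: kalgebra C K by fact
  interpret h: kalgebra_hom A B K h by unfold_locales fact
  interpret p: kalgebra_hom A C K p by unfold_locales fact
  have num: "\<exists>a\<in>carrier A. \<exists>n::nat. b \<otimes>\<^bsub>B\<^esub> (h f [^]\<^bsub>B\<^esub> n) = h a" if "b \<in> carrier B" for b
    using loc that unfolding is_localization_def by blast
  have ker: "\<exists>n::nat. (f [^]\<^bsub>A\<^esub> n) \<otimes>\<^bsub>A\<^esub> a = \<zero>\<^bsub>A\<^esub>" if "a \<in> carrier A" "h a = \<zero>\<^bsub>B\<^esub>" for a
    using loc that unfolding is_localization_def by blast
  have hU: "h f \<in> Units B" using loc unfolding is_localization_def by blast
  have pn: "p f [^]\<^bsub>C\<^esub> (n::nat) \<in> Units C" for n using C.unit_pow[OF pf] .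
  have pz: "p a = \<zero>\<^bsub>C\<^esub>" if "a \<in> carrier A" "h a = \<zero>\<^bsub>B\<^esub>" for a
  proof -
    from ker[OF that] obtain n :: nat where "(f [^]\<^bsub>A\<^esub> n) \<otimes>\<^bsub>A\<^esub> a = \<zero>\<^bsub>A\<^esub>" by blast
    then have "p ((f [^]\<^bsub>A\<^esub> n) \<otimes>\<^bsub>A\<^esub> a) = \<zero>\<^bsub>C\<^esub>" by simp
    then have "p f [^]\<^bsub>C\<^esub> n \<otimes>\<^bsub>C\<^esub> p a = \<zero>\<^bsub>C\<^esub>" using that fA by (simp add: p.hom_pow)
    then have "p a \<otimes>\<^bsub>C\<^esub> (p f [^]\<^bsub>C\<^esub> n) = \<zero>\<^bsub>C\<^esub> \<otimes>\<^bsub>C\<^esub> (p f [^]\<^bsub>C\<^esub> n)"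
      using that fA C.m_comm C.Units_closed[OF pn] by simp
    then show ?thesis using C.unit_cancel[OF pn] that by blast
  qed
  have peq: "p a = p a'" if "a \<in> carrier A" "a' \<in> carrier A" "h a = h a'" for a a'
  proof -
    have "p (a \<ominus>\<^bsub>A\<^esub> a') = \<zero>\<^bsub>C\<^esub>" using that by (intro pz) simp_all
    then show ?thesis using that by simp
  qed
  \<comment> \<open>The condition says that c is the fraction p a / (p f)^n for some representation
    of b as a / f^n; that all representations give the same c is shown by cross
    multiplication.\<close>
  define g where "g b = (THE c. c \<in> carrier C \<and> (\<exists>a\<in>carrier A. \<exists>n::nat.
     b \<otimes>\<^bsub>B\<^esub> (h f [^]\<^bsub>B\<^esub> n) = h a \<and> c \<otimes>\<^bsub>C\<^esub> (p f [^]\<^bsub>C\<^esub> n) = p a))" for b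
  have gI: "g b = c" if bB: "b \<in> carrier B" and cC: "c \<in> carrier C" and aA: "a \<in> carrier A"
    and e1: "b \<otimes>\<^bsub>B\<^esub> (h f [^]\<^bsub>B\<^esub> (n::nat)) = h a" and e2: "c \<otimes>\<^bsub>C\<^esub> (p f [^]\<^bsub>C\<^esub> n) = p a" for a b c n
    unfolding g_def
  proof (rule the_equality)
    show "c \<in> carrier C \<and> (\<exists>a\<in>carrier A. \<exists>n::nat.
     b \<otimes>\<^bsub>B\<^esub> (h f [^]\<^bsub>B\<^esub> n) = h a \<and> c \<otimes>\<^bsub>C\<^esub> (p f [^]\<^bsub>C\<^esub> n) = p a)" using that by blast
  next
    fix c' assume "c' \<in> carrier C \<and> (\<exists>a\<in>carrier A. \<exists>n::nat.
     b \<otimes>\<^bsub>B\<^esub> (h f [^]\<^bsub>B\<^esub> n) = h a \<and> c' \<otimes>\<^bsub>C\<^esub> (p f [^]\<^bsub>C\<^esub> n) = p a)"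
    then obtain a' m where c': "c' \<in> carrier C" and a': "a' \<in> carrier A" and
      e3: "b \<otimes>\<^bsub>B\<^esub> (h f [^]\<^bsub>B\<^esub> (m::nat)) = h a'" and e4: "c' \<otimes>\<^bsub>C\<^esub> (p f [^]\<^bsub>C\<^esub> m) = p a'" by blast
    have hn: "h f [^]\<^bsub>B\<^esub> (n::nat) \<in> carrier B" for n using fA by simp
    have pnc: "p f [^]\<^bsub>C\<^esub> (n::nat) \<in> carrier C" for n using fA by simp
    have "h (a \<otimes>\<^bsub>A\<^esub> f [^]\<^bsub>A\<^esub> m) = h (a' \<otimes>\<^bsub>A\<^esub> f [^]\<^bsub>A\<^esub> n)"
      using aA a' fA by (simp add: h.hom_pow e1[symmetric] e3[symmetric] bB B.m_ac)
    then have "p (a \<otimes>\<^bsub>A\<^esub> f [^]\<^bsub>A\<^esub> m) = p (a' \<otimes>\<^bsub>A\<^esub> f [^]\<^bsub>A\<^esub> n)" by (rule peq[rotated 2]) (use aA a' fA in simp_all)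
    then have "p a \<otimes>\<^bsub>C\<^esub> p f [^]\<^bsub>C\<^esub> m = p a' \<otimes>\<^bsub>C\<^esub> p f [^]\<^bsub>C\<^esub> n"
      using aA a' fA by (simp add: p.hom_pow)
    then have "c \<otimes>\<^bsub>C\<^esub> p f [^]\<^bsub>C\<^esub> n \<otimes>\<^bsub>C\<^esub> p f [^]\<^bsub>C\<^esub> m = c' \<otimes>\<^bsub>C\<^esub> p f [^]\<^bsub>C\<^esub> m \<otimes>\<^bsub>C\<^esub> p f [^]\<^bsub>C\<^esub> n"
      using e2 e4 by simp
    then have "c' \<otimes>\<^bsub>C\<^esub> (p f [^]\<^bsub>C\<^esub> n \<otimes>\<^bsub>C\<^esub> p f [^]\<^bsub>C\<^esub> m) = c \<otimes>\<^bsub>C\<^esub> (p f [^]\<^bsub>C\<^esub> n \<otimes>\<^bsub>C\<^esub> p f [^]\<^bsub>C\<^esub> m)"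
      using cC c' pnc by (simp add: C.m_ac)
    then show "c' = c" using C.unit_cancel[OF C.Units_m_closed[OF pn pn]] cC c' by blast
  qed
  have ex: "\<exists>a n c. a \<in> carrier A \<and> c \<in> carrier C \<and> b \<otimes>\<^bsub>B\<^esub> (h f [^]\<^bsub>B\<^esub> (n::nat)) = h a \<and>
      c \<otimes>\<^bsub>C\<^esub> (p f [^]\<^bsub>C\<^esub> n) = p a \<and> g b = c" if b: "b \<in> carrier B" for b
  proof -
    from num[OF b] obtain a n where a: "a \<in> carrier A" and e: "b \<otimes>\<^bsub>B\<^esub> (h f [^]\<^bsub>B\<^esub> (n::nat)) = h a" by blast
    let ?c = "p a \<otimes>\<^bsub>C\<^esub> inv\<^bsub>C\<^esub> (p f [^]\<^bsub>C\<^esub> n)"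
    have c: "?c \<in> carrier C" using a pn by simp
    have "?c \<otimes>\<^bsub>C\<^esub> (p f [^]\<^bsub>C\<^esub> n) = p a" using a pn C.Units_closed[OF pn]
      by (simp add: C.m_assoc C.Units_l_inv)
    with gI[OF b c a e] a c e show ?thesis by blast
  qed
  have "alg_hom K B C g"
  proof (rule alg_homI)
    fix b assume b: "b \<in> carrier B"
    show "g b \<in> carrier C" using ex[OF b] by blast
    fix k assume k: "k \<in> K"
    from ex[OF b] obtain a n c where a: "a \<in> carrier A" "c \<in> carrier C"
      "b \<otimes>\<^bsub>B\<^esub> (h f [^]\<^bsub>B\<^esub> (n::nat)) = h a" "c \<otimes>\<^bsub>C\<^esub> (p f [^]\<^bsub>C\<^esub> n) = p a" "g b = c" by blast
    have "g (k \<odot>\<^bsub>B\<^esub> b) = k \<odot>\<^bsub>C\<^esub> c"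
      using a k b fA by (intro gI[of _ _ "k \<odot>\<^bsub>A\<^esub> a" n]) (simp_all add: B.sm_mult C.sm_mult)
    then show "g (k \<odot>\<^bsub>B\<^esub> b) = k \<odot>\<^bsub>C\<^esub> g b" using a by simp
  next
    fix b b' assume b: "b \<in> carrier B" and b': "b' \<in> carrier B"
    from ex[OF b] obtain a n c where a: "a \<in> carrier A" "c \<in> carrier C"
      "b \<otimes>\<^bsub>B\<^esub> (h f [^]\<^bsub>B\<^esub> (n::nat)) = h a" "c \<otimes>\<^bsub>C\<^esub> (p f [^]\<^bsub>C\<^esub> n) = p a" "g b = c" by blast
    from ex[OF b'] obtain a' n' c' where a': "a' \<in> carrier A" "c' \<in> carrier C"
      "b' \<otimes>\<^bsub>B\<^esub> (h f [^]\<^bsub>B\<^esub> (n'::nat)) = h a'" "c' \<otimes>\<^bsub>C\<^esub> (p f [^]\<^bsub>C\<^esub> n') = p a'" "g b' = c'" by blast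
    have 1: "b \<otimes>\<^bsub>B\<^esub> b' \<otimes>\<^bsub>B\<^esub> (h f [^]\<^bsub>B\<^esub> (n + n')) = h (a \<otimes>\<^bsub>A\<^esub> a')"
    proof -
      have "b \<otimes>\<^bsub>B\<^esub> b' \<otimes>\<^bsub>B\<^esub> (h f [^]\<^bsub>B\<^esub> (n + n')) = (b \<otimes>\<^bsub>B\<^esub> (h f [^]\<^bsub>B\<^esub> n)) \<otimes>\<^bsub>B\<^esub> (b' \<otimes>\<^bsub>B\<^esub> (h f [^]\<^bsub>B\<^esub> n'))"
        using fA b b' by (simp add: B.nat_pow_mult[symmetric] B.m_ac)
      then show ?thesis using a a' by simp
    qed
    have 2: "c \<otimes>\<^bsub>C\<^esub> c' \<otimes>\<^bsub>C\<^esub> (p f [^]\<^bsub>C\<^esub> (n + n')) = p (a \<otimes>\<^bsub>A\<^esub> a')"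
    proof -
      have "c \<otimes>\<^bsub>C\<^esub> c' \<otimes>\<^bsub>C\<^esub> (p f [^]\<^bsub>C\<^esub> (n + n')) = (c \<otimes>\<^bsub>C\<^esub> (p f [^]\<^bsub>C\<^esub> n)) \<otimes>\<^bsub>C\<^esub> (c' \<otimes>\<^bsub>C\<^esub> (p f [^]\<^bsub>C\<^esub> n'))"
        using fA a(1,2) a'(1,2) by (simp add: C.nat_pow_mult[symmetric] C.m_ac)
      then show ?thesis using a a' by simp
    qed
    show "g (b \<otimes>\<^bsub>B\<^esub> b') = g b \<otimes>\<^bsub>C\<^esub> g b'"
      using gI[OF _ _ _ 1 2] a a' b b' by simp
    have 3: "(b \<oplus>\<^bsub>B\<^esub> b') \<otimes>\<^bsub>B\<^esub> (h f [^]\<^bsub>B\<^esub> (n + n')) = h (a \<otimes>\<^bsub>A\<^esub> f [^]\<^bsub>A\<^esub> n' \<oplus>\<^bsub>A\<^esub> a' \<otimes>\<^bsub>A\<^esub> f [^]\<^bsub>A\<^esub> n)"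
      using fA b b' a(1,2) a'(1,2) by (simp add: B.nat_pow_mult[symmetric] h.hom_pow a(3)[symmetric] a'(3)[symmetric] B.l_distr B.m_ac)
    have 4: "(c \<oplus>\<^bsub>C\<^esub> c') \<otimes>\<^bsub>C\<^esub> (p f [^]\<^bsub>C\<^esub> (n + n')) = p (a \<otimes>\<^bsub>A\<^esub> f [^]\<^bsub>A\<^esub> n' \<oplus>\<^bsub>A\<^esub> a' \<otimes>\<^bsub>A\<^esub> f [^]\<^bsub>A\<^esub> n)"
      using fA b b' a(1,2) a'(1,2) by (simp add: C.nat_pow_mult[symmetric] p.hom_pow a(4)[symmetric] a'(4)[symmetric] C.l_distr C.m_ac)
    show "g (b \<oplus>\<^bsub>B\<^esub> b') = g b \<oplus>\<^bsub>C\<^esub> g b'"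
      using gI[OF _ _ _ 3 4] a a' b b' fA by simp
  next
    show "g \<one>\<^bsub>B\<^esub> = \<one>\<^bsub>C\<^esub>" by (rule gI[of _ _ "\<one>\<^bsub>A\<^esub>" 0]) simp_all
  qed
  moreover have "g (h a) = p a" if "a \<in> carrier A" for a
    using that by (intro gI[of _ _ a 0]) simp_all
  ultimately show ?thesis using that by blast
qed

subsection \<open>Tensor products\<close>

text \<open>One step of Gaussian elimination: write j as a remainder plus a combination of the other
  elements and move the scalars of the combination to the second argument. If the remainder is
  negligible, the sum has become one term shorter. Only a balanced biadditive p is assumed, because
  the step is applied to a tensor product, to its image in another algebra, and to the contraction
  \<mu> b . a with a functional.\<close>

lemma bilinear_elimination:
  assumes "kalgebra A K" "kalgebra B K" "kalgebra E K"
    and pc: "\<And>a b. a \<in> carrier A \<Longrightarrow> b \<in> carrier B \<Longrightarrow> p a b \<in> carrier E"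
    and pl: "\<And>a a' b. a \<in> carrier A \<Longrightarrow> a' \<in> carrier A \<Longrightarrow> b \<in> carrier B \<Longrightarrow>
      p (a \<oplus>\<^bsub>A\<^esub> a') b = p a b \<oplus>\<^bsub>E\<^esub> p a' b"
    and pr: "\<And>a b b'. a \<in> carrier A \<Longrightarrow> b \<in> carrier B \<Longrightarrow> b' \<in> carrier B \<Longrightarrow>
      p a (b \<oplus>\<^bsub>B\<^esub> b') = p a b \<oplus>\<^bsub>E\<^esub> p a b'"
    and pk: "\<And>k a b. k \<in> K \<Longrightarrow> a \<in> carrier A \<Longrightarrow> b \<in> carrier B \<Longrightarrow>
      p (k \<odot>\<^bsub>A\<^esub> a) b = p a (k \<odot>\<^bsub>B\<^esub> b)"
    and S: "finite S" "S \<subseteq> carrier A" "j \<in> S" and c: "c \<in> S \<rightarrow> carrier B" and k: "k \<in> S \<rightarrow> K"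
  shows "(\<Oplus>\<^bsub>E\<^esub>a\<in>S. p a (c a)) =
    (\<Oplus>\<^bsub>E\<^esub>a\<in>S - {j}. p a (c a \<oplus>\<^bsub>B\<^esub> k a \<odot>\<^bsub>B\<^esub> c j)) \<oplus>\<^bsub>E\<^esub>
    p (j \<ominus>\<^bsub>A\<^esub> (\<Oplus>\<^bsub>A\<^esub>a\<in>S - {j}. k a \<odot>\<^bsub>A\<^esub> a)) (c j)"
proof -
  interpret A: kalgebra A K by fact
  interpret B: kalgebra B K by fact
  interpret E: kalgebra E K by fact
  have cj: "c j \<in> carrier B" using c S by auto
  have jA: "j \<in> carrier A" using S by auto
  have p0: "p \<zero>\<^bsub>A\<^esub> b = \<zero>\<^bsub>E\<^esub>" if "b \<in> carrier B" for b
  proof -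
    have "p \<zero>\<^bsub>A\<^esub> b \<oplus>\<^bsub>E\<^esub> p \<zero>\<^bsub>A\<^esub> b = p \<zero>\<^bsub>A\<^esub> b" using pl[of "\<zero>\<^bsub>A\<^esub>" "\<zero>\<^bsub>A\<^esub>" b] that by simp
    then show ?thesis using pc that by (metis E.add.l_cancel_one A.zero_closed)
  qed
  have pS: "p (\<Oplus>\<^bsub>A\<^esub>a\<in>F. k a \<odot>\<^bsub>A\<^esub> a) (c j) = (\<Oplus>\<^bsub>E\<^esub>a\<in>F. p a (k a \<odot>\<^bsub>B\<^esub> c j))"
    if "finite F" "F \<subseteq> S" for F using that
  proof (induction F)
    case empty then show ?case using p0 cj by simp
  next
    case (insert x F)
    have x: "x \<in> carrier A" "k x \<in> K" using insert S k by auto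
    have F: "(\<lambda>a. k a \<odot>\<^bsub>A\<^esub> a) \<in> F \<rightarrow> carrier A" "(\<lambda>a. p a (k a \<odot>\<^bsub>B\<^esub> c j)) \<in> F \<rightarrow> carrier E"
      using insert.prems S k pc cj by (auto simp: Pi_iff subset_iff)
    then show ?case using insert x cj pc
      by (simp add: A.finsum_insert E.finsum_insert pl A.finsum_closed pk)
  qed
  let ?F = "S - {j}"
  have F: "finite ?F" "?F \<subseteq> S" "j \<notin> ?F" "S = insert j ?F" using S by auto
  let ?s = "\<Oplus>\<^bsub>A\<^esub>a\<in>?F. k a \<odot>\<^bsub>A\<^esub> a"
  have f1: "(\<lambda>a. k a \<odot>\<^bsub>A\<^esub> a) \<in> ?F \<rightarrow> carrier A" using S k by auto
  have s: "?s \<in> carrier A" using f1 by simp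
  have f2: "(\<lambda>a. p a (k a \<odot>\<^bsub>B\<^esub> c j)) \<in> ?F \<rightarrow> carrier E" using S k pc cj by (auto simp: Pi_iff)
  have f3: "(\<lambda>a. p a (c a)) \<in> ?F \<rightarrow> carrier E" using S c pc by auto
  have "p j (c j) = p ((j \<ominus>\<^bsub>A\<^esub> ?s) \<oplus>\<^bsub>A\<^esub> ?s) (c j)"
    using jA s by (simp add: a_minus_def A.a_assoc A.l_neg)
  also have "\<dots> = p (j \<ominus>\<^bsub>A\<^esub> ?s) (c j) \<oplus>\<^bsub>E\<^esub> p ?s (c j)" using jA s cj by (intro pl) auto
  finally have pj: "p j (c j) = p (j \<ominus>\<^bsub>A\<^esub> ?s) (c j) \<oplus>\<^bsub>E\<^esub> (\<Oplus>\<^bsub>E\<^esub>a\<in>?F. p a (k a \<odot>\<^bsub>B\<^esub> c j))"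
    using pS[OF F(1,2)] by simp
  have pp: "p (j \<ominus>\<^bsub>A\<^esub> ?s) (c j) \<in> carrier E" using pc jA s cj by simp
  have "(\<Oplus>\<^bsub>E\<^esub>a\<in>S. p a (c a)) = p j (c j) \<oplus>\<^bsub>E\<^esub> (\<Oplus>\<^bsub>E\<^esub>a\<in>?F. p a (c a))"
    using E.finsum_insert[OF F(1,3) f3] pc jA cj F(4) by metis
  also have "(\<Oplus>\<^bsub>E\<^esub>a\<in>?F. p a (c a \<oplus>\<^bsub>B\<^esub> k a \<odot>\<^bsub>B\<^esub> c j)) = (\<Oplus>\<^bsub>E\<^esub>a\<in>?F. p a (c a) \<oplus>\<^bsub>E\<^esub> p a (k a \<odot>\<^bsub>B\<^esub> c j))"
    using S k c cj f2 f3 by (intro E.finsum_cong') (auto intro!: pr)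
  then have "(\<Oplus>\<^bsub>E\<^esub>a\<in>?F. p a (c a \<oplus>\<^bsub>B\<^esub> k a \<odot>\<^bsub>B\<^esub> c j)) =
      (\<Oplus>\<^bsub>E\<^esub>a\<in>?F. p a (c a)) \<oplus>\<^bsub>E\<^esub> (\<Oplus>\<^bsub>E\<^esub>a\<in>?F. p a (k a \<odot>\<^bsub>B\<^esub> c j))"
    using E.finsum_addf[OF f3 f2] by simp
  ultimately show ?thesis unfolding pj using pp f2 f3
    by (simp add: E.a_ac E.finsum_closed)
qed

text \<open>Induction on the number of elements of S. Either S is linearly independent modulo N, or
  a nontrivial combination lies in N and can be divided by a nonzero coefficient, so that some j is
  congruent modulo N to a combination of the others. The premise of the step has the shape produced
  by \<open>bilinear_elimination\<close>.\<close>

lemma elimination_induct: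
  assumes "kalgebra A K" "kalgebra B K"
    and N: "N \<subseteq> carrier A" "\<And>k a. k \<in> K \<Longrightarrow> a \<in> N \<Longrightarrow> k \<odot>\<^bsub>A\<^esub> a \<in> N"
    and S: "finite S" "S \<subseteq> carrier A"
    and c: "c \<in> S \<rightarrow> carrier B"
    and base: "\<And>S c. finite S \<Longrightarrow> S \<subseteq> carrier A \<Longrightarrow> c \<in> S \<rightarrow> carrier B \<Longrightarrow>
      (\<And>k. k \<in> S \<rightarrow> K \<Longrightarrow> (\<Oplus>\<^bsub>A\<^esub>a\<in>S. k a \<odot>\<^bsub>A\<^esub> a) \<in> N \<Longrightarrow> \<forall>a\<in>S. k a = 0) \<Longrightarrow> P S c"
    and step: "\<And>S c j k. finite S \<Longrightarrow> S \<subseteq> carrier A \<Longrightarrow> c \<in> S \<rightarrow> carrier B \<Longrightarrow> j \<in> S \<Longrightarrow> k \<in> S \<rightarrow> K \<Longrightarrow>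
      j \<ominus>\<^bsub>A\<^esub> (\<Oplus>\<^bsub>A\<^esub>a\<in>S - {j}. k a \<odot>\<^bsub>A\<^esub> a) \<in> N \<Longrightarrow>
      P (S - {j}) (\<lambda>a. c a \<oplus>\<^bsub>B\<^esub> k a \<odot>\<^bsub>B\<^esub> c j) \<Longrightarrow> P S c"
  shows "P S c"
proof -
  interpret A: kalgebra A K by fact
  interpret B: kalgebra B K by fact
  show ?thesis using S c
  proof (induction "card S" arbitrary: S c rule: less_induct)
    case less
    show ?case
    proof (cases "\<exists>k. k \<in> S \<rightarrow> K \<and> (\<Oplus>\<^bsub>A\<^esub>a\<in>S. k a \<odot>\<^bsub>A\<^esub> a) \<in> N \<and> (\<exists>j\<in>S. k j \<noteq> 0)")
      case False
      show ?thesis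
      proof (rule base[OF less.prems])
        fix k assume "k \<in> S \<rightarrow> K" "(\<Oplus>\<^bsub>A\<^esub>a\<in>S. k a \<odot>\<^bsub>A\<^esub> a) \<in> N"
        then show "\<forall>a\<in>S. k a = 0" using False by blast
      qed
    next
      case True
      then obtain k j where k: "k \<in> S \<rightarrow> K" "(\<Oplus>\<^bsub>A\<^esub>a\<in>S. k a \<odot>\<^bsub>A\<^esub> a) \<in> N" "j \<in> S" "k j \<noteq> 0" by blast
      let ?F = "S - {j}"
      have F: "finite ?F" "j \<notin> ?F" "S = insert j ?F" using less.prems k by auto
      have kj: "k j \<in> K" "j \<in> carrier A" using k less.prems by auto
      have f: "(\<lambda>a. k a \<odot>\<^bsub>A\<^esub> a) \<in> ?F \<rightarrow> carrier A" using less.prems k by auto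
      \<comment> \<open>The relation is solved for j: with these coefficients j - \<Sum> l a . a is
        the given combination divided by \<open>k j\<close>.\<close>
      define l where "l a = - (inverse (k j) * k a)" for a
      have l: "l \<in> S \<rightarrow> K" using k by (auto simp: l_def Pi_iff)
      have "(\<Oplus>\<^bsub>A\<^esub>a\<in>S. k a \<odot>\<^bsub>A\<^esub> a) = k j \<odot>\<^bsub>A\<^esub> j \<oplus>\<^bsub>A\<^esub> (\<Oplus>\<^bsub>A\<^esub>a\<in>?F. k a \<odot>\<^bsub>A\<^esub> a)"
        using A.finsum_insert[OF F(1,2) f] kj F(3) by (metis A.sm_closed)
      then have "inverse (k j) \<odot>\<^bsub>A\<^esub> (\<Oplus>\<^bsub>A\<^esub>a\<in>S. k a \<odot>\<^bsub>A\<^esub> a) =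
          inverse (k j) \<odot>\<^bsub>A\<^esub> (k j \<odot>\<^bsub>A\<^esub> j) \<oplus>\<^bsub>A\<^esub> inverse (k j) \<odot>\<^bsub>A\<^esub> (\<Oplus>\<^bsub>A\<^esub>a\<in>?F. k a \<odot>\<^bsub>A\<^esub> a)"
        using kj f by (simp add: A.sm_r_distr A.finsum_closed)
      also have "inverse (k j) \<odot>\<^bsub>A\<^esub> (k j \<odot>\<^bsub>A\<^esub> j) = j"
        using A.sm_assoc[of "inverse (k j)" "k j" j] kj k by simp
      also have "inverse (k j) \<odot>\<^bsub>A\<^esub> (\<Oplus>\<^bsub>A\<^esub>a\<in>?F. k a \<odot>\<^bsub>A\<^esub> a) = \<ominus>\<^bsub>A\<^esub> (\<Oplus>\<^bsub>A\<^esub>a\<in>?F. l a \<odot>\<^bsub>A\<^esub> a)"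
      proof -
        have "inverse (k j) \<odot>\<^bsub>A\<^esub> (\<Oplus>\<^bsub>A\<^esub>a\<in>H. k a \<odot>\<^bsub>A\<^esub> a) = \<ominus>\<^bsub>A\<^esub> (\<Oplus>\<^bsub>A\<^esub>a\<in>H. l a \<odot>\<^bsub>A\<^esub> a)"
          if "finite H" "H \<subseteq> S" for H using that
        proof (induction H)
          case empty then show ?case using kj by simp
        next
          case (insert x H)
          have x: "x \<in> carrier A" "k x \<in> K" "l x \<in> K" using insert less.prems k l by auto
          have g: "(\<lambda>a. k a \<odot>\<^bsub>A\<^esub> a) \<in> H \<rightarrow> carrier A" "(\<lambda>a. l a \<odot>\<^bsub>A\<^esub> a) \<in> H \<rightarrow> carrier A"
            using insert.prems less.prems k l by (auto simp: Pi_iff subset_iff)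
          have "inverse (k j) \<odot>\<^bsub>A\<^esub> (k x \<odot>\<^bsub>A\<^esub> x) = \<ominus>\<^bsub>A\<^esub> (l x \<odot>\<^bsub>A\<^esub> x)"
            using A.sm_assoc[of "inverse (k j)" "k x" x] x kj by (simp add: l_def A.sm_minus)
          then show ?case using insert x g kj
            by (simp add: A.finsum_insert A.sm_r_distr A.finsum_closed A.minus_add)
        qed
        then show ?thesis using F by blast
      qed
      finally have "j \<ominus>\<^bsub>A\<^esub> (\<Oplus>\<^bsub>A\<^esub>a\<in>?F. l a \<odot>\<^bsub>A\<^esub> a) \<in> N"
        using N(2)[OF _ k(2), of "inverse (k j)"] kj by (simp add: a_minus_def)
      moreover have "P ?F (\<lambda>a. c a \<oplus>\<^bsub>B\<^esub> l a \<odot>\<^bsub>B\<^esub> c j)"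
      proof (rule less.hyps)
        show "card ?F < card S" using card_Diff1_less[OF less.prems(1) k(3)] .
        show "(\<lambda>a. c a \<oplus>\<^bsub>B\<^esub> l a \<odot>\<^bsub>B\<^esub> c j) \<in> ?F \<rightarrow> carrier B" using less.prems k l by (auto simp: Pi_iff)
      qed (use less.prems in auto)
      ultimately show ?thesis using step[OF less.prems k(3) l] by blast
    qed
  qed
qed

text \<open>The graph of the homomorphism to be constructed, generated term by term. In contrast to
  the sums over sets S in \<open>is_tensor_product\<close>, the same left factor may occur
  repeatedly, so closure under sums and products is immediate and well-definedness is a separate
  question.\<close>

inductive tensor_rel for A B T C \<alpha> \<beta> f g where
  zero: "tensor_rel A B T C \<alpha> \<beta> f g \<zero>\<^bsub>T\<^esub> \<zero>\<^bsub>C\<^esub>"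
| add: "tensor_rel A B T C \<alpha> \<beta> f g t r \<Longrightarrow> a \<in> carrier A \<Longrightarrow> b \<in> carrier B \<Longrightarrow>
    tensor_rel A B T C \<alpha> \<beta> f g (t \<oplus>\<^bsub>T\<^esub> \<alpha> a \<otimes>\<^bsub>T\<^esub> \<beta> b) (r \<oplus>\<^bsub>C\<^esub> f a \<otimes>\<^bsub>C\<^esub> g b)"

text \<open>The universal property of the tensor product, obtained from generation by products and
  independence over linearly independent left factors. Generation makes the relation
  \<open>tensor_rel\<close> total; independence makes it single-valued.\<close>

lemma tensor_lift:
  assumes "kalgebra A K" "kalgebra B K" "kalgebra T K" "kalgebra C K"
    and tp: "is_tensor_product K A B T \<alpha> \<beta>" and f: "alg_hom K A C f" and g: "alg_hom K B C g"
  obtains p where "alg_hom K T C p" "\<And>a. a \<in> carrier A \<Longrightarrow> p (\<alpha> a) = f a"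
    "\<And>b. b \<in> carrier B \<Longrightarrow> p (\<beta> b) = g b"
proof -
  interpret A: kalgebra A K by fact
  interpret B: kalgebra B K by fact
  interpret T: kalgebra T K by fact
  interpret C: kalgebra C K by fact
  have al: "alg_hom K A T \<alpha>" and be: "alg_hom K B T \<beta>" using tp by (simp_all add: is_tensor_product_def)
  interpret al: kalgebra_hom A T K \<alpha> by unfold_locales fact
  interpret be: kalgebra_hom B T K \<beta> by unfold_locales fact
  interpret f: kalgebra_hom A C K f by unfold_locales fact
  interpret g: kalgebra_hom B C K g by unfold_locales fact
  let ?R = "tensor_rel A B T C \<alpha> \<beta> f g"
  have cl: "t \<in> carrier T \<and> r \<in> carrier C" if "?R t r" for t r
    using that by induction auto
  have R0: "?R \<zero>\<^bsub>T\<^esub> \<zero>\<^bsub>C\<^esub>" by (rule tensor_rel.zero)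
  have R1: "?R (\<alpha> a \<otimes>\<^bsub>T\<^esub> \<beta> b) (f a \<otimes>\<^bsub>C\<^esub> g b)" if "a \<in> carrier A" "b \<in> carrier B" for a b
    using tensor_rel.add[OF R0 that] that by simp
  have Radd: "?R (t \<oplus>\<^bsub>T\<^esub> t') (r \<oplus>\<^bsub>C\<^esub> r')" if "?R t' r'" "?R t r" for t r t' r'
    using that(1)
  proof induction
    case zero then show ?case using that(2) cl by simp
  next
    case (add t' r' a b)
    have "?R ((t \<oplus>\<^bsub>T\<^esub> t') \<oplus>\<^bsub>T\<^esub> \<alpha> a \<otimes>\<^bsub>T\<^esub> \<beta> b) ((r \<oplus>\<^bsub>C\<^esub> r') \<oplus>\<^bsub>C\<^esub> f a \<otimes>\<^bsub>C\<^esub> g b)"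
      using add by (blast intro: tensor_rel.add)
    then show ?case using add cl[OF that(2)] cl[OF add(1)] by (simp add: T.a_assoc C.a_assoc)
  qed
  have Rsm: "?R (k \<odot>\<^bsub>T\<^esub> t) (k \<odot>\<^bsub>C\<^esub> r)" if "?R t r" "k \<in> K" for t r k
    using that(1)
  proof induction
    case zero then show ?case using that(2) R0 by simp
  next
    case (add t r a b)
    have "?R (k \<odot>\<^bsub>T\<^esub> t \<oplus>\<^bsub>T\<^esub> \<alpha> (k \<odot>\<^bsub>A\<^esub> a) \<otimes>\<^bsub>T\<^esub> \<beta> b) (k \<odot>\<^bsub>C\<^esub> r \<oplus>\<^bsub>C\<^esub> f (k \<odot>\<^bsub>A\<^esub> a) \<otimes>\<^bsub>C\<^esub> g b)"
      using add that(2) by (intro tensor_rel.add) auto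
    then show ?case using add cl[OF add(1)] that(2)
      by (simp add: T.sm_r_distr C.sm_r_distr T.sm_mult C.sm_mult)
  qed
  have Rm1: "?R (t \<otimes>\<^bsub>T\<^esub> (\<alpha> a \<otimes>\<^bsub>T\<^esub> \<beta> b)) (r \<otimes>\<^bsub>C\<^esub> (f a \<otimes>\<^bsub>C\<^esub> g b))"
    if "?R t r" "a \<in> carrier A" "b \<in> carrier B" for t r a b
    using that(1)
  proof induction
    case zero then show ?case using that R0 by simp
  next
    case (add t r a' b')
    have "?R (t \<otimes>\<^bsub>T\<^esub> (\<alpha> a \<otimes>\<^bsub>T\<^esub> \<beta> b) \<oplus>\<^bsub>T\<^esub> \<alpha> (a' \<otimes>\<^bsub>A\<^esub> a) \<otimes>\<^bsub>T\<^esub> \<beta> (b' \<otimes>\<^bsub>B\<^esub> b))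
      (r \<otimes>\<^bsub>C\<^esub> (f a \<otimes>\<^bsub>C\<^esub> g b) \<oplus>\<^bsub>C\<^esub> f (a' \<otimes>\<^bsub>A\<^esub> a) \<otimes>\<^bsub>C\<^esub> g (b' \<otimes>\<^bsub>B\<^esub> b))"
      using add that by (intro tensor_rel.add) auto
    moreover have "(t \<oplus>\<^bsub>T\<^esub> \<alpha> a' \<otimes>\<^bsub>T\<^esub> \<beta> b') \<otimes>\<^bsub>T\<^esub> (\<alpha> a \<otimes>\<^bsub>T\<^esub> \<beta> b) =
        t \<otimes>\<^bsub>T\<^esub> (\<alpha> a \<otimes>\<^bsub>T\<^esub> \<beta> b) \<oplus>\<^bsub>T\<^esub> \<alpha> (a' \<otimes>\<^bsub>A\<^esub> a) \<otimes>\<^bsub>T\<^esub> \<beta> (b' \<otimes>\<^bsub>B\<^esub> b)"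
      "(r \<oplus>\<^bsub>C\<^esub> f a' \<otimes>\<^bsub>C\<^esub> g b') \<otimes>\<^bsub>C\<^esub> (f a \<otimes>\<^bsub>C\<^esub> g b) =
        r \<otimes>\<^bsub>C\<^esub> (f a \<otimes>\<^bsub>C\<^esub> g b) \<oplus>\<^bsub>C\<^esub> f (a' \<otimes>\<^bsub>A\<^esub> a) \<otimes>\<^bsub>C\<^esub> g (b' \<otimes>\<^bsub>B\<^esub> b)"
      using add cl[OF add(1)] that(2,3) by (simp_all add: T.l_distr C.l_distr T.r_distr C.r_distr T.m_ac C.m_ac)
    ultimately show ?case by simp
  qed
  have Rm: "?R (t \<otimes>\<^bsub>T\<^esub> t') (r \<otimes>\<^bsub>C\<^esub> r')" if "?R t' r'" "?R t r" for t r t' r'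
    using that(1)
  proof induction
    case zero then show ?case using that(2) cl R0 by simp
  next
    case (add t' r' a b)
    show ?case using Radd[OF Rm1[OF that(2) add(2,3)] add(4)] add cl[OF that(2)] cl[OF add(1)]
      by (simp add: T.r_distr C.r_distr)
  qed
  have Rsum: "?R (\<Oplus>\<^bsub>T\<^esub>a\<in>S. \<alpha> a \<otimes>\<^bsub>T\<^esub> \<beta> (c a)) (\<Oplus>\<^bsub>C\<^esub>a\<in>S. f a \<otimes>\<^bsub>C\<^esub> g (c a))"
    if "finite S" "S \<subseteq> carrier A" "c \<in> S \<rightarrow> carrier B" for S c
    using that
  proof (induction S)
    case empty then show ?case using R0 by simp
  next
    case (insert x S)
    have x: "x \<in> carrier A" "c x \<in> carrier B" using insert by auto
    have "?R ((\<Oplus>\<^bsub>T\<^esub>a\<in>S. \<alpha> a \<otimes>\<^bsub>T\<^esub> \<beta> (c a)) \<oplus>\<^bsub>T\<^esub> \<alpha> x \<otimes>\<^bsub>T\<^esub> \<beta> (c x)) ((\<Oplus>\<^bsub>C\<^esub>a\<in>S. f a \<otimes>\<^bsub>C\<^esub> g (c a)) \<oplus>\<^bsub>C\<^esub> f x \<otimes>\<^bsub>C\<^esub> g (c x))"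
      using insert x by (intro tensor_rel.add) auto
    moreover have "(\<lambda>a. \<alpha> a \<otimes>\<^bsub>T\<^esub> \<beta> (c a)) \<in> S \<rightarrow> carrier T" "(\<lambda>a. f a \<otimes>\<^bsub>C\<^esub> g (c a)) \<in> S \<rightarrow> carrier C"
      using insert by auto
    ultimately show ?case using insert x by (simp add: T.finsum_insert C.finsum_insert T.a_comm C.a_comm T.finsum_closed C.finsum_closed)
  qed
  have total: "\<exists>r. ?R t r" if "t \<in> carrier T" for t
  proof -
    have "\<exists>S \<subseteq> carrier A. finite S \<and>
        (\<exists>c \<in> S \<rightarrow> carrier B. t = (\<Oplus>\<^bsub>T\<^esub>a\<in>S. \<alpha> a \<otimes>\<^bsub>T\<^esub> \<beta> (c a)))"
      using tp that unfolding is_tensor_product_def by blast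
    then show ?thesis using Rsum by blast
  qed
  have indep: "\<forall>a\<in>S. c a = \<zero>\<^bsub>B\<^esub>" if "lin_indep K A S" "c \<in> S \<rightarrow> carrier B"
     "(\<Oplus>\<^bsub>T\<^esub>a\<in>S. \<alpha> a \<otimes>\<^bsub>T\<^esub> \<beta> (c a)) = \<zero>\<^bsub>T\<^esub>" for S c
    using tp that unfolding is_tensor_product_def by blast
  have N0: "{\<zero>\<^bsub>A\<^esub>} \<subseteq> carrier A" "\<And>k a. k \<in> K \<Longrightarrow> a \<in> {\<zero>\<^bsub>A\<^esub>} \<Longrightarrow> k \<odot>\<^bsub>A\<^esub> a \<in> {\<zero>\<^bsub>A\<^esub>}" by auto
  \<comment> \<open>With N = {0} the remainder split off by elimination is zero, so both sums keep
    their values while S shrinks to a linearly independent set. There the vanishing in T forces all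
    coefficients to vanish.\<close>
  have main: "(\<Oplus>\<^bsub>T\<^esub>a\<in>S. \<alpha> a \<otimes>\<^bsub>T\<^esub> \<beta> (c a)) = \<zero>\<^bsub>T\<^esub> \<longrightarrow> (\<Oplus>\<^bsub>C\<^esub>a\<in>S. f a \<otimes>\<^bsub>C\<^esub> g (c a)) = \<zero>\<^bsub>C\<^esub>"
    (is "?P S c") if "finite S" "S \<subseteq> carrier A" "c \<in> S \<rightarrow> carrier B" for S c
  proof (rule elimination_induct[OF \<open>kalgebra A K\<close> \<open>kalgebra B K\<close> N0 that])
    fix S c
    assume base: "finite S" "S \<subseteq> carrier A" "c \<in> S \<rightarrow> carrier B"
      "\<And>k. k \<in> S \<rightarrow> K \<Longrightarrow> (\<Oplus>\<^bsub>A\<^esub>a\<in>S. k a \<odot>\<^bsub>A\<^esub> a) \<in> {\<zero>\<^bsub>A\<^esub>} \<Longrightarrow> \<forall>a\<in>S. k a = 0"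
    then have "lin_indep K A S" by (auto simp: lin_indep_def)
    show "?P S c"
    proof
      assume "(\<Oplus>\<^bsub>T\<^esub>a\<in>S. \<alpha> a \<otimes>\<^bsub>T\<^esub> \<beta> (c a)) = \<zero>\<^bsub>T\<^esub>"
      then have "\<forall>a\<in>S. c a = \<zero>\<^bsub>B\<^esub>" using indep \<open>lin_indep K A S\<close> base by blast
      then show "(\<Oplus>\<^bsub>C\<^esub>a\<in>S. f a \<otimes>\<^bsub>C\<^esub> g (c a)) = \<zero>\<^bsub>C\<^esub>"
        using base by (intro C.add.finprod_one_eqI) auto
    qed
  next
    fix S c j k
    assume step: "finite S" "S \<subseteq> carrier A" "c \<in> S \<rightarrow> carrier B" "j \<in> S" "k \<in> S \<rightarrow> K"
      "j \<ominus>\<^bsub>A\<^esub> (\<Oplus>\<^bsub>A\<^esub>a\<in>S - {j}. k a \<odot>\<^bsub>A\<^esub> a) \<in> {\<zero>\<^bsub>A\<^esub>}" "?P (S - {j}) (\<lambda>a. c a \<oplus>\<^bsub>B\<^esub> k a \<odot>\<^bsub>B\<^esub> c j)"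
    have cj: "c j \<in> carrier B" using step by auto
    have "(\<Oplus>\<^bsub>T\<^esub>a\<in>S. \<alpha> a \<otimes>\<^bsub>T\<^esub> \<beta> (c a)) = (\<Oplus>\<^bsub>T\<^esub>a\<in>S - {j}. \<alpha> a \<otimes>\<^bsub>T\<^esub> \<beta> (c a \<oplus>\<^bsub>B\<^esub> k a \<odot>\<^bsub>B\<^esub> c j)) \<oplus>\<^bsub>T\<^esub>
      \<alpha> (j \<ominus>\<^bsub>A\<^esub> (\<Oplus>\<^bsub>A\<^esub>a\<in>S - {j}. k a \<odot>\<^bsub>A\<^esub> a)) \<otimes>\<^bsub>T\<^esub> \<beta> (c j)"
      using step by (intro bilinear_elimination[OF \<open>kalgebra A K\<close> \<open>kalgebra B K\<close> \<open>kalgebra T K\<close>])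
        (auto simp: T.l_distr T.r_distr T.sm_mult T.sm_mult2)
    moreover have "(\<Oplus>\<^bsub>C\<^esub>a\<in>S. f a \<otimes>\<^bsub>C\<^esub> g (c a)) = (\<Oplus>\<^bsub>C\<^esub>a\<in>S - {j}. f a \<otimes>\<^bsub>C\<^esub> g (c a \<oplus>\<^bsub>B\<^esub> k a \<odot>\<^bsub>B\<^esub> c j)) \<oplus>\<^bsub>C\<^esub>
      f (j \<ominus>\<^bsub>A\<^esub> (\<Oplus>\<^bsub>A\<^esub>a\<in>S - {j}. k a \<odot>\<^bsub>A\<^esub> a)) \<otimes>\<^bsub>C\<^esub> g (c j)"
      using step by (intro bilinear_elimination[OF \<open>kalgebra A K\<close> \<open>kalgebra B K\<close> \<open>kalgebra C K\<close>])
        (auto simp: C.l_distr C.r_distr C.sm_mult C.sm_mult2)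
    moreover have z: "j \<ominus>\<^bsub>A\<^esub> (\<Oplus>\<^bsub>A\<^esub>a\<in>S - {j}. k a \<odot>\<^bsub>A\<^esub> a) = \<zero>\<^bsub>A\<^esub>" using step(6) by simp
    moreover have "(\<Oplus>\<^bsub>T\<^esub>a\<in>S - {j}. \<alpha> a \<otimes>\<^bsub>T\<^esub> \<beta> (c a \<oplus>\<^bsub>B\<^esub> k a \<odot>\<^bsub>B\<^esub> c j)) \<in> carrier T"
      "(\<Oplus>\<^bsub>C\<^esub>a\<in>S - {j}. f a \<otimes>\<^bsub>C\<^esub> g (c a \<oplus>\<^bsub>B\<^esub> k a \<odot>\<^bsub>B\<^esub> c j)) \<in> carrier C"
      using step(1-5) cj by (auto intro!: T.finsum_closed C.finsum_closed simp: Pi_iff subset_iff)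
    ultimately show "?P S c" using step(7) cj by (simp del: A.add.finprod_closed)
  qed
  have rep: "\<exists>S c. finite S \<and> S \<subseteq> carrier A \<and> c \<in> S \<rightarrow> carrier B \<and>
      t = (\<Oplus>\<^bsub>T\<^esub>a\<in>S. \<alpha> a \<otimes>\<^bsub>T\<^esub> \<beta> (c a)) \<and> r = (\<Oplus>\<^bsub>C\<^esub>a\<in>S. f a \<otimes>\<^bsub>C\<^esub> g (c a))" if "?R t r" for t r
    using that
  proof induction
    case zero
    show ?case by (intro exI[of _ "{}"]) auto
  next
    case (add t r a b)
    then obtain S c where S: "finite S" "S \<subseteq> carrier A" "c \<in> S \<rightarrow> carrier B"
      "t = (\<Oplus>\<^bsub>T\<^esub>a\<in>S. \<alpha> a \<otimes>\<^bsub>T\<^esub> \<beta> (c a))" "r = (\<Oplus>\<^bsub>C\<^esub>a\<in>S. f a \<otimes>\<^bsub>C\<^esub> g (c a))" by blast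
    define F where "F = S - {a}"
    \<comment> \<open>The left factor a may already occur in the sum. Its old coefficient, or zero
      if there is none, is merged with the new one, since \<open>main\<close> is about sums over
      sets of distinct left factors.\<close>
    define c0 where "c0 = (if a \<in> S then c a else \<zero>\<^bsub>B\<^esub>)"
    have F: "finite F" "a \<notin> F" "F \<subseteq> carrier A" "c \<in> F \<rightarrow> carrier B" and c0: "c0 \<in> carrier B"
      using S by (auto simp: F_def c0_def)
    have fT: "(\<lambda>a. \<alpha> a \<otimes>\<^bsub>T\<^esub> \<beta> (c a)) \<in> F \<rightarrow> carrier T" "(\<lambda>a. f a \<otimes>\<^bsub>C\<^esub> g (c a)) \<in> F \<rightarrow> carrier C" using F by auto
    have tr: "t = \<alpha> a \<otimes>\<^bsub>T\<^esub> \<beta> c0 \<oplus>\<^bsub>T\<^esub> (\<Oplus>\<^bsub>T\<^esub>a\<in>F. \<alpha> a \<otimes>\<^bsub>T\<^esub> \<beta> (c a)) \<and> r = f a \<otimes>\<^bsub>C\<^esub> g c0 \<oplus>\<^bsub>C\<^esub> (\<Oplus>\<^bsub>C\<^esub>a\<in>F. f a \<otimes>\<^bsub>C\<^esub> g (c a))"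
    proof (cases "a \<in> S")
      case True
      then have "S = insert a F" by (auto simp: F_def)
      then show ?thesis using S(4,5) True F fT add c0
        by (simp add: c0_def T.finsum_insert C.finsum_insert)
    next
      case False
      then have "F = S" by (auto simp: F_def)
      then show ?thesis using S(4,5) False fT add by (simp add: c0_def T.finsum_closed C.finsum_closed)
    qed
    let ?c = "c(a := c0 \<oplus>\<^bsub>B\<^esub> b)"
    have cong: "(\<Oplus>\<^bsub>T\<^esub>a\<in>F. \<alpha> a \<otimes>\<^bsub>T\<^esub> \<beta> (?c a)) = (\<Oplus>\<^bsub>T\<^esub>a\<in>F. \<alpha> a \<otimes>\<^bsub>T\<^esub> \<beta> (c a))"
      "(\<Oplus>\<^bsub>C\<^esub>a\<in>F. f a \<otimes>\<^bsub>C\<^esub> g (?c a)) = (\<Oplus>\<^bsub>C\<^esub>a\<in>F. f a \<otimes>\<^bsub>C\<^esub> g (c a))"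
      using F fT by (auto intro!: T.finsum_cong' C.finsum_cong')
    have fT': "(\<lambda>a. \<alpha> a \<otimes>\<^bsub>T\<^esub> \<beta> (?c a)) \<in> F \<rightarrow> carrier T" "(\<lambda>a. f a \<otimes>\<^bsub>C\<^esub> g (?c a)) \<in> F \<rightarrow> carrier C"
      using F c0 add(2,3) by (auto simp: Pi_iff subset_iff)
    have "t \<oplus>\<^bsub>T\<^esub> \<alpha> a \<otimes>\<^bsub>T\<^esub> \<beta> b = (\<Oplus>\<^bsub>T\<^esub>a\<in>insert a F. \<alpha> a \<otimes>\<^bsub>T\<^esub> \<beta> (?c a))"
      using T.finsum_insert[OF F(1,2) fT'(1)] cong tr fT c0 add
      by (simp add: T.finsum_closed T.r_distr T.a_ac)
    moreover have "r \<oplus>\<^bsub>C\<^esub> f a \<otimes>\<^bsub>C\<^esub> g b = (\<Oplus>\<^bsub>C\<^esub>a\<in>insert a F. f a \<otimes>\<^bsub>C\<^esub> g (?c a))"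
      using C.finsum_insert[OF F(1,2) fT'(2)] cong tr fT c0 add
      by (simp add: C.finsum_closed C.r_distr C.a_ac)
    moreover have "finite (insert a F)" "insert a F \<subseteq> carrier A" "?c \<in> insert a F \<rightarrow> carrier B"
      using F c0 add(2,3) by (auto simp: Pi_iff)
    ultimately show ?case by (intro exI[of _ "insert a F"] exI[of _ ?c] conjI)
  qed
  have zero: "r = \<zero>\<^bsub>C\<^esub>" if "?R \<zero>\<^bsub>T\<^esub> r" for r 
  proof -
    from rep[OF that] obtain S c where S: "finite S" "S \<subseteq> carrier A" "c \<in> S \<rightarrow> carrier B"
      and "\<zero>\<^bsub>T\<^esub> = (\<Oplus>\<^bsub>T\<^esub>a\<in>S. \<alpha> a \<otimes>\<^bsub>T\<^esub> \<beta> (c a))" "r = (\<Oplus>\<^bsub>C\<^esub>a\<in>S. f a \<otimes>\<^bsub>C\<^esub> g (c a))" by blast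
    then show ?thesis using main[OF S] by (simp only:)
  qed
  \<comment> \<open>Since the relation is compatible with sums and scalars, it is enough that zero
    is related to nothing but zero.\<close>
  have uniq: "r = r'" if "?R t r" "?R t r'" for t r r'
  proof -
    have "?R (t \<oplus>\<^bsub>T\<^esub> (- 1) \<odot>\<^bsub>T\<^esub> t) (r \<oplus>\<^bsub>C\<^esub> (- 1) \<odot>\<^bsub>C\<^esub> r')" using Radd[OF Rsm[OF that(2), of "-1"] that(1)] by simp
    then have "r \<ominus>\<^bsub>C\<^esub> r' = \<zero>\<^bsub>C\<^esub>" using zero cl that by (simp add: T.sm_uminus1 C.sm_uminus1 T.r_neg a_minus_def)
    then show ?thesis using cl that by simp
  qed
  define p where "p t = (THE r. ?R t r)" for t
  have pI: "p t = r" if "?R t r" for t r unfolding p_def using uniq that by blast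
  have pR: "?R t (p t)" if "t \<in> carrier T" for t using total[OF that] pI by blast
  have pa: "p (\<alpha> a) = f a" if "a \<in> carrier A" for a using pI[OF R1[OF that B.one_closed]] that by simp
  have pb: "p (\<beta> b) = g b" if "b \<in> carrier B" for b using pI[OF R1[OF A.one_closed that]] that by simp
  have "alg_hom K T C p"
  proof (rule alg_homI)
    show "p \<one>\<^bsub>T\<^esub> = \<one>\<^bsub>C\<^esub>" using pa[of "\<one>\<^bsub>A\<^esub>"] by simp
    fix t assume t: "t \<in> carrier T"
    show "p t \<in> carrier C" using cl[OF pR[OF t]] by simp
    show "p (k \<odot>\<^bsub>T\<^esub> t) = k \<odot>\<^bsub>C\<^esub> p t" if "k \<in> K" for k by (rule pI[OF Rsm[OF pR[OF t] that]])
    fix t' assume t': "t' \<in> carrier T"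
    show "p (t \<oplus>\<^bsub>T\<^esub> t') = p t \<oplus>\<^bsub>C\<^esub> p t'" by (rule pI[OF Radd[OF pR[OF t'] pR[OF t]]])
    show "p (t \<otimes>\<^bsub>T\<^esub> t') = p t \<otimes>\<^bsub>C\<^esub> p t'" by (rule pI[OF Rm[OF pR[OF t'] pR[OF t]]])
  qed
  then show ?thesis using that pa pb by blast
qed

lemma tensor_hom_eqI:
  assumes "kalgebra A K" "kalgebra B K" "kalgebra T K" "kalgebra C K"
    and tp: "is_tensor_product K A B T \<alpha> \<beta>" and p: "alg_hom K T C p" and q: "alg_hom K T C q"
    and pq: "\<And>a. a \<in> carrier A \<Longrightarrow> p (\<alpha> a) = q (\<alpha> a)" "\<And>b. b \<in> carrier B \<Longrightarrow> p (\<beta> b) = q (\<beta> b)"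
    and t: "t \<in> carrier T"
  shows "p t = q t"
proof -
  interpret A: kalgebra A K by fact
  interpret B: kalgebra B K by fact
  interpret T: kalgebra T K by fact
  interpret C: kalgebra C K by fact
  have al: "alg_hom K A T \<alpha>" and be: "alg_hom K B T \<beta>" using tp by (simp_all add: is_tensor_product_def)
  interpret al: kalgebra_hom A T K \<alpha> by unfold_locales fact
  interpret be: kalgebra_hom B T K \<beta> by unfold_locales fact
  interpret p: kalgebra_hom T C K p by unfold_locales fact
  interpret q: kalgebra_hom T C K q by unfold_locales fact
  have "\<exists>S \<subseteq> carrier A. finite S \<and>
        (\<exists>c \<in> S \<rightarrow> carrier B. t = (\<Oplus>\<^bsub>T\<^esub>a\<in>S. \<alpha> a \<otimes>\<^bsub>T\<^esub> \<beta> (c a)))"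
    using tp t unfolding is_tensor_product_def by blast
  then obtain S c where S: "S \<subseteq> carrier A" "finite S" "c \<in> S \<rightarrow> carrier B"
    "t = (\<Oplus>\<^bsub>T\<^esub>a\<in>S. \<alpha> a \<otimes>\<^bsub>T\<^esub> \<beta> (c a))" by blast
  have m: "(\<lambda>a. \<alpha> a \<otimes>\<^bsub>T\<^esub> \<beta> (c a)) \<in> S \<rightarrow> carrier T" using S by auto
  have "(\<Oplus>\<^bsub>C\<^esub>a\<in>S. p (\<alpha> a \<otimes>\<^bsub>T\<^esub> \<beta> (c a))) = (\<Oplus>\<^bsub>C\<^esub>a\<in>S. q (\<alpha> a \<otimes>\<^bsub>T\<^esub> \<beta> (c a)))"
    using S pq by (intro C.finsum_cong') (auto simp: Pi_iff subset_iff)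
  then show ?thesis using S(4) p.hom_finsum[OF m] q.hom_finsum[OF m] by (simp add: comp_def)
qed

text \<open>If the functionals \<open>\<phi> t\<close> separate the functional \<open>\<nu>\<close> from zero, then so do the maps
  \<open>id \<otimes> \<phi> t\<close> for \<open>id \<otimes> \<nu>\<close>, even modulo a subspace; the coefficients are reduced until they are
  linearly independent modulo the subspace.\<close>

lemma tensor_functional:
  assumes "kalgebra A K" "kalgebra B K"
    and N: "N \<subseteq> carrier A" "\<And>k a. k \<in> K \<Longrightarrow> a \<in> N \<Longrightarrow> k \<odot>\<^bsub>A\<^esub> a \<in> N" "\<zero>\<^bsub>A\<^esub> \<in> N"
      "\<And>a b. a \<in> N \<Longrightarrow> b \<in> N \<Longrightarrow> a \<oplus>\<^bsub>A\<^esub> b \<in> N"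
    and phi: "\<And>t. t \<in> I \<Longrightarrow> \<phi> t \<in> carrier B \<rightarrow> K"
      "\<And>t b b'. t \<in> I \<Longrightarrow> b \<in> carrier B \<Longrightarrow> b' \<in> carrier B \<Longrightarrow> \<phi> t (b \<oplus>\<^bsub>B\<^esub> b') = \<phi> t b + \<phi> t b'"
      "\<And>t k b. t \<in> I \<Longrightarrow> k \<in> K \<Longrightarrow> b \<in> carrier B \<Longrightarrow> \<phi> t (k \<odot>\<^bsub>B\<^esub> b) = k * \<phi> t b"
    and lam: "\<nu> \<in> carrier B \<rightarrow> K"
      "\<And>b b'. b \<in> carrier B \<Longrightarrow> b' \<in> carrier B \<Longrightarrow> \<nu> (b \<oplus>\<^bsub>B\<^esub> b') = \<nu> b + \<nu> b'"
      "\<And>k b. k \<in> K \<Longrightarrow> b \<in> carrier B \<Longrightarrow> \<nu> (k \<odot>\<^bsub>B\<^esub> b) = k * \<nu> b"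
    and sep: "\<And>b. b \<in> carrier B \<Longrightarrow> (\<And>t. t \<in> I \<Longrightarrow> \<phi> t b = 0) \<Longrightarrow> \<nu> b = 0"
    and S: "finite S" "S \<subseteq> carrier A" "c \<in> S \<rightarrow> carrier B"
    and van: "\<And>t. t \<in> I \<Longrightarrow> (\<Oplus>\<^bsub>A\<^esub>a\<in>S. \<phi> t (c a) \<odot>\<^bsub>A\<^esub> a) \<in> N"
  shows "(\<Oplus>\<^bsub>A\<^esub>a\<in>S. \<nu> (c a) \<odot>\<^bsub>A\<^esub> a) \<in> N"
proof -
  interpret A: kalgebra A K by fact
  interpret B: kalgebra B K by fact
  have Nm: "a \<ominus>\<^bsub>A\<^esub> b \<in> N" if "a \<in> N" "b \<in> N" for a b
    using N(2)[of "-1" b] N(4)[OF that(1), of "(-1) \<odot>\<^bsub>A\<^esub> b"] that N(1) by (auto simp: A.sm_uminus1 a_minus_def)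
  have elim: "(\<Oplus>\<^bsub>A\<^esub>a\<in>S. \<mu> (c a) \<odot>\<^bsub>A\<^esub> a) = (\<Oplus>\<^bsub>A\<^esub>a\<in>S - {j}. \<mu> (c a \<oplus>\<^bsub>B\<^esub> k a \<odot>\<^bsub>B\<^esub> c j) \<odot>\<^bsub>A\<^esub> a) \<oplus>\<^bsub>A\<^esub>
      \<mu> (c j) \<odot>\<^bsub>A\<^esub> (j \<ominus>\<^bsub>A\<^esub> (\<Oplus>\<^bsub>A\<^esub>a\<in>S - {j}. k a \<odot>\<^bsub>A\<^esub> a))"
    if "finite S" "S \<subseteq> carrier A" "j \<in> S" "c \<in> S \<rightarrow> carrier B" "k \<in> S \<rightarrow> K" and
      mu: "\<mu> \<in> carrier B \<rightarrow> K"
      "\<And>b b'. b \<in> carrier B \<Longrightarrow> b' \<in> carrier B \<Longrightarrow> \<mu> (b \<oplus>\<^bsub>B\<^esub> b') = \<mu> b + \<mu> b'"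
      "\<And>k b. k \<in> K \<Longrightarrow> b \<in> carrier B \<Longrightarrow> \<mu> (k \<odot>\<^bsub>B\<^esub> b) = k * \<mu> b" for \<mu> S c j k
  proof (rule bilinear_elimination[where p = "\<lambda>a b. \<mu> b \<odot>\<^bsub>A\<^esub> a", OF \<open>kalgebra A K\<close> \<open>kalgebra B K\<close> \<open>kalgebra A K\<close>])
    fix k a b assume h: "k \<in> K" "a \<in> carrier A" "b \<in> carrier B"
    have mb: "\<mu> b \<in> K" using mu h by auto
    show "\<mu> b \<odot>\<^bsub>A\<^esub> (k \<odot>\<^bsub>A\<^esub> a) = \<mu> (k \<odot>\<^bsub>B\<^esub> b) \<odot>\<^bsub>A\<^esub> a"
      using h mb by (simp add: mu(3) A.sm_assoc[symmetric] mult.commute)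
  qed (use that in \<open>auto simp: A.sm_r_distr A.sm_l_distr Pi_iff\<close>)
  have "(\<forall>t\<in>I. (\<Oplus>\<^bsub>A\<^esub>a\<in>S. \<phi> t (c a) \<odot>\<^bsub>A\<^esub> a) \<in> N) \<longrightarrow> (\<Oplus>\<^bsub>A\<^esub>a\<in>S. \<nu> (c a) \<odot>\<^bsub>A\<^esub> a) \<in> N"
    (is "?P S c")
  proof (rule elimination_induct[OF \<open>kalgebra A K\<close> \<open>kalgebra B K\<close> N(1,2) S])
    fix S c
    assume base: "finite S" "S \<subseteq> carrier A" "c \<in> S \<rightarrow> carrier B"
      "\<And>k. k \<in> S \<rightarrow> K \<Longrightarrow> (\<Oplus>\<^bsub>A\<^esub>a\<in>S. k a \<odot>\<^bsub>A\<^esub> a) \<in> N \<Longrightarrow> \<forall>a\<in>S. k a = 0"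
    show "?P S c"
    proof
      assume *: "\<forall>t\<in>I. (\<Oplus>\<^bsub>A\<^esub>a\<in>S. \<phi> t (c a) \<odot>\<^bsub>A\<^esub> a) \<in> N"
      have "\<phi> t (c a) = 0" if "t \<in> I" "a \<in> S" for t a
        using base(4)[of "\<lambda>a. \<phi> t (c a)"] * that phi(1)[OF that(1)] base(3) by (auto simp: Pi_iff)
      then have "\<nu> (c a) = 0" if "a \<in> S" for a using sep[of "c a"] that base(3) by (simp add: Pi_iff)
      then have "(\<Oplus>\<^bsub>A\<^esub>a\<in>S. \<nu> (c a) \<odot>\<^bsub>A\<^esub> a) = \<zero>\<^bsub>A\<^esub>"
        using base by (intro A.add.finprod_one_eqI) auto
      then show "(\<Oplus>\<^bsub>A\<^esub>a\<in>S. \<nu> (c a) \<odot>\<^bsub>A\<^esub> a) \<in> N" using N by simp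
    qed
  next
    fix S c j k
    assume step: "finite S" "S \<subseteq> carrier A" "c \<in> S \<rightarrow> carrier B" "j \<in> S" "k \<in> S \<rightarrow> K"
      "j \<ominus>\<^bsub>A\<^esub> (\<Oplus>\<^bsub>A\<^esub>a\<in>S - {j}. k a \<odot>\<^bsub>A\<^esub> a) \<in> N" "?P (S - {j}) (\<lambda>a. c a \<oplus>\<^bsub>B\<^esub> k a \<odot>\<^bsub>B\<^esub> c j)"
    let ?n = "j \<ominus>\<^bsub>A\<^esub> (\<Oplus>\<^bsub>A\<^esub>a\<in>S - {j}. k a \<odot>\<^bsub>A\<^esub> a)"
    have cj: "c j \<in> carrier B" using step by auto
    \<comment> \<open>The remainder lies in N, hence the term that elimination splits off can be
      subtracted from the sums for \<phi> t and added back to the sum for \<nu> without leaving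
      N.\<close>
    have in1: "\<mu> (c j) \<odot>\<^bsub>A\<^esub> ?n \<in> N" if "\<mu> \<in> carrier B \<rightarrow> K" for \<mu> using that cj step by (intro N(2)) auto
    show "?P S c"
    proof
      assume *: "\<forall>t\<in>I. (\<Oplus>\<^bsub>A\<^esub>a\<in>S. \<phi> t (c a) \<odot>\<^bsub>A\<^esub> a) \<in> N"
      have "(\<Oplus>\<^bsub>A\<^esub>a\<in>S - {j}. \<phi> t (c a \<oplus>\<^bsub>B\<^esub> k a \<odot>\<^bsub>B\<^esub> c j) \<odot>\<^bsub>A\<^esub> a) \<in> N" if t: "t \<in> I" for t
      proof -
        let ?s = "\<Oplus>\<^bsub>A\<^esub>a\<in>S - {j}. \<phi> t (c a \<oplus>\<^bsub>B\<^esub> k a \<odot>\<^bsub>B\<^esub> c j) \<odot>\<^bsub>A\<^esub> a"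
        have sc: "?s \<in> carrier A" using step cj phi(1)[OF t] by (intro A.finsum_closed) (auto simp: Pi_iff)
        have nc: "\<phi> t (c j) \<odot>\<^bsub>A\<^esub> ?n \<in> N" using in1 phi t by blast
        have "(\<Oplus>\<^bsub>A\<^esub>a\<in>S. \<phi> t (c a) \<odot>\<^bsub>A\<^esub> a) = ?s \<oplus>\<^bsub>A\<^esub> \<phi> t (c j) \<odot>\<^bsub>A\<^esub> ?n"
          by (rule elim[OF step(1,2,4,3,5) phi(1)[OF t] phi(2)[OF t] phi(3)[OF t]])
        then have "?s \<oplus>\<^bsub>A\<^esub> \<phi> t (c j) \<odot>\<^bsub>A\<^esub> ?n \<in> N" using bspec[OF * t] by (simp only:)
        from Nm[OF this nc] show ?thesis using sc subsetD[OF N(1) nc]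
          by (simp add: a_minus_def A.a_assoc A.r_neg del: A.add.finprod_closed)
      qed
      then have "(\<Oplus>\<^bsub>A\<^esub>a\<in>S - {j}. \<nu> (c a \<oplus>\<^bsub>B\<^esub> k a \<odot>\<^bsub>B\<^esub> c j) \<odot>\<^bsub>A\<^esub> a) \<in> N" using step(7) by blast
      then have "(\<Oplus>\<^bsub>A\<^esub>a\<in>S - {j}. \<nu> (c a \<oplus>\<^bsub>B\<^esub> k a \<odot>\<^bsub>B\<^esub> c j) \<odot>\<^bsub>A\<^esub> a) \<oplus>\<^bsub>A\<^esub> \<nu> (c j) \<odot>\<^bsub>A\<^esub> ?n \<in> N"
        by (rule N(4)[OF _ in1[OF lam(1)]])
      moreover have "(\<Oplus>\<^bsub>A\<^esub>a\<in>S. \<nu> (c a) \<odot>\<^bsub>A\<^esub> a) =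
          (\<Oplus>\<^bsub>A\<^esub>a\<in>S - {j}. \<nu> (c a \<oplus>\<^bsub>B\<^esub> k a \<odot>\<^bsub>B\<^esub> c j) \<odot>\<^bsub>A\<^esub> a) \<oplus>\<^bsub>A\<^esub> \<nu> (c j) \<odot>\<^bsub>A\<^esub> ?n"
        by (rule elim[OF step(1,2,4,3,5) lam])
      ultimately show "(\<Oplus>\<^bsub>A\<^esub>a\<in>S. \<nu> (c a) \<odot>\<^bsub>A\<^esub> a) \<in> N" by (simp only:)
    qed
  qed
  then show ?thesis using van by blast
qed

subsection \<open>The flow of a derivation at a rational point\<close>

text \<open>This is the algebra of sections of \<open>spec_field K\<close> over its point, so
  homomorphisms into it are the algebraic side of K-points.\<close>

definition kscalar :: "complex set \<Rightarrow> (complex, complex) module" where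
  "kscalar K = \<lparr>carrier = K, mult = (*), one = 1, zero = 0, add = (+), smult = (*)\<rparr>"

lemma kscalar_simps [simp]:
  "carrier (kscalar K) = K" "mult (kscalar K) = (*)" "one (kscalar K) = 1" "zero (kscalar K) = 0"
  "add (kscalar K) = (+)" "smult (kscalar K) = (*)"
  by (simp_all add: kscalar_def)

lemma algebra_kscalar:
  assumes "K = \<real> \<or> K = UNIV"
  shows "algebra (scalars K) (kscalar K)"
proof -
  note cl = ground_closed[OF assms]
  have ring: "cring R" if R: "carrier R = K" "mult R = (*)" "one R = 1" "zero R = 0" "add R = (+)" for R
  proof (rule cringI)
    show "abelian_group R"
      by (rule abelian_groupI) (use R cl in \<open>auto intro: bexI[where x = "- x" for x]\<close>)
    show "comm_monoid R"
      by (rule comm_monoidI) (use R cl in auto)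
  qed (use R in \<open>auto simp: distrib_right\<close>)
  show ?thesis
    by (rule algebraI, rule ring, simp_all add: scalars_def ring)
      (use cl in \<open>auto simp: ring_distribs intro!: ring\<close>)
qed

text \<open>\<open>poly_bound A K S k M a\<close>: \<open>a\<close> is a polynomial in \<open>S\<close> of degree at most \<open>k\<close> whose
  coefficients have absolute values summing up to at most \<open>M\<close>.\<close>

inductive poly_bound :: "(complex, 'a) module \<Rightarrow> complex set \<Rightarrow> 'a set \<Rightarrow> nat \<Rightarrow> real \<Rightarrow> 'a \<Rightarrow> bool"
  for A K S where
  const: "c \<in> K \<Longrightarrow> poly_bound A K S 0 (norm c) (c \<odot>\<^bsub>A\<^esub> \<one>\<^bsub>A\<^esub>)"
| gen: "x \<in> S \<Longrightarrow> poly_bound A K S 1 1 x"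
| add: "poly_bound A K S k M a \<Longrightarrow> poly_bound A K S k M' b \<Longrightarrow> poly_bound A K S k (M + M') (a \<oplus>\<^bsub>A\<^esub> b)"
| mult: "poly_bound A K S k M a \<Longrightarrow> poly_bound A K S l M' b \<Longrightarrow>
    poly_bound A K S (k + l) (M * M') (a \<otimes>\<^bsub>A\<^esub> b)"
| mono: "poly_bound A K S k M a \<Longrightarrow> k \<le> k' \<Longrightarrow> M \<le> M' \<Longrightarrow> poly_bound A K S k' M' a"

text \<open>In the application A is the coordinate ring of an affine neighbourhood of the unit
  element of G, D the vector field v on it, and e the evaluation at the unit element.\<close>

locale derivation_at_point = kalgebra A K for A :: "(complex, 'a) module" (structure) and K +
  fixes D :: "'a \<Rightarrow> 'a" and e :: "'a \<Rightarrow> complex"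
  assumes D_lin: "linear_on K A A D"
    and D_mult: "\<And>a b. a \<in> carrier A \<Longrightarrow> b \<in> carrier A \<Longrightarrow> D (a \<otimes> b) = D a \<otimes> b \<oplus> a \<otimes> D b"
    and e_hom: "alg_hom K A (kscalar K) e"
begin

lemma D_closed [simp, intro]: "a \<in> carrier A \<Longrightarrow> D a \<in> carrier A"
  and D_add: "a \<in> carrier A \<Longrightarrow> b \<in> carrier A \<Longrightarrow> D (a \<oplus> b) = D a \<oplus> D b"
  and D_smult: "k \<in> K \<Longrightarrow> a \<in> carrier A \<Longrightarrow> D (k \<odot> a) = k \<odot> D a"
  using D_lin by (auto simp: linear_on_def)

lemma e_closed [simp, intro]: "a \<in> carrier A \<Longrightarrow> e a \<in> K"
  and e_add: "a \<in> carrier A \<Longrightarrow> b \<in> carrier A \<Longrightarrow> e (a \<oplus> b) = e a + e b"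
  and e_mult: "a \<in> carrier A \<Longrightarrow> b \<in> carrier A \<Longrightarrow> e (a \<otimes> b) = e a * e b"
  and e_one: "e \<one> = 1"
  and e_smult: "k \<in> K \<Longrightarrow> a \<in> carrier A \<Longrightarrow> e (k \<odot> a) = k * e a"
  using e_hom by (auto simp: alg_hom_def ring_hom_def)

lemma e_zero: "e \<zero> = 0"
  using e_add[of \<zero> \<zero>] by simp

lemma D_one: "D \<one> = \<zero>"
proof -
  have "D \<one> = D \<one> \<oplus> D \<one>" using D_mult[of \<one> \<one>] by simp
  then show ?thesis by (metis D_closed add.l_cancel_one one_closed)
qed

lemma D_zero: "D \<zero> = \<zero>"
  using D_smult[of 0 \<zero>] by simp

lemma Dn_closed [simp, intro]: "a \<in> carrier A \<Longrightarrow> (D ^^ n) a \<in> carrier A"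
  by (induction n) auto

lemma Dn_add: "a \<in> carrier A \<Longrightarrow> b \<in> carrier A \<Longrightarrow> (D ^^ n) (a \<oplus> b) = (D ^^ n) a \<oplus> (D ^^ n) b"
  by (induction n) (auto simp: D_add)

lemma Dn_smult: "k \<in> K \<Longrightarrow> a \<in> carrier A \<Longrightarrow> (D ^^ n) (k \<odot> a) = k \<odot> (D ^^ n) a"
  by (induction n) (auto simp: D_smult)

lemma Dn_one: "(D ^^ n) \<one> = (if n = 0 then \<one> else \<zero>)"
  by (induction n) (auto simp: D_one D_zero)

definition taylor :: "'a \<Rightarrow> nat \<Rightarrow> complex" where
  "taylor a n = e ((D ^^ n) a) / fact n"

lemma taylor_add: "a \<in> carrier A \<Longrightarrow> b \<in> carrier A \<Longrightarrow> taylor (a \<oplus> b) n = taylor a n + taylor b n"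
  by (simp add: taylor_def Dn_add e_add add_divide_distrib)

lemma taylor_smult: "k \<in> K \<Longrightarrow> a \<in> carrier A \<Longrightarrow> taylor (k \<odot> a) n = k * taylor a n"
  by (simp add: taylor_def Dn_smult e_smult)

lemma taylor_one: "taylor \<one> n = (if n = 0 then 1 else 0)"
  by (simp add: taylor_def Dn_one e_one e_zero)

lemma taylor_D: "taylor (D a) n = of_nat (Suc n) * taylor a (Suc n)"
  by (simp add: taylor_def funpow_swap1[symmetric] field_simps del: of_nat_Suc)

lemma taylor_K: "a \<in> carrier A \<Longrightarrow> taylor a n \<in> K"
proof -
  assume "a \<in> carrier A"
  moreover have "fact n \<in> K" using Kcl(7)[of "fact n"] by simp
  ultimately show ?thesis unfolding taylor_def by (intro Kcl(9)) auto
qed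

text \<open>Multiplicativity of the exponential of a derivation, coefficient by coefficient. By
  \<open>taylor_D\<close>, n + 1 times the coefficient of order n + 1 is the coefficient of order n
  of the derivative, so the product rule and the induction hypothesis apply; finally n + 1 is
  cancelled.\<close>

lemma taylor_mult:
  "a \<in> carrier A \<Longrightarrow> b \<in> carrier A \<Longrightarrow> taylor (a \<otimes> b) n = (\<Sum>i\<le>n. taylor a i * taylor b (n - i))"
proof (induction n arbitrary: a b)
  case 0 then show ?case by (simp add: taylor_def e_mult)
next
  case (Suc n)
  let ?a = "taylor a" and ?b = "taylor b"
  have "of_nat (Suc n) * taylor (a \<otimes> b) (Suc n) = taylor (D a \<otimes> b) n + taylor (a \<otimes> D b) n"
    using Suc.prems by (simp add: taylor_D[symmetric] D_mult taylor_add del: of_nat_Suc)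
  also have "taylor (D a \<otimes> b) n = (\<Sum>i\<le>n. of_nat (Suc i) * ?a (Suc i) * ?b (n - i))"
    using Suc by (simp add: taylor_D)
  \<comment> \<open>The index shift adds a term with i = 0, and the second sum below is extended by
    i = n + 1. Both new terms have weight 0, and the weights i and n + 1 - i add up to n +
    1.\<close>
  also have "\<dots> = (\<Sum>i\<le>Suc n. of_nat i * ?a i * ?b (Suc n - i))"
    by (subst sum.atMost_Suc_shift) simp
  also have "taylor (a \<otimes> D b) n = (\<Sum>i\<le>n. of_nat (Suc n - i) * ?a i * ?b (Suc n - i))"
    using Suc by (simp add: taylor_D Suc_diff_le mult_ac)
  also have "\<dots> = (\<Sum>i\<le>Suc n. of_nat (Suc n - i) * ?a i * ?b (Suc n - i))" by simp
  also have "(\<Sum>i\<le>Suc n. of_nat i * ?a i * ?b (Suc n - i)) + (\<Sum>i\<le>Suc n. of_nat (Suc n - i) * ?a i * ?b (Suc n - i))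
      = (\<Sum>i\<le>Suc n. of_nat (Suc n) * (?a i * ?b (Suc n - i)))"
    unfolding sum.distrib[symmetric]
    by (intro sum.cong) (auto simp: of_nat_diff algebra_simps simp del: of_nat_Suc)
  finally have "of_nat (Suc n) * taylor (a \<otimes> b) (Suc n) = of_nat (Suc n) * (\<Sum>i\<le>Suc n. ?a i * ?b (Suc n - i))"
    by (simp only: sum_distrib_left)
  then show ?case by (simp only: mult_cancel_left of_nat_eq_0_iff) simp
qed

lemma poly_bound_closed:
  assumes "S \<subseteq> carrier A" "poly_bound A K S k M a" shows "a \<in> carrier A \<and> 0 \<le> M"
  using assms(2,1) by induction auto

text \<open>Monomials of degree at most k in numbers bounded by B are bounded by B^k; here B \<ge> 1
  is what allows the degree bound to be raised in the case \<open>mono\<close>.\<close>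

lemma poly_bound_value:
  assumes S: "S \<subseteq> carrier A" and B: "1 \<le> B" "\<And>x. x \<in> S \<Longrightarrow> norm (e x) \<le> B"
    and pb: "poly_bound A K S k M a"
  shows "norm (e a) \<le> M * B ^ k"
  using pb
proof induction
  case (const c) then show ?case by (simp add: e_smult e_one)
next
  case (gen x) then show ?case using B by simp
next
  case (add k M a M' b)
  have "norm (e (a \<oplus> b)) \<le> norm (e a) + norm (e b)"
    using poly_bound_closed[OF S] add by (metis e_add norm_triangle_ineq)
  then show ?case using add by (simp add: algebra_simps)
next
  case (mult k M a l M' b)
  have "norm (e (a \<otimes> b)) = norm (e a) * norm (e b)"
    using poly_bound_closed[OF S] mult by (metis e_mult norm_mult)
  also have "\<dots> \<le> (M * B ^ k) * (M' * B ^ l)"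
    using mult poly_bound_closed[OF S mult(1)] B by (intro mult_mono) auto
  finally show ?case by (simp add: power_add mult_ac)
next
  case (mono k M a k' M')
  have "norm (e a) \<le> M * B ^ k" by fact
  also have "\<dots> \<le> M' * B ^ k'"
    using mono poly_bound_closed[OF S mono(1)] B by (intro mult_mono power_increasing) auto
  finally show ?case .
qed

text \<open>By the Leibniz rule, D replaces one of at most k generators in a monomial by a
  polynomial of degree d and size C. The degree bound k + d is one more than necessary for k > 0,
  but it also covers constants without subtraction.\<close>

lemma poly_bound_D:
  assumes S: "S \<subseteq> carrier A" and C: "0 \<le> C" "\<And>x. x \<in> S \<Longrightarrow> poly_bound A K S d C (D x)"
    and pb: "poly_bound A K S k M a"
  shows "poly_bound A K S (k + d) (real k * M * C) (D a)"
  using pb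
proof induction
  case (const c)
  have "D (c \<odot> \<one>) = 0 \<odot> \<one>" using const by (simp add: D_smult D_one)
  moreover have "poly_bound A K S (0 + d) (real 0 * norm c * C) (0 \<odot> \<one>)"
    using poly_bound.mono[OF poly_bound.const[of 0 K A S]] by simp
  ultimately show ?case by simp
next
  case (gen x)
  then show ?case using poly_bound.mono[OF C(2)] by simp
next
  case (add k M a M' b)
  then show ?case using poly_bound.add[OF add(3,4)] poly_bound_closed[OF S add(1)] poly_bound_closed[OF S add(2)]
    by (simp add: D_add algebra_simps)
next
  case (mult k M a l M' b)
  have "poly_bound A K S (k + l + d) (real k * M * C * M') (D a \<otimes> b)"
    using poly_bound.mult[OF mult(3,2)] by (simp add: add_ac)
  moreover have "poly_bound A K S (k + l + d) (M * (real l * M' * C)) (a \<otimes> D b)"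
    using poly_bound.mult[OF mult(1,4)] by (simp add: add_ac)
  ultimately have "poly_bound A K S (k + l + d) (real k * M * C * M' + M * (real l * M' * C)) (D a \<otimes> b \<oplus> a \<otimes> D b)"
    by (rule poly_bound.add)
  then show ?case using poly_bound_closed[OF S mult(1)] poly_bound_closed[OF S mult(2)]
    by (simp add: D_mult algebra_simps)
next
  case (mono k M a k' M')
  have "real k * M * C \<le> real k' * M' * C"
    using mono poly_bound_closed[OF S mono(1)] C by (intro mult_mono) auto
  then show ?case using poly_bound.mono[OF mono(4), of "k' + d" "real k' * M' * C"] mono(2) by simp
qed

text \<open>The degree after n steps is at most 1 + n d, which is also the factor lost in the next
  step. Since 1 + n d \<le> (n + 1) (1 + d), these factors multiply up to n! (1 + d)^n, and it is
  this n! that the denominators of the exponential series absorb.\<close>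

lemma poly_bound_Dn:
  assumes S: "S \<subseteq> carrier A" and C: "0 \<le> C" "\<And>x. x \<in> S \<Longrightarrow> poly_bound A K S d C (D x)"
    and x: "x \<in> S"
  shows "poly_bound A K S (1 + n * d) (fact n * (C * (1 + real d)) ^ n) ((D ^^ n) x)"
proof (induction n)
  case 0 show ?case using poly_bound.gen[of x S A K] x by simp
next
  case (Suc n)
  let ?M = "fact n * (C * (1 + real d)) ^ n"
  have "poly_bound A K S (1 + n * d + d) (real (1 + n * d) * ?M * C) (D ((D ^^ n) x))"
    by (rule poly_bound_D[OF S C Suc])
  moreover have "real (1 + n * d) * ?M * C \<le> fact (Suc n) * (C * (1 + real d)) ^ Suc n"
  proof -
    have "real (1 + n * d) \<le> real (Suc n) * (1 + real d)" by (simp add: algebra_simps)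
    then have "real (1 + n * d) * (?M * C) \<le> (real (Suc n) * (1 + real d)) * (?M * C)"
      using C by (intro mult_right_mono) auto
    then show ?thesis by (simp add: algebra_simps)
  qed
  ultimately have "poly_bound A K S (1 + n * d + d) (fact (Suc n) * (C * (1 + real d)) ^ Suc n) (D ((D ^^ n) x))"
    by (rule poly_bound.mono[OF _ order_refl])
  then show ?case by (simp add: add_ac)
qed

lemma poly_bound_ex:
  assumes "finite S" "S \<subseteq> carrier A" "carrier A = generate_ring A (S \<union> (\<lambda>k. k \<odot> \<one>) ` K)"
    and a: "a \<in> carrier A"
  shows "\<exists>k M. poly_bound A K S k M a"
proof -
  from a have "a \<in> generate_ring A (S \<union> (\<lambda>k. k \<odot> \<one>) ` K)" using assms by simp
  then show ?thesis
  proof induction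
    case one
    show ?case using poly_bound.const[of 1 K A S] by (auto simp del: Kcl)
  next
    case (incl h)
    then show ?case using poly_bound.const[of _ K A S] poly_bound.gen[of _ S A K] by blast
  next
    case (a_inv h)
    then obtain k M where h: "poly_bound A K S k M h" by blast
    then have "\<ominus> h = ((- 1) \<odot> \<one>) \<otimes> h"
      using poly_bound_closed[OF assms(2) h] by (simp add: sm_uminus1 l_minus)
    then show ?case using poly_bound.mult[OF poly_bound.const[of "-1"] h] by auto
  next
    case (eng_add h1 h2)
    then obtain k M k' M' where h: "poly_bound A K S k M h1" "poly_bound A K S k' M' h2" by blast
    have "poly_bound A K S (max k k') M h1" "poly_bound A K S (max k k') M' h2"
      using h by (auto intro: poly_bound.mono)
    then show ?case by (intro exI) (rule poly_bound.add)
  next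
    case (eng_mult h1 h2)
    then obtain k M k' M' where h: "poly_bound A K S k M h1" "poly_bound A K S k' M' h2" by blast
    then show ?case by (intro exI) (rule poly_bound.mult)
  qed
qed

text \<open>One radius has to serve all of A, as the functional for a given t must be defined
  everywhere. It is determined by the finitely many generators.\<close>

lemma radius_ex:
  assumes "fin_gen_algebra K A"
  obtains r :: real where "0 < r" "\<And>a. a \<in> carrier A \<Longrightarrow> summable (\<lambda>n. norm (taylor a n) * r ^ n)"
proof -
  from assms obtain S where S: "S \<subseteq> carrier A" "finite S"
    and gen: "carrier A = generate_ring A (S \<union> (\<lambda>k. k \<odot> \<one>) ` K)"
    unfolding fin_gen_algebra_def by blast
  have "\<exists>d C. 0 \<le> C \<and> (\<forall>x\<in>F. poly_bound A K S d C (D x))" if "finite F" "F \<subseteq> S" for F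
    using that
  proof (induction F)
    case empty show ?case by auto
  next
    case (insert x F)
    then obtain d C where C: "0 \<le> C" "\<forall>x\<in>F. poly_bound A K S d C (D x)" by auto
    from insert obtain k M where M: "poly_bound A K S k M (D x)"
      using poly_bound_ex[OF S(2,1) gen, of "D x"] S by auto
    have "\<forall>y\<in>insert x F. poly_bound A K S (max d k) (max C M) (D y)"
      using C M by (auto intro: poly_bound.mono)
    then show ?case using C by (intro exI[of _ "max d k"] exI[of _ "max C M"]) auto
  qed
  from this[OF S(2)] obtain d C where C: "0 \<le> C" "\<And>x. x \<in> S \<Longrightarrow> poly_bound A K S d C (D x)" by blast
  \<comment> \<open>Inserting 1 gives B \<ge> 1 and makes the maximum meaningful when there are no
    generators.\<close>
  define B where "B = Max (insert 1 ((\<lambda>x. norm (e x)) ` S))"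
  have B: "1 \<le> B" "\<And>x. x \<in> S \<Longrightarrow> norm (e x) \<le> B" using S by (auto simp: B_def)
  \<comment> \<open>The bounds for e (D^n x), divided by n!, are (C (1 + d))^n B^(1 + n d), which is
    B Q^n: Taylor coefficients of generators grow at most geometrically with ratio Q.\<close>
  define Q where "Q = C * (1 + real d) * B ^ d"
  have Q: "0 \<le> Q" using C B by (simp add: Q_def)
  \<comment> \<open>Adding 1 covers Q = 0, and the product Q r stays below 1/2.\<close>
  define r where "r = 1 / (2 * (Q + 1))"
  have r: "0 < r" "Q * r < 1" using Q by (auto simp: r_def field_simps)
  have sgen: "summable (\<lambda>n. norm (taylor x n) * r ^ n)" if x: "x \<in> S" for x
  proof (rule summable_comparison_test')
    show "summable (\<lambda>n. B * (Q * r) ^ n)" using Q r by (intro summable_mult summable_geometric) auto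
    fix n :: nat
    have "norm (e ((D ^^ n) x)) \<le> fact n * (C * (1 + real d)) ^ n * B ^ (1 + n * d)"
      by (rule poly_bound_value[OF S(1) B poly_bound_Dn[OF S(1) C x]])
    then have "norm (taylor x n) \<le> (C * (1 + real d)) ^ n * B ^ (1 + n * d)"
      by (simp add: taylor_def norm_divide field_simps)
    also have "\<dots> = B * Q ^ n" by (simp add: Q_def power_mult_distrib power_mult[symmetric] mult_ac)
    finally have "norm (taylor x n) * r ^ n \<le> B * Q ^ n * r ^ n" using r by (intro mult_right_mono) auto
    then show "norm (norm (taylor x n) * r ^ n) \<le> B * (Q * r) ^ n"
      using r by (simp add: power_mult_distrib mult_ac)
  qed
  \<comment> \<open>For this fixed r, absolute summability is inherited by sums and, through the
    Cauchy product, by products. Hence it passes from generators to polynomials without shrinking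
    r.\<close>
  have "summable (\<lambda>n. norm (taylor a n) * r ^ n)" if a: "a \<in> carrier A" for a
  proof -
    from poly_bound_ex[OF S(2,1) gen a] obtain k M where "poly_bound A K S k M a" by blast
    then show ?thesis
    proof induction
      case (const c)
      have "norm (taylor (c \<odot> \<one>) n) * r ^ n = 0" if "n \<notin> {0}" for n
        using const that by (simp add: taylor_smult taylor_one)
      then show ?case by (intro summable_finite[of "{0}"]) auto
    next
      case (gen x) then show ?case by (rule sgen)
    next
      case (add k M a M' b)
      have "a \<in> carrier A" "b \<in> carrier A" using add poly_bound_closed[OF S(1)] by auto
      then show ?case
        using summable_add[OF add(3,4)] r
        by (intro summable_comparison_test'[OF summable_add[OF add(3,4)]])
          (auto simp: taylor_add norm_mult distrib_right[symmetric] intro!: mult_right_mono norm_triangle_ineq)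
    next
      case (mult k M a l M' b)
      have ab: "a \<in> carrier A" "b \<in> carrier A" using mult poly_bound_closed[OF S(1)] by auto
      let ?f = "\<lambda>n. norm (taylor a n) * r ^ n" and ?g = "\<lambda>n. norm (taylor b n) * r ^ n"
      have "summable (\<lambda>n. \<Sum>i\<le>n. ?f i * ?g (n - i))"
        using mult r by (intro summable_Cauchy_product) auto
      moreover have "norm (norm (taylor (a \<otimes> b) n) * r ^ n) \<le> (\<Sum>i\<le>n. ?f i * ?g (n - i))" for n
      proof -
        have "norm (taylor (a \<otimes> b) n) \<le> (\<Sum>i\<le>n. norm (taylor a i) * norm (taylor b (n - i)))"
          unfolding taylor_mult[OF ab] by (rule order_trans[OF norm_sum]) (simp add: norm_mult)
        then have "norm (taylor (a \<otimes> b) n) * r ^ n \<le> (\<Sum>i\<le>n. norm (taylor a i) * norm (taylor b (n - i))) * r ^ n"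
          using r by (intro mult_right_mono) auto
        also have "\<dots> = (\<Sum>i\<le>n. ?f i * ?g (n - i))"
          unfolding sum_distrib_right
        proof (rule sum.cong)
          fix i assume "i \<in> {..n}"
          then have "r ^ n = r ^ i * r ^ (n - i)" by (simp flip: power_add)
          then show "norm (taylor a i) * norm (taylor b (n - i)) * r ^ n = ?f i * ?g (n - i)" by simp
        qed simp
        finally show ?thesis using r by simp
      qed
      ultimately show ?case by (rule summable_comparison_test'[where N = 0])
    next
      case mono then show ?case by blast
    qed
  qed
  then show ?thesis using that r by blast
qed

text \<open>The functional \<Phi> t is e applied to the exponential of t D; absolute convergence
  allows the Cauchy product and makes it multiplicative. The parameter t is real for both ground
  fields, which keeps the values in K when K = \<real>. The last clause is the derivative at 0 in
  the form needed later: a function that vanishes along the flow has derivative zero at its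
  start.\<close>

theorem flow_ex:
  assumes "fin_gen_algebra K A"
  obtains r :: real and \<Phi> :: "real \<Rightarrow> 'a \<Rightarrow> complex" where "0 < r"
    "\<And>t. \<bar>t\<bar> < r \<Longrightarrow> alg_hom K A (kscalar K) (\<Phi> t)"
    "\<And>a. a \<in> carrier A \<Longrightarrow> \<Phi> 0 a = e a"
    "\<And>a. a \<in> carrier A \<Longrightarrow> (\<lambda>t. \<Phi> t a) \<midarrow>0\<rightarrow> e a"
    "\<And>a \<delta>. a \<in> carrier A \<Longrightarrow> 0 < \<delta> \<Longrightarrow> (\<And>t. \<bar>t\<bar> < \<delta> \<Longrightarrow> \<Phi> t a = 0) \<Longrightarrow> e (D a) = 0"
proof -
  from radius_ex[OF assms] obtain r :: real where r: "0 < r"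
    and sr: "\<And>a. a \<in> carrier A \<Longrightarrow> summable (\<lambda>n. norm (taylor a n) * r ^ n)" by blast
  define F where "F a z = (\<Sum>n. taylor a n * z ^ n)" for a z
  define \<Phi> where "\<Phi> t a = F a (complex_of_real t)" for t a
  have sn: "summable (\<lambda>n. norm (taylor a n * z ^ n))" if "a \<in> carrier A" "norm z \<le> r" for a z
    using that r by (intro summable_comparison_test'[OF sr[OF that(1)], of 0])
      (auto simp: norm_mult norm_power intro!: mult_left_mono power_mono)
  have s: "summable (\<lambda>n. taylor a n * z ^ n)" if "a \<in> carrier A" "norm z \<le> r" for a z
    using summable_norm_cancel[OF sn[OF that]] .
  \<comment> \<open>For K = \<real> all terms of the series are real, so the imaginary part of the
    sum is zero.\<close>
  have Fin: "F a (complex_of_real t) \<in> K" if a: "a \<in> carrier A" and t: "\<bar>t\<bar> < r" for a t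
  proof (cases "K = UNIV")
    case False
    then have K: "K = \<real>" using ground by simp
    have "(\<lambda>n. taylor a n * complex_of_real t ^ n) sums F a (complex_of_real t)"
      unfolding F_def using s[OF a] t by (intro summable_sums) auto
    then have "(\<lambda>n. Im (taylor a n * complex_of_real t ^ n)) sums Im (F a (complex_of_real t))"
      by (rule sums_Im)
    moreover have "Im (taylor a n * complex_of_real t ^ n) = 0" for n
      using taylor_K[OF a, of n] K by (auto simp: complex_is_Real_iff simp flip: of_real_power)
    ultimately have "(\<lambda>n. 0) sums Im (F a (complex_of_real t))" by (simp only:)
    then have "Im (F a (complex_of_real t)) = 0" by (simp add: sums_iff)
    then show ?thesis using K by (simp add: complex_is_Real_iff)
  qed simp
  have hom: "alg_hom K A (kscalar K) (\<Phi> t)" if t: "\<bar>t\<bar> < r" for t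
  proof (rule alg_homI)
    let ?z = "complex_of_real t"
    have z: "norm ?z \<le> r" using t by simp
    fix a assume a: "a \<in> carrier A"
    show "\<Phi> t a \<in> carrier (kscalar K)" using Fin[OF a t] by (simp add: \<Phi>_def)
    show "\<Phi> t (k \<odot> a) = k \<odot>\<^bsub>kscalar K\<^esub> \<Phi> t a" if "k \<in> K" for k
      using a that suminf_mult[OF s[OF a z], of k] by (simp add: \<Phi>_def F_def taylor_smult mult.assoc)
    fix b assume b: "b \<in> carrier A"
    show "\<Phi> t (a \<oplus> b) = \<Phi> t a \<oplus>\<^bsub>kscalar K\<^esub> \<Phi> t b"
      using a b suminf_add[OF s[OF a z] s[OF b z]] by (simp add: \<Phi>_def F_def taylor_add distrib_right)
    have "F a ?z * F b ?z = (\<Sum>n. \<Sum>i\<le>n. (taylor a i * ?z ^ i) * (taylor b (n - i) * ?z ^ (n - i)))"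
      unfolding F_def by (rule Cauchy_product[OF sn[OF a z] sn[OF b z]])
    also have "\<dots> = (\<Sum>n. taylor (a \<otimes> b) n * ?z ^ n)"
    proof (rule suminf_cong)
      fix n
      show "(\<Sum>i\<le>n. (taylor a i * ?z ^ i) * (taylor b (n - i) * ?z ^ (n - i))) = taylor (a \<otimes> b) n * ?z ^ n"
        unfolding taylor_mult[OF a b] sum_distrib_right
      proof (rule sum.cong)
        fix i assume "i \<in> {..n}"
        then have "?z ^ n = ?z ^ i * ?z ^ (n - i)" by (simp flip: power_add)
        then show "taylor a i * ?z ^ i * (taylor b (n - i) * ?z ^ (n - i)) = taylor a i * taylor b (n - i) * ?z ^ n"
          by simp
      qed simp
    qed
    finally show "\<Phi> t (a \<otimes> b) = \<Phi> t a \<otimes>\<^bsub>kscalar K\<^esub> \<Phi> t b" by (simp add: \<Phi>_def F_def)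
  next
    have "(\<lambda>n. taylor \<one> n * complex_of_real t ^ n) = (\<lambda>n. if n = 0 then 1 else 0)"
      by (auto simp: taylor_one)
    then show "\<Phi> t \<one> = \<one>\<^bsub>kscalar K\<^esub>" using sums_single[of 0 "\<lambda>_. 1::complex"]
      by (simp add: \<Phi>_def F_def sums_iff)
  qed
  have F0: "\<Phi> 0 a = e a" if "a \<in> carrier A" for a
    using powser_zero[of "taylor a"] by (simp add: \<Phi>_def F_def) (simp add: taylor_def)
  \<comment> \<open>The power series is differentiated in a complex variable; its linear coefficient
    is e (D a).\<close>
  have der: "DERIV (F a) 0 :> e (D a)" if a: "a \<in> carrier A" for a
  proof -
    have "DERIV (\<lambda>x. \<Sum>n. taylor a n * x ^ n) 0 :> (\<Sum>n. diffs (taylor a) n * 0 ^ n)"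
      using s[OF a, of "of_real r"] r by (intro termdiffs_strong[where K = "of_real r"]) auto
    then show ?thesis by (simp add: F_def[abs_def] diffs_def taylor_def)
  qed
  have cont: "(\<lambda>t. \<Phi> t a) \<midarrow>0\<rightarrow> e a" if a: "a \<in> carrier A" for a
  proof -
    have "isCont (F a) 0" using DERIV_isCont[OF der[OF a]] .
    then have "isCont (\<lambda>t. F a (complex_of_real t)) 0"
      by (intro isCont_o2[where g = "F a" and f = complex_of_real]) auto
    then show ?thesis using F0[OF a] by (simp add: isCont_def \<Phi>_def)
  qed
  have van: "e (D a) = 0" if a: "a \<in> carrier A" and d: "0 < \<delta>"
    and z: "\<And>t. \<bar>t\<bar> < \<delta> \<Longrightarrow> \<Phi> t a = 0" for a \<delta>
  proof -
    have "((\<lambda>h. (F a (0 + h) - F a 0) / h) \<longlongrightarrow> e (D a)) (at 0)"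
      using der[OF a] by (simp add: DERIV_def)
    \<comment> \<open>The vanishing is known only for real t with |t| < \<delta>, so the difference
      quotient is evaluated along a real null sequence. With n + 2 in the denominator every term,
      including the first, is strictly smaller than \<delta>.\<close>
    moreover have "filterlim (\<lambda>n. complex_of_real (\<delta> / real (n + 2))) (at 0) sequentially"
    proof -
      have "(\<lambda>n. \<delta> / real (n + 2)) \<longlonglongrightarrow> 0"
        by (rule LIMSEQ_ignore_initial_segment[OF lim_const_over_n, of \<delta> 2])
      then have "(\<lambda>n. complex_of_real (\<delta> / real (n + 2))) \<longlonglongrightarrow> complex_of_real 0"
        by (rule tendsto_of_real)
      moreover have "\<forall>\<^sub>F n in sequentially. complex_of_real (\<delta> / real (n + 2)) \<noteq> 0"
        using d by (intro always_eventually) (simp del: of_nat_add of_real_divide)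
      ultimately show ?thesis by (intro filterlim_atI) simp_all
    qed
    ultimately have "(\<lambda>n. (F a (0 + complex_of_real (\<delta> / real (n + 2))) - F a 0) / complex_of_real (\<delta> / real (n + 2))) \<longlonglongrightarrow> e (D a)"
      by (rule filterlim_compose)
    moreover have "F a (complex_of_real (\<delta> / real (n + 2))) = 0" for n
    proof -
      have "\<delta> * 1 < \<delta> * real (n + 2)" using d by (intro mult_strict_left_mono) auto
      then have "\<bar>\<delta> / real (n + 2)\<bar> < \<delta>" using d by (simp add: divide_less_eq abs_of_pos del: of_nat_add)
      then show ?thesis using z unfolding \<Phi>_def by blast
    qed
    moreover have "F a 0 = 0" using z[of 0] d by (simp add: \<Phi>_def)
    ultimately have "(\<lambda>n. 0::complex) \<longlonglongrightarrow> e (D a)" by simp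
    then show ?thesis by (simp add: LIMSEQ_const_iff)
  qed
  show ?thesis by (rule that[OF r hom F0 cont van])
qed

end

section \<open>Sheaves of algebras\<close>

locale ksheaf =
  fixes K :: "complex set" and X :: "('p, 's) kspace"
  assumes K_ground: "K = \<real> \<or> K = UNIV" and sheaf: "sheaf_of_algebras K X"
begin

lemmas sheaf_axioms = sheaf[unfolded sheaf_of_algebras_def]
lemmas sheaf_restr = sheaf_axioms[THEN conjunct2, THEN conjunct1, rule_format]
lemmas sheaf_id = sheaf_axioms[THEN conjunct2, THEN conjunct2, THEN conjunct1, rule_format]
lemmas sheaf_trans =
  sheaf_axioms[THEN conjunct2, THEN conjunct2, THEN conjunct2, THEN conjunct1, rule_format]
lemmas sheaf_glue =
  sheaf_axioms[THEN conjunct2, THEN conjunct2, THEN conjunct2, THEN conjunct2, THEN spec, THEN spec, THEN mp]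

lemma alg: "opn X U \<Longrightarrow> kalgebra (sect X U) K"
  using sheaf_axioms K_ground by (auto intro: kalgebraI)

lemma restr_alg_hom:
  "opn X U \<Longrightarrow> opn X V \<Longrightarrow> V \<subseteq> U \<Longrightarrow> alg_hom K (sect X U) (sect X V) (restr X U V)"
  using sheaf_restr by blast

lemma restr_hom:
  "opn X U \<Longrightarrow> opn X V \<Longrightarrow> V \<subseteq> U \<Longrightarrow> kalgebra_hom (sect X U) (sect X V) K (restr X U V)"
  by (intro kalgebra_hom.intro alg kalgebra_hom_axioms.intro restr_alg_hom)

lemma restr_id [simp]: "opn X U \<Longrightarrow> s \<in> carrier (sect X U) \<Longrightarrow> restr X U U s = s"
  using sheaf_id by blast

lemma restr_restr [simp]:
  "opn X U \<Longrightarrow> opn X V \<Longrightarrow> opn X W \<Longrightarrow> W \<subseteq> V \<Longrightarrow> V \<subseteq> U \<Longrightarrow> s \<in> carrier (sect X U) \<Longrightarrow>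
    restr X V W (restr X U V s) = restr X U W s"
  using sheaf_trans by blast

context
  fixes U V assumes UV: "opn X U" "opn X V" "V \<subseteq> U"
begin

interpretation r: kalgebra_hom "sect X U" "sect X V" K "restr X U V" by (rule restr_hom[OF UV])

lemma restr_closed [simp, intro]: "s \<in> carrier (sect X U) \<Longrightarrow> restr X U V s \<in> carrier (sect X V)"
  by simp
lemma restr_add: "s \<in> carrier (sect X U) \<Longrightarrow> t \<in> carrier (sect X U) \<Longrightarrow>
  restr X U V (s \<oplus>\<^bsub>sect X U\<^esub> t) = restr X U V s \<oplus>\<^bsub>sect X V\<^esub> restr X U V t" by simp
lemma restr_mult: "s \<in> carrier (sect X U) \<Longrightarrow> t \<in> carrier (sect X U) \<Longrightarrow>
  restr X U V (s \<otimes>\<^bsub>sect X U\<^esub> t) = restr X U V s \<otimes>\<^bsub>sect X V\<^esub> restr X U V t" by simp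
lemma restr_minus: "s \<in> carrier (sect X U) \<Longrightarrow> t \<in> carrier (sect X U) \<Longrightarrow>
  restr X U V (s \<ominus>\<^bsub>sect X U\<^esub> t) = restr X U V s \<ominus>\<^bsub>sect X V\<^esub> restr X U V t" by simp
lemma restr_neg: "s \<in> carrier (sect X U) \<Longrightarrow>
  restr X U V (\<ominus>\<^bsub>sect X U\<^esub> s) = \<ominus>\<^bsub>sect X V\<^esub> restr X U V s" by simp
lemma restr_one: "restr X U V \<one>\<^bsub>sect X U\<^esub> = \<one>\<^bsub>sect X V\<^esub>" by simp
lemma restr_zero: "restr X U V \<zero>\<^bsub>sect X U\<^esub> = \<zero>\<^bsub>sect X V\<^esub>" by simp
lemma restr_smult: "k \<in> K \<Longrightarrow> s \<in> carrier (sect X U) \<Longrightarrow>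
  restr X U V (k \<odot>\<^bsub>sect X U\<^esub> s) = k \<odot>\<^bsub>sect X V\<^esub> restr X U V s" by simp
lemma restr_pow: "s \<in> carrier (sect X U) \<Longrightarrow>
  restr X U V (s [^]\<^bsub>sect X U\<^esub> (n::nat)) = restr X U V s [^]\<^bsub>sect X V\<^esub> n" by (rule r.hom_pow)
lemma restr_Units: "s \<in> Units (sect X U) \<Longrightarrow> restr X U V s \<in> Units (sect X V)"
  by (rule r.hom_Units)

end

lemmas restr_simps = restr_add restr_mult restr_minus restr_neg restr_one restr_zero restr_smult restr_pow

lemma glue_unique:
  assumes "\<And>V. V \<in> \<U> \<Longrightarrow> opn X V" "\<And>V. V \<in> \<U> \<Longrightarrow> s V \<in> carrier (sect X V)"
    "\<And>V W. V \<in> \<U> \<Longrightarrow> W \<in> \<U> \<Longrightarrow> restr X V (V \<inter> W) (s V) = restr X W (V \<inter> W) (s W)"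
  shows "\<exists>!t. t \<in> carrier (sect X (\<Union>\<U>)) \<and> (\<forall>V\<in>\<U>. restr X (\<Union>\<U>) V t = s V)"
  by (rule sheaf_glue) (use assms in blast)

text \<open>The uniqueness part of gluing, applied to the family of all open subsets on which s and
  t agree.\<close>

lemma section_eqI:
  assumes U: "opn X U" and s: "s \<in> carrier (sect X U)" and t: "t \<in> carrier (sect X U)"
    and loc: "\<And>x. x \<in> U \<Longrightarrow> \<exists>V. opn X V \<and> x \<in> V \<and> V \<subseteq> U \<and> restr X U V s = restr X U V t"
  shows "s = t"
proof -
  let ?\<U> = "{V. opn X V \<and> V \<subseteq> U \<and> restr X U V s = restr X U V t}"
  have un: "\<Union>?\<U> = U" using loc by blast
  have "\<exists>!r. r \<in> carrier (sect X (\<Union>?\<U>)) \<and> (\<forall>V\<in>?\<U>. restr X (\<Union>?\<U>) V r = restr X U V s)"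
  proof (rule glue_unique)
    show "opn X V" "restr X U V s \<in> carrier (sect X V)" if "V \<in> ?\<U>" for V
      using that restr_closed[OF U _ _ s] by blast+
    show "restr X V (V \<inter> W) (restr X U V s) = restr X W (V \<inter> W) (restr X U W s)"
      if V: "V \<in> ?\<U>" and W: "W \<in> ?\<U>" for V W
    proof -
      have "opn X V" "opn X W" "V \<subseteq> U" "W \<subseteq> U" using V W by blast+
      then show ?thesis using U s by (simp add: openin_Int)
    qed
  qed
  then show ?thesis unfolding un using s t by (smt (verit) mem_Collect_eq)
qed

text \<open>There is no point at which local agreement would have to be checked.\<close>

lemma zero_ring_empty:
  assumes "s \<in> carrier (sect X {})" "t \<in> carrier (sect X {})" shows "s = t"
  by (rule section_eqI[of "{}"]) (use assms in auto)

text \<open>A form of gluing for a set of pairs in which an open set may occur several times and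
  agreement is asked only near each common point. Agreement on whole overlaps follows from
  \<open>section_eqI\<close>; for S = S' it shows that each open set carries only one section of the
  family.\<close>

lemma glue:
  assumes F: "\<And>S \<sigma>. (S, \<sigma>) \<in> F \<Longrightarrow> opn X S \<and> S \<subseteq> U \<and> \<sigma> \<in> carrier (sect X S)"
    and cov: "\<And>x. x \<in> U \<Longrightarrow> \<exists>(S, \<sigma>)\<in>F. x \<in> S"
    and compat: "\<And>S \<sigma> S' \<sigma>' x. (S, \<sigma>) \<in> F \<Longrightarrow> (S', \<sigma>') \<in> F \<Longrightarrow> x \<in> S \<Longrightarrow> x \<in> S' \<Longrightarrow>
      \<exists>N. opn X N \<and> x \<in> N \<and> N \<subseteq> S \<and> N \<subseteq> S' \<and> restr X S N \<sigma> = restr X S' N \<sigma>'"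
  shows "\<exists>!\<tau>. \<tau> \<in> carrier (sect X U) \<and> (\<forall>(S, \<sigma>)\<in>F. restr X U S \<tau> = \<sigma>)"
proof -
  have agree: "restr X S (S \<inter> S') \<sigma> = restr X S' (S \<inter> S') \<sigma>'" if m: "(S, \<sigma>) \<in> F" "(S', \<sigma>') \<in> F" for S \<sigma> S' \<sigma>'
  proof (rule section_eqI[of "S \<inter> S'"])
    have o: "opn X S" "opn X S'" "\<sigma> \<in> carrier (sect X S)" "\<sigma>' \<in> carrier (sect X S')" using F m by auto
    then show o2: "opn X (S \<inter> S')" by blast
    show "restr X S (S \<inter> S') \<sigma> \<in> carrier (sect X (S \<inter> S'))"
      "restr X S' (S \<inter> S') \<sigma>' \<in> carrier (sect X (S \<inter> S'))" using o o2 by auto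
    fix x assume "x \<in> S \<inter> S'"
    then obtain N where N: "opn X N" "x \<in> N" "N \<subseteq> S" "N \<subseteq> S'" "restr X S N \<sigma> = restr X S' N \<sigma>'"
      using compat[OF m, of x] by blast
    then show "\<exists>V. opn X V \<and> x \<in> V \<and> V \<subseteq> S \<inter> S' \<and>
       restr X (S \<inter> S') V (restr X S (S \<inter> S') \<sigma>) = restr X (S \<inter> S') V (restr X S' (S \<inter> S') \<sigma>')"
      using o o2 by (intro exI[of _ N]) simp
  qed
  have uniq: "\<sigma> = \<sigma>'" if "(S, \<sigma>) \<in> F" "(S, \<sigma>') \<in> F" for S \<sigma> \<sigma>'
    using agree[OF that] F[OF that(1)] F[OF that(2)] by simp
  define s where "s S = (THE \<sigma>. (S, \<sigma>) \<in> F)" for S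
  have s: "s S = \<sigma>" if "(S, \<sigma>) \<in> F" for S \<sigma> unfolding s_def using that uniq by blast
  let ?\<U> = "fst ` F"
  have sF: "(V, s V) \<in> F" if "V \<in> ?\<U>" for V using that s by force
  have un: "\<Union>?\<U> = U"
  proof
    show "\<Union>?\<U> \<subseteq> U" using F by fastforce
    show "U \<subseteq> \<Union>?\<U>" using cov by force
  qed
  have *: "\<exists>!t. t \<in> carrier (sect X (\<Union>?\<U>)) \<and> (\<forall>V\<in>?\<U>. restr X (\<Union>?\<U>) V t = s V)"
  proof (rule glue_unique)
    fix V assume "V \<in> ?\<U>"
    from sF[OF this] show "opn X V" "s V \<in> carrier (sect X V)" using F by blast+
  next
    fix V W assume "V \<in> ?\<U>" "W \<in> ?\<U>"
    then show "restr X V (V \<inter> W) (s V) = restr X W (V \<inter> W) (s W)" by (intro agree sF)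
  qed
  have "(\<forall>V\<in>?\<U>. restr X (\<Union>?\<U>) V t = s V) = (\<forall>(S, \<sigma>)\<in>F. restr X U S t = \<sigma>)" for t
    unfolding un using s sF by (fastforce simp: split_beta)
  then show ?thesis using * unfolding un by simp
qed

lemma invertible_in: "invertible_at X x U s \<Longrightarrow> x \<in> U"
  by (auto simp: invertible_at_def)

lemma invertible_unit: "opn X U \<Longrightarrow> x \<in> U \<Longrightarrow> s \<in> Units (sect X U) \<Longrightarrow> invertible_at X x U s"
  using kalgebra.axioms(1)[OF alg] unfolding invertible_at_def
  by (metis (no_types, lifting) restr_id monoid.Units_closed cring.cring_simprules(6) cring_def ring.is_monoid subset_refl)

lemma invertible_restr [simp]:
  assumes "opn X U" "opn X V" "V \<subseteq> U" "x \<in> V" "s \<in> carrier (sect X U)"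
  shows "invertible_at X x V (restr X U V s) \<longleftrightarrow> invertible_at X x U s"
proof
  assume "invertible_at X x V (restr X U V s)"
  then obtain W where "opn X W" "x \<in> W" "W \<subseteq> V" "restr X V W (restr X U V s) \<in> Units (sect X W)"
    by (auto simp: invertible_at_def)
  moreover from this have "restr X U W s \<in> Units (sect X W)" "W \<subseteq> U" using assms by auto
  ultimately show "invertible_at X x U s" unfolding invertible_at_def by blast
next
  assume "invertible_at X x U s"
  then obtain W where W: "opn X W" "x \<in> W" "W \<subseteq> U" "restr X U W s \<in> Units (sect X W)"
    by (auto simp: invertible_at_def)
  have "restr X W (W \<inter> V) (restr X U W s) \<in> Units (sect X (W \<inter> V))"
    by (rule restr_Units) (use W assms in auto)
  then have "restr X V (W \<inter> V) (restr X U V s) \<in> Units (sect X (W \<inter> V))" using W assms by (simp add: openin_Int)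
  then show "invertible_at X x V (restr X U V s)" using W assms unfolding invertible_at_def
    by (intro exI[of _ "W \<inter> V"]) auto
qed

lemma invertible_mult [simp]:
  assumes "opn X U" "x \<in> U" "s \<in> carrier (sect X U)" "t \<in> carrier (sect X U)"
  shows "invertible_at X x U (s \<otimes>\<^bsub>sect X U\<^esub> t) \<longleftrightarrow> invertible_at X x U s \<and> invertible_at X x U t"
proof
  assume "invertible_at X x U (s \<otimes>\<^bsub>sect X U\<^esub> t)"
  then obtain W where W: "opn X W" "x \<in> W" "W \<subseteq> U" "restr X U W (s \<otimes>\<^bsub>sect X U\<^esub> t) \<in> Units (sect X W)"
    by (auto simp: invertible_at_def)
  interpret kalgebra "sect X W" K using alg W by simp
  have "restr X U W s \<otimes>\<^bsub>sect X W\<^esub> restr X U W t \<in> Units (sect X W)"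
    using W assms by (simp add: restr_simps)
  then have "restr X U W s \<in> Units (sect X W)" "restr X U W t \<in> Units (sect X W)"
    using W assms by (auto intro: prod_unit_l prod_unit_r)
  then show "invertible_at X x U s \<and> invertible_at X x U t" using W unfolding invertible_at_def by blast
next
  assume "invertible_at X x U s \<and> invertible_at X x U t"
  then obtain W W' where W: "opn X W" "x \<in> W" "W \<subseteq> U" "restr X U W s \<in> Units (sect X W)"
     and W': "opn X W'" "x \<in> W'" "W' \<subseteq> U" "restr X U W' t \<in> Units (sect X W')"
    by (auto simp: invertible_at_def)
  let ?V = "W \<inter> W'"
  have V: "opn X ?V" "x \<in> ?V" "?V \<subseteq> U" using W W' by auto
  interpret kalgebra "sect X ?V" K using alg V by simp
  have "restr X W ?V (restr X U W s) \<in> Units (sect X ?V)" "restr X W' ?V (restr X U W' t) \<in> Units (sect X ?V)"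
    using W W' V by (auto intro: restr_Units)
  then have "restr X U ?V s \<in> Units (sect X ?V)" "restr X U ?V t \<in> Units (sect X ?V)"
    using W W' V assms by simp_all
  then have "restr X U ?V (s \<otimes>\<^bsub>sect X U\<^esub> t) \<in> Units (sect X ?V)" using V assms by (simp add: restr_simps)
  then show "invertible_at X x U (s \<otimes>\<^bsub>sect X U\<^esub> t)" using V unfolding invertible_at_def by blast
qed

lemma invertible_one [simp]: "opn X U \<Longrightarrow> x \<in> U \<Longrightarrow> invertible_at X x U \<one>\<^bsub>sect X U\<^esub>"
proof -
  assume U: "opn X U" "x \<in> U"
  interpret kalgebra "sect X U" K using alg U by simp
  show ?thesis using U by (intro invertible_unit) auto
qed

lemma openin_invertible: "opn X U \<Longrightarrow> s \<in> carrier (sect X U) \<Longrightarrow> opn X {x \<in> U. invertible_at X x U s}"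
proof -
  assume U: "opn X U" "s \<in> carrier (sect X U)"
  have "{x \<in> U. invertible_at X x U s} = \<Union>{V. opn X V \<and> V \<subseteq> U \<and> restr X U V s \<in> Units (sect X V)}"
    by (auto simp: invertible_at_def)
  moreover have "opn X (\<Union>{V. opn X V \<and> V \<subseteq> U \<and> restr X U V s \<in> Units (sect X V)})"
    by (rule openin_Union) auto
  ultimately show ?thesis by (simp only:)
qed

end

text \<open>This says that the stalks are local rings without forming stalks: a sum of two nonunits
  is a nonunit, and zero is a nonunit.\<close>

locale locally_ringed = ksheaf +
  assumes local_add: "opn X U \<Longrightarrow> x \<in> U \<Longrightarrow> s \<in> carrier (sect X U) \<Longrightarrow> t \<in> carrier (sect X U) \<Longrightarrow>
      invertible_at X x U (s \<oplus>\<^bsub>sect X U\<^esub> t) \<Longrightarrow> invertible_at X x U s \<or> invertible_at X x U t"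
    and local_zero: "opn X U \<Longrightarrow> \<not> invertible_at X x U \<zero>\<^bsub>sect X U\<^esub>"
begin

text \<open>The contraction along h of the maximal ideal of the stalk at x. This is how a ring
  homomorphism out of the coordinate ring of an affine scheme produces a point of that
  scheme.\<close>

lemma nonunits_prime:
  assumes U: "opn X U" "x \<in> U" and h: "alg_hom K A (sect X U) h" and A: "kalgebra A K"
  shows "primeideal {a \<in> carrier A. \<not> invertible_at X x U (h a)} A"
proof -
  interpret A: kalgebra A K by fact
  interpret kalgebra "sect X U" K using alg U by simp
  interpret h: kalgebra_hom A "sect X U" K h by unfold_locales fact
  let ?P = "{a \<in> carrier A. \<not> invertible_at X x U (h a)}"
  have "ideal ?P A"
  proof (rule idealI[OF A.ring_axioms])
    show "subgroup ?P (add_monoid A)"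
    proof (rule A.add.subgroupI)
      show "?P \<subseteq> carrier A" by auto
      show "?P \<noteq> {}" using local_zero[OF U(1)] by (auto intro!: exI[of _ "\<zero>\<^bsub>A\<^esub>"])
      fix a assume a: "a \<in> ?P"
      have "h (\<ominus>\<^bsub>A\<^esub> a) = h (\<ominus>\<^bsub>A\<^esub> \<one>\<^bsub>A\<^esub>) \<otimes>\<^bsub>sect X U\<^esub> h a"
        using a by (simp add: l_minus)
      then show "\<ominus>\<^bsub>A\<^esub> a \<in> ?P" using a U by simp
      fix b assume "b \<in> ?P"
      then show "a \<oplus>\<^bsub>A\<^esub> b \<in> ?P" using a U local_add[OF U, of "h a" "h b"] by auto
    qed
  qed (use U in auto)
  moreover have "\<one>\<^bsub>A\<^esub> \<notin> ?P" using U by simp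
  then have "carrier A \<noteq> ?P" by (metis A.one_closed)
  ultimately show ?thesis
    using U A.is_cring by (intro primeidealI) auto
qed

end

section \<open>Affine open sets\<close>

lemma openin_zariski:
  "openin (zariski A) Z \<longleftrightarrow> (\<exists>E \<subseteq> carrier A. Z = {P. primeideal P A \<and> \<not> E \<subseteq> P})"
  unfolding zariski_def by (subst topology_inverse'[OF istopology_zariski]) (rule refl)

lemma topspace_zariski: "topspace (zariski A) = {P. primeideal P A}"
proof -
  have "openin (zariski A) {P. primeideal P A \<and> \<not> carrier A \<subseteq> P}" by (auto simp: openin_zariski)
  moreover have "P \<in> {P. primeideal P A \<and> \<not> carrier A \<subseteq> P}" if "primeideal P A" for P
    using that primeideal.I_notcarr[OF that] ideal.Icarr[OF primeideal.axioms(1)[OF that]] by auto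
  ultimately have "{P. primeideal P A} \<subseteq> topspace (zariski A)"
    using openin_subset by blast
  then show ?thesis by (auto simp: topspace_def openin_zariski)
qed

lemma (in kalgebra) unit_cancel_zero:
  "u \<in> Units A \<Longrightarrow> x \<in> carrier A \<Longrightarrow> x \<otimes> u = \<zero> \<Longrightarrow> x = \<zero>"
  using unit_cancel[of u x \<zero>] Units_closed[of u] by simp

lemma (in kalgebra_hom) primeideal_preimage:
  assumes "primeideal P B"
  shows "primeideal {a \<in> carrier A. h a \<in> P} A"
proof -
  interpret P: primeideal P B by fact
  have "ideal {a \<in> carrier A. h a \<in> P} A"
  proof (rule idealI[OF A.ring_axioms])
    show "subgroup {a \<in> carrier A. h a \<in> P} (add_monoid A)"
      by (rule A.add.subgroupI) (auto intro: exI[of _ "\<zero>\<^bsub>A\<^esub>"])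
  qed (auto intro: P.I_l_closed P.I_r_closed)
  moreover have "\<one>\<^bsub>A\<^esub> \<notin> {a \<in> carrier A. h a \<in> P}" using P.one_imp_carrier P.I_notcarr by auto
  then have "carrier A \<noteq> {a \<in> carrier A. h a \<in> P}" by (metis A.one_closed)
  ultimately show ?thesis using P.I_prime A.is_cring by (intro primeidealI) auto
qed

definition pt_ideal :: "('p, 's) kspace \<Rightarrow> 'p set \<Rightarrow> 'p \<Rightarrow> 's set" where
  "pt_ideal X U x = {f \<in> carrier (sect X U). \<not> invertible_at X x U f}"

definition basic :: "('p, 's) kspace \<Rightarrow> 'p set \<Rightarrow> 's \<Rightarrow> 'p set" where
  "basic X U f = {x \<in> U. invertible_at X x U f}"

lemma basic_subset: "basic X U f \<subseteq> U"
  by (auto simp: basic_def)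

lemma in_basic_iff: "x \<in> basic X U f \<longleftrightarrow> invertible_at X x U f"
  by (auto simp: basic_def invertible_at_def)

text \<open>\<open>open_sub\<close> changes only the topology, and open neighbourhoods inside U are
  the same for both spaces; so affineness of U can be expressed with the data of X alone.\<close>

lemma affine_open_iff:
  assumes U: "opn X U"
  shows "affine_open X U \<longleftrightarrow>
    homeomorphic_map (subtopology (ptop X) U) (zariski (sect X U)) (pt_ideal X U) \<and>
    (\<forall>f\<in>carrier (sect X U). is_localization (sect X U) f (sect X (basic X U f)) (restr X U (basic X U f)))"
proof -
  have pts: "topspace (subtopology (ptop X) U) = U" using openin_subset[OF U] by auto
  have inv: "invertible_at (open_sub X U) x U s = invertible_at X x U s" for x s
    using openin_open_subtopology[OF U] by (auto simp: invertible_at_def open_sub_def)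
  have p: "pts (open_sub X U) = U" using pts by (simp add: open_sub_def)
  have s: "sect (open_sub X U) = sect X" "restr (open_sub X U) = restr X" "ptop (open_sub X U) = subtopology (ptop X) U"
    by (simp_all add: open_sub_def)
  show ?thesis using U unfolding affine_open_def affine_def p Let_def inv
    unfolding s pt_ideal_def[abs_def] basic_def by simp
qed

context ksheaf
begin

lemma openin_basic: "opn X U \<Longrightarrow> f \<in> carrier (sect X U) \<Longrightarrow> opn X (basic X U f)"
  unfolding basic_def by (rule openin_invertible)

lemma affine_openI:
  assumes U: "opn X U"
    and prime: "\<And>x. x \<in> U \<Longrightarrow> primeideal (pt_ideal X U x) (sect X U)"
    and inj: "\<And>x y. x \<in> U \<Longrightarrow> y \<in> U \<Longrightarrow> pt_ideal X U x = pt_ideal X U y \<Longrightarrow> x = y"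
    and surj: "\<And>P. primeideal P (sect X U) \<Longrightarrow> \<exists>x\<in>U. pt_ideal X U x = P"
    and basis: "\<And>x N. opn X N \<Longrightarrow> N \<subseteq> U \<Longrightarrow> x \<in> N \<Longrightarrow>
      \<exists>f\<in>carrier (sect X U). x \<in> basic X U f \<and> basic X U f \<subseteq> N"
    and loc: "\<And>f. f \<in> carrier (sect X U) \<Longrightarrow>
      is_localization (sect X U) f (sect X (basic X U f)) (restr X U (basic X U f))"
  shows "affine_open X U"
proof -
  have ts: "topspace (subtopology (ptop X) U) = U" using openin_subset[OF U] by auto
  have "homeomorphic_map (subtopology (ptop X) U) (zariski (sect X U)) (pt_ideal X U)"
  proof (rule bijective_open_imp_homeomorphic_map)
    show "continuous_map (subtopology (ptop X) U) (zariski (sect X U)) (pt_ideal X U)"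
      unfolding continuous_map_def ts
    proof (intro conjI allI impI)
      show "pt_ideal X U \<in> U \<rightarrow> topspace (zariski (sect X U))" using prime by (auto simp: topspace_zariski)
      fix Z assume "openin (zariski (sect X U)) Z"
      then obtain E where E: "E \<subseteq> carrier (sect X U)" "Z = {P. primeideal P (sect X U) \<and> \<not> E \<subseteq> P}"
        by (auto simp: openin_zariski)
      then have "{x \<in> U. pt_ideal X U x \<in> Z} = (\<Union>f\<in>E. basic X U f)"
        using prime by (auto simp: pt_ideal_def basic_def)
      moreover have "opn X (\<Union>f\<in>E. basic X U f)" using E U openin_basic by blast
      ultimately show "openin (subtopology (ptop X) U) {x \<in> U. pt_ideal X U x \<in> Z}"
        unfolding openin_open_subtopology[OF U] by (simp add: basic_def) blast
    qed
    show "open_map (subtopology (ptop X) U) (zariski (sect X U)) (pt_ideal X U)"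
      unfolding open_map_def openin_open_subtopology[OF U]
    proof (intro allI impI)
      fix N assume N: "opn X N \<and> N \<subseteq> U"
      \<comment> \<open>The largest set of functions whose basic open sets fit into N. By the basis
        hypothesis these basic sets cover N, so the image of N is the Zariski open set defined by
        them.\<close>
      let ?E = "{f \<in> carrier (sect X U). basic X U f \<subseteq> N}"
      have "pt_ideal X U ` N = {P. primeideal P (sect X U) \<and> \<not> ?E \<subseteq> P}"
      proof (intro Set.set_eqI iffI)
        fix P assume "P \<in> pt_ideal X U ` N"
        then obtain x where x: "x \<in> N" "P = pt_ideal X U x" by auto
        with N basis obtain f where "f \<in> carrier (sect X U)" "x \<in> basic X U f" "basic X U f \<subseteq> N" by meson
        then show "P \<in> {P. primeideal P (sect X U) \<and> \<not> ?E \<subseteq> P}" using x N prime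
          by (auto simp: pt_ideal_def basic_def)
      next
        fix P assume "P \<in> {P. primeideal P (sect X U) \<and> \<not> ?E \<subseteq> P}"
        then obtain f where P: "primeideal P (sect X U)" "f \<in> ?E" "f \<notin> P" by blast
        then obtain x where "x \<in> U" "pt_ideal X U x = P" using surj by blast
        then show "P \<in> pt_ideal X U ` N" using P by (auto simp: pt_ideal_def basic_def)
      qed
      then show "openin (zariski (sect X U)) (pt_ideal X U ` N)"
        unfolding openin_zariski by (intro exI[of _ ?E]) auto
    qed
    show "pt_ideal X U ` topspace (subtopology (ptop X) U) = topspace (zariski (sect X U))"
      unfolding ts topspace_zariski using prime surj by blast
    show "inj_on (pt_ideal X U) (topspace (subtopology (ptop X) U))"
      unfolding ts using inj by (auto intro: inj_onI)
  qed
  then show ?thesis using affine_open_iff[OF U] loc by blast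
qed

section \<open>Affine open sets, their basic open subsets and the locality of their stalks\<close>

context
  fixes U assumes aff: "affine_open X U"
begin

lemma affine_opn: "opn X U"
  using aff by (simp add: affine_open_def)

lemma affine_homeo: "homeomorphic_map (subtopology (ptop X) U) (zariski (sect X U)) (pt_ideal X U)"
  using affine_open_iff[OF affine_opn] aff by blast

lemma affine_localization:
  "f \<in> carrier (sect X U) \<Longrightarrow> is_localization (sect X U) f (sect X (basic X U f)) (restr X U (basic X U f))"
  using affine_open_iff[OF affine_opn] aff by blast

lemma affine_topspace: "topspace (subtopology (ptop X) U) = U"
  using openin_subset[OF affine_opn] by auto

lemma affine_prime: "x \<in> U \<Longrightarrow> primeideal (pt_ideal X U x) (sect X U)"
  using homeomorphic_imp_surjective_map[OF affine_homeo] unfolding topspace_zariski affine_topspace by blast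

lemma affine_surj:
  assumes "primeideal P (sect X U)" shows "\<exists>x\<in>U. pt_ideal X U x = P"
proof -
  have "P \<in> pt_ideal X U ` U"
    using homeomorphic_imp_surjective_map[OF affine_homeo] assms unfolding topspace_zariski affine_topspace by simp
  then show ?thesis by auto
qed

lemma affine_inj: "x \<in> U \<Longrightarrow> y \<in> U \<Longrightarrow> pt_ideal X U x = pt_ideal X U y \<Longrightarrow> x = y"
  using homeomorphic_imp_injective_map[OF affine_homeo] unfolding affine_topspace by (auto dest: inj_onD)

text \<open>The homeomorphism with the spectrum maps N \<inter> U to the complement of a zero set;
  any of its defining functions that does not vanish at x serves as f.\<close>

lemma affine_basis:
  assumes N: "opn X N" and x: "x \<in> N" "x \<in> U"
  shows "\<exists>f\<in>carrier (sect X U). x \<in> basic X U f \<and> basic X U f \<subseteq> N"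
proof -
  let ?N = "N \<inter> U"
  have "openin (subtopology (ptop X) U) ?N" using N affine_opn
    by (simp add: openin_open_subtopology openin_Int)
  then have "openin (zariski (sect X U)) (pt_ideal X U ` ?N)"
    using homeomorphic_imp_open_map[OF affine_homeo] by (auto simp: open_map_def)
  then obtain E where E: "E \<subseteq> carrier (sect X U)" "pt_ideal X U ` ?N = {P. primeideal P (sect X U) \<and> \<not> E \<subseteq> P}"
    unfolding openin_zariski by blast
  have "pt_ideal X U x \<in> pt_ideal X U ` ?N" using x by blast
  then obtain f where f: "f \<in> E" "f \<notin> pt_ideal X U x" unfolding E by blast
  have "basic X U f \<subseteq> ?N"
  proof
    fix y assume y: "y \<in> basic X U f"
    then have yU: "y \<in> U" and "f \<notin> pt_ideal X U y" by (auto simp: basic_def pt_ideal_def)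
    then have "pt_ideal X U y \<in> pt_ideal X U ` ?N" unfolding E using f affine_prime by blast
    then show "y \<in> ?N" using affine_inj yU by blast
  qed
  then show ?thesis using f E x by (intro bexI[of _ f]) (auto simp: basic_def pt_ideal_def)
qed

lemma affine_numerator:
  assumes "f \<in> carrier (sect X U)" "s \<in> carrier (sect X (basic X U f))"
  obtains a n where "a \<in> carrier (sect X U)"
    "s \<otimes>\<^bsub>sect X (basic X U f)\<^esub> (restr X U (basic X U f) f [^]\<^bsub>sect X (basic X U f)\<^esub> (n::nat)) =
      restr X U (basic X U f) a"
  using affine_localization[OF assms(1)] assms(2) unfolding is_localization_def by blast

lemma affine_basic_unit: "f \<in> carrier (sect X U) \<Longrightarrow> restr X U (basic X U f) f \<in> Units (sect X (basic X U f))"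
  using affine_localization unfolding is_localization_def by blast

lemma affine_invertible_fraction:
  assumes f: "f \<in> carrier (sect X U)" and s: "s \<in> carrier (sect X (basic X U f))" and a: "a \<in> carrier (sect X U)"
    and e: "s \<otimes>\<^bsub>sect X (basic X U f)\<^esub> (restr X U (basic X U f) f [^]\<^bsub>sect X (basic X U f)\<^esub> (n::nat)) =
      restr X U (basic X U f) a" and x: "x \<in> basic X U f"
  shows "invertible_at X x (basic X U f) s \<longleftrightarrow> invertible_at X x U a"
proof -
  let ?D = "basic X U f"
  have D: "opn X ?D" using openin_basic affine_opn f by blast
  interpret kalgebra "sect X ?D" K using alg D by simp
  have u: "restr X U ?D f [^]\<^bsub>sect X ?D\<^esub> n \<in> Units (sect X ?D)" using affine_basic_unit[OF f] by (rule unit_pow)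
  have "invertible_at X x ?D s \<longleftrightarrow> invertible_at X x ?D (restr X U ?D a)"
    unfolding e[symmetric] using D s u x invertible_unit[OF D x u] by (simp add: Units_closed)
  also have "\<dots> \<longleftrightarrow> invertible_at X x U a"
    by (rule invertible_restr[OF affine_opn D basic_subset x a])
  finally show ?thesis .
qed

text \<open>After shrinking V to a basic open set D(f), both sections are fractions with powers of f
  as denominators, and invertibility at x can be tested on numerators. The numerators vanishing at x
  form a prime ideal of the coordinate ring of U, in particular they are closed under sums.\<close>

lemma affine_local_add:
  assumes x: "x \<in> U" and V: "opn X V" "x \<in> V" and s: "s \<in> carrier (sect X V)" "t \<in> carrier (sect X V)"
    and i: "invertible_at X x V (s \<oplus>\<^bsub>sect X V\<^esub> t)"
  shows "invertible_at X x V s \<or> invertible_at X x V t"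
proof -
  from affine_basis[OF V x] obtain f where f: "f \<in> carrier (sect X U)" "x \<in> basic X U f" "basic X U f \<subseteq> V" by blast
  let ?D = "basic X U f"
  have D: "opn X ?D" "?D \<subseteq> U" by (rule openin_basic[OF affine_opn f(1)], rule basic_subset)
  interpret V: kalgebra "sect X V" K using alg V by simp
  interpret A: kalgebra "sect X U" K using alg affine_opn by simp
  interpret B: kalgebra "sect X ?D" K using alg D by simp
  let ?r = "restr X U ?D" and ?s = "restr X V ?D s" and ?t = "restr X V ?D t"
  have st: "?s \<in> carrier (sect X ?D)" "?t \<in> carrier (sect X ?D)" using V D f s by auto
  from affine_numerator[OF f(1) st(1)] obtain a n where a: "a \<in> carrier (sect X U)"
    "?s \<otimes>\<^bsub>sect X ?D\<^esub> (?r f [^]\<^bsub>sect X ?D\<^esub> (n::nat)) = ?r a" by blast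
  from affine_numerator[OF f(1) st(2)] obtain b m where b: "b \<in> carrier (sect X U)"
    "?t \<otimes>\<^bsub>sect X ?D\<^esub> (?r f [^]\<^bsub>sect X ?D\<^esub> (m::nat)) = ?r b" by blast
  have rf: "?r f \<in> carrier (sect X ?D)" using f D affine_opn by auto
  \<comment> \<open>The numerators over the common denominator f^(n + m).\<close>
  let ?a = "a \<otimes>\<^bsub>sect X U\<^esub> f [^]\<^bsub>sect X U\<^esub> m" and ?b = "b \<otimes>\<^bsub>sect X U\<^esub> f [^]\<^bsub>sect X U\<^esub> n"
  have ab: "?a \<in> carrier (sect X U)" "?b \<in> carrier (sect X U)" using a b f by auto
  have ea: "?s \<otimes>\<^bsub>sect X ?D\<^esub> (?r f [^]\<^bsub>sect X ?D\<^esub> (n + m)) = ?r ?a"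
    using a(1) b(1) f rf st D affine_opn
    by (simp add: restr_simps a(2)[symmetric] B.nat_pow_mult[symmetric] B.m_assoc)
  have eb: "?t \<otimes>\<^bsub>sect X ?D\<^esub> (?r f [^]\<^bsub>sect X ?D\<^esub> (n + m)) = ?r ?b"
    using a(1) b(1) f rf st D affine_opn
    by (simp add: restr_simps b(2)[symmetric] B.nat_pow_mult[symmetric] B.m_ac)
  have es: "(?s \<oplus>\<^bsub>sect X ?D\<^esub> ?t) \<otimes>\<^bsub>sect X ?D\<^esub> (?r f [^]\<^bsub>sect X ?D\<^esub> (n + m)) = ?r (?a \<oplus>\<^bsub>sect X U\<^esub> ?b)"
    using ab D affine_opn st rf by (simp add: restr_add ea[symmetric] eb[symmetric] B.l_distr)
  have "invertible_at X x ?D (?s \<oplus>\<^bsub>sect X ?D\<^esub> ?t)" using i V D f s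
    by (simp flip: restr_add) 
  then have "invertible_at X x U (?a \<oplus>\<^bsub>sect X U\<^esub> ?b)"
    using affine_invertible_fraction[OF f(1) _ _ es f(2)] st ab by simp
  moreover interpret P: primeideal "pt_ideal X U x" "sect X U" by (rule affine_prime[OF x])
  have "?a \<oplus>\<^bsub>sect X U\<^esub> ?b \<in> pt_ideal X U x" if "?a \<in> pt_ideal X U x" "?b \<in> pt_ideal X U x"
    using that by (rule P.a_closed)
  ultimately have "invertible_at X x U ?a \<or> invertible_at X x U ?b" using ab unfolding pt_ideal_def by blast
  then have "invertible_at X x ?D ?s \<or> invertible_at X x ?D ?t"
    using affine_invertible_fraction[OF f(1) st(1) ab(1) ea f(2)]
      affine_invertible_fraction[OF f(1) st(2) ab(2) eb f(2)] by blast
  then show ?thesis using V D f s by simp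
qed

lemma affine_local_zero:
  assumes x: "x \<in> U" and V: "opn X V" "x \<in> V"
  shows "\<not> invertible_at X x V \<zero>\<^bsub>sect X V\<^esub>"
proof
  assume "invertible_at X x V \<zero>\<^bsub>sect X V\<^esub>"
  moreover have W: "opn X (U \<inter> V)" using V affine_opn by blast
  interpret V: kalgebra "sect X V" K using alg V by simp
  interpret U: kalgebra "sect X U" K using alg affine_opn by simp
  have "restr X V (U \<inter> V) \<zero>\<^bsub>sect X V\<^esub> = restr X U (U \<inter> V) \<zero>\<^bsub>sect X U\<^esub>"
    using W V affine_opn by (simp add: restr_zero)
  ultimately have "invertible_at X x U \<zero>\<^bsub>sect X U\<^esub>"
    using invertible_restr[OF V(1) W _ _ V.zero_closed, of x] invertible_restr[OF affine_opn W _ _ U.zero_closed, of x] V x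
    by simp
  moreover interpret P: primeideal "pt_ideal X U x" "sect X U" by (rule affine_prime[OF x])
  have "\<zero>\<^bsub>sect X U\<^esub> \<in> pt_ideal X U x" by (rule P.zero_closed)
  ultimately show False unfolding pt_ideal_def by blast
qed

text \<open>The primes of a localization at f are the primes that avoid f, which gives the points of
  D(f). For an element b = a / f^k of the localization, D(b) coincides with D(a f) in U, so the
  localization at b is obtained from the known one at a f.\<close>

lemma affine_open_basic:
  assumes f: "f \<in> carrier (sect X U)"
  shows "affine_open X (basic X U f)"
proof (rule affine_openI)
  let ?D = "basic X U f"
  let ?r = "restr X U ?D"
  note U = affine_opn
  show D: "opn X ?D" using openin_basic U f by blast
  have DU: "?D \<subseteq> U" by (rule basic_subset)
  interpret A: kalgebra "sect X U" K using alg U by simp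
  interpret B: kalgebra "sect X ?D" K using alg D by simp
  interpret r: kalgebra_hom "sect X U" "sect X ?D" K ?r by (rule restr_hom[OF U D DU])
  have uf: "?r f \<in> Units (sect X ?D)" by (rule affine_basic_unit[OF f])
  have num: "\<exists>a\<in>carrier (sect X U). \<exists>n. s \<otimes>\<^bsub>sect X ?D\<^esub> (?r f [^]\<^bsub>sect X ?D\<^esub> (n::nat)) = ?r a"
    if "s \<in> carrier (sect X ?D)" for s
    using affine_numerator[OF f that] by metis
  have contr: "{a \<in> carrier (sect X U). ?r a \<in> pt_ideal X ?D x} = pt_ideal X U x" if "x \<in> ?D" for x
    using that U D DU by (auto simp: pt_ideal_def)
  have mem: "s \<in> pt_ideal X ?D x \<longleftrightarrow> a \<in> pt_ideal X U x"
    if "x \<in> ?D" "s \<in> carrier (sect X ?D)" "a \<in> carrier (sect X U)"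
     "s \<otimes>\<^bsub>sect X ?D\<^esub> (?r f [^]\<^bsub>sect X ?D\<^esub> (n::nat)) = ?r a" for x s a n
    using affine_invertible_fraction[OF f that(2,3,4,1)] that by (simp add: pt_ideal_def)
  show "primeideal (pt_ideal X ?D x) (sect X ?D)" if x: "x \<in> ?D" for x
  proof -
    have xU: "x \<in> U" using x DU by blast
    have "ideal (pt_ideal X ?D x) (sect X ?D)"
    proof (rule idealI[OF B.ring_axioms])
      show "subgroup (pt_ideal X ?D x) (add_monoid (sect X ?D))"
      proof (rule B.add.subgroupI)
        show "pt_ideal X ?D x \<subseteq> carrier (sect X ?D)" by (auto simp: pt_ideal_def)
        show "pt_ideal X ?D x \<noteq> {}" using affine_local_zero[OF xU D x] by (auto simp: pt_ideal_def)
        fix s assume s: "s \<in> pt_ideal X ?D x"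
        then have sc: "s \<in> carrier (sect X ?D)" by (simp add: pt_ideal_def)
        have "\<ominus>\<^bsub>sect X ?D\<^esub> s = \<ominus>\<^bsub>sect X ?D\<^esub> \<one>\<^bsub>sect X ?D\<^esub> \<otimes>\<^bsub>sect X ?D\<^esub> s" using sc by (simp add: B.l_minus)
        then show "\<ominus>\<^bsub>sect X ?D\<^esub> s \<in> pt_ideal X ?D x" using s sc D x by (simp add: pt_ideal_def)
        fix t assume t: "t \<in> pt_ideal X ?D x"
        then show "s \<oplus>\<^bsub>sect X ?D\<^esub> t \<in> pt_ideal X ?D x"
          using s affine_local_add[OF xU D x, of s t] by (auto simp: pt_ideal_def)
      qed
    qed (use D x in \<open>auto simp: pt_ideal_def\<close>)
    moreover have "\<one>\<^bsub>sect X ?D\<^esub> \<notin> pt_ideal X ?D x" using D x by (simp add: pt_ideal_def)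
    then have "carrier (sect X ?D) \<noteq> pt_ideal X ?D x" by (metis B.one_closed)
    ultimately show ?thesis using D x B.is_cring by (intro primeidealI) (auto simp: pt_ideal_def)
  qed
  show "x = y" if "x \<in> ?D" "y \<in> ?D" "pt_ideal X ?D x = pt_ideal X ?D y" for x y
  proof (rule affine_inj)
    show "pt_ideal X U x = pt_ideal X U y" unfolding contr[OF that(1), symmetric] contr[OF that(2), symmetric] that(3) ..
  qed (use that DU in auto)
  show "\<exists>x\<in>?D. pt_ideal X ?D x = P" if P: "primeideal P (sect X ?D)" for P
  proof -
    interpret P: primeideal P "sect X ?D" by fact
    have pU: "p \<notin> P" if "p \<in> Units (sect X ?D)" for p
    proof
      assume "p \<in> P"
      then have "inv\<^bsub>sect X ?D\<^esub> p \<otimes>\<^bsub>sect X ?D\<^esub> p \<in> P" using P.I_l_closed that by blast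
      then have "\<one>\<^bsub>sect X ?D\<^esub> \<in> P" using that by simp
      then show False using P.one_imp_carrier P.I_notcarr by simp
    qed
    \<comment> \<open>The candidate point is found in U, as the point of the contracted prime. It
      lies in D(f) because a prime contains no unit, and P is recovered from its numerators.\<close>
    let ?Q = "{a \<in> carrier (sect X U). ?r a \<in> P}"
    have "primeideal ?Q (sect X U)"
      by (rule r.primeideal_preimage[OF P])
    then obtain x where x: "x \<in> U" "pt_ideal X U x = ?Q" using affine_surj by blast
    have "f \<notin> ?Q" using pU[OF uf] by simp
    then have xD: "x \<in> ?D" using x f by (auto simp: pt_ideal_def in_basic_iff)
    have "s \<in> pt_ideal X ?D x \<longleftrightarrow> s \<in> P" if s: "s \<in> carrier (sect X ?D)" for s
    proof -
      obtain a n where a: "a \<in> carrier (sect X U)" "s \<otimes>\<^bsub>sect X ?D\<^esub> (?r f [^]\<^bsub>sect X ?D\<^esub> (n::nat)) = ?r a"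
        using num[OF s] by blast
      have un: "?r f [^]\<^bsub>sect X ?D\<^esub> n \<in> Units (sect X ?D)" using uf by (rule B.unit_pow)
      have "s \<in> pt_ideal X ?D x \<longleftrightarrow> ?r a \<in> P" using mem[OF xD s a] x(2) a(1) by auto
      also have "\<dots> \<longleftrightarrow> s \<in> P" unfolding a(2)[symmetric]
        using P.I_prime[OF s B.Units_closed[OF un]] pU[OF un] P.I_r_closed[OF _ B.Units_closed[OF un]] by blast
      finally show ?thesis .
    qed
    moreover have "pt_ideal X ?D x \<subseteq> carrier (sect X ?D)" "P \<subseteq> carrier (sect X ?D)"
      using P.Icarr unfolding pt_ideal_def by blast+
    ultimately have "pt_ideal X ?D x = P" by blast
    then show ?thesis using xD by blast
  qed
  have bas: "basic X ?D (?r g) = ?D \<inter> basic X U g" if "g \<in> carrier (sect X U)" for g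
    using that U D DU by (auto simp: basic_def)
  show "\<exists>g\<in>carrier (sect X ?D). x \<in> basic X ?D g \<and> basic X ?D g \<subseteq> N"
    if "opn X N" "N \<subseteq> ?D" "x \<in> N" for x N
  proof -
    from affine_basis[OF that(1,3)] that DU obtain g where "g \<in> carrier (sect X U)" "x \<in> basic X U g" "basic X U g \<subseteq> N"
      by blast
    then show ?thesis using bas[of g] that by (intro bexI[of _ "?r g"]) auto
  qed
  show "is_localization (sect X ?D) b (sect X (basic X ?D b)) (restr X ?D (basic X ?D b))"
    if b: "b \<in> carrier (sect X ?D)" for b
  proof -
    obtain a k where a: "a \<in> carrier (sect X U)" "b \<otimes>\<^bsub>sect X ?D\<^esub> (?r f [^]\<^bsub>sect X ?D\<^esub> (k::nat)) = ?r a"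
      using num[OF b] by blast
    let ?E = "basic X ?D b"
    have E: "opn X ?E" "?E \<subseteq> ?D" by (rule openin_basic[OF D b], rule basic_subset)
    \<comment> \<open>The factor f confines the basic open set to D(f), and a cuts out D(b) there
      since a and b differ by a unit on D(f).\<close>
    let ?g = "a \<otimes>\<^bsub>sect X U\<^esub> f"
    have g: "?g \<in> carrier (sect X U)" using a f by simp
    have Eg: "?E = basic X U ?g"
    proof (intro Set.set_eqI iffI)
      fix x assume x: "x \<in> ?E"
      then have "x \<in> ?D" "x \<in> U" using E DU by blast+
      then show "x \<in> basic X U ?g" using x affine_invertible_fraction[OF f b a(1) a(2)] a f U
        by (auto simp: in_basic_iff)
    next
      fix x assume x: "x \<in> basic X U ?g"
      then have xU: "x \<in> U" by (simp add: basic_def)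
      then have xD: "x \<in> ?D" using x a f U by (simp add: in_basic_iff)
      then show "x \<in> ?E" using x xU affine_invertible_fraction[OF f b a(1) a(2) xD] a f U
        by (simp add: in_basic_iff)
    qed
    interpret C: kalgebra "sect X ?E" K using alg E by simp
    let ?q = "restr X ?D ?E"
    interpret q: kalgebra_hom "sect X ?D" "sect X ?E" K ?q by (rule restr_hom[OF D E])
    have EU: "?E \<subseteq> U" using E DU by blast
    have qr: "restr X U ?E x = ?q (?r x)" if "x \<in> carrier (sect X U)" for x using that U D DU E by simp
    have lg: "is_localization (sect X U) ?g (sect X ?E) (restr X U ?E)"
      unfolding Eg by (rule affine_localization[OF g])
    have qg: "restr X U ?E ?g \<in> Units (sect X ?E)" using lg by (simp add: is_localization_def)
    have rf: "?r f \<in> carrier (sect X ?D)" using f by simp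
    have rfn: "?r f [^]\<^bsub>sect X ?D\<^esub> (n::nat) \<in> Units (sect X ?D)" for n using uf by (rule B.unit_pow)
    have rg: "?r ?g = b \<otimes>\<^bsub>sect X ?D\<^esub> (?r f [^]\<^bsub>sect X ?D\<^esub> (Suc k))"
      using a(1) f b rf by (simp add: a(2)[symmetric] B.m_ac)
    have ub: "?q b \<in> Units (sect X ?E)"
    proof (rule C.prod_unit_l)
      show "?q b \<otimes>\<^bsub>sect X ?E\<^esub> ?q (?r f [^]\<^bsub>sect X ?D\<^esub> (Suc k)) \<in> Units (sect X ?E)"
        using qg unfolding qr[OF g] rg using b rf by (simp del: nat_pow_Suc)
    qed (use b rf in auto)
    show ?thesis
      unfolding is_localization_def
    proof (intro conjI ballI impI)
      show "?q \<in> ring_hom (sect X ?D) (sect X ?E)" by (rule q.homh)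
      show "?q b \<in> Units (sect X ?E)" by (rule ub)
      fix s assume s: "s \<in> carrier (sect X ?E)"
      then obtain c n where c: "c \<in> carrier (sect X U)"
        "s \<otimes>\<^bsub>sect X ?E\<^esub> (restr X U ?E ?g [^]\<^bsub>sect X ?E\<^esub> (n::nat)) = restr X U ?E c"
        using lg unfolding is_localization_def by blast
      let ?u = "(?r f [^]\<^bsub>sect X ?D\<^esub> (Suc k)) [^]\<^bsub>sect X ?D\<^esub> n"
      have u: "?u \<in> Units (sect X ?D)" by (rule B.unit_pow[OF rfn])
      \<comment> \<open>On D(f) the function a f equals b f^(k + 1). A fraction with denominator (a
        f)^n thus becomes one with denominator b^n after the numerator has been divided by the unit
        (f^(k + 1))^n.\<close>
      let ?c = "?r c \<otimes>\<^bsub>sect X ?D\<^esub> inv\<^bsub>sect X ?D\<^esub> ?u"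
      have "restr X U ?E ?g [^]\<^bsub>sect X ?E\<^esub> n = ?q b [^]\<^bsub>sect X ?E\<^esub> n \<otimes>\<^bsub>sect X ?E\<^esub> ?q ?u"
        unfolding qr[OF g] rg using b rf
        by (simp add: q.hom_pow C.nat_pow_distrib del: nat_pow_Suc)
      then have "s \<otimes>\<^bsub>sect X ?E\<^esub> (?q b [^]\<^bsub>sect X ?E\<^esub> n) \<otimes>\<^bsub>sect X ?E\<^esub> ?q ?u = ?q (?r c)"
        using c(2) s b B.Units_closed[OF u] qr[OF c(1)] by (simp add: C.m_assoc del: nat_pow_Suc)
      moreover have "?q ?c \<otimes>\<^bsub>sect X ?E\<^esub> ?q ?u = ?q (?r c)"
      proof -
        have "?c \<otimes>\<^bsub>sect X ?D\<^esub> ?u = ?r c" using c u B.Units_closed[OF u]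
          by (simp add: B.m_assoc del: nat_pow_Suc)
        then show ?thesis using c u B.Units_closed[OF u] by (simp flip: q.hom_mult del: nat_pow_Suc)
      qed
      ultimately have "s \<otimes>\<^bsub>sect X ?E\<^esub> (?q b [^]\<^bsub>sect X ?E\<^esub> n) = ?q ?c"
        using C.unit_cancel[OF q.hom_Units[OF u]] s b c u by (simp del: nat_pow_Suc)
      then show "\<exists>a\<in>carrier (sect X ?D). \<exists>n::nat. s \<otimes>\<^bsub>sect X ?E\<^esub> (?q b [^]\<^bsub>sect X ?E\<^esub> n) = ?q a"
        using c u by (intro bexI[of _ ?c] exI[of _ n]) (auto simp del: nat_pow_Suc)
    next
      fix t assume t: "t \<in> carrier (sect X ?D)" and z: "?q t = \<zero>\<^bsub>sect X ?E\<^esub>"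
      obtain c j where c: "c \<in> carrier (sect X U)" "t \<otimes>\<^bsub>sect X ?D\<^esub> (?r f [^]\<^bsub>sect X ?D\<^esub> (j::nat)) = ?r c"
        using num[OF t] by blast
      have "restr X U ?E c = \<zero>\<^bsub>sect X ?E\<^esub>" unfolding qr[OF c(1)] c(2)[symmetric] using t z rf by simp
      then obtain n :: nat where n: "?g [^]\<^bsub>sect X U\<^esub> n \<otimes>\<^bsub>sect X U\<^esub> c = \<zero>\<^bsub>sect X U\<^esub>"
        using lg c unfolding is_localization_def by blast
      let ?v = "(?r f [^]\<^bsub>sect X ?D\<^esub> (Suc k)) [^]\<^bsub>sect X ?D\<^esub> n \<otimes>\<^bsub>sect X ?D\<^esub> ?r f [^]\<^bsub>sect X ?D\<^esub> j"
      have v: "?v \<in> Units (sect X ?D)" using B.Units_m_closed[OF B.unit_pow[OF rfn] rfn] .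
      have "?r (?g [^]\<^bsub>sect X U\<^esub> n \<otimes>\<^bsub>sect X U\<^esub> c) = \<zero>\<^bsub>sect X ?D\<^esub>" unfolding n by simp
      then have "?r ?g [^]\<^bsub>sect X ?D\<^esub> n \<otimes>\<^bsub>sect X ?D\<^esub> ?r c = \<zero>\<^bsub>sect X ?D\<^esub>"
        using r.hom_mult[OF A.nat_pow_closed[OF g, of n] c(1)] r.hom_pow[OF g, of n] by (simp only:)
      then have "b [^]\<^bsub>sect X ?D\<^esub> n \<otimes>\<^bsub>sect X ?D\<^esub> t \<otimes>\<^bsub>sect X ?D\<^esub> ?v = \<zero>\<^bsub>sect X ?D\<^esub>"
        unfolding rg c(2)[symmetric] using b t rf
        by (simp add: B.nat_pow_distrib B.m_ac del: nat_pow_Suc)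
      then have "b [^]\<^bsub>sect X ?D\<^esub> n \<otimes>\<^bsub>sect X ?D\<^esub> t = \<zero>\<^bsub>sect X ?D\<^esub>"
        by (rule B.unit_cancel_zero[OF v, rotated]) (use b t in simp)
      then show "\<exists>n::nat. b [^]\<^bsub>sect X ?D\<^esub> n \<otimes>\<^bsub>sect X ?D\<^esub> t = \<zero>\<^bsub>sect X ?D\<^esub>" by blast
    qed
  qed
qed

end

end

locale kscheme =
  fixes K :: "complex set" and X :: "('p, 's) kspace"
  assumes ground: "K = \<real> \<or> K = UNIV" and is_scheme: "scheme K X"
begin

sublocale ksheaf K X
  using ground is_scheme by unfold_locales (auto simp: scheme_def)

lemma affine_cover: "x \<in> pts X \<Longrightarrow> \<exists>U. affine_open X U \<and> x \<in> U"
  using is_scheme by (auto simp: scheme_def)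

sublocale locally_ringed K X
proof
  fix U x s t assume U: "opn X U" "x \<in> U" "s \<in> carrier (sect X U)" "t \<in> carrier (sect X U)"
    "invertible_at X x U (s \<oplus>\<^bsub>sect X U\<^esub> t)"
  have "x \<in> pts X" using U openin_subset by blast
  with affine_cover obtain V where "affine_open X V" "x \<in> V" by blast
  then show "invertible_at X x U s \<or> invertible_at X x U t" using affine_local_add U by blast
next
  fix U x assume U: "opn X U"
  show "\<not> invertible_at X x U \<zero>\<^bsub>sect X U\<^esub>"
  proof
    assume i: "invertible_at X x U \<zero>\<^bsub>sect X U\<^esub>"
    then have x: "x \<in> U" by (rule invertible_in)
    then have "x \<in> pts X" using U openin_subset by blast
    with affine_cover obtain V where "affine_open X V" "x \<in> V" by blast
    then show False using affine_local_zero U x i by blast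
  qed
qed

lemma affine_nbhd:
  assumes "opn X N" "x \<in> N"
  obtains U where "affine_open X U" "x \<in> U" "U \<subseteq> N"
proof -
  have "x \<in> pts X" using assms openin_subset by blast
  with affine_cover obtain V where V: "affine_open X V" "x \<in> V" by blast
  with affine_basis[OF V(1) assms V(2)] obtain f where
    "f \<in> carrier (sect X V)" "x \<in> basic X V f" "basic X V f \<subseteq> N" by blast
  then show ?thesis using that affine_open_basic[OF V(1)] by blast
qed

end

section \<open>Morphisms\<close>

lemma pre_mono: "V \<subseteq> W \<Longrightarrow> pre X f V \<subseteq> pre X f W"
  by (auto simp: pre_def)

locale kmorphism = X: ksheaf K X + Y: ksheaf K Y
  for K and X :: "('p, 's) kspace" and Y :: "('q, 't) kspace" +
  fixes f :: "('p, 's, 'q, 't) kmor"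
  assumes mor: "morphism K X Y f"
begin

lemmas mor_props = mor[unfolded morphism_def]
lemmas mor_hom = mor_props[THEN conjunct2, THEN conjunct1, rule_format]
lemmas mor_restr = mor_props[THEN conjunct2, THEN conjunct2, THEN conjunct1, rule_format]
lemmas mor_local = mor_props[THEN conjunct2, THEN conjunct2, THEN conjunct2, rule_format]

lemma continuous: "continuous_map (ptop X) (ptop Y) (pmap f)"
  by (rule mor_props[THEN conjunct1])

lemma pmap_in [simp, intro]: "x \<in> pts X \<Longrightarrow> pmap f x \<in> pts Y"
  using continuous by (auto simp: continuous_map_def)

lemma pre_pts [simp]: "pre X f (pts Y) = pts X"
  by (auto simp: pre_def)

lemma openin_pre [simp, intro]: "opn Y V \<Longrightarrow> opn X (pre X f V)"
  using continuous by (simp add: continuous_map_def pre_def)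

lemma pull_hom: "opn Y V \<Longrightarrow> alg_hom K (sect Y V) (sect X (pre X f V)) (pull f V)"
  by (rule mor_hom)

lemma pull_khom: "opn Y V \<Longrightarrow> kalgebra_hom (sect Y V) (sect X (pre X f V)) K (pull f V)"
  by (intro kalgebra_hom.intro X.alg Y.alg kalgebra_hom_axioms.intro pull_hom openin_pre)

lemma pull_closed [simp, intro]: "opn Y V \<Longrightarrow> s \<in> carrier (sect Y V) \<Longrightarrow> pull f V s \<in> carrier (sect X (pre X f V))"
  by (rule alg_hom_closed[OF pull_hom])

lemma pull_restr:
  "opn Y V \<Longrightarrow> opn Y W \<Longrightarrow> W \<subseteq> V \<Longrightarrow> s \<in> carrier (sect Y V) \<Longrightarrow>
    pull f W (restr Y V W s) = restr X (pre X f V) (pre X f W) (pull f V s)"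
  by (rule mor_restr) auto

text \<open>The definition of a morphism only demands that invertibility is reflected, which is
  locality on stalks. That it is preserved follows because ring homomorphisms map units to
  units.\<close>

lemma pull_invertible:
  assumes V: "opn Y V" and s: "s \<in> carrier (sect Y V)" and x: "x \<in> pre X f V"
  shows "invertible_at X x (pre X f V) (pull f V s) \<longleftrightarrow> invertible_at Y (pmap f x) V s"
proof
  assume "invertible_at X x (pre X f V) (pull f V s)"
  with V s x show "invertible_at Y (pmap f x) V s" by (rule mor_local)
next
  assume "invertible_at Y (pmap f x) V s"
  then obtain W where W: "opn Y W" "pmap f x \<in> W" "W \<subseteq> V" "restr Y V W s \<in> Units (sect Y W)"
    unfolding invertible_at_def by blast
  interpret p: kalgebra_hom "sect Y W" "sect X (pre X f W)" K "pull f W" by (rule pull_khom[OF W(1)])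
  have xW: "x \<in> pre X f W" using x W by (auto simp: pre_def)
  have "pull f W (restr Y V W s) \<in> Units (sect X (pre X f W))" by (rule p.hom_Units[OF W(4)])
  then have "restr X (pre X f V) (pre X f W) (pull f V s) \<in> Units (sect X (pre X f W))"
    using pull_restr[OF V W(1,3) s] by simp
  then show "invertible_at X x (pre X f V) (pull f V s)"
    unfolding invertible_at_def
    by (intro exI[of _ "pre X f W"] conjI openin_pre[OF W(1)] xW pre_mono[OF W(3)])
qed

lemma pre_basic: "opn Y V \<Longrightarrow> s \<in> carrier (sect Y V) \<Longrightarrow> pre X f (basic Y V s) = basic X (pre X f V) (pull f V s)"
  using pull_invertible by (auto simp: basic_def pre_def)

end

lemma kmorphismI: "ksheaf K X \<Longrightarrow> ksheaf K Y \<Longrightarrow> morphism K X Y f \<Longrightarrow> kmorphism K X Y f"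
  by (simp add: kmorphism_def kmorphism_axioms_def)

lemma pre_mcomp:
  "kmorphism K X Y f \<Longrightarrow> pre X (mcomp Y g f) V = pre X f (pre Y g V)"
  using kmorphism.pmap_in by (fastforce simp: pre_def mcomp_def)

lemma pmap_mcomp [simp]: "pmap (mcomp Y g f) x = pmap g (pmap f x)"
  by (simp add: mcomp_def)

lemma pull_mcomp [simp]: "pull (mcomp Y g f) V s = pull f (pre Y g V) (pull g V s)"
  by (simp add: mcomp_def)

lemma morphism_mcomp:
  assumes "kmorphism K X Y f" "kmorphism K Y Z g"
  shows "kmorphism K X Z (mcomp Y g f)"
proof -
  interpret f: kmorphism K X Y f by fact
  interpret g: kmorphism K Y Z g by fact
  note pre = pre_mcomp[OF assms(1), of g]
  have "morphism K X Z (mcomp Y g f)" unfolding morphism_def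
  proof (intro conjI allI impI ballI)
    show "continuous_map (ptop X) (ptop Z) (pmap (mcomp Y g f))"
      using continuous_map_compose[OF f.continuous g.continuous] by (simp add: mcomp_def)
    fix V assume V: "opn Z V"
    show "alg_hom K (sect Z V) (sect X (pre X (mcomp Y g f) V)) (pull (mcomp Y g f) V)"
      using alg_hom_compose[OF g.pull_hom[OF V] f.pull_hom[OF g.openin_pre[OF V]]] unfolding pre by (simp add: mcomp_def)
    fix s x assume s: "s \<in> carrier (sect Z V)" "x \<in> pre X (mcomp Y g f) V"
      "invertible_at X x (pre X (mcomp Y g f) V) (pull (mcomp Y g f) V s)"
    then have "x \<in> pre X f (pre Y g V)" "pmap f x \<in> pre Y g V" unfolding pre by (auto simp: pre_def)
    then show "invertible_at Z (pmap (mcomp Y g f) x) V s"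
      using s V unfolding pre by (simp add: f.pull_invertible g.pull_invertible)
  next
    fix V W s assume "opn Z V \<and> opn Z W \<and> W \<subseteq> V" "s \<in> carrier (sect Z V)"
    then show "pull (mcomp Y g f) W (restr Z V W s) =
       restr X (pre X (mcomp Y g f) V) (pre X (mcomp Y g f) W) (pull (mcomp Y g f) V s)"
      unfolding pre by (simp add: g.pull_restr f.pull_restr pre_mono)
  qed
  then show ?thesis by (intro kmorphismI f.X.ksheaf_axioms g.Y.ksheaf_axioms)
qed

lemma pre_mid: "opn X U \<Longrightarrow> pre X mid U = U"
  using openin_subset[of "ptop X" U] by (auto simp: pre_def mid_def)

lemma pmap_mid [simp]: "pmap mid x = x" and pull_mid [simp]: "pull mid V s = s"
  by (simp_all add: mid_def)

lemma morphism_mid: "ksheaf K X \<Longrightarrow> kmorphism K X X mid"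
proof -
  assume "ksheaf K X"
  then interpret ksheaf K X .
  have "morphism K X X mid" unfolding morphism_def
    by (auto simp: pre_mid alg_hom_def ring_hom_def continuous_map_eq[OF continuous_map_id])
  then show ?thesis by (intro kmorphismI ksheaf_axioms)
qed

lemma mor_eq_refl: "mor_eq X Y f f"
  by (simp add: mor_eq_def)

lemma mor_eq_sym: "mor_eq X Y f g \<Longrightarrow> mor_eq X Y g f"
  by (simp add: mor_eq_def)

lemma mor_eq_trans: "mor_eq X Y f g \<Longrightarrow> mor_eq X Y g h \<Longrightarrow> mor_eq X Y f h"
  by (simp add: mor_eq_def)

lemma mor_eq_pmap: "mor_eq X Y f g \<Longrightarrow> x \<in> pts X \<Longrightarrow> pmap f x = pmap g x"
  by (simp add: mor_eq_def)

lemma mor_eq_pull: "mor_eq X Y f g \<Longrightarrow> opn Y V \<Longrightarrow> s \<in> carrier (sect Y V) \<Longrightarrow> pull f V s = pull g V s"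
  by (simp add: mor_eq_def)

lemma mor_eq_pre: "mor_eq X Y f g \<Longrightarrow> pre X f V = pre X g V"
  by (auto simp: mor_eq_def pre_def)

lemma mor_eq_mcomp_left:
  assumes "mor_eq Y Z g g'" "kmorphism K X Y f"
  shows "mor_eq X Z (mcomp Y g f) (mcomp Y g' f)"
proof -
  interpret f: kmorphism K X Y f by fact
  show ?thesis unfolding mor_eq_def
    using mor_eq_pmap[OF assms(1)] mor_eq_pull[OF assms(1)] mor_eq_pre[OF assms(1)] by simp
qed

lemma mor_eq_mcomp_right:
  assumes "mor_eq X Y f f'" "kmorphism K Y Z g"
  shows "mor_eq X Z (mcomp Y g f) (mcomp Y g f')"
proof -
  interpret g: kmorphism K Y Z g by fact
  show ?thesis unfolding mor_eq_def
    using mor_eq_pmap[OF assms(1)] mor_eq_pull[OF assms(1)] by simp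
qed

lemma mcomp_assoc: "kmorphism K X Y f \<Longrightarrow> mcomp Z h (mcomp Y g f) = mcomp Y (mcomp Z h g) f"
  if "kmorphism K Y Z g" for f g h
  using that pre_mcomp[of K Y Z g h] by (simp add: mcomp_def comp_assoc)

lemma mcomp_mid_left: "kmorphism K X Y f \<Longrightarrow> mor_eq X Y (mcomp Y mid f) f"
  by (auto simp: mor_eq_def pre_mid)

lemma mcomp_mid_right: "kmorphism K X Y f \<Longrightarrow> mor_eq X Y (mcomp X f mid) f"
  by (auto simp: mor_eq_def)

subsection \<open>Gluing morphisms\<close>

text \<open>A triple (B, S, \<psi>) describes the pull-back of sections over B only, on the part S
  of the source. By \<open>cov\<close> the triples resolve arbitrarily small neighbourhoods N of the
  image point, which is enough to reach sections over all open V, by gluing the pieces with B inside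
  V.\<close>

lemma glue_morphism:
  fixes hp :: "'p \<Rightarrow> 'q" and \<I> :: "('q set \<times> 'p set \<times> ('t \<Rightarrow> 's)) set"
  assumes T: "ksheaf K T" and P: "ksheaf K P"
    and I: "\<And>B S \<psi>. (B, S, \<psi>) \<in> \<I> \<Longrightarrow> opn P B \<and> opn T S \<and> hp ` S \<subseteq> B \<and> alg_hom K (sect P B) (sect T S) \<psi>"
    and loc: "\<And>B S \<psi> s t. (B, S, \<psi>) \<in> \<I> \<Longrightarrow> s \<in> carrier (sect P B) \<Longrightarrow> t \<in> S \<Longrightarrow>
      invertible_at T t S (\<psi> s) \<Longrightarrow> invertible_at P (hp t) B s"
    and cov: "\<And>t N. t \<in> pts T \<Longrightarrow> opn P N \<Longrightarrow> hp t \<in> N \<Longrightarrow> \<exists>(B, S, \<psi>)\<in>\<I>. t \<in> S \<and> B \<subseteq> N"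
    and hp: "\<And>t. t \<in> pts T \<Longrightarrow> hp t \<in> pts P"
    and compat: "\<And>B S \<psi> B' S' \<psi>' t V s. (B, S, \<psi>) \<in> \<I> \<Longrightarrow> (B', S', \<psi>') \<in> \<I> \<Longrightarrow> t \<in> S \<Longrightarrow> t \<in> S' \<Longrightarrow>
      opn P V \<Longrightarrow> B \<subseteq> V \<Longrightarrow> B' \<subseteq> V \<Longrightarrow> s \<in> carrier (sect P V) \<Longrightarrow>
      \<exists>N. opn T N \<and> t \<in> N \<and> N \<subseteq> S \<and> N \<subseteq> S' \<and> restr T S N (\<psi> (restr P V B s)) = restr T S' N (\<psi>' (restr P V B' s))"
  obtains h :: "('p, 's, 'q, 't) kmor" where "kmorphism K T P h" "pmap h = hp"
    "\<And>B S \<psi> V s. (B, S, \<psi>) \<in> \<I> \<Longrightarrow> opn P V \<Longrightarrow> B \<subseteq> V \<Longrightarrow> s \<in> carrier (sect P V) \<Longrightarrow>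
      restr T (pre T h V) S (pull h V s) = \<psi> (restr P V B s)"
proof -
  interpret T: ksheaf K T by fact
  interpret P: ksheaf K P by fact
  define pV where "pV V = {t \<in> pts T. hp t \<in> V}" for V
  have SpV: "S \<subseteq> pV V" if "(B, S, \<psi>) \<in> \<I>" "B \<subseteq> V" for B S \<psi> V
    using I[OF that(1)] that(2) openin_subset[of "ptop T" S] by (auto simp: pV_def)
  \<comment> \<open>Continuity is not assumed: the preimage of V is the union of the sets S that
    belong to some B inside V.\<close>
  have opV: "opn T (pV V)" if "opn P V" for V
  proof -
    have "pV V = \<Union>{S. \<exists>B \<psi>. (B, S, \<psi>) \<in> \<I> \<and> B \<subseteq> V}"
    proof
      show "\<Union>{S. \<exists>B \<psi>. (B, S, \<psi>) \<in> \<I> \<and> B \<subseteq> V} \<subseteq> pV V" using SpV by blast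
      show "pV V \<subseteq> \<Union>{S. \<exists>B \<psi>. (B, S, \<psi>) \<in> \<I> \<and> B \<subseteq> V}"
        using cov[OF _ that] by (fastforce simp: pV_def)
    qed
    moreover have "opn T (\<Union>{S. \<exists>B \<psi>. (B, S, \<psi>) \<in> \<I> \<and> B \<subseteq> V})" by (rule openin_Union) (use I in blast)
    ultimately show ?thesis by (simp only:)
  qed
  define F where "F V s = {(S, \<psi> (restr P V B s)) | B S \<psi>. (B, S, \<psi>) \<in> \<I> \<and> B \<subseteq> V}" for V s
  have ex: "\<exists>!\<tau>. \<tau> \<in> carrier (sect T (pV V)) \<and> (\<forall>(S, \<sigma>)\<in>F V s. restr T (pV V) S \<tau> = \<sigma>)"
    if V: "opn P V" and s: "s \<in> carrier (sect P V)" for V s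
  proof (rule T.glue)
    fix S \<sigma> assume "(S, \<sigma>) \<in> F V s"
    then obtain B \<psi> where B: "(B, S, \<psi>) \<in> \<I>" "B \<subseteq> V" "\<sigma> = \<psi> (restr P V B s)" unfolding F_def by blast
    then show "opn T S \<and> S \<subseteq> pV V \<and> \<sigma> \<in> carrier (sect T S)"
      using I[OF B(1)] SpV[OF B(1,2)] V s alg_hom_closed P.restr_closed[OF V _ B(2) s] by metis
  next
    fix t assume "t \<in> pV V"
    then show "\<exists>(S, \<sigma>)\<in>F V s. t \<in> S" using cov[OF _ V, of t] unfolding F_def pV_def by fastforce
  next
    fix S \<sigma> S' \<sigma>' t assume "(S, \<sigma>) \<in> F V s" "(S', \<sigma>') \<in> F V s" and t: "t \<in> S" "t \<in> S'"
    then obtain B \<psi> B' \<psi>' where B: "(B, S, \<psi>) \<in> \<I>" "B \<subseteq> V" "\<sigma> = \<psi> (restr P V B s)"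
      and B': "(B', S', \<psi>') \<in> \<I>" "B' \<subseteq> V" "\<sigma>' = \<psi>' (restr P V B' s)" unfolding F_def by blast
    show "\<exists>N. opn T N \<and> t \<in> N \<and> N \<subseteq> S \<and> N \<subseteq> S' \<and> restr T S N \<sigma> = restr T S' N \<sigma>'"
      unfolding B(3) B'(3) by (rule compat[OF B(1) B'(1) t V B(2) B'(2) s])
  qed
  define pl where "pl V s = (THE \<tau>. \<tau> \<in> carrier (sect T (pV V)) \<and> (\<forall>(S, \<sigma>)\<in>F V s. restr T (pV V) S \<tau> = \<sigma>))" for V s
  have pl: "pl V s \<in> carrier (sect T (pV V)) \<and> (\<forall>(S, \<sigma>)\<in>F V s. restr T (pV V) S (pl V s) = \<sigma>)"
    if "opn P V" "s \<in> carrier (sect P V)" for V s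
    unfolding pl_def by (rule theI') (rule ex[OF that])
  have plr: "restr T (pV V) S (pl V s) = \<psi> (restr P V B s)"
    if "opn P V" "s \<in> carrier (sect P V)" "(B, S, \<psi>) \<in> \<I>" "B \<subseteq> V" for V s B S \<psi>
  proof -
    have "(S, \<psi> (restr P V B s)) \<in> F V s" unfolding F_def using that(3,4) by blast
    then show ?thesis using bspec[OF conjunct2[OF pl[OF that(1,2)]]] by fastforce
  qed
  have eqI: "\<sigma> = \<tau>" if V: "opn P V" and st: "\<sigma> \<in> carrier (sect T (pV V))" "\<tau> \<in> carrier (sect T (pV V))"
    and e: "\<And>B S \<psi>. (B, S, \<psi>) \<in> \<I> \<Longrightarrow> B \<subseteq> V \<Longrightarrow> restr T (pV V) S \<sigma> = restr T (pV V) S \<tau>" for V \<sigma> \<tau>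
  proof (rule T.section_eqI[OF opV[OF V] st])
    fix t assume "t \<in> pV V"
    then obtain B S \<psi> where B: "(B, S, \<psi>) \<in> \<I>" "t \<in> S" "B \<subseteq> V" using cov[OF _ V, of t] unfolding pV_def by fastforce
    then show "\<exists>N. opn T N \<and> t \<in> N \<and> N \<subseteq> pV V \<and> restr T (pV V) N \<sigma> = restr T (pV V) N \<tau>"
      using I[OF B(1)] SpV[OF B(1,3)] e[OF B(1,3)] by blast
  qed
  define h where "h = \<lparr>pmap = hp, pull = pl\<rparr>"
  have h: "pmap h = hp" "pull h = pl" by (simp_all add: h_def)
  have pre: "pre T h V = pV V" for V by (simp add: pre_def pV_def h)
  have "morphism K T P h" unfolding morphism_def
  proof (intro conjI allI impI ballI)
    show "continuous_map (ptop T) (ptop P) (pmap h)"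
      unfolding continuous_map_def h using opV hp by (auto simp: pV_def)
    fix V assume V: "opn P V"
    interpret A: kalgebra "sect P V" K using P.alg V by simp
    interpret C: kalgebra "sect T (pV V)" K using T.alg opV[OF V] by simp
    show "alg_hom K (sect P V) (sect T (pre T h V)) (pull h V)"
      unfolding pre h
    proof (rule alg_homI)
      fix s assume s: "s \<in> carrier (sect P V)"
      show "pl V s \<in> carrier (sect T (pV V))" using pl[OF V s] by blast
      fix s' assume s': "s' \<in> carrier (sect P V)"
      show "pl V (s \<otimes>\<^bsub>sect P V\<^esub> s') = pl V s \<otimes>\<^bsub>sect T (pV V)\<^esub> pl V s'"
      proof (rule eqI[OF V])
        fix B S \<psi> assume B: "(B, S, \<psi>) \<in> \<I>" "B \<subseteq> V"
        note b = I[OF B(1)]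
        interpret k: kalgebra_hom "sect P B" "sect T S" K \<psi>
          using b P.alg T.alg by (simp add: kalgebra_hom_def kalgebra_hom_axioms_def)
        show "restr T (pV V) S (pl V (s \<otimes>\<^bsub>sect P V\<^esub> s')) = restr T (pV V) S (pl V s \<otimes>\<^bsub>sect T (pV V)\<^esub> pl V s')"
          using b B V s s' pl[OF V s] pl[OF V s'] opV[OF V] SpV[OF B]
          by (simp add: plr[OF V _ B] T.restr_mult P.restr_mult)
      qed (use pl V s s' in auto)
      show "pl V (s \<oplus>\<^bsub>sect P V\<^esub> s') = pl V s \<oplus>\<^bsub>sect T (pV V)\<^esub> pl V s'"
      proof (rule eqI[OF V])
        fix B S \<psi> assume B: "(B, S, \<psi>) \<in> \<I>" "B \<subseteq> V"
        note b = I[OF B(1)]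
        interpret k: kalgebra_hom "sect P B" "sect T S" K \<psi>
          using b P.alg T.alg by (simp add: kalgebra_hom_def kalgebra_hom_axioms_def)
        show "restr T (pV V) S (pl V (s \<oplus>\<^bsub>sect P V\<^esub> s')) = restr T (pV V) S (pl V s \<oplus>\<^bsub>sect T (pV V)\<^esub> pl V s')"
          using b B V s s' pl[OF V s] pl[OF V s'] opV[OF V] SpV[OF B]
          by (simp add: plr[OF V _ B] T.restr_add P.restr_add)
      qed (use pl V s s' in auto)
    next
      show "pl V \<one>\<^bsub>sect P V\<^esub> = \<one>\<^bsub>sect T (pV V)\<^esub>"
      proof (rule eqI[OF V])
        fix B S \<psi> assume B: "(B, S, \<psi>) \<in> \<I>" "B \<subseteq> V"
        note b = I[OF B(1)]
        interpret k: kalgebra_hom "sect P B" "sect T S" K \<psi>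
          using b P.alg T.alg by (simp add: kalgebra_hom_def kalgebra_hom_axioms_def)
        show "restr T (pV V) S (pl V \<one>\<^bsub>sect P V\<^esub>) = restr T (pV V) S \<one>\<^bsub>sect T (pV V)\<^esub>"
          using b B V opV[OF V] SpV[OF B]
          by (simp add: plr[OF V _ B] T.restr_one P.restr_one)
      qed (use pl V in auto)
    next
      fix k s assume k: "k \<in> K" and s: "s \<in> carrier (sect P V)"
      show "pl V (k \<odot>\<^bsub>sect P V\<^esub> s) = k \<odot>\<^bsub>sect T (pV V)\<^esub> pl V s"
      proof (rule eqI[OF V])
        fix B S \<psi> assume B: "(B, S, \<psi>) \<in> \<I>" "B \<subseteq> V"
        note b = I[OF B(1)]
        interpret k: kalgebra_hom "sect P B" "sect T S" K \<psi>
          using b P.alg T.alg by (simp add: kalgebra_hom_def kalgebra_hom_axioms_def)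
        show "restr T (pV V) S (pl V (k \<odot>\<^bsub>sect P V\<^esub> s)) = restr T (pV V) S (k \<odot>\<^bsub>sect T (pV V)\<^esub> pl V s)"
          using b B V s k pl[OF V s] opV[OF V] SpV[OF B]
          by (simp add: plr[OF V _ B] T.restr_smult P.restr_smult)
      qed (use pl V s k in auto)
    qed
  next
    fix V W s assume VW: "opn P V \<and> opn P W \<and> W \<subseteq> V" and s: "s \<in> carrier (sect P V)"
    then have V: "opn P V" and W: "opn P W" and WV: "W \<subseteq> V" by auto
    have sub: "pV W \<subseteq> pV V" using WV by (auto simp: pV_def)
    have sW: "restr P V W s \<in> carrier (sect P W)" using V W WV s by simp
    show "pull h W (restr P V W s) = restr T (pre T h V) (pre T h W) (pull h V s)"
      unfolding pre h
    proof (rule eqI[OF W])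
      fix B S \<psi> assume B: "(B, S, \<psi>) \<in> \<I>" "B \<subseteq> W"
      note b = I[OF B(1)]
      have BV: "B \<subseteq> V" using B WV by blast
      show "restr T (pV W) S (pl W (restr P V W s)) = restr T (pV W) S (restr T (pV V) (pV W) (pl V s))"
        using b B V W s sW pl[OF V s] opV[OF V] opV[OF W] SpV[OF B] sub BV WV
        by (simp add: plr[OF W sW B] plr[OF V s B(1) BV])
    qed (use pl[OF W sW] pl[OF V s] opV V W sub in auto)
  next
    fix V s t assume V: "opn P V" and s: "s \<in> carrier (sect P V)" and t: "t \<in> pre T h V"
      and i: "invertible_at T t (pre T h V) (pull h V s)"
    have "t \<in> pts T" "hp t \<in> V" using t by (auto simp: pre_def h)
    with cov V obtain B S \<psi> where B: "(B, S, \<psi>) \<in> \<I>" "t \<in> S" "B \<subseteq> V" by fastforce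
    note b = I[OF B(1)]
    have "invertible_at T t S (\<psi> (restr P V B s))"
      unfolding plr[OF V s B(1,3), symmetric]
      using T.invertible_restr[OF opV[OF V] _ SpV[OF B(1,3)] B(2)] b i pl[OF V s] unfolding pre h by blast
    then have "invertible_at P (hp t) B (restr P V B s)"
      by (rule loc[OF B(1) _ B(2), rotated]) (use b B V s in auto)
    then show "invertible_at P (pmap h t) V s"
      using P.invertible_restr[OF V _ B(3) _ s, of "hp t"] b B(2) unfolding h by blast
  qed
  then have "kmorphism K T P h" by (intro kmorphismI T P)
  then show ?thesis
    by (rule that[OF _ h(1)]) (simp add: pre h plr)
qed

subsection \<open>Morphisms into a scheme\<close>

lemma (in kmorphism) restr_pull:
  assumes "opn Y V" "opn Y B" "B \<subseteq> V" "opn X N" "N \<subseteq> pre X f B" "s \<in> carrier (sect Y V)"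
  shows "restr X (pre X f V) N (pull f V s) = restr X (pre X f B) N (pull f B (restr Y V B s))"
proof -
  have "restr X (pre X f B) N (pull f B (restr Y V B s)) =
      restr X (pre X f B) N (restr X (pre X f V) (pre X f B) (pull f V s))"
    using assms by (simp add: pull_restr)
  also have "\<dots> = restr X (pre X f V) N (pull f V s)"
    using assms pre_mono[OF assms(3), of X f] by (intro X.restr_restr) auto
  finally show ?thesis by simp
qed

text \<open>A chart (W, S, \<phi>) stands for a morphism from S to the affine scheme W, given by its
  ring homomorphism. The relation expresses that the first chart is a restriction of the
  second.\<close>

definition chart_le :: "('q, 't) kspace \<Rightarrow> ('p, 's) kspace \<Rightarrow>
    'q set \<times> 'p set \<times> ('t \<Rightarrow> 's) \<Rightarrow> 'q set \<times> 'p set \<times> ('t \<Rightarrow> 's) \<Rightarrow> bool" where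
  "chart_le P T = (\<lambda>(W', S', \<phi>') (W, S, \<phi>). W' \<subseteq> W \<and> S' \<subseteq> S \<and>
     (\<forall>s\<in>carrier (sect P W). \<phi>' (restr P W W' s) = restr T S S' (\<phi> s)))"

text \<open>For a locally ringed source, a homomorphism from the coordinate ring of an affine W to
  the sections over S is a morphism S to W: the point t goes to the prime of functions that become
  nonunits at t. Charts agreeing with common refinements glue. As the sets W need not form a basis,
  the charts are first extended to basic open subsets of W by the universal property of
  localizations.\<close>

lemma charts_morphism:
  fixes \<I> :: "('q set \<times> 'p set \<times> ('t \<Rightarrow> 's)) set"
  assumes T: "locally_ringed K T" and P: "ksheaf K P"
    and I: "\<And>W S \<phi>. (W, S, \<phi>) \<in> \<I> \<Longrightarrow>
      affine_open P W \<and> opn T S \<and> alg_hom K (sect P W) (sect T S) \<phi>"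
    and cov: "\<And>t. t \<in> pts T \<Longrightarrow> \<exists>(W, S, \<phi>)\<in>\<I>. t \<in> S"
    and compat: "\<And>W S \<phi> W' S' \<phi>' t. (W, S, \<phi>) \<in> \<I> \<Longrightarrow> (W', S', \<phi>') \<in> \<I> \<Longrightarrow> t \<in> S \<Longrightarrow> t \<in> S' \<Longrightarrow>
      \<exists>W'' S'' \<phi>''. (W'', S'', \<phi>'') \<in> \<I> \<and> t \<in> S'' \<and>
        chart_le P T (W'', S'', \<phi>'') (W, S, \<phi>) \<and> chart_le P T (W'', S'', \<phi>'') (W', S', \<phi>')"
  obtains h :: "('p, 's, 'q, 't) kmor" where "kmorphism K T P h"
    "\<And>W S \<phi>. (W, S, \<phi>) \<in> \<I> \<Longrightarrow> S \<subseteq> pre T h W"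
    "\<And>W S \<phi> s. (W, S, \<phi>) \<in> \<I> \<Longrightarrow> s \<in> carrier (sect P W) \<Longrightarrow> restr T (pre T h W) S (pull h W s) = \<phi> s"
proof -
  interpret T: locally_ringed K T by fact
  interpret P: ksheaf K P by fact
  have IW: "affine_open P W" "opn P W" and IS: "opn T S" and Ih: "alg_hom K (sect P W) (sect T S) \<phi>"
    if "(W, S, \<phi>) \<in> \<I>" for W S \<phi>
    using I[OF that] P.affine_opn by auto
  \<comment> \<open>The chart (W, S, \<phi>) sends t to p.\<close>
  define Q where "Q t W S \<phi> p \<longleftrightarrow> p \<in> W \<and>
    pt_ideal P W p = {s \<in> carrier (sect P W). \<not> invertible_at T t S (\<phi> s)}" for t W S and \<phi> :: "'t \<Rightarrow> 's" and p
  have Qex: "\<exists>p. Q t W S \<phi> p" if i: "(W, S, \<phi>) \<in> \<I>" and t: "t \<in> S" for t W S \<phi>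
    using P.affine_surj[OF IW(1)[OF i] T.nonunits_prime[OF IS[OF i] t Ih[OF i] P.alg[OF IW(2)[OF i]]]]
    unfolding Q_def by blast
  have Quniq: "p = p'" if i: "(W, S, \<phi>) \<in> \<I>" and "Q t W S \<phi> p" "Q t W S \<phi> p'" for t W S \<phi> p p'
    using P.affine_inj[OF IW(1)[OF i], of p p'] that(2,3) unfolding Q_def by simp
  have Qsub: "Q t W S \<phi> p" if i: "(W, S, \<phi>) \<in> \<I>" and k: "(W', S', \<phi>') \<in> \<I>" and t: "t \<in> S'" "S' \<subseteq> S" "W' \<subseteq> W"
    and e: "\<forall>s\<in>carrier (sect P W). \<phi>' (restr P W W' s) = restr T S S' (\<phi> s)" and q: "Q t W' S' \<phi>' p"
    for t W S \<phi> W' S' \<phi>' p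
  proof -
    have pW: "p \<in> W'" using q by (simp add: Q_def)
    have "invertible_at P p W s \<longleftrightarrow> invertible_at T t S (\<phi> s)" if s: "s \<in> carrier (sect P W)" for s
    proof -
      have sc: "restr P W W' s \<in> carrier (sect P W')" using IW(2)[OF i] IW(2)[OF k] t s by simp
      have "invertible_at P p W s \<longleftrightarrow> invertible_at P p W' (restr P W W' s)"
        by (rule P.invertible_restr[OF IW(2)[OF i] IW(2)[OF k] t(3) pW s, symmetric])
      also have "\<dots> \<longleftrightarrow> invertible_at T t S' (\<phi>' (restr P W W' s))"
        using q sc unfolding Q_def pt_ideal_def by blast
      also have "\<dots> \<longleftrightarrow> invertible_at T t S (\<phi> s)" unfolding bspec[OF e s]
        by (rule T.invertible_restr[OF IS[OF i] IS[OF k] t(2,1) alg_hom_closed[OF Ih[OF i] s]])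
      finally show ?thesis .
    qed
    then show ?thesis using pW t unfolding Q_def pt_ideal_def by blast
  qed
  \<comment> \<open>Two charts at t send t to the same point, namely to the one given by a common
    refinement, because a point of an affine open set is determined by its prime ideal.\<close>
  have ex: "\<exists>p. \<forall>W S \<phi>. (W, S, \<phi>) \<in> \<I> \<longrightarrow> t \<in> S \<longrightarrow> Q t W S \<phi> p" if tT: "t \<in> pts T" for t
  proof -
    from cov[OF tT] obtain W S \<phi> where i: "(W, S, \<phi>) \<in> \<I>" and t: "t \<in> S" by blast
    from Qex[OF i t] obtain p where p: "Q t W S \<phi> p" by blast
    have "Q t W' S' \<phi>' p" if j: "(W', S', \<phi>') \<in> \<I>" and t': "t \<in> S'" for W' S' \<phi>'
    proof -
      from compat[OF i j t t'] obtain W'' S'' \<phi>'' where k12: "(W'', S'', \<phi>'') \<in> \<I>" "t \<in> S''"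
        and le: "chart_le P T (W'', S'', \<phi>'') (W, S, \<phi>)" "chart_le P T (W'', S'', \<phi>'') (W', S', \<phi>')" by blast
      note k = k12 le[unfolded chart_le_def split_conv, THEN conjunct2, THEN conjunct1]
        le[unfolded chart_le_def split_conv, THEN conjunct1]
      note e = le[unfolded chart_le_def split_conv, THEN conjunct2, THEN conjunct2]
      from Qex[OF k(1,2)] obtain p'' where p'': "Q t W'' S'' \<phi>'' p''" by blast
      have "p'' = p" by (rule Quniq[OF i Qsub[OF i k(1,2,3,5) e(1) p''] p])
      then show ?thesis using Qsub[OF j k(1,2,4,6) e(2) p''] by simp
    qed
    then show ?thesis by blast
  qed
  define hp where "hp t = (SOME p. \<forall>W S \<phi>. (W, S, \<phi>) \<in> \<I> \<longrightarrow> t \<in> S \<longrightarrow> Q t W S \<phi> p)" for t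
  have SpT: "t \<in> pts T" if "(W, S, \<phi>) \<in> \<I>" "t \<in> S" for W S \<phi> t
    using openin_subset[OF IS[OF that(1)]] that(2) by blast
  have hpQ: "Q t W S \<phi> (hp t)" if "(W, S, \<phi>) \<in> \<I>" "t \<in> S" for t W S \<phi>
    using someI_ex[OF ex[OF SpT[OF that]]] that unfolding hp_def by blast
  have hpW: "hp t \<in> W" if "(W, S, \<phi>) \<in> \<I>" "t \<in> S" for t W S \<phi>
    using hpQ[OF that] by (simp add: Q_def)
  have hpinv: "invertible_at P (hp t) W s \<longleftrightarrow> invertible_at T t S (\<phi> s)"
    if "(W, S, \<phi>) \<in> \<I>" "t \<in> S" "s \<in> carrier (sect P W)" for t W S \<phi> s
    using hpQ[OF that(1,2)] that(3) unfolding Q_def pt_ideal_def by blast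
  \<comment> \<open>The refined family: a chart is restricted to the part S' on which \<phi> f is a
    unit, where it extends to the sections over D(f).\<close>
  define \<J> where "\<J> = {(B, S', \<psi>) | B S' \<psi>. \<exists>W S \<phi> f. (W, S, \<phi>) \<in> \<I> \<and> f \<in> carrier (sect P W) \<and>
     B = basic P W f \<and> opn T S' \<and> S' \<subseteq> S \<and> restr T S S' (\<phi> f) \<in> Units (sect T S') \<and>
     alg_hom K (sect P B) (sect T S') \<psi> \<and>
     (\<forall>r\<in>carrier (sect P W). \<psi> (restr P W B r) = restr T S S' (\<phi> r))}"
  have J: "\<exists>W S \<phi> f. (W, S, \<phi>) \<in> \<I> \<and> f \<in> carrier (sect P W) \<and>
     B = basic P W f \<and> opn T S' \<and> S' \<subseteq> S \<and> restr T S S' (\<phi> f) \<in> Units (sect T S') \<and>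
     alg_hom K (sect P B) (sect T S') \<psi> \<and>
     (\<forall>r\<in>carrier (sect P W). \<psi> (restr P W B r) = restr T S S' (\<phi> r))" if "(B, S', \<psi>) \<in> \<J>" for B S' \<psi>
    using that unfolding \<J>_def by blast
  have Jex: "\<exists>S' \<psi>. (basic P W f, S', \<psi>) \<in> \<J> \<and> t \<in> S' \<and> S' \<subseteq> S \<and> opn T S' \<and>
      restr T S S' (\<phi> f) \<in> Units (sect T S') \<and> alg_hom K (sect P (basic P W f)) (sect T S') \<psi> \<and>
      (\<forall>r\<in>carrier (sect P W). \<psi> (restr P W (basic P W f) r) = restr T S S' (\<phi> r))"
    if i: "(W, S, \<phi>) \<in> \<I>" and t: "t \<in> S" and f: "f \<in> carrier (sect P W)" and inv: "invertible_at P (hp t) W f"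
    for W S \<phi> t f
  proof -
    have "invertible_at T t S (\<phi> f)" using hpinv[OF i t f] inv by simp
    then obtain S' where S': "opn T S'" "t \<in> S'" "S' \<subseteq> S" "restr T S S' (\<phi> f) \<in> Units (sect T S')"
      unfolding invertible_at_def by blast
    let ?B = "basic P W f"
    have B: "opn P ?B" by (rule P.openin_basic[OF IW(2)[OF i] f])
    have h1: "alg_hom K (sect P W) (sect T S') (\<lambda>r. restr T S S' (\<phi> r))"
      by (rule alg_hom_compose[OF Ih[OF i] T.restr_alg_hom[OF IS[OF i] S'(1,3)]])
    obtain \<psi> where "alg_hom K (sect P ?B) (sect T S') \<psi>"
        "\<And>r. r \<in> carrier (sect P W) \<Longrightarrow> \<psi> (restr P W ?B r) = restr T S S' (\<phi> r)"
      using localization_lift[OF P.alg[OF IW(2)[OF i]] P.alg[OF B] T.alg[OF S'(1)]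
        P.affine_localization[OF IW(1)[OF i] f] P.restr_alg_hom[OF IW(2)[OF i] B basic_subset] f h1 S'(4)] by blast
    then have "(?B, S', \<psi>) \<in> \<J> \<and> t \<in> S' \<and> S' \<subseteq> S \<and> opn T S' \<and>
      restr T S S' (\<phi> f) \<in> Units (sect T S') \<and> alg_hom K (sect P ?B) (sect T S') \<psi> \<and>
      (\<forall>r\<in>carrier (sect P W). \<psi> (restr P W ?B r) = restr T S S' (\<phi> r))"
      using i f S' unfolding \<J>_def mem_Collect_eq
      by (intro conjI exI[of _ ?B] exI[of _ S'] exI[of _ \<psi>] exI[of _ W] exI[of _ S] exI[of _ \<phi>] exI[of _ f] refl) simp_all
    then show ?thesis by (intro exI)
  qed
  \<comment> \<open>The two homomorphisms agree on functions coming from W1. A section over B1 =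
    D(f1) is a fraction with a power of f1 as denominator, and f1 becomes a unit on N, so they agree
    on it as well.\<close>
  have frac: "restr T S1 N (\<psi>1 s) = \<psi>3' (restr P B1 B3 s)"
    if j1: "(W1, Z1, \<phi>1) \<in> \<I>" "f1 \<in> carrier (sect P W1)" "B1 = basic P W1 f1" "opn T S1" "S1 \<subseteq> Z1"
      "restr T Z1 S1 (\<phi>1 f1) \<in> Units (sect T S1)" "alg_hom K (sect P B1) (sect T S1) \<psi>1"
      "\<forall>r\<in>carrier (sect P W1). \<psi>1 (restr P W1 B1 r) = restr T Z1 S1 (\<phi>1 r)"
    and N: "opn T N" "N \<subseteq> S1" and B3: "opn P B3" "B3 \<subseteq> B1"
    and h3: "alg_hom K (sect P B3) (sect T N) \<psi>3'"
      "\<forall>r\<in>carrier (sect P W1). \<psi>3' (restr P W1 B3 r) = restr T Z1 N (\<phi>1 r)"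
    and s: "s \<in> carrier (sect P B1)" for W1 Z1 \<phi>1 f1 B1 S1 \<psi>1 N B3 \<psi>3' s
  proof -
    have oW: "opn P W1" "opn P B1" "B1 \<subseteq> W1" unfolding j1(3)
      by (rule IW(2)[OF j1(1)], rule P.openin_basic[OF IW(2)[OF j1(1)] j1(2)], rule basic_subset)
    interpret C: kalgebra "sect T N" K by (rule T.alg[OF N(1)])
    interpret h1: kalgebra_hom "sect P B1" "sect T S1" K \<psi>1
      using j1 oW P.alg T.alg by (simp add: kalgebra_hom_def kalgebra_hom_axioms_def)
    interpret h3: kalgebra_hom "sect P B3" "sect T N" K \<psi>3'
      using h3 B3 N P.alg T.alg by (simp add: kalgebra_hom_def kalgebra_hom_axioms_def)
    interpret p: kalgebra_hom "sect P B1" "sect P B3" K "restr P B1 B3" by (rule P.restr_hom[OF oW(2) B3])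
    interpret q: kalgebra_hom "sect T S1" "sect T N" K "restr T S1 N" by (rule T.restr_hom[OF j1(4) N])
    obtain a n where a: "a \<in> carrier (sect P W1)" and
      e: "s \<otimes>\<^bsub>sect P B1\<^esub> (restr P W1 B1 f1 [^]\<^bsub>sect P B1\<^esub> (n::nat)) = restr P W1 B1 a"
      using P.affine_numerator[OF IW(1)[OF j1(1)] j1(2) s[unfolded j1(3)]] unfolding j1(3) by blast
    have rf: "restr P W1 B1 f1 \<in> carrier (sect P B1)" using oW j1(2) by simp
    let ?u = "restr T Z1 N (\<phi>1 f1)"
    have Z1: "opn T Z1" by (rule IS[OF j1(1)])
    have ph: "\<phi>1 r \<in> carrier (sect T Z1)" if "r \<in> carrier (sect P W1)" for r using alg_hom_closed[OF Ih[OF j1(1)] that] .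
    have rr: "restr T S1 N (restr T Z1 S1 (\<phi>1 r)) = restr T Z1 N (\<phi>1 r)" if "r \<in> carrier (sect P W1)" for r
      using ph[OF that] Z1 j1(4,5) N by simp
    have pr: "restr P B1 B3 (restr P W1 B1 r) = restr P W1 B3 r" if "r \<in> carrier (sect P W1)" for r
      using that oW B3 by simp
    have u: "?u \<in> Units (sect T N)" using q.hom_Units[OF j1(6)] rr[OF j1(2)] by simp
    have "restr T S1 N (\<psi>1 s) \<otimes>\<^bsub>sect T N\<^esub> ?u [^]\<^bsub>sect T N\<^esub> n = restr T S1 N (\<psi>1 (s \<otimes>\<^bsub>sect P B1\<^esub> (restr P W1 B1 f1 [^]\<^bsub>sect P B1\<^esub> n)))"
      using s rf j1(8) rr[OF j1(2)] j1(2) T.restr_closed[OF Z1 j1(4,5) ph[OF j1(2)]] by (simp add: h1.hom_pow q.hom_pow)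
    also have "\<dots> = restr T Z1 N (\<phi>1 a)" unfolding e using a j1(8) rr[OF a] by simp
    also have "\<dots> = \<psi>3' (restr P B1 B3 (restr P W1 B1 a))" using h3(2) a pr[OF a] by simp
    also have "\<dots> = \<psi>3' (restr P B1 B3 s) \<otimes>\<^bsub>sect T N\<^esub> ?u [^]\<^bsub>sect T N\<^esub> n"
      unfolding e[symmetric] using s rf h3(2) j1(2) pr[OF j1(2)] p.hom_closed[OF rf] by (simp add: p.hom_pow h3.hom_pow)
    finally show ?thesis using C.unit_cancel[OF C.unit_pow[OF u]] s by simp
  qed
  obtain h :: "('p, 's, 'q, 't) kmor" where h: "kmorphism K T P h" "pmap h = hp"
    and hJ: "\<And>B S \<psi> V s. (B, S, \<psi>) \<in> \<J> \<Longrightarrow> opn P V \<Longrightarrow> B \<subseteq> V \<Longrightarrow> s \<in> carrier (sect P V) \<Longrightarrow>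
      restr T (pre T h V) S (pull h V s) = \<psi> (restr P V B s)"
  proof (rule glue_morphism[OF T.ksheaf_axioms P, of \<J> hp])
    fix B S' \<psi> assume "(B, S', \<psi>) \<in> \<J>"
    from J[OF this] obtain W S \<phi> f where j: "(W, S, \<phi>) \<in> \<I>" "f \<in> carrier (sect P W)"
     "B = basic P W f" "opn T S'" "S' \<subseteq> S" "restr T S S' (\<phi> f) \<in> Units (sect T S')"
     "alg_hom K (sect P B) (sect T S') \<psi>"
     "\<forall>r\<in>carrier (sect P W). \<psi> (restr P W B r) = restr T S S' (\<phi> r)" by blast
    have B: "opn P B" unfolding j(3) by (rule P.openin_basic[OF IW(2)[OF j(1)] j(2)])
    have inB: "hp t \<in> B" if "t \<in> S'" for t
    proof -
      have "invertible_at T t S (\<phi> f)" using that j(4,5,6) unfolding invertible_at_def by blast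
      then show ?thesis using hpinv[OF j(1) _ j(2)] that j(5) unfolding j(3) in_basic_iff by blast
    qed
    show "opn P B \<and> opn T S' \<and> hp ` S' \<subseteq> B \<and> alg_hom K (sect P B) (sect T S') \<psi>"
      using B inB j by blast
    fix s t assume s: "s \<in> carrier (sect P B)" and t: "t \<in> S'" and i: "invertible_at T t S' (\<psi> s)"
    obtain a n where a: "a \<in> carrier (sect P W)" and
      e: "s \<otimes>\<^bsub>sect P B\<^esub> (restr P W B f [^]\<^bsub>sect P B\<^esub> (n::nat)) = restr P W B a"
      using P.affine_numerator[OF IW(1)[OF j(1)] j(2) s[unfolded j(3)]] unfolding j(3) by blast
    interpret k: kalgebra_hom "sect P B" "sect T S'" K \<psi>
      using j B P.alg T.alg by (simp add: kalgebra_hom_def kalgebra_hom_axioms_def)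
    have rf: "restr P W B f \<in> carrier (sect P B)" 
      by (rule P.restr_closed[OF IW(2)[OF j(1)] B _ j(2)]) (simp add: j(3) basic_subset)
    have "invertible_at T t S' (\<psi> (restr P W B f [^]\<^bsub>sect P B\<^esub> n))"
      using T.invertible_unit[OF j(4) t k.B.unit_pow[OF j(6)]] rf j(2,8) by (simp add: k.hom_pow)
    then have "invertible_at T t S' (\<psi> (s \<otimes>\<^bsub>sect P B\<^esub> (restr P W B f [^]\<^bsub>sect P B\<^esub> n)))"
      using i s rf j(4) t by simp
    then have "invertible_at T t S' (restr T S S' (\<phi> a))" unfolding e using j(8) a by simp
    then have "invertible_at T t S (\<phi> a)"
      using T.invertible_restr[OF IS[OF j(1)] j(4,5) t alg_hom_closed[OF Ih[OF j(1)] a]] by simp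
    then have "invertible_at P (hp t) W a" using hpinv[OF j(1) _ a] t j(5) by blast
    then show "invertible_at P (hp t) B s"
      using P.affine_invertible_fraction[OF IW(1)[OF j(1)] j(2) s[unfolded j(3)] a e[unfolded j(3)] inB[OF t, unfolded j(3)]]
      unfolding j(3) by blast
  next
    fix t N assume t: "t \<in> pts T" and N: "opn P N" "hp t \<in> N"
    from cov[OF t] obtain W S \<phi> where i: "(W, S, \<phi>) \<in> \<I>" "t \<in> S" by blast
    from P.affine_basis[OF IW(1)[OF i(1)] N hpW[OF i]] obtain f where
      f: "f \<in> carrier (sect P W)" "hp t \<in> basic P W f" "basic P W f \<subseteq> N" by blast
    from Jex[OF i f(1)] f(2,3) show "\<exists>(B, S, \<psi>)\<in>\<J>. t \<in> S \<and> B \<subseteq> N" unfolding in_basic_iff by blast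
  next
    fix t assume t: "t \<in> pts T"
    from cov[OF t] obtain W S \<phi> where i: "(W, S, \<phi>) \<in> \<I>" "t \<in> S" by blast
    then show "hp t \<in> pts P" using hpW[OF i] openin_subset[OF IW(2)[OF i(1)]] by blast
  next
    fix B1 S1 \<psi>1 B2 S2 \<psi>2 t V s
    assume J1: "(B1, S1, \<psi>1) \<in> \<J>" and J2: "(B2, S2, \<psi>2) \<in> \<J>" and t: "t \<in> S1" "t \<in> S2"
      and V: "opn P V" "B1 \<subseteq> V" "B2 \<subseteq> V" "s \<in> carrier (sect P V)"
    from J[OF J1] obtain W1 Z1 \<phi>1 f1 where j1: "(W1, Z1, \<phi>1) \<in> \<I>" "f1 \<in> carrier (sect P W1)"
     "B1 = basic P W1 f1" "opn T S1" "S1 \<subseteq> Z1" "restr T Z1 S1 (\<phi>1 f1) \<in> Units (sect T S1)"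
     "alg_hom K (sect P B1) (sect T S1) \<psi>1"
     "\<forall>r\<in>carrier (sect P W1). \<psi>1 (restr P W1 B1 r) = restr T Z1 S1 (\<phi>1 r)" by blast
    from J[OF J2] obtain W2 Z2 \<phi>2 f2 where j2: "(W2, Z2, \<phi>2) \<in> \<I>" "f2 \<in> carrier (sect P W2)"
     "B2 = basic P W2 f2" "opn T S2" "S2 \<subseteq> Z2" "restr T Z2 S2 (\<phi>2 f2) \<in> Units (sect T S2)"
     "alg_hom K (sect P B2) (sect T S2) \<psi>2"
     "\<forall>r\<in>carrier (sect P W2). \<psi>2 (restr P W2 B2 r) = restr T Z2 S2 (\<phi>2 r)" by blast
    have tZ: "t \<in> Z1" "t \<in> Z2" using t j1(5) j2(5) by auto
    from compat[OF j1(1) j2(1) tZ] obtain W3 Z3 \<phi>3 where k12: "(W3, Z3, \<phi>3) \<in> \<I>" "t \<in> Z3"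
      and le: "chart_le P T (W3, Z3, \<phi>3) (W1, Z1, \<phi>1)" "chart_le P T (W3, Z3, \<phi>3) (W2, Z2, \<phi>2)" by blast
    note k = k12 le[unfolded chart_le_def split_conv, THEN conjunct2, THEN conjunct1]
      le[unfolded chart_le_def split_conv, THEN conjunct1]
    note e12 = le[unfolded chart_le_def split_conv, THEN conjunct2, THEN conjunct2]
    note e1 = e12(1) and e2 = e12(2)
    have inv1: "hp t \<in> B1"
    proof -
      have "invertible_at T t Z1 (\<phi>1 f1)" using t j1(4,5,6) unfolding invertible_at_def by blast
      then show ?thesis using hpinv[OF j1(1) tZ(1) j1(2)] unfolding j1(3) in_basic_iff by blast
    qed
    have inv2: "hp t \<in> B2"
    proof -
      have "invertible_at T t Z2 (\<phi>2 f2)" using t j2(4,5,6) unfolding invertible_at_def by blast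
      then show ?thesis using hpinv[OF j2(1) tZ(2) j2(2)] unfolding j2(3) in_basic_iff by blast
    qed
    have oB: "opn P B1" "opn P B2"
      unfolding j1(3) j2(3) by (rule P.openin_basic[OF IW(2)[OF j1(1)] j1(2)], rule P.openin_basic[OF IW(2)[OF j2(1)] j2(2)])
    have "opn P (B1 \<inter> B2)" "hp t \<in> B1 \<inter> B2" using oB inv1 inv2 by auto
    from P.affine_basis[OF IW(1)[OF k(1)] this hpW[OF k(1,2)]] obtain f3 where
      f3: "f3 \<in> carrier (sect P W3)" "hp t \<in> basic P W3 f3" "basic P W3 f3 \<subseteq> B1 \<inter> B2" by blast
    let ?B = "basic P W3 f3"
    from Jex[OF k(1,2) f3(1) f3(2)[unfolded in_basic_iff]] obtain S3 \<psi>3 where S3: "t \<in> S3" "S3 \<subseteq> Z3" "opn T S3"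
       "alg_hom K (sect P ?B) (sect T S3) \<psi>3"
       "\<forall>r\<in>carrier (sect P W3). \<psi>3 (restr P W3 ?B r) = restr T Z3 S3 (\<phi>3 r)" by blast
    let ?N = "S1 \<inter> S2 \<inter> S3"
    have N: "opn T ?N" "t \<in> ?N" "?N \<subseteq> S1" "?N \<subseteq> S2" "?N \<subseteq> S3" using j1(4) j2(4) S3 t by auto
    have B: "opn P ?B" "?B \<subseteq> W3" "?B \<subseteq> B1" "?B \<subseteq> B2"
      using P.openin_basic[OF IW(2)[OF k(1)] f3(1)] basic_subset[of P W3 f3] f3(3) by auto
    let ?p = "\<lambda>r. restr T S3 ?N (\<psi>3 r)"
    have hp3: "alg_hom K (sect P ?B) (sect T ?N) ?p"
      by (rule alg_hom_compose[OF S3(4) T.restr_alg_hom[OF S3(3) N(1,5)]])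
    have p3: "?p (restr P Wi ?B r) = restr T Zi ?N (\<phi>i r)"
      if "(Wi, Zi, \<phi>i) \<in> \<I>" "W3 \<subseteq> Wi" "Z3 \<subseteq> Zi" "\<forall>s\<in>carrier (sect P Wi). \<phi>3 (restr P Wi W3 s) = restr T Zi Z3 (\<phi>i s)"
        "r \<in> carrier (sect P Wi)" for Wi Zi \<phi>i r
    proof -
      note o = IW(2)[OF that(1)] IW(2)[OF k(1)] IS[OF that(1)] IS[OF k(1)]
      have r3: "restr P Wi W3 r \<in> carrier (sect P W3)" using o that by simp
      have "restr P Wi ?B r = restr P W3 ?B (restr P Wi W3 r)" using o that B by simp
      then have "\<psi>3 (restr P Wi ?B r) = restr T Z3 S3 (restr T Zi Z3 (\<phi>i r))"
        using S3(5) r3 that(4,5) by simp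
      then show ?thesis using o that S3 N alg_hom_closed[OF Ih[OF that(1)] that(5)] by simp
    qed
    have s1: "restr P V B1 s \<in> carrier (sect P B1)" "restr P V B2 s \<in> carrier (sect P B2)" using V oB by simp_all
    have "restr T S1 ?N (\<psi>1 (restr P V B1 s)) = ?p (restr P B1 ?B (restr P V B1 s))"
      by (rule frac[OF j1 N(1,3) B(1,3) hp3 _ s1(1)]) (use p3[OF j1(1) k(5,3) e1] in blast)
    moreover have "restr T S2 ?N (\<psi>2 (restr P V B2 s)) = ?p (restr P B2 ?B (restr P V B2 s))"
      by (rule frac[OF j2 N(1,4) B(1,4) hp3 _ s1(2)]) (use p3[OF j2(1) k(6,4) e2] in blast)
    moreover have "restr P B1 ?B (restr P V B1 s) = restr P B2 ?B (restr P V B2 s)"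
      using V oB B by simp
    ultimately show "\<exists>N. opn T N \<and> t \<in> N \<and> N \<subseteq> S1 \<and> N \<subseteq> S2 \<and>
        restr T S1 N (\<psi>1 (restr P V B1 s)) = restr T S2 N (\<psi>2 (restr P V B2 s))"
      using N by (intro exI[of _ ?N]) simp
  next
    fix h :: "('p, 's, 'q, 't) kmor"
    assume "kmorphism K T P h" "pmap h = hp"
      "\<And>B S \<psi> V s. (B, S, \<psi>) \<in> \<J> \<Longrightarrow> opn P V \<Longrightarrow> B \<subseteq> V \<Longrightarrow> s \<in> carrier (sect P V) \<Longrightarrow>
        restr T (pre T h V) S (pull h V s) = \<psi> (restr P V B s)"
    then show thesis by (rule that)
  qed
  interpret h: kmorphism K T P h by fact
  have sub: "S \<subseteq> pre T h W" if i: "(W, S, \<phi>) \<in> \<I>" for W S \<phi>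
    using hpW[OF i] SpT[OF i] h(2) by (auto simp: pre_def)
  have res: "restr T (pre T h W) S (pull h W s) = \<phi> s" if i: "(W, S, \<phi>) \<in> \<I>" and s: "s \<in> carrier (sect P W)" for W S \<phi> s
  proof (rule T.section_eqI[OF IS[OF i]])
    note W = IW(2)[OF i]
    show "restr T (pre T h W) S (pull h W s) \<in> carrier (sect T S)" using W s sub[OF i] IS[OF i] by auto
    show ps: "\<phi> s \<in> carrier (sect T S)" by (rule alg_hom_closed[OF Ih[OF i] s])
    fix t assume t: "t \<in> S"
    interpret A: kalgebra "sect P W" K using P.alg W by simp
    \<comment> \<open>For the function 1 the basic open set is W itself, so near each point of S the
      given chart reappears in the refined family and its values can be compared with the glued
      morphism.\<close>
    have B1: "basic P W \<one>\<^bsub>sect P W\<^esub> = W" using W by (auto simp: in_basic_iff dest: P.invertible_in)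
    obtain S' \<psi> where S': "(W, S', \<psi>) \<in> \<J>" "t \<in> S'" "S' \<subseteq> S" "opn T S'"
       "\<forall>r\<in>carrier (sect P W). \<psi> (restr P W W r) = restr T S S' (\<phi> r)"
      using Jex[OF i t A.one_closed] P.invertible_one[OF W hpW[OF i t]] unfolding B1 by blast
    have "restr T S S' (restr T (pre T h W) S (pull h W s)) = restr T (pre T h W) S' (pull h W s)"
      using W s sub[OF i] IS[OF i] S' by (intro T.restr_restr) auto
    also have "\<dots> = restr T S S' (\<phi> s)" using hJ[OF S'(1) W subset_refl s] S'(5) s by simp
    finally show "\<exists>N. opn T N \<and> t \<in> N \<and> N \<subseteq> S \<and> restr T S N (restr T (pre T h W) S (pull h W s)) = restr T S N (\<phi> s)"
      using S' by blast
  qed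
  show ?thesis using h(1) sub res by (rule that)
qed

text \<open>On points: the images in W have the same prime ideal, since invertibility of a section
  of W at the image is invertibility of its pull-back. On sections over an arbitrary V: near a point
  they are fractions over a basic open set contained in V, with numerator and denominator from
  W.\<close>

lemma morphism_eqI:
  assumes h: "kmorphism K T P h" and h': "kmorphism K T P h'"
    and loc: "\<And>t. t \<in> pts T \<Longrightarrow> \<exists>W S. affine_open P W \<and> opn T S \<and> t \<in> S \<and> S \<subseteq> pre T h W \<and> S \<subseteq> pre T h' W \<and>
      (\<forall>s\<in>carrier (sect P W). restr T (pre T h W) S (pull h W s) = restr T (pre T h' W) S (pull h' W s))"
  shows "mor_eq T P h h'"
proof -
  interpret h: kmorphism K T P h by fact
  interpret h': kmorphism K T P h' by fact
  have pt: "pmap h t = pmap h' t" if t: "t \<in> pts T" for t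
  proof -
    from loc[OF t] obtain W S where W: "affine_open P W" "opn T S" "t \<in> S" "S \<subseteq> pre T h W" "S \<subseteq> pre T h' W"
      "\<forall>s\<in>carrier (sect P W). restr T (pre T h W) S (pull h W s) = restr T (pre T h' W) S (pull h' W s)" by blast
    have oW: "opn P W" by (rule h.Y.affine_opn[OF W(1)])
    have t2: "t \<in> pre T h W" "t \<in> pre T h' W" using W by auto
    have "invertible_at P (pmap h t) W s = invertible_at P (pmap h' t) W s" if s: "s \<in> carrier (sect P W)" for s
    proof -
      have "invertible_at P (pmap h t) W s \<longleftrightarrow> invertible_at T t (pre T h W) (pull h W s)"
        by (rule h.pull_invertible[OF oW s t2(1), symmetric])
      also have "\<dots> \<longleftrightarrow> invertible_at T t S (restr T (pre T h W) S (pull h W s))"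
        by (rule h.X.invertible_restr[OF h.openin_pre[OF oW] W(2,4,3) h.pull_closed[OF oW s], symmetric])
      also have "\<dots> \<longleftrightarrow> invertible_at T t S (restr T (pre T h' W) S (pull h' W s))" using W(6) s by simp
      also have "\<dots> \<longleftrightarrow> invertible_at T t (pre T h' W) (pull h' W s)"
        by (rule h.X.invertible_restr[OF h'.openin_pre[OF oW] W(2,5,3) h'.pull_closed[OF oW s]])
      also have "\<dots> \<longleftrightarrow> invertible_at P (pmap h' t) W s"
        by (rule h'.pull_invertible[OF oW s t2(2)])
      finally show ?thesis .
    qed
    then have "pt_ideal P W (pmap h t) = pt_ideal P W (pmap h' t)" unfolding pt_ideal_def by blast
    then show ?thesis using h.Y.affine_inj[OF W(1)] t2 by (auto simp: pre_def)
  qed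
  have pre: "pre T h V = pre T h' V" for V using pt by (auto simp: pre_def)
  have "pull h V s = pull h' V s" if V: "opn P V" and s: "s \<in> carrier (sect P V)" for V s
  proof (rule h.X.section_eqI[of "pre T h V"])
    show "opn T (pre T h V)" using V by simp
    show "pull h V s \<in> carrier (sect T (pre T h V))" using V s by simp
    show "pull h' V s \<in> carrier (sect T (pre T h V))" using V s unfolding pre by simp
    fix t assume t: "t \<in> pre T h V"
    then have "t \<in> pts T" by (simp add: pre_def)
    from loc[OF this] obtain W S where W: "affine_open P W" "opn T S" "t \<in> S" "S \<subseteq> pre T h W" "S \<subseteq> pre T h' W"
      "\<forall>s\<in>carrier (sect P W). restr T (pre T h W) S (pull h W s) = restr T (pre T h' W) S (pull h' W s)" by blast
    have oW: "opn P W" by (rule h.Y.affine_opn[OF W(1)])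
    have "pmap h t \<in> V" "pmap h t \<in> W" using t W by (auto simp: pre_def)
    from h.Y.affine_basis[OF W(1) V this] obtain f where
      f: "f \<in> carrier (sect P W)" "pmap h t \<in> basic P W f" "basic P W f \<subseteq> V" by blast
    let ?B = "basic P W f"
    have B: "opn P ?B" "?B \<subseteq> W" by (rule h.Y.openin_basic[OF oW f(1)], rule basic_subset)
    let ?N = "S \<inter> pre T h ?B"
    have N: "opn T ?N" "t \<in> ?N" "?N \<subseteq> pre T h ?B" "?N \<subseteq> S" "?N \<subseteq> pre T h V"
      using openin_Int[OF W(2) h.openin_pre[OF B(1)]] W(3) f(2) t pre_mono[OF f(3), of T h] by (auto simp: pre_def)
    have N': "?N \<subseteq> pre T h' ?B" using N unfolding pre by simp
    let ?s = "restr P V ?B s"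
    have sB: "?s \<in> carrier (sect P ?B)" using V B f s by simp
    obtain a n where a: "a \<in> carrier (sect P W)" and
      e: "?s \<otimes>\<^bsub>sect P ?B\<^esub> (restr P W ?B f [^]\<^bsub>sect P ?B\<^esub> (n::nat)) = restr P W ?B a"
      using h.Y.affine_numerator[OF W(1) f(1) sB] by blast
    interpret A: kalgebra "sect P ?B" K using h.Y.alg B by simp
    interpret C: kalgebra "sect T ?N" K using h.X.alg N by simp
    have rf: "restr P W ?B f \<in> carrier (sect P ?B)" using oW B f by simp
    define u where "u = restr T (pre T h W) ?N (pull h W f)"
    have same: "restr T (pre T h W) ?N (pull h W r) = restr T (pre T h' W) ?N (pull h' W r)"
      if r: "r \<in> carrier (sect P W)" for r
    proof -
      have "restr T (pre T h W) ?N (pull h W r) = restr T S ?N (restr T (pre T h W) S (pull h W r))"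
        by (rule h.X.restr_restr[OF h.openin_pre[OF oW] W(2) N(1,4) W(4) h.pull_closed[OF oW r], symmetric])
      also have "\<dots> = restr T S ?N (restr T (pre T h' W) S (pull h' W r))" using W(6) r by simp
      also have "\<dots> = restr T (pre T h' W) ?N (pull h' W r)"
        by (rule h.X.restr_restr[OF h'.openin_pre[OF oW] W(2) N(1,4) W(5) h'.pull_closed[OF oW r]])
      finally show ?thesis .
    qed
    \<comment> \<open>For either morphism the pull-back of s is the quotient of the pull-backs of a
      and f^n, the latter being a unit. It is stated for a general k in order to be used for
      both.\<close>
    have fr: "restr T (pre T k V) ?N (pull k V s) \<otimes>\<^bsub>sect T ?N\<^esub> restr T (pre T k W) ?N (pull k W f) [^]\<^bsub>sect T ?N\<^esub> n =
        restr T (pre T k W) ?N (pull k W a) \<and> restr T (pre T k W) ?N (pull k W f) \<in> Units (sect T ?N)"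
      if k: "kmorphism K T P k" and Nk: "?N \<subseteq> pre T k ?B" for k
    proof -
      interpret k: kmorphism K T P k by fact
      interpret p: kalgebra_hom "sect P ?B" "sect T (pre T k ?B)" K "pull k ?B" by (rule k.pull_khom[OF B(1)])
      interpret q: kalgebra_hom "sect T (pre T k ?B)" "sect T ?N" K "restr T (pre T k ?B) ?N"
        by (rule h.X.restr_hom[OF k.openin_pre[OF B(1)] N(1) Nk])
      have u: "restr T (pre T k W) ?N (pull k W r) = restr T (pre T k ?B) ?N (pull k ?B (restr P W ?B r))"
        if "r \<in> carrier (sect P W)" for r by (rule k.restr_pull[OF oW B N(1) Nk that])
      have v: "restr T (pre T k V) ?N (pull k V s) = restr T (pre T k ?B) ?N (pull k ?B ?s)"
        by (rule k.restr_pull[OF V B(1) f(3) N(1) Nk s])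
      have "restr T (pre T k ?B) ?N (pull k ?B (?s \<otimes>\<^bsub>sect P ?B\<^esub> (restr P W ?B f [^]\<^bsub>sect P ?B\<^esub> (n::nat)))) =
          restr T (pre T k ?B) ?N (pull k ?B (restr P W ?B a))" by (simp only: e)
      then show ?thesis unfolding u[OF f(1)] u[OF a] v
        using sB rf q.hom_Units[OF p.hom_Units[OF h.Y.affine_basic_unit[OF W(1) f(1)]]]
        by (simp add: p.hom_pow q.hom_pow)
    qed
    have "restr T (pre T h V) ?N (pull h V s) = restr T (pre T h' V) ?N (pull h' V s)"
    proof (rule C.unit_cancel)
      show "restr T (pre T h V) ?N (pull h V s) \<otimes>\<^bsub>sect T ?N\<^esub> restr T (pre T h W) ?N (pull h W f) [^]\<^bsub>sect T ?N\<^esub> n =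
        restr T (pre T h' V) ?N (pull h' V s) \<otimes>\<^bsub>sect T ?N\<^esub> restr T (pre T h W) ?N (pull h W f) [^]\<^bsub>sect T ?N\<^esub> n"
        using fr[OF h N(3)] fr[OF h' N'] same[OF a] same[OF f(1)] by simp
      show "restr T (pre T h W) ?N (pull h W f) [^]\<^bsub>sect T ?N\<^esub> n \<in> Units (sect T ?N)"
        using fr[OF h N(3)] C.unit_pow by blast
      show "restr T (pre T h V) ?N (pull h V s) \<in> carrier (sect T ?N)" using N V s by simp
      show "restr T (pre T h' V) ?N (pull h' V s) \<in> carrier (sect T ?N)" using N V s unfolding pre by simp
    qed
    then show "\<exists>N. opn T N \<and> t \<in> N \<and> N \<subseteq> pre T h V \<and>
        restr T (pre T h V) N (pull h V s) = restr T (pre T h V) N (pull h' V s)"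
      using N unfolding pre by blast
  qed
  then show ?thesis using pt by (simp add: mor_eq_def)
qed

section \<open>Fibre products\<close>

locale kproduct = X: kscheme K X + Y: kscheme K Y
  for K and X :: "('x, 'd) kspace" and Y :: "('y, 'e) kspace" +
  fixes P :: "('p, 's, 'x, 'd, 'y, 'e) kprod"
  assumes fibre: "fibre_product K X Y P"
begin

lemmas fibre_props = fibre[unfolded fibre_product_def]

sublocale Z: kscheme K "pobj P"
  using fibre_props X.ground by unfold_locales blast+

sublocale l: kmorphism K "pobj P" X "prl P"
  using fibre_props by (intro kmorphismI Z.ksheaf_axioms X.ksheaf_axioms) blast

sublocale r: kmorphism K "pobj P" Y "prr P"
  using fibre_props by (intro kmorphismI Z.ksheaf_axioms Y.ksheaf_axioms) blast

text \<open>The open subset U x V of the product. The functions \<open>inl U V a\<close> and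
  \<open>inr U V b\<close> below are a \<otimes> 1 and 1 \<otimes> b on it.\<close>

definition box :: "'x set \<Rightarrow> 'y set \<Rightarrow> 'p set" where
  "box U V = pre (pobj P) (prl P) U \<inter> pre (pobj P) (prr P) V"

definition inl :: "'x set \<Rightarrow> 'y set \<Rightarrow> 'd \<Rightarrow> 's" where
  "inl U V a = restr (pobj P) (pre (pobj P) (prl P) U) (box U V) (pull (prl P) U a)"

definition inr :: "'x set \<Rightarrow> 'y set \<Rightarrow> 'e \<Rightarrow> 's" where
  "inr U V b = restr (pobj P) (pre (pobj P) (prr P) V) (box U V) (pull (prr P) V b)"

lemma box_affine:
  assumes "affine_open X U" "affine_open Y V"
  shows "affine_open (pobj P) (box U V)"
    "is_tensor_product K (sect X U) (sect Y V) (sect (pobj P) (box U V)) (inl U V) (inr U V)"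
proof -
  have "let U' = pre (pobj P) (prl P) U; V' = pre (pobj P) (prr P) V; W = U' \<inter> V' in
           affine_open (pobj P) W \<and>
           is_tensor_product K (sect X U) (sect Y V) (sect (pobj P) W)
             (\<lambda>a. restr (pobj P) U' W (pull (prl P) U a))
             (\<lambda>b. restr (pobj P) V' W (pull (prr P) V b))"
    using fibre_props assms by blast
  then show "affine_open (pobj P) (box U V)"
    "is_tensor_product K (sect X U) (sect Y V) (sect (pobj P) (box U V)) (inl U V) (inr U V)"
    unfolding Let_def box_def inl_def[abs_def] inr_def[abs_def] by blast+
qed

lemma openin_box: "opn X U \<Longrightarrow> opn Y V \<Longrightarrow> opn (pobj P) (box U V)"
  unfolding box_def by (intro openin_Int l.openin_pre r.openin_pre)

lemma box_subset: "box U V \<subseteq> pre (pobj P) (prl P) U" "box U V \<subseteq> pre (pobj P) (prr P) V"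
  by (auto simp: box_def)

lemma box_mono: "U' \<subseteq> U \<Longrightarrow> V' \<subseteq> V \<Longrightarrow> box U' V' \<subseteq> box U V"
  unfolding box_def by (intro Int_mono pre_mono)

lemma inl_closed: "opn X U \<Longrightarrow> opn Y V \<Longrightarrow> a \<in> carrier (sect X U) \<Longrightarrow> inl U V a \<in> carrier (sect (pobj P) (box U V))"
  unfolding inl_def by (intro Z.restr_closed l.openin_pre openin_box box_subset l.pull_closed)

lemma inr_closed: "opn X U \<Longrightarrow> opn Y V \<Longrightarrow> b \<in> carrier (sect Y V) \<Longrightarrow> inr U V b \<in> carrier (sect (pobj P) (box U V))"
  unfolding inr_def by (intro Z.restr_closed r.openin_pre openin_box box_subset r.pull_closed)

lemma restr_inl:
  assumes "opn X U" "opn Y V" "opn X U'" "opn Y V'" "U' \<subseteq> U" "V' \<subseteq> V" "a \<in> carrier (sect X U)"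
  shows "restr (pobj P) (box U V) (box U' V') (inl U V a) = inl U' V' (restr X U U' a)"
proof -
  have "restr (pobj P) (box U V) (box U' V') (inl U V a) =
      restr (pobj P) (pre (pobj P) (prl P) U) (box U' V') (pull (prl P) U a)"
    unfolding inl_def
    by (rule Z.restr_restr[OF l.openin_pre[OF assms(1)] openin_box[OF assms(1,2)] openin_box[OF assms(3,4)]
      box_mono[OF assms(5,6)] box_subset(1) l.pull_closed[OF assms(1,7)]])
  also have "\<dots> = inl U' V' (restr X U U' a)" unfolding inl_def
    by (rule l.restr_pull[OF assms(1,3,5) openin_box[OF assms(3,4)] box_subset(1) assms(7)])
  finally show ?thesis .
qed

lemma restr_inr:
  assumes "opn X U" "opn Y V" "opn X U'" "opn Y V'" "U' \<subseteq> U" "V' \<subseteq> V" "b \<in> carrier (sect Y V)"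
  shows "restr (pobj P) (box U V) (box U' V') (inr U V b) = inr U' V' (restr Y V V' b)"
proof -
  have "restr (pobj P) (box U V) (box U' V') (inr U V b) =
      restr (pobj P) (pre (pobj P) (prr P) V) (box U' V') (pull (prr P) V b)"
    unfolding inr_def
    by (rule Z.restr_restr[OF r.openin_pre[OF assms(2)] openin_box[OF assms(1,2)] openin_box[OF assms(3,4)]
      box_mono[OF assms(5,6)] box_subset(2) r.pull_closed[OF assms(2,7)]])
  also have "\<dots> = inr U' V' (restr Y V V' b)" unfolding inr_def
    by (rule r.restr_pull[OF assms(2,4,6) openin_box[OF assms(3,4)] box_subset(2) assms(7)])
  finally show ?thesis .
qed

lemma pull_inl:
  assumes h: "kmorphism K T (pobj P) h" and U: "opn X U" "opn Y V" and S: "opn T S" "S \<subseteq> pre T h (box U V)"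
    and a: "a \<in> carrier (sect X U)"
  shows "restr T (pre T h (box U V)) S (pull h (box U V) (inl U V a)) =
    restr T (pre T (mcomp (pobj P) (prl P) h) U) S (pull (mcomp (pobj P) (prl P) h) U a)"
proof -
  interpret h: kmorphism K T "pobj P" h by fact
  show ?thesis unfolding inl_def pull_mcomp pre_mcomp[OF h]
    by (rule h.restr_pull[OF l.openin_pre[OF U(1)] openin_box[OF U] box_subset(1) S l.pull_closed[OF U(1) a], symmetric])
qed

lemma pull_inr:
  assumes h: "kmorphism K T (pobj P) h" and U: "opn X U" "opn Y V" and S: "opn T S" "S \<subseteq> pre T h (box U V)"
    and b: "b \<in> carrier (sect Y V)"
  shows "restr T (pre T h (box U V)) S (pull h (box U V) (inr U V b)) =
    restr T (pre T (mcomp (pobj P) (prr P) h) V) S (pull (mcomp (pobj P) (prr P) h) V b)"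
proof -
  interpret h: kmorphism K T "pobj P" h by fact
  show ?thesis unfolding inr_def pull_mcomp pre_mcomp[OF h]
    by (rule h.restr_pull[OF r.openin_pre[OF U(2)] openin_box[OF U] box_subset(2) S r.pull_closed[OF U(2) b], symmetric])
qed

lemma pre_box:
  "kmorphism K T (pobj P) h \<Longrightarrow> pre T h (box U V) = pre T (mcomp (pobj P) (prl P) h) U \<inter> pre T (mcomp (pobj P) (prr P) h) V"
  by (auto simp: pre_mcomp box_def) (auto simp: pre_def)

lemma pull_box_hom:
  assumes h: "kmorphism K T (pobj P) h" and U: "affine_open X U" "affine_open Y V"
    and S: "opn T S" "S \<subseteq> pre T h (box U V)"
  shows "alg_hom K (sect (pobj P) (box U V)) (sect T S) (\<lambda>s. restr T (pre T h (box U V)) S (pull h (box U V) s))"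
proof -
  interpret h: kmorphism K T "pobj P" h by fact
  have o: "opn (pobj P) (box U V)" using U X.affine_opn Y.affine_opn openin_box by blast
  show ?thesis by (rule alg_hom_compose[OF h.pull_hom[OF o] h.X.restr_alg_hom[OF h.openin_pre[OF o] S]])
qed

text \<open>Around each point of T both morphisms land in an affine box. There the pull-back is a
  ring homomorphism on a tensor product, and the projections determine it on a \<otimes> 1 and 1
  \<otimes> b.\<close>

theorem pairing_unique:
  assumes h: "kmorphism K T (pobj P) h" and h': "kmorphism K T (pobj P) h'"
    and l: "mor_eq T X (mcomp (pobj P) (prl P) h) (mcomp (pobj P) (prl P) h')"
    and r: "mor_eq T Y (mcomp (pobj P) (prr P) h) (mcomp (pobj P) (prr P) h')"
  shows "mor_eq T (pobj P) h h'"
proof (rule morphism_eqI[OF h h'])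
  interpret h: kmorphism K T "pobj P" h by fact
  interpret h': kmorphism K T "pobj P" h' by fact
  fix t assume t: "t \<in> pts T"
  have "pmap (prl P) (pmap h t) \<in> pts X" "pmap (prr P) (pmap h t) \<in> pts Y" using t by auto
  then obtain U V where U: "affine_open X U" "pmap (prl P) (pmap h t) \<in> U"
    and V: "affine_open Y V" "pmap (prr P) (pmap h t) \<in> V"
    using X.affine_cover Y.affine_cover by blast
  note o = X.affine_opn[OF U(1)] Y.affine_opn[OF V(1)]
  let ?S = "pre T h (box U V)"
  have S: "opn T ?S" using openin_box[OF o] by simp
  have S': "?S = pre T h' (box U V)"
    unfolding pre_box[OF h] pre_box[OF h'] using mor_eq_pre[OF l] mor_eq_pre[OF r] by simp
  have tS: "t \<in> ?S" using U V t h.pmap_in[OF t] by (simp add: pre_def box_def)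
  have "restr T (pre T h (box U V)) ?S (pull h (box U V) s) = restr T (pre T h' (box U V)) ?S (pull h' (box U V) s)"
    if s: "s \<in> carrier (sect (pobj P) (box U V))" for s
  proof (rule tensor_hom_eqI[OF X.alg[OF o(1)] Y.alg[OF o(2)] Z.alg[OF openin_box[OF o]] h.X.alg[OF S]
      box_affine(2)[OF U(1) V(1)] _ _ _ _ s])
    show "alg_hom K (sect (pobj P) (box U V)) (sect T ?S) (\<lambda>s. restr T (pre T h (box U V)) ?S (pull h (box U V) s))"
      by (rule pull_box_hom[OF h U(1) V(1) S subset_refl])
    show "alg_hom K (sect (pobj P) (box U V)) (sect T ?S) (\<lambda>s. restr T (pre T h' (box U V)) ?S (pull h' (box U V) s))"
      by (rule pull_box_hom[OF h' U(1) V(1) S]) (simp add: S')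
    fix a assume a: "a \<in> carrier (sect X U)"
    show "restr T (pre T h (box U V)) ?S (pull h (box U V) (inl U V a)) = restr T (pre T h' (box U V)) ?S (pull h' (box U V) (inl U V a))"
      using pull_inl[OF h o S subset_refl a] pull_inl[OF h' o S _ a] S' mor_eq_pull[OF l o(1) a] mor_eq_pre[OF l] by simp
  next
    fix b assume b: "b \<in> carrier (sect Y V)"
    show "restr T (pre T h (box U V)) ?S (pull h (box U V) (inr U V b)) = restr T (pre T h' (box U V)) ?S (pull h' (box U V) (inr U V b))"
      using pull_inr[OF h o S subset_refl b] pull_inr[OF h' o S _ b] S' mor_eq_pull[OF r o(2) b] mor_eq_pre[OF r] by simp
  qed
  then show "\<exists>W S. affine_open (pobj P) W \<and> opn T S \<and> t \<in> S \<and> S \<subseteq> pre T h W \<and> S \<subseteq> pre T h' W \<and>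
      (\<forall>s\<in>carrier (sect (pobj P) W). restr T (pre T h W) S (pull h W s) = restr T (pre T h' W) S (pull h' W s))"
    using box_affine(1)[OF U(1) V(1)] S tS S' by (intro exI[of _ "box U V"] exI[of _ ?S]) auto
qed

theorem pairing_ex:
  assumes T: "locally_ringed K T" and f: "kmorphism K T X f" and g: "kmorphism K T Y g"
  obtains h where "kmorphism K T (pobj P) h" "mor_eq T X (mcomp (pobj P) (prl P) h) f"
    "mor_eq T Y (mcomp (pobj P) (prr P) h) g"
proof -
  interpret T: locally_ringed K T by fact
  interpret f: kmorphism K T X f by fact
  interpret g: kmorphism K T Y g by fact
  define S where "S U V = pre T f U \<inter> pre T g V" for U V
  define ok where "ok U V \<phi> \<longleftrightarrow> affine_open X U \<and> affine_open Y V \<and>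
     alg_hom K (sect (pobj P) (box U V)) (sect T (S U V)) \<phi> \<and>
     (\<forall>a\<in>carrier (sect X U). \<phi> (inl U V a) = restr T (pre T f U) (S U V) (pull f U a)) \<and>
     (\<forall>b\<in>carrier (sect Y V). \<phi> (inr U V b) = restr T (pre T g V) (S U V) (pull g V b))" for U V \<phi>
  define \<I> where "\<I> = {(box U V, S U V, \<phi>) | U V \<phi>. ok U V \<phi>}"
  have I: "\<exists>U V. W = box U V \<and> Z = S U V \<and> ok U V \<phi>" if "(W, Z, \<phi>) \<in> \<I>" for W Z \<phi>
    using that unfolding \<I>_def by blast
  have oS: "opn T (S U V)" if "opn X U" "opn Y V" for U V using that by (auto simp: S_def)
  have Sf: "S U V \<subseteq> pre T f U" and Sg: "S U V \<subseteq> pre T g V" for U V by (auto simp: S_def)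
  have Smono: "S U' V' \<subseteq> S U V" if "U' \<subseteq> U" "V' \<subseteq> V" for U V U' V'
    unfolding S_def by (intro Int_mono pre_mono that)
  have ex: "\<exists>\<phi>. ok U V \<phi>" if U: "affine_open X U" and V: "affine_open Y V" for U V
  proof -
    note o = X.affine_opn[OF U] Y.affine_opn[OF V]
    have ff: "alg_hom K (sect X U) (sect T (S U V)) (\<lambda>a. restr T (pre T f U) (S U V) (pull f U a))"
      by (rule alg_hom_compose[OF f.pull_hom[OF o(1)] T.restr_alg_hom[OF f.openin_pre[OF o(1)] oS[OF o] Sf]])
    have gg: "alg_hom K (sect Y V) (sect T (S U V)) (\<lambda>b. restr T (pre T g V) (S U V) (pull g V b))"
      by (rule alg_hom_compose[OF g.pull_hom[OF o(2)] T.restr_alg_hom[OF g.openin_pre[OF o(2)] oS[OF o] Sg]])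
    obtain p where "alg_hom K (sect (pobj P) (box U V)) (sect T (S U V)) p"
        "\<And>a. a \<in> carrier (sect X U) \<Longrightarrow> p (inl U V a) = restr T (pre T f U) (S U V) (pull f U a)"
        "\<And>b. b \<in> carrier (sect Y V) \<Longrightarrow> p (inr U V b) = restr T (pre T g V) (S U V) (pull g V b)"
      using tensor_lift[OF X.alg[OF o(1)] Y.alg[OF o(2)] Z.alg[OF openin_box[OF o]] T.alg[OF oS[OF o]]
        box_affine(2)[OF U V] ff gg] by blast
    then show ?thesis unfolding ok_def using U V by blast
  qed
  \<comment> \<open>Restriction to a smaller box is compared on the factors a \<otimes> 1 and 1
    \<otimes> b, where the charts are restrictions of the pull-backs along f and g.\<close>
  have le: "chart_le (pobj P) T (box U' V', S U' V', \<phi>') (box U V, S U V, \<phi>)"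
    if k: "ok U V \<phi>" and k': "ok U' V' \<phi>'" and s: "U' \<subseteq> U" "V' \<subseteq> V" for U V \<phi> U' V' \<phi>'
    unfolding chart_le_def split_conv
  proof (intro conjI ballI box_mono s Smono)
    have aff: "affine_open X U" "affine_open Y V" "affine_open X U'" "affine_open Y V'"
      and h: "alg_hom K (sect (pobj P) (box U V)) (sect T (S U V)) \<phi>"
      and h': "alg_hom K (sect (pobj P) (box U' V')) (sect T (S U' V')) \<phi>'"
      using k k' unfolding ok_def by blast+
    note o = X.affine_opn[OF aff(1)] Y.affine_opn[OF aff(2)] X.affine_opn[OF aff(3)] Y.affine_opn[OF aff(4)]
    fix t assume t: "t \<in> carrier (sect (pobj P) (box U V))"
    show "\<phi>' (restr (pobj P) (box U V) (box U' V') t) = restr T (S U V) (S U' V') (\<phi> t)"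
    proof (rule tensor_hom_eqI[OF X.alg[OF o(1)] Y.alg[OF o(2)] Z.alg[OF openin_box[OF o(1,2)]] T.alg[OF oS[OF o(3,4)]]
        box_affine(2)[OF aff(1,2)] _ _ _ _ t])
      show "alg_hom K (sect (pobj P) (box U V)) (sect T (S U' V')) (\<lambda>t. \<phi>' (restr (pobj P) (box U V) (box U' V') t))"
        by (rule alg_hom_compose[OF Z.restr_alg_hom[OF openin_box[OF o(1,2)] openin_box[OF o(3,4)] box_mono[OF s]] h'])
      show "alg_hom K (sect (pobj P) (box U V)) (sect T (S U' V')) (\<lambda>t. restr T (S U V) (S U' V') (\<phi> t))"
        by (rule alg_hom_compose[OF h T.restr_alg_hom[OF oS[OF o(1,2)] oS[OF o(3,4)] Smono[OF s]]])
      fix a assume a: "a \<in> carrier (sect X U)"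
      have ra: "restr X U U' a \<in> carrier (sect X U')" using o s a by simp
      have "\<phi>' (restr (pobj P) (box U V) (box U' V') (inl U V a)) = restr T (pre T f U') (S U' V') (pull f U' (restr X U U' a))"
        using k' ra unfolding restr_inl[OF o s a] ok_def by blast
      also have "\<dots> = restr T (pre T f U) (S U' V') (pull f U a)"
        by (rule f.restr_pull[OF o(1,3) s(1) oS[OF o(3,4)] Sf a, symmetric])
      also have "\<dots> = restr T (S U V) (S U' V') (restr T (pre T f U) (S U V) (pull f U a))"
        by (rule T.restr_restr[OF f.openin_pre[OF o(1)] oS[OF o(1,2)] oS[OF o(3,4)] Smono[OF s] Sf f.pull_closed[OF o(1) a], symmetric])
      also have "restr T (pre T f U) (S U V) (pull f U a) = \<phi> (inl U V a)" using k a unfolding ok_def by simp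
      finally show "\<phi>' (restr (pobj P) (box U V) (box U' V') (inl U V a)) = restr T (S U V) (S U' V') (\<phi> (inl U V a))" .
    next
      fix b assume b: "b \<in> carrier (sect Y V)"
      have rb: "restr Y V V' b \<in> carrier (sect Y V')" using o s b by simp
      have "\<phi>' (restr (pobj P) (box U V) (box U' V') (inr U V b)) = restr T (pre T g V') (S U' V') (pull g V' (restr Y V V' b))"
        using k' rb unfolding restr_inr[OF o s b] ok_def by blast
      also have "\<dots> = restr T (pre T g V) (S U' V') (pull g V b)"
        by (rule g.restr_pull[OF o(2,4) s(2) oS[OF o(3,4)] Sg b, symmetric])
      also have "\<dots> = restr T (S U V) (S U' V') (restr T (pre T g V) (S U V) (pull g V b))"
        by (rule T.restr_restr[OF g.openin_pre[OF o(2)] oS[OF o(1,2)] oS[OF o(3,4)] Smono[OF s] Sg g.pull_closed[OF o(2) b], symmetric])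
      also have "restr T (pre T g V) (S U V) (pull g V b) = \<phi> (inr U V b)" using k b unfolding ok_def by simp
      finally show "\<phi>' (restr (pobj P) (box U V) (box U' V') (inr U V b)) = restr T (S U V) (S U' V') (\<phi> (inr U V b))" .
    qed
  qed
  have fgt: "pmap f t \<in> U" "pmap g t \<in> V" "t \<in> pts T" if "t \<in> S U V" for t U V
    using that by (auto simp: S_def pre_def)
  have tS: "t \<in> S U V" if "t \<in> pts T" "pmap f t \<in> U" "pmap g t \<in> V" for t U V
    using that by (auto simp: S_def pre_def)
  obtain h where h: "kmorphism K T (pobj P) h"
    and hS: "\<And>W S \<phi>. (W, S, \<phi>) \<in> \<I> \<Longrightarrow> S \<subseteq> pre T h W"
    and hp: "\<And>W S \<phi> s. (W, S, \<phi>) \<in> \<I> \<Longrightarrow> s \<in> carrier (sect (pobj P) W) \<Longrightarrow>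
      restr T (pre T h W) S (pull h W s) = \<phi> s"
  proof (rule charts_morphism[OF T Z.ksheaf_axioms, of \<I>])
    fix W Z \<phi> assume "(W, Z, \<phi>) \<in> \<I>"
    from I[OF this] obtain U V where i: "W = box U V" "Z = S U V" "ok U V \<phi>" by blast
    then show "affine_open (pobj P) W \<and> opn T Z \<and> alg_hom K (sect (pobj P) W) (sect T Z) \<phi>"
      unfolding ok_def using box_affine(1) oS X.affine_opn Y.affine_opn by blast
  next
    fix t assume t: "t \<in> pts T"
    then obtain U V where U: "affine_open X U" "pmap f t \<in> U" and V: "affine_open Y V" "pmap g t \<in> V"
      using X.affine_cover[OF f.pmap_in[OF t]] Y.affine_cover[OF g.pmap_in[OF t]] by blast
    from ex[OF U(1) V(1)] obtain \<phi> where "ok U V \<phi>" by blast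
    then have "(box U V, S U V, \<phi>) \<in> \<I>" unfolding \<I>_def by blast
    then show "\<exists>(W, Z, \<phi>)\<in>\<I>. t \<in> Z" using tS[OF t U(2) V(2)] by blast
  next
    fix W Z \<phi> W' Z' \<phi>' t assume i: "(W, Z, \<phi>) \<in> \<I>" and i': "(W', Z', \<phi>') \<in> \<I>" and t: "t \<in> Z" "t \<in> Z'"
    from I[OF i] obtain U V where j: "W = box U V" "Z = S U V" "ok U V \<phi>" by blast
    from I[OF i'] obtain U' V' where j': "W' = box U' V'" "Z' = S U' V'" "ok U' V' \<phi>'" by blast
    have o: "opn X U" "opn Y V" "opn X U'" "opn Y V'"
      using j(3) j'(3) X.affine_opn Y.affine_opn unfolding ok_def by blast+
    have "opn X (U \<inter> U')" "opn Y (V \<inter> V')" using o by auto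
    moreover have "pmap f t \<in> U \<inter> U'" "pmap g t \<in> V \<inter> V'" using fgt t unfolding j(2) j'(2) by blast+
    ultimately obtain U'' V'' where U: "affine_open X U''" "pmap f t \<in> U''" "U'' \<subseteq> U \<inter> U'"
      and V: "affine_open Y V''" "pmap g t \<in> V''" "V'' \<subseteq> V \<inter> V'"
      using X.affine_nbhd Y.affine_nbhd by metis
    from ex[OF U(1) V(1)] obtain \<phi>'' where k: "ok U'' V'' \<phi>''" by blast
    have "(box U'' V'', S U'' V'', \<phi>'') \<in> \<I>" unfolding \<I>_def using k by blast
    moreover have "t \<in> S U'' V''" using tS U V fgt(3) t unfolding j(2) by blast
    moreover have "chart_le (pobj P) T (box U'' V'', S U'' V'', \<phi>'') (W, Z, \<phi>)"
      unfolding j(1,2) by (rule le[OF j(3) k]) (use U V in auto)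
    moreover have "chart_le (pobj P) T (box U'' V'', S U'' V'', \<phi>'') (W', Z', \<phi>')"
      unfolding j'(1,2) by (rule le[OF j'(3) k]) (use U V in auto)
    ultimately show "\<exists>W'' S'' \<phi>''. (W'', S'', \<phi>'') \<in> \<I> \<and> t \<in> S'' \<and>
        chart_le (pobj P) T (W'', S'', \<phi>'') (W, Z, \<phi>) \<and> chart_le (pobj P) T (W'', S'', \<phi>'') (W', Z', \<phi>')" by blast
  next
    fix h assume "kmorphism K T (pobj P) h"
      "\<And>W S \<phi>. (W, S, \<phi>) \<in> \<I> \<Longrightarrow> S \<subseteq> pre T h W"
      "\<And>W S \<phi> s. (W, S, \<phi>) \<in> \<I> \<Longrightarrow> s \<in> carrier (sect (pobj P) W) \<Longrightarrow> restr T (pre T h W) S (pull h W s) = \<phi> s"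
    then show thesis by (rule that)
  qed
  interpret h: kmorphism K T "pobj P" h by fact
  have lh: "kmorphism K T X (mcomp (pobj P) (prl P) h)" by (rule morphism_mcomp[OF h l.kmorphism_axioms])
  have rh: "kmorphism K T Y (mcomp (pobj P) (prr P) h)" by (rule morphism_mcomp[OF h r.kmorphism_axioms])
  have chart: "\<exists>U V \<phi>. ok U V \<phi> \<and> t \<in> S U V \<and> (box U V, S U V, \<phi>) \<in> \<I>" if t: "t \<in> pts T" for t
  proof -
    obtain U V where U: "affine_open X U" "pmap f t \<in> U" and V: "affine_open Y V" "pmap g t \<in> V"
      using X.affine_cover[OF f.pmap_in[OF t]] Y.affine_cover[OF g.pmap_in[OF t]] by blast
    from ex[OF U(1) V(1)] obtain \<phi> where "ok U V \<phi>" by blast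
    moreover from this have "(box U V, S U V, \<phi>) \<in> \<I>" unfolding \<I>_def by blast
    ultimately show ?thesis using tS[OF t U(2) V(2)] by blast
  qed
  have "mor_eq T X (mcomp (pobj P) (prl P) h) f"
  proof (rule morphism_eqI[OF lh f])
    fix t assume "t \<in> pts T"
    from chart[OF this] obtain U V \<phi> where c: "ok U V \<phi>" "t \<in> S U V" "(box U V, S U V, \<phi>) \<in> \<I>" by blast
    have aff: "affine_open X U" "affine_open Y V" using c(1) unfolding ok_def by blast+
    note o = X.affine_opn[OF aff(1)] Y.affine_opn[OF aff(2)]
    have sub: "S U V \<subseteq> pre T (mcomp (pobj P) (prl P) h) U"
      using hS[OF c(3)] unfolding pre_box[OF h] by blast
    have "restr T (pre T (mcomp (pobj P) (prl P) h) U) (S U V) (pull (mcomp (pobj P) (prl P) h) U a) =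
        restr T (pre T f U) (S U V) (pull f U a)" if a: "a \<in> carrier (sect X U)" for a
      using pull_inl[OF h o oS[OF o] hS[OF c(3)] a] hp[OF c(3) inl_closed[OF o a]] c(1) a unfolding ok_def by simp
    then show "\<exists>W S. affine_open X W \<and> opn T S \<and> t \<in> S \<and> S \<subseteq> pre T (mcomp (pobj P) (prl P) h) W \<and> S \<subseteq> pre T f W \<and>
      (\<forall>s\<in>carrier (sect X W). restr T (pre T (mcomp (pobj P) (prl P) h) W) S (pull (mcomp (pobj P) (prl P) h) W s) =
         restr T (pre T f W) S (pull f W s))"
      using aff(1) oS[OF o] c(2) sub Sf by (intro exI[of _ U] exI[of _ "S U V"]) blast
  qed
  moreover have "mor_eq T Y (mcomp (pobj P) (prr P) h) g"
  proof (rule morphism_eqI[OF rh g])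
    fix t assume "t \<in> pts T"
    from chart[OF this] obtain U V \<phi> where c: "ok U V \<phi>" "t \<in> S U V" "(box U V, S U V, \<phi>) \<in> \<I>" by blast
    have aff: "affine_open X U" "affine_open Y V" using c(1) unfolding ok_def by blast+
    note o = X.affine_opn[OF aff(1)] Y.affine_opn[OF aff(2)]
    have sub: "S U V \<subseteq> pre T (mcomp (pobj P) (prr P) h) V"
      using hS[OF c(3)] unfolding pre_box[OF h] by blast
    have "restr T (pre T (mcomp (pobj P) (prr P) h) V) (S U V) (pull (mcomp (pobj P) (prr P) h) V b) =
        restr T (pre T g V) (S U V) (pull g V b)" if b: "b \<in> carrier (sect Y V)" for b
      using pull_inr[OF h o oS[OF o] hS[OF c(3)] b] hp[OF c(3) inr_closed[OF o b]] c(1) b unfolding ok_def by simp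
    then show "\<exists>W S. affine_open Y W \<and> opn T S \<and> t \<in> S \<and> S \<subseteq> pre T (mcomp (pobj P) (prr P) h) W \<and> S \<subseteq> pre T g W \<and>
      (\<forall>s\<in>carrier (sect Y W). restr T (pre T (mcomp (pobj P) (prr P) h) W) S (pull (mcomp (pobj P) (prr P) h) W s) =
         restr T (pre T g W) S (pull g W s))"
      using aff(2) oS[OF o] c(2) sub Sg by (intro exI[of _ V] exI[of _ "S U V"]) blast
  qed
  ultimately show ?thesis using that[OF h] by blast
qed

context
  fixes T :: "('q, 'u) kspace" and f g
  assumes T: "locally_ringed K T" and f: "kmorphism K T X f" and g: "kmorphism K T Y g"
begin

text \<open>Existence is what gives content to the choice in the definition of
  \<open>pairing\<close>.\<close>

lemma pairing_props:
  "kmorphism K T (pobj P) (pairing K T X Y P f g)"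
  "mor_eq T X (mcomp (pobj P) (prl P) (pairing K T X Y P f g)) f"
  "mor_eq T Y (mcomp (pobj P) (prr P) (pairing K T X Y P f g)) g"
proof -
  from pairing_ex[OF T f g] obtain h where "kmorphism K T (pobj P) h" "mor_eq T X (mcomp (pobj P) (prl P) h) f"
    "mor_eq T Y (mcomp (pobj P) (prr P) h) g" by blast
  then have "morphism K T (pobj P) h \<and> mor_eq T X (mcomp (pobj P) (prl P) h) f \<and>
     mor_eq T Y (mcomp (pobj P) (prr P) h) g" using kmorphism.mor by blast
  then have *: "morphism K T (pobj P) (pairing K T X Y P f g) \<and>
    mor_eq T X (mcomp (pobj P) (prl P) (pairing K T X Y P f g)) f \<and>
    mor_eq T Y (mcomp (pobj P) (prr P) (pairing K T X Y P f g)) g"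
    unfolding pairing_def by (rule someI)
  then show "kmorphism K T (pobj P) (pairing K T X Y P f g)"
    by (intro kmorphismI locally_ringed.axioms(1)[OF T] Z.ksheaf_axioms) blast
  from * show "mor_eq T X (mcomp (pobj P) (prl P) (pairing K T X Y P f g)) f"
    "mor_eq T Y (mcomp (pobj P) (prr P) (pairing K T X Y P f g)) g" by blast+
qed

lemma pairing_eqI:
  assumes "kmorphism K T (pobj P) h" "mor_eq T X (mcomp (pobj P) (prl P) h) f" "mor_eq T Y (mcomp (pobj P) (prr P) h) g"
  shows "mor_eq T (pobj P) h (pairing K T X Y P f g)"
  by (rule pairing_unique[OF assms(1) pairing_props(1)])
    (rule mor_eq_trans[OF assms(2) mor_eq_sym[OF pairing_props(2)]],
     rule mor_eq_trans[OF assms(3) mor_eq_sym[OF pairing_props(3)]])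

end

end

section \<open>Rational points and orbits\<close>

lemma unit_sets: "(U :: unit set) = {} \<or> U = UNIV"
  by (cases "() \<in> U") (auto simp: UNIV_unit)

definition zero_algebra :: "(complex, complex) module" where
  "zero_algebra = \<lparr>carrier = {0}, mult = (*), one = 0, zero = 0, add = (+), smult = (*)\<rparr>"

lemma zero_algebra_simps [simp]:
  "carrier zero_algebra = {0}" "mult zero_algebra = (*)" "one zero_algebra = 0" "zero zero_algebra = 0"
  "add zero_algebra = (+)" "smult zero_algebra = (*)"
  by (simp_all add: zero_algebra_def)

lemma algebra_zero_algebra:
  assumes "K = \<real> \<or> K = UNIV"
  shows "algebra (scalars K) zero_algebra"
proof (rule algebraI)
  interpret k: kalgebra "kscalar K" K by (rule kalgebraI[OF assms algebra_kscalar[OF assms]])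
  show "cring (scalars K)"
    using algebra_kscalar[OF assms] by (simp add: algebra_def module_def)
  show "cring zero_algebra"
  proof (rule cringI)
    show "abelian_group zero_algebra" by (rule abelian_groupI) auto
    show "comm_monoid zero_algebra" by (rule comm_monoidI) auto
  qed auto
qed (auto simp: scalars_def)

lemma spec_field_simps [simp]:
  "ptop (spec_field K) = discrete_topology UNIV" "sect (spec_field K) {} = zero_algebra"
  "sect (spec_field K) UNIV = kscalar K" "restr (spec_field K) U {} s = 0" "restr (spec_field K) U UNIV s = s"
  by (simp_all add: spec_field_def kscalar_def zero_algebra_def)

lemma sheaf_spec_field:
  assumes "K = \<real> \<or> K = UNIV"
  shows "sheaf_of_algebras K (spec_field K)"
  unfolding sheaf_of_algebras_def
proof (intro conjI allI impI ballI)
  fix U :: "unit set"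
  show "algebra (scalars K) (sect (spec_field K) U)"
    using unit_sets[of U] algebra_kscalar[OF assms] algebra_zero_algebra[OF assms] by auto
  show "restr (spec_field K) U U s = s" if "s \<in> carrier (sect (spec_field K) U)" for s
    using unit_sets[of U] that by auto
  fix V :: "unit set"
  show "alg_hom K (sect (spec_field K) U) (sect (spec_field K) V) (restr (spec_field K) U V)"
    if "opn (spec_field K) U \<and> opn (spec_field K) V \<and> V \<subseteq> U"
    using unit_sets[of U] unit_sets[of V] that by (auto intro!: alg_homI)
  fix W :: "unit set"
  show "restr (spec_field K) V W (restr (spec_field K) U V s) = restr (spec_field K) U W s"
    if "opn (spec_field K) U \<and> opn (spec_field K) V \<and> opn (spec_field K) W \<and> W \<subseteq> V \<and> V \<subseteq> U" for s
    using unit_sets[of U] unit_sets[of V] unit_sets[of W] that by auto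
next
  fix \<U> :: "unit set set" and s
  assume *: "(\<forall>V\<in>\<U>. opn (spec_field K) V \<and> s V \<in> carrier (sect (spec_field K) V)) \<and>
    (\<forall>V\<in>\<U>. \<forall>W\<in>\<U>. restr (spec_field K) V (V \<inter> W) (s V) = restr (spec_field K) W (V \<inter> W) (s W))"
  show "\<exists>!t. t \<in> carrier (sect (spec_field K) (\<Union>\<U>)) \<and> (\<forall>V\<in>\<U>. restr (spec_field K) (\<Union>\<U>) V t = s V)"
  proof (cases "UNIV \<in> \<U>")
    case True
    then have un: "\<Union>\<U> = UNIV" by blast
    have "s V = (if V = {} then 0 else s UNIV)" if "V \<in> \<U>" for V
      using unit_sets[of V] * that by auto
    moreover have r: "restr (spec_field K) UNIV V t = (if V = {} then 0 else t)" for V t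
      using unit_sets[of V] by auto
    ultimately have sV: "(if V = {} then 0 else s UNIV) = s V" if "V \<in> \<U>" for V using that by simp
    have c: "s UNIV \<in> carrier (sect (spec_field K) UNIV)" using * True by blast
    show ?thesis unfolding un r
    proof (rule ex1I[of _ "s UNIV"])
      show "s UNIV \<in> carrier (sect (spec_field K) UNIV) \<and> (\<forall>V\<in>\<U>. (if V = {} then 0 else s UNIV) = s V)"
        using c sV by blast
      fix t assume "t \<in> carrier (sect (spec_field K) UNIV) \<and> (\<forall>V\<in>\<U>. (if V = {} then 0 else t) = s V)"
      then show "t = s UNIV" using True by force
    qed
  next
    case False
    then have V: "V = {}" if "V \<in> \<U>" for V using unit_sets[of V] that by auto
    then have un: "\<Union>\<U> = {}" by blast
    have "s V = 0" if "V \<in> \<U>" for V using V[OF that] * that by fastforce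
    moreover have "restr (spec_field K) {} V t = 0" if "V \<in> \<U>" for V t using V[OF that] by simp
    ultimately show ?thesis unfolding un by (intro ex1I[of _ 0]) auto
  qed
qed

lemma units_kscalar:
  assumes "K = \<real> \<or> K = UNIV"
  shows "Units (kscalar K) = K - {0}"
proof -
  have "\<exists>l\<in>K. l * k = 1 \<and> k * l = 1" if "k \<in> K" "k \<noteq> 0" for k
    using that ground_closed(6)[OF assms, of k] by (intro bexI[of _ "inverse k"]) auto
  then show ?thesis by (auto simp: Units_def)
qed

text \<open>Being locally ringed is all that \<open>charts_morphism\<close> and
  \<open>pairing_ex\<close> ask of a source, so this makes K-points available for both.\<close>

lemma locally_ringed_spec_field:
  assumes K: "K = \<real> \<or> K = UNIV"
  shows "locally_ringed K (spec_field K)"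
proof -
  have inv: "invertible_at (spec_field K) x U s \<longleftrightarrow> U = UNIV \<and> s \<in> K - {0}" for x U s
  proof (cases "U = {}")
    case False
    then have U: "U = UNIV" using unit_sets by blast
    have "V = UNIV" if "x \<in> V" for V using unit_sets[of V] that by auto
    then have "invertible_at (spec_field K) x UNIV s \<longleftrightarrow> s \<in> Units (kscalar K)"
      unfolding invertible_at_def by (metis UNIV_I openin_topspace spec_field_simps(1,3,5) subset_UNIV topspace_discrete_topology)
    then show ?thesis unfolding U units_kscalar[OF K] by simp
  qed (auto simp: invertible_at_def)
  show ?thesis
  proof (unfold_locales)
    fix U :: "unit set" and x s t
    assume "x \<in> U" "s \<in> carrier (sect (spec_field K) U)" "t \<in> carrier (sect (spec_field K) U)"
      "invertible_at (spec_field K) x U (s \<oplus>\<^bsub>sect (spec_field K) U\<^esub> t)"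
    then show "invertible_at (spec_field K) x U s \<or> invertible_at (spec_field K) x U t"
      unfolding inv using unit_sets[of U] by auto
  next
    fix U :: "unit set" and x
    show "\<not> invertible_at (spec_field K) x U \<zero>\<^bsub>sect (spec_field K) U\<^esub>"
      unfolding inv by auto
  qed (use K sheaf_spec_field[OF K] in auto)
qed

lemma pre_to_spec: "pre X (to_spec_field X) V = (if V = {} then {} else pts X)"
  using unit_sets[of V] by (auto simp: pre_def to_spec_field_def Let_def)

lemma pull_to_spec:
  "pull (to_spec_field X) V k = k \<odot>\<^bsub>sect X (pre X (to_spec_field X) V)\<^esub> \<one>\<^bsub>sect X (pre X (to_spec_field X) V)\<^esub>"
  unfolding pre_to_spec by (simp add: to_spec_field_def Let_def)

lemma to_spec_field_morphism:
  assumes "locally_ringed K X"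
  shows "kmorphism K X (spec_field K) (to_spec_field X)"
proof -
  interpret X: locally_ringed K X by fact
  interpret S: locally_ringed K "spec_field K" by (rule locally_ringed_spec_field[OF X.K_ground])
  let ?t = "to_spec_field X"
  have op: "opn X (pre X ?t V)" for V by (simp add: pre_to_spec)
  have eq0: "a = b" if "a \<in> carrier (sect X {})" "b \<in> carrier (sect X {})" for a b
    using X.zero_ring_empty that by blast
  have cl: "k \<in> K" if "k \<in> carrier (sect (spec_field K) V)" for k V
    using that unit_sets[of V] ground_closed(1)[OF X.K_ground] by auto
  have "morphism K X (spec_field K) ?t" unfolding morphism_def
  proof (intro conjI allI impI ballI)
    show "continuous_map (ptop X) (ptop (spec_field K)) (pmap ?t)"
      unfolding continuous_map_def using op by (auto simp: pre_def)
    fix V :: "unit set"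
    interpret A: kalgebra "sect X (pre X ?t V)" K using X.alg op by simp
    show "alg_hom K (sect (spec_field K) V) (sect X (pre X ?t V)) (pull ?t V)"
    proof (cases "V = {}")
      case True
      interpret E: kalgebra "sect X {}" K using X.alg by simp
      have p: "pre X ?t V = {}" by (simp add: pre_to_spec True)
      show ?thesis unfolding p
        by (rule alg_homI) (auto simp: True pull_to_spec pre_to_spec intro!: eq0)
    next
      case False
      then have V: "V = UNIV" using unit_sets by blast
      interpret B: kalgebra "sect X (pre X ?t UNIV)" K using X.alg op by simp
      show ?thesis unfolding V
        by (rule alg_homI) (auto simp: pull_to_spec B.sm_l_distr B.sm_mult B.sm_mult2 mult.commute
          simp flip: B.sm_assoc)
    qed
    fix s x assume s: "s \<in> carrier (sect (spec_field K) V)" and x: "x \<in> pre X ?t V"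
      and i: "invertible_at X x (pre X ?t V) (pull ?t V s)"
    have V: "V = UNIV" using x unit_sets[of V] by (auto simp: pre_to_spec)
    have "s \<noteq> 0" using i X.local_zero[OF op[of V]] unfolding pull_to_spec by auto
    then have "s \<in> Units (sect (spec_field K) UNIV)" using s V units_kscalar[OF X.K_ground] by simp
    then show "invertible_at (spec_field K) (pmap ?t x) V s" unfolding V
      by (intro S.invertible_unit) auto
  next
    fix V W :: "unit set" and s assume VW: "opn (spec_field K) V \<and> opn (spec_field K) W \<and> W \<subseteq> V" and s: "s \<in> carrier (sect (spec_field K) V)"
    interpret A: kalgebra "sect X (pre X ?t V)" K using X.alg op by simp
    interpret B: kalgebra "sect X (pre X ?t W)" K using X.alg op by simp
    have sub: "pre X ?t W \<subseteq> pre X ?t V" using VW by (intro pre_mono) simp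
    have sK: "s \<in> K" by (rule cl[OF s])
    show "pull ?t W (restr (spec_field K) V W s) = restr X (pre X ?t V) (pre X ?t W) (pull ?t V s)"
    proof (cases "W = {}")
      case True
      then have e: "pre X ?t W = {}" by (simp add: pre_to_spec)
      have "pull ?t W (restr (spec_field K) V W s) \<in> carrier (sect X (pre X ?t W))"
        unfolding pull_to_spec by (intro B.sm_closed B.one_closed) (simp add: True)
      moreover have "pull ?t V s \<in> carrier (sect X (pre X ?t V))"
        unfolding pull_to_spec using sK by simp
      then have "restr X (pre X ?t V) (pre X ?t W) (pull ?t V s) \<in> carrier (sect X (pre X ?t W))"
        by (rule X.restr_closed[OF op op sub])
      ultimately show ?thesis using eq0 unfolding e by blast
    next
      case False
      then have W: "W = UNIV" using unit_sets by blast
      then have V: "V = UNIV" using VW by blast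
      interpret C: kalgebra "sect X (pre X ?t UNIV)" K using X.alg op by simp
      show ?thesis using X.restr_id[OF op[of UNIV], of "s \<odot>\<^bsub>sect X (pre X ?t UNIV)\<^esub> \<one>\<^bsub>sect X (pre X ?t UNIV)\<^esub>"] sK
        unfolding V W pull_to_spec by simp
    qed
  qed
  then show ?thesis by (intro kmorphismI X.ksheaf_axioms S.ksheaf_axioms)
qed

text \<open>Pull-backs are K-linear and preserve 1, hence constants go to constants.\<close>

lemma to_spec_unique:
  assumes f: "kmorphism K T X f" and "locally_ringed K X" "locally_ringed K T"
  shows "mor_eq T (spec_field K) (mcomp X (to_spec_field X) f) (to_spec_field T)"
proof -
  interpret f: kmorphism K T X f by fact
  interpret X: locally_ringed K X by fact
  interpret t: kmorphism K X "spec_field K" "to_spec_field X" by (rule to_spec_field_morphism[OF assms(2)])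
  have pre: "pre T f (pre X (to_spec_field X) V) = pre T (to_spec_field T) V" for V
    unfolding pre_to_spec using f.pre_pts by (auto simp: pre_def)
  have "pull f (pre X (to_spec_field X) V) (pull (to_spec_field X) V s) = pull (to_spec_field T) V s"
    if s: "s \<in> carrier (sect (spec_field K) V)" for V s
  proof -
    have o: "opn X (pre X (to_spec_field X) V)" by (simp add: pre_to_spec)
    interpret p: kalgebra_hom "sect X (pre X (to_spec_field X) V)" "sect T (pre T f (pre X (to_spec_field X) V))" K
      "pull f (pre X (to_spec_field X) V)" by (rule f.pull_khom[OF o])
    have "s \<in> K" using s unit_sets[of V] ground_closed(1)[OF ksheaf.K_ground[OF locally_ringed.axioms(1)[OF assms(2)]]] by auto
    then show ?thesis unfolding pull_to_spec pre[symmetric] by simp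
  qed
  then show ?thesis by (simp add: mor_eq_def)
qed

lemma to_spec_field_spec:
  assumes "K = \<real> \<or> K = UNIV"
  shows "mor_eq (spec_field K) (spec_field K) (to_spec_field (spec_field K)) mid"
proof -
  have "pull (to_spec_field (spec_field K)) V s = s" if "s \<in> carrier (sect (spec_field K) V)" for V s
    using that unit_sets[of V] unfolding pull_to_spec pre_to_spec by auto
  then show ?thesis by (simp add: mor_eq_def)
qed

lemma K_point_iff:
  assumes "ksheaf K G"
  shows "g \<in> K_points K G \<longleftrightarrow> kmorphism K (spec_field K) G g"
  using kmorphismI[OF locally_ringed.axioms(1)[OF locally_ringed_spec_field[OF ksheaf.K_ground[OF assms]]] assms] kmorphism.mor
  unfolding K_points_def by blast

lemma const_mor_morphism:
  assumes "locally_ringed K X" "kmorphism K (spec_field K) G g"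
  shows "kmorphism K X G (const_mor K X g)"
  unfolding const_mor_def by (rule morphism_mcomp[OF to_spec_field_morphism[OF assms(1)] assms(2)])

lemma const_mor_mcomp:
  assumes f: "kmorphism K T X f" and X: "locally_ringed K X" and T: "locally_ringed K T"
    and g: "kmorphism K (spec_field K) G g"
  shows "mor_eq T G (mcomp X (const_mor K X g) f) (const_mor K T g)"
  unfolding const_mor_def mcomp_assoc[OF to_spec_field_morphism[OF X] f, symmetric]
  by (rule mor_eq_mcomp_right[OF to_spec_unique[OF f X T] g])

lemma const_mor_cong:
  assumes "locally_ringed K X" "mor_eq (spec_field K) G g g'"
  shows "mor_eq X G (const_mor K X g) (const_mor K X g')"
  unfolding const_mor_def by (rule mor_eq_mcomp_left[OF assms(2) to_spec_field_morphism[OF assms(1)]])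

section \<open>Operations m(f, g) built from pairings, and their compatibility with
  composition\<close>

context kproduct
begin

lemma app_morphism:
  assumes "locally_ringed K T" "kmorphism K T X f" "kmorphism K T Y g" "kmorphism K (pobj P) Z m"
  shows "kmorphism K T Z (mcomp (pobj P) m (pairing K T X Y P f g))"
  by (rule morphism_mcomp[OF pairing_props(1)[OF assms(1-3)] assms(4)])

lemma app_cong:
  assumes T: "locally_ringed K T" and f: "kmorphism K T X f" "kmorphism K T X f'"
    and g: "kmorphism K T Y g" "kmorphism K T Y g'" and m: "kmorphism K (pobj P) Z m"
    and "mor_eq T X f f'" "mor_eq T Y g g'"
  shows "mor_eq T Z (mcomp (pobj P) m (pairing K T X Y P f g)) (mcomp (pobj P) m (pairing K T X Y P f' g'))"
proof (rule mor_eq_mcomp_right[OF _ m])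
  show "mor_eq T (pobj P) (pairing K T X Y P f g) (pairing K T X Y P f' g')"
    by (rule pairing_eqI[OF T f(2) g(2) pairing_props(1)[OF T f(1) g(1)]])
      (rule mor_eq_trans[OF pairing_props(2)[OF T f(1) g(1)] assms(7)],
       rule mor_eq_trans[OF pairing_props(3)[OF T f(1) g(1)] assms(8)])
qed

lemma pairing_mcomp:
  assumes T: "locally_ringed K T" and S: "locally_ringed K S"
    and f: "kmorphism K T X f" and g: "kmorphism K T Y g" and u: "kmorphism K S T u"
  shows "mor_eq S (pobj P) (mcomp T (pairing K T X Y P f g) u) (pairing K S X Y P (mcomp T f u) (mcomp T g u))"
proof (rule pairing_eqI[OF S morphism_mcomp[OF u f] morphism_mcomp[OF u g]])
  note p = pairing_props[OF T f g]
  show "kmorphism K S (pobj P) (mcomp T (pairing K T X Y P f g) u)" by (rule morphism_mcomp[OF u p(1)])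
  show "mor_eq S X (mcomp (pobj P) (prl P) (mcomp T (pairing K T X Y P f g) u)) (mcomp T f u)"
    unfolding mcomp_assoc[OF p(1) u] by (rule mor_eq_mcomp_left[OF p(2) u])
  show "mor_eq S Y (mcomp (pobj P) (prr P) (mcomp T (pairing K T X Y P f g) u)) (mcomp T g u)"
    unfolding mcomp_assoc[OF p(1) u] by (rule mor_eq_mcomp_left[OF p(3) u])
qed

lemma app_mcomp:
  assumes T: "locally_ringed K T" and S: "locally_ringed K S"
    and f: "kmorphism K T X f" and g: "kmorphism K T Y g" and u: "kmorphism K S T u"
    and m: "kmorphism K (pobj P) Z m"
  shows "mor_eq S Z (mcomp T (mcomp (pobj P) m (pairing K T X Y P f g)) u)
    (mcomp (pobj P) m (pairing K S X Y P (mcomp T f u) (mcomp T g u)))"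
  unfolding mcomp_assoc[OF pairing_props(1)[OF T f g] u, symmetric]
  by (rule mor_eq_mcomp_right[OF pairing_mcomp[OF T S f g u] m])

end

section \<open>The action of rational points and its orbits\<close>

locale kaction =
  fixes K :: "complex set" and X :: "('x, 'd) kspace" and G :: "('g, 'a, 'm, 'b, 'n, 'c) kgroup"
    and XG :: "('r, 'e, 'x, 'd, 'g, 'a) kprod" and XGG :: "('t, 'f, 'r, 'e, 'g, 'a) kprod"
    and A :: "('r, 'e, 'x, 'd) kmor"
  assumes gr: "K = \<real> \<or> K = UNIV" and algX: "algebraic_scheme K X" and algG: "algebraic_group K G"
    and action: "algebraic_action K X G XG XGG A"
begin

lemmas G_props = algG[unfolded algebraic_group_def Let_def]
lemmas A_props = action[unfolded algebraic_action_def Let_def]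

sublocale X: kscheme K X
  using algX gr by unfold_locales (auto simp: algebraic_scheme_def)

sublocale G: kscheme K "gspc G"
  using G_props gr by unfold_locales (auto simp: algebraic_scheme_def)

sublocale GG: kproduct K "gspc G" "gspc G" "gsq G"
  using G_props by unfold_locales blast

sublocale XG: kproduct K X "gspc G" XG
  using A_props by unfold_locales blast

sublocale XGG: kproduct K "pobj XG" "gspc G" XGG
  using A_props by unfold_locales blast

sublocale A: kmorphism K "pobj XG" X A
  using A_props by (intro kmorphismI XG.Z.ksheaf_axioms X.ksheaf_axioms) blast

lemma S_lr: "locally_ringed K (spec_field K)"
  by (rule locally_ringed_spec_field[OF gr])

lemma mul_mor: "kmorphism K (pobj (gsq G)) (gspc G) (gmul G)"
  using G_props by (intro kmorphismI GG.Z.ksheaf_axioms G.ksheaf_axioms) blast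

lemma inv_mor: "kmorphism K (gspc G) (gspc G) (ginv G)"
  using G_props by (intro kmorphismI G.ksheaf_axioms) blast

lemma one_point: "gone G \<in> K_points K (gspc G)"
  using G_props by blast

lemma point_iff: "g \<in> K_points K (gspc G) \<longleftrightarrow> kmorphism K (spec_field K) (gspc G) g"
  by (rule K_point_iff[OF G.ksheaf_axioms])

lemmas A_mor = A.kmorphism_axioms
lemmas X_lr = X.locally_ringed_axioms
lemmas G_lr = G.locally_ringed_axioms
lemmas mid_X = morphism_mid[OF X.ksheaf_axioms]
lemmas mid_G = morphism_mid[OF G.ksheaf_axioms]

lemma aprod_unfold:
  "aprod K X G XG A T f g = mcomp (pobj XG) A (pairing K T X (gspc G) XG f g)"
  by (simp add: aprod_def)

lemma gprod_unfold:
  "gprod K G T f g = mcomp (pobj (gsq G)) (gmul G) (pairing K T (gspc G) (gspc G) (gsq G) f g)"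
  by (simp add: gprod_def gpair_def)

lemmas aprod_mor = XG.app_morphism[OF _ _ _ A_mor, folded aprod_unfold]
lemmas aprod_cong = XG.app_cong[OF _ _ _ _ _ A_mor, folded aprod_unfold]
lemmas aprod_mcomp = XG.app_mcomp[OF _ _ _ _ _ A_mor, folded aprod_unfold]
lemmas gprod_mor = GG.app_morphism[OF _ _ _ mul_mor, folded gprod_unfold]
lemmas gprod_cong = GG.app_cong[OF _ _ _ _ _ mul_mor, folded gprod_unfold]
lemmas gprod_mcomp = GG.app_mcomp[OF _ _ _ _ _ mul_mor, folded gprod_unfold]

text \<open>The axiom of an action concerns the three projections of (X x G) x G, the universal
  triple. An arbitrary triple is obtained from it by composing with a morphism into this
  product.\<close>

lemma aprod_assoc:
  assumes T: "locally_ringed K T" and f: "kmorphism K T X f" and g: "kmorphism K T (gspc G) g"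
    and h: "kmorphism K T (gspc G) h"
  shows "mor_eq T X (aprod K X G XG A T (aprod K X G XG A T f g) h) (aprod K X G XG A T f (gprod K G T g h))"
proof -
  let ?W = "pobj XGG" and ?ap = "aprod K X G XG A"
  let ?x = "mcomp (pobj XG) (prl XG) (prl XGG)" and ?g = "mcomp (pobj XG) (prr XG) (prl XGG)" and ?h = "prr XGG"
  note W = XGG.Z.locally_ringed_axioms
  have x: "kmorphism K ?W X ?x" by (rule morphism_mcomp[OF XGG.l.kmorphism_axioms XG.l.kmorphism_axioms])
  have g0: "kmorphism K ?W (gspc G) ?g" by (rule morphism_mcomp[OF XGG.l.kmorphism_axioms XG.r.kmorphism_axioms])
  note h0 = XGG.r.kmorphism_axioms
  let ?p = "pairing K T X (gspc G) XG f g"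
  note p = XG.pairing_props[OF T f g]
  \<comment> \<open>The morphism ((f, g), h) from T into (X x G) x G.\<close>
  define u where "u = pairing K T (pobj XG) (gspc G) XGG ?p h"
  note u = XGG.pairing_props[OF T p(1) h, folded u_def]
  have ax: "mor_eq ?W X (?ap ?W (?ap ?W ?x ?g) ?h) (?ap ?W ?x (gprod K G ?W ?g ?h))"
    using A_props by blast
  have xu: "mor_eq T X (mcomp ?W ?x u) f"
    unfolding mcomp_assoc[OF XGG.l.kmorphism_axioms u(1), symmetric]
    by (rule mor_eq_trans[OF mor_eq_mcomp_right[OF u(2) XG.l.kmorphism_axioms] p(2)])
  have gu: "mor_eq T (gspc G) (mcomp ?W ?g u) g"
    unfolding mcomp_assoc[OF XGG.l.kmorphism_axioms u(1), symmetric]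
    by (rule mor_eq_trans[OF mor_eq_mcomp_right[OF u(2) XG.r.kmorphism_axioms] p(3)])
  note hu = u(3)
  note xu' = morphism_mcomp[OF u(1) x] and gu' = morphism_mcomp[OF u(1) g0] and hu' = morphism_mcomp[OF u(1) h0]
  have 1: "mor_eq T X (mcomp ?W (?ap ?W (?ap ?W ?x ?g) ?h) u) (?ap T (mcomp ?W (?ap ?W ?x ?g) u) (mcomp ?W ?h u))"
    by (rule aprod_mcomp[OF W T aprod_mor[OF W x g0] h0 u(1)])
  have 2: "mor_eq T X (mcomp ?W (?ap ?W ?x ?g) u) (?ap T f g)"
    by (rule mor_eq_trans[OF aprod_mcomp[OF W T x g0 u(1)] aprod_cong[OF T xu' f gu' g xu gu]])
  have 3: "mor_eq T X (?ap T (mcomp ?W (?ap ?W ?x ?g) u) (mcomp ?W ?h u)) (?ap T (?ap T f g) h)"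
    by (rule aprod_cong[OF T morphism_mcomp[OF u(1) aprod_mor[OF W x g0]] aprod_mor[OF T f g] hu' h 2 hu])
  have 4: "mor_eq T X (mcomp ?W (?ap ?W ?x (gprod K G ?W ?g ?h)) u) (?ap T (mcomp ?W ?x u) (mcomp ?W (gprod K G ?W ?g ?h) u))"
    by (rule aprod_mcomp[OF W T x gprod_mor[OF W g0 h0] u(1)])
  have 5: "mor_eq T (gspc G) (mcomp ?W (gprod K G ?W ?g ?h) u) (gprod K G T g h)"
    by (rule mor_eq_trans[OF gprod_mcomp[OF W T g0 h0 u(1)] gprod_cong[OF T gu' g hu' h gu hu]])
  have 6: "mor_eq T X (?ap T (mcomp ?W ?x u) (mcomp ?W (gprod K G ?W ?g ?h) u)) (?ap T f (gprod K G T g h))"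
    by (rule aprod_cong[OF T xu' f morphism_mcomp[OF u(1) gprod_mor[OF W g0 h0]] gprod_mor[OF T g h] xu 5])
  from mor_eq_trans[OF mor_eq_sym[OF mor_eq_trans[OF 1 3]] mor_eq_trans[OF mor_eq_mcomp_left[OF ax u(1)] mor_eq_trans[OF 4 6]]]
  show ?thesis .
qed

abbreviation rho :: "('g, 'a) kpoint \<Rightarrow> ('x, 'd, 'x, 'd) kmor" where
  "rho g \<equiv> act_by K X G XG A g"

abbreviation "spt \<equiv> K_points K (gspc G)"

lemma const_X: "g \<in> spt \<Longrightarrow> kmorphism K X (gspc G) (const_mor K X g)"
  unfolding point_iff by (rule const_mor_morphism[OF X_lr])

lemma rho_mor: "g \<in> spt \<Longrightarrow> kmorphism K X X (rho g)"
  unfolding act_by_def by (rule aprod_mor[OF X_lr mid_X const_X])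

lemma rho_cong:
  assumes "g \<in> spt" "g' \<in> spt" "mor_eq (spec_field K) (gspc G) g g'"
  shows "mor_eq X X (rho g) (rho g')"
  unfolding act_by_def
  by (rule aprod_cong[OF X_lr mid_X mid_X const_X[OF assms(1)] const_X[OF assms(2)] mor_eq_refl const_mor_cong[OF X_lr assms(3)]])

lemma rho_one: "mor_eq X X (rho (gone G)) mid"
  unfolding act_by_def using A_props by blast

lemma gprod_point: "g \<in> spt \<Longrightarrow> h \<in> spt \<Longrightarrow> gprod K G (spec_field K) g h \<in> spt"
  unfolding point_iff by (rule gprod_mor[OF S_lr])

text \<open>G acts from the right, so acting by g and then by h is the action of the product g h in
  this order.\<close>

lemma rho_rho:
  assumes g: "g \<in> spt" and h: "h \<in> spt"
  shows "mor_eq X X (mcomp X (rho h) (rho g)) (rho (gprod K G (spec_field K) g h))"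
proof -
  let ?c = "const_mor K X" and ?ap = "aprod K X G XG A X"
  note rg = rho_mor[OF g] and cg = const_X[OF g] and ch = const_X[OF h]
  have g': "kmorphism K (spec_field K) (gspc G) g" and h': "kmorphism K (spec_field K) (gspc G) h"
    using g h unfolding point_iff .
  have 1: "mor_eq X X (mcomp X (rho h) (rho g)) (?ap (mcomp X mid (rho g)) (mcomp X (?c h) (rho g)))"
    using aprod_mcomp[OF X_lr X_lr mid_X ch rg] unfolding act_by_def[of K X G XG A h] .
  have 2: "mor_eq X X (?ap (mcomp X mid (rho g)) (mcomp X (?c h) (rho g))) (?ap (rho g) (?c h))"
    by (rule aprod_cong[OF X_lr morphism_mcomp[OF rg mid_X] rg morphism_mcomp[OF rg ch] ch
      mcomp_mid_left[OF rg] const_mor_mcomp[OF rg X_lr X_lr h']])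
  have 3: "mor_eq X X (?ap (rho g) (?c h)) (?ap mid (gprod K G X (?c g) (?c h)))"
    unfolding act_by_def[of K X G XG A g] by (rule aprod_assoc[OF X_lr mid_X cg ch])
  have 4: "mor_eq X (gspc G) (gprod K G X (?c g) (?c h)) (?c (gprod K G (spec_field K) g h))"
    unfolding const_mor_def
    by (rule mor_eq_sym[OF gprod_mcomp[OF S_lr X_lr g' h' to_spec_field_morphism[OF X_lr]]])
  have 5: "mor_eq X X (?ap mid (gprod K G X (?c g) (?c h))) (rho (gprod K G (spec_field K) g h))"
    unfolding act_by_def
    by (rule aprod_cong[OF X_lr mid_X mid_X gprod_mor[OF X_lr cg ch] const_X[OF gprod_point[OF g h]] mor_eq_refl 4])
  show ?thesis by (rule mor_eq_trans[OF 1 mor_eq_trans[OF 2 mor_eq_trans[OF 3 5]]])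
qed

text \<open>The inverse point, through the law g g^(-1) = e for the universal point of G composed
  with g. A left inverse of the automorphism is enough to show that moving a point does not change
  its orbit.\<close>

lemma rho_inverse:
  assumes g: "g \<in> spt"
  shows "\<exists>h\<in>spt. mor_eq X X (mcomp X (rho h) (rho g)) mid"
proof
  let ?h = "mcomp (gspc G) (ginv G) g"
  have g': "kmorphism K (spec_field K) (gspc G) g" using g unfolding point_iff .
  have h': "kmorphism K (spec_field K) (gspc G) ?h" by (rule morphism_mcomp[OF g' inv_mor])
  show h: "?h \<in> spt" unfolding point_iff by (rule h')
  have e': "kmorphism K (spec_field K) (gspc G) (gone G)" using one_point unfolding point_iff .
  have ax: "mor_eq (gspc G) (gspc G) (gprod K G (gspc G) mid (ginv G)) (const_mor K (gspc G) (gone G))"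
    using G_props by blast
  have 1: "mor_eq (spec_field K) (gspc G) (mcomp (gspc G) (gprod K G (gspc G) mid (ginv G)) g) (gprod K G (spec_field K) (mcomp (gspc G) mid g) ?h)"
    by (rule gprod_mcomp[OF G_lr S_lr mid_G inv_mor g'])
  have 2: "mor_eq (spec_field K) (gspc G) (gprod K G (spec_field K) (mcomp (gspc G) mid g) ?h) (gprod K G (spec_field K) g ?h)"
    by (rule gprod_cong[OF S_lr morphism_mcomp[OF g' mid_G] g' h' h' mcomp_mid_left[OF g'] mor_eq_refl])
  have 3: "mor_eq (spec_field K) (gspc G) (mcomp (gspc G) (const_mor K (gspc G) (gone G)) g) (const_mor K (spec_field K) (gone G))"
    by (rule const_mor_mcomp[OF g' G_lr S_lr e'])
  have 4: "mor_eq (spec_field K) (gspc G) (const_mor K (spec_field K) (gone G)) (gone G)"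
    unfolding const_mor_def
    by (rule mor_eq_trans[OF mor_eq_mcomp_right[OF to_spec_field_spec[OF gr] e'] mcomp_mid_right[OF e']])
  have "mor_eq (spec_field K) (gspc G) (gprod K G (spec_field K) g ?h) (gone G)"
    by (rule mor_eq_trans[OF mor_eq_sym[OF mor_eq_trans[OF 1 2]] mor_eq_trans[OF mor_eq_mcomp_left[OF ax g'] mor_eq_trans[OF 3 4]]])
  from rho_cong[OF gprod_point[OF g h] one_point this]
  show "mor_eq X X (mcomp X (rho ?h) (rho g)) mid"
    using mor_eq_trans[OF rho_rho[OF g h] mor_eq_trans[OF _ rho_one]] by blast
qed

lemma orbit_rho:
  assumes g: "g \<in> spt" and x: "x \<in> pts X"
  shows "orbit K X G XG A (pmap (rho g) x) = orbit K X G XG A x"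
proof -
  have sub: "orbit K X G XG A (pmap (rho g) x) \<subseteq> orbit K X G XG A x" if g: "g \<in> spt" and x: "x \<in> pts X" for g x
  proof
    fix y assume "y \<in> orbit K X G XG A (pmap (rho g) x)"
    then obtain h where h: "h \<in> spt" "y = pmap (rho h) (pmap (rho g) x)" unfolding orbit_def by blast
    have "y = pmap (rho (gprod K G (spec_field K) g h)) x"
      using mor_eq_pmap[OF rho_rho[OF g h(1)] x] h(2) by simp
    then show "y \<in> orbit K X G XG A x" using gprod_point[OF g h(1)] unfolding orbit_def by blast
  qed
  from rho_inverse[OF g] obtain h where h: "h \<in> spt" "mor_eq X X (mcomp X (rho h) (rho g)) mid" by blast
  have "pmap (rho g) x \<in> pts X" using kmorphism.pmap_in[OF rho_mor[OF g] x] .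
  from sub[OF h(1) this] have "orbit K X G XG A x \<subseteq> orbit K X G XG A (pmap (rho g) x)"
    using mor_eq_pmap[OF h(2) x] by simp
  then show ?thesis using sub[OF g x] by blast
qed

text \<open>Over a union of orbits the pull-back by g is an endomorphism of a single algebra of
  sections, so that invariance of a section is a meaningful equation.\<close>

lemma pre_rho_saturated:
  assumes "g \<in> spt"
  shows "pre X (rho g) {x \<in> pts X. orbit K X G XG A x \<in> W} = {x \<in> pts X. orbit K X G XG A x \<in> W}"
  using orbit_rho[OF assms] kmorphism.pmap_in[OF rho_mor[OF assms]] by (auto simp: pre_def)

end

section \<open>Invariant functions are annihilated by the infinitesimal action\<close>

lemma linear_on_finsum:
  assumes "kalgebra A K" "kalgebra B K" and D: "linear_on K A B D" and S: "finite S" "f \<in> S \<rightarrow> carrier A"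
  shows "D (\<Oplus>\<^bsub>A\<^esub>a\<in>S. f a) = (\<Oplus>\<^bsub>B\<^esub>a\<in>S. D (f a))"
proof -
  interpret A: kalgebra A K by fact
  interpret B: kalgebra B K by fact
  have Dc: "D a \<in> carrier B" and Da: "b \<in> carrier A \<Longrightarrow> D (a \<oplus>\<^bsub>A\<^esub> b) = D a \<oplus>\<^bsub>B\<^esub> D b" if "a \<in> carrier A" for a b
    using D that by (auto simp: linear_on_def)
  have "D \<zero>\<^bsub>A\<^esub> = D \<zero>\<^bsub>A\<^esub> \<oplus>\<^bsub>B\<^esub> D \<zero>\<^bsub>A\<^esub>" using Da[of "\<zero>\<^bsub>A\<^esub>" "\<zero>\<^bsub>A\<^esub>"] by simp
  then have D0: "D \<zero>\<^bsub>A\<^esub> = \<zero>\<^bsub>B\<^esub>" by (metis Dc B.add.l_cancel_one A.zero_closed)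
  show ?thesis using S
  proof (induction S)
    case empty then show ?case by (simp add: D0)
  next
    case (insert x F)
    have fx: "f x \<in> carrier A" "f \<in> F \<rightarrow> carrier A" "(\<lambda>a. D (f a)) \<in> F \<rightarrow> carrier B"
      using insert.prems Dc by (auto simp: Pi_iff)
    then show ?case using insert Dc by (simp add: A.finsum_insert B.finsum_insert Da A.finsum_closed)
  qed
qed

lemma linear_on_minus:
  assumes "kalgebra A K" "kalgebra B K" and D: "linear_on K A B D" and ab: "a \<in> carrier A" "b \<in> carrier A"
  shows "D (a \<ominus>\<^bsub>A\<^esub> b) = D a \<ominus>\<^bsub>B\<^esub> D b"
proof -
  interpret A: kalgebra A K by fact
  interpret B: kalgebra B K by fact
  have Dc: "D c \<in> carrier B" if "c \<in> carrier A" for c using D that by (auto simp: linear_on_def)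
  have "D ((a \<ominus>\<^bsub>A\<^esub> b) \<oplus>\<^bsub>A\<^esub> b) = D (a \<ominus>\<^bsub>A\<^esub> b) \<oplus>\<^bsub>B\<^esub> D b"
    using D ab A.minus_closed[OF ab] unfolding linear_on_def by blast
  moreover have "(a \<ominus>\<^bsub>A\<^esub> b) \<oplus>\<^bsub>A\<^esub> b = a" using ab by (simp add: a_minus_def A.a_assoc A.l_neg)
  ultimately have "D a = D (a \<ominus>\<^bsub>A\<^esub> b) \<oplus>\<^bsub>B\<^esub> D b" by simp
  then show ?thesis using Dc ab A.minus_closed[OF ab] by (simp add: a_minus_def B.a_assoc B.r_neg)
qed

lemma (in ksheaf) vector_field_props:
  assumes D: "vector_field K X D" and U: "opn X U"
  shows "linear_on K (sect X U) (sect X U) (D U)"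
    "a \<in> carrier (sect X U) \<Longrightarrow> D U a \<in> carrier (sect X U)"
    "a \<in> carrier (sect X U) \<Longrightarrow> b \<in> carrier (sect X U) \<Longrightarrow>
      D U (a \<otimes>\<^bsub>sect X U\<^esub> b) = D U a \<otimes>\<^bsub>sect X U\<^esub> b \<oplus>\<^bsub>sect X U\<^esub> a \<otimes>\<^bsub>sect X U\<^esub> D U b"
    "opn X V \<Longrightarrow> V \<subseteq> U \<Longrightarrow> a \<in> carrier (sect X U) \<Longrightarrow> D V (restr X U V a) = restr X U V (D U a)"
proof -
  note d = D[unfolded vector_field_def]
  have u: "linear_on K (sect X U) (sect X U) (D U) \<and>
        (\<forall>a\<in>carrier (sect X U). \<forall>b\<in>carrier (sect X U). D U (a \<otimes>\<^bsub>sect X U\<^esub> b) =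
           (D U a \<otimes>\<^bsub>sect X U\<^esub> b) \<oplus>\<^bsub>sect X U\<^esub> (a \<otimes>\<^bsub>sect X U\<^esub> D U b))"
    by (rule d[THEN conjunct2, THEN conjunct1, rule_format, OF U])
  show l: "linear_on K (sect X U) (sect X U) (D U)" using u by (rule conjunct1)
  show "D U a \<in> carrier (sect X U)" if "a \<in> carrier (sect X U)" using l that by (auto simp: linear_on_def)
  show "D U (a \<otimes>\<^bsub>sect X U\<^esub> b) = D U a \<otimes>\<^bsub>sect X U\<^esub> b \<oplus>\<^bsub>sect X U\<^esub> a \<otimes>\<^bsub>sect X U\<^esub> D U b"
    if "a \<in> carrier (sect X U)" "b \<in> carrier (sect X U)" using u that by blast
  show "D V (restr X U V a) = restr X U V (D U a)" if "opn X V" "V \<subseteq> U" "a \<in> carrier (sect X U)"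
    by (rule d[THEN conjunct2, THEN conjunct2, rule_format]) (use that U in auto)
qed

text \<open>A single chart with source \<open>spec_field K\<close> is glued. This turns the
  functionals of the flow into honest points of G.\<close>

lemma (in kscheme) rational_point_ex:
  assumes V: "affine_open X V" and p: "alg_hom K (sect X V) (kscalar K) p"
  obtains g where "g \<in> K_points K X" "pmap g () \<in> V" "\<And>b. b \<in> carrier (sect X V) \<Longrightarrow> pull g V b = p b"
proof -
  interpret S: locally_ringed K "spec_field K" by (rule locally_ringed_spec_field[OF ground])
  obtain g where g: "kmorphism K (spec_field K) X g"
    and gV: "\<And>W S \<phi>. (W, S, \<phi>) \<in> {(V, UNIV, p)} \<Longrightarrow> S \<subseteq> pre (spec_field K) g W"
    and gp: "\<And>W S \<phi> s. (W, S, \<phi>) \<in> {(V, UNIV, p)} \<Longrightarrow> s \<in> carrier (sect X W) \<Longrightarrow>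
      restr (spec_field K) (pre (spec_field K) g W) S (pull g W s) = \<phi> s"
  proof (rule charts_morphism[OF S.locally_ringed_axioms ksheaf_axioms, of "{(V, UNIV, p)}"])
    fix W S \<phi> assume "(W, S, \<phi>) \<in> {(V, UNIV :: unit set, p)}"
    then show "affine_open X W \<and> opn (spec_field K) S \<and> alg_hom K (sect X W) (sect (spec_field K) S) \<phi>"
      using V p by simp
  next
    fix W S \<phi> W' S' \<phi>' and t :: unit
    assume i: "(W, S, \<phi>) \<in> {(V, UNIV :: unit set, p)}" "(W', S', \<phi>') \<in> {(V, UNIV :: unit set, p)}"
    have "chart_le X (spec_field K) (V, UNIV, p) (V, UNIV, p)"
      unfolding chart_le_def using affine_opn[OF V] by simp
    then show "\<exists>W'' S'' \<phi>''. (W'', S'', \<phi>'') \<in> {(V, UNIV, p)} \<and> t \<in> S'' \<and>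
        chart_le X (spec_field K) (W'', S'', \<phi>'') (W, S, \<phi>) \<and> chart_le X (spec_field K) (W'', S'', \<phi>'') (W', S', \<phi>')"
      using i by auto
  next
    fix g assume "kmorphism K (spec_field K) X g"
      "\<And>W S \<phi>. (W, S, \<phi>) \<in> {(V, UNIV, p)} \<Longrightarrow> S \<subseteq> pre (spec_field K) g W"
      "\<And>W S \<phi> s. (W, S, \<phi>) \<in> {(V, UNIV, p)} \<Longrightarrow> s \<in> carrier (sect X W) \<Longrightarrow>
        restr (spec_field K) (pre (spec_field K) g W) S (pull g W s) = \<phi> s"
    then show thesis by (rule that)
  qed auto
  show ?thesis
  proof (rule that)
    show "g \<in> K_points K X" using g unfolding K_point_iff[OF ksheaf_axioms] .
    show "pmap g () \<in> V" using gV[of V UNIV p] by (auto simp: pre_def split: if_splits)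
    show "pull g V b = p b" if "b \<in> carrier (sect X V)" for b using gp[OF _ that] by simp
  qed
qed

section \<open>Slices of the product X x G at rational points of G\<close>

context kaction
begin

text \<open>The morphism from x to (x, g). Followed by A it is the action of g; for the unit element
  it is the map along which \<open>infinitesimal_action\<close> pulls back.\<close>

definition slice :: "('g, 'a) kpoint \<Rightarrow> ('x, 'd, 'r, 'e) kmor" where
  "slice g = pairing K X X (gspc G) XG mid (const_mor K X g)"

lemma rho_slice: "rho g = mcomp (pobj XG) A (slice g)"
  by (simp add: act_by_def aprod_def slice_def)

text \<open>On an affine box U x V containing g in the second factor this is the homomorphism id
  \<otimes> ev_g to the sections over U, where ev_g is evaluation at g, called
  \<open>value_at g V\<close>.\<close>

definition slice_pull :: "('g, 'a) kpoint \<Rightarrow> 'x set \<Rightarrow> 'g set \<Rightarrow> 'e \<Rightarrow> 'd" where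
  "slice_pull g U V s = restr X (pre X (slice g) (XG.box U V)) U (pull (slice g) (XG.box U V) s)"

definition value_at :: "('g, 'a) kpoint \<Rightarrow> 'g set \<Rightarrow> 'a \<Rightarrow> complex" where
  "value_at g V b = pull g V b"

context
  fixes g assumes g: "g \<in> spt"
begin

lemmas slice_props = XG.pairing_props[OF X_lr mid_X const_X[OF g], folded slice_def]

interpretation s: kmorphism K X "pobj XG" "slice g" by (rule slice_props(1))

lemma pre_slice: "pre X (slice g) (pre (pobj XG) A U) = pre X (rho g) U"
  unfolding rho_slice by (rule pre_mcomp[OF slice_props(1), symmetric])

lemma slice_box:
  assumes U: "opn X U" and V: "pmap g () \<in> V"
  shows "U \<subseteq> pre X (slice g) (XG.box U V)"
proof
  fix x assume x: "x \<in> U"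
  then have xX: "x \<in> pts X" using openin_subset[OF U] by blast
  have "pmap (prl XG) (pmap (slice g) x) = x" "pmap (prr XG) (pmap (slice g) x) = pmap g ()"
    using mor_eq_pmap[OF slice_props(2) xX] mor_eq_pmap[OF slice_props(3) xX] by (simp_all add: const_mor_def)
  then show "x \<in> pre X (slice g) (XG.box U V)" using x xX V s.pmap_in[OF xX] by (simp add: pre_def XG.box_def)
qed

lemma value_hom:
  assumes V: "opn (gspc G) V" "pmap g () \<in> V"
  shows "alg_hom K (sect (gspc G) V) (kscalar K) (value_at g V)"
proof -
  interpret g: kmorphism K "spec_field K" "gspc G" g using g unfolding point_iff .
  have "pre (spec_field K) g V = UNIV" using V by (auto simp: pre_def)
  then show ?thesis using g.pull_hom[OF V(1)] by (simp add: value_at_def[abs_def])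
qed

context
  fixes U V assumes U: "affine_open X U" and V: "affine_open (gspc G) V" and gV: "pmap g () \<in> V"
begin

lemmas oU = X.affine_opn[OF U]
lemmas oV = G.affine_opn[OF V]
lemmas oB = XG.openin_box[OF oU oV]

lemma slice_pull_hom: "alg_hom K (sect (pobj XG) (XG.box U V)) (sect X U) (slice_pull g U V)"
  using XG.pull_box_hom[OF slice_props(1) U V oU slice_box[OF oU gV]]
  by (simp add: slice_pull_def[abs_def])

lemma slice_pull_inl: "a \<in> carrier (sect X U) \<Longrightarrow> slice_pull g U V (XG.inl U V a) = a"
proof -
  assume a: "a \<in> carrier (sect X U)"
  have "slice_pull g U V (XG.inl U V a) = restr X (pre X mid U) U (pull mid U a)"
    unfolding slice_pull_def XG.pull_inl[OF slice_props(1) oU oV oU slice_box[OF oU gV] a]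
      mor_eq_pull[OF slice_props(2) oU a] mor_eq_pre[OF slice_props(2)] ..
  also have "\<dots> = a" using oU a by (simp add: pre_mid)
  finally show ?thesis .
qed

lemma slice_pull_inr:
  "b \<in> carrier (sect (gspc G) V) \<Longrightarrow> slice_pull g U V (XG.inr U V b) = value_at g V b \<odot>\<^bsub>sect X U\<^esub> \<one>\<^bsub>sect X U\<^esub>"
proof -
  assume b: "b \<in> carrier (sect (gspc G) V)"
  interpret g: kmorphism K "spec_field K" "gspc G" g using g unfolding point_iff .
  have pg: "pre (spec_field K) g V = UNIV" using gV by (auto simp: pre_def)
  have vK: "value_at g V b \<in> K" using alg_hom_closed[OF value_hom[OF oV gV] b] by simp
  have pc: "pre X (const_mor K X g) V = pts X"
    unfolding const_mor_def pre_mcomp[OF to_spec_field_morphism[OF X_lr]] pg pre_to_spec by simp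
  have "slice_pull g U V (XG.inr U V b) = restr X (pre X (const_mor K X g) V) U (pull (const_mor K X g) V b)"
    unfolding slice_pull_def XG.pull_inr[OF slice_props(1) oU oV oU slice_box[OF oU gV] b]
      mor_eq_pull[OF slice_props(3) oV b] mor_eq_pre[OF slice_props(3)] ..
  also have "pull (const_mor K X g) V b = value_at g V b \<odot>\<^bsub>sect X (pts X)\<^esub> \<one>\<^bsub>sect X (pts X)\<^esub>"
    unfolding const_mor_def pull_mcomp pg pull_to_spec pre_to_spec by (simp add: value_at_def)
  also have "restr X (pre X (const_mor K X g) V) U (value_at g V b \<odot>\<^bsub>sect X (pts X)\<^esub> \<one>\<^bsub>sect X (pts X)\<^esub>) =
      value_at g V b \<odot>\<^bsub>sect X U\<^esub> \<one>\<^bsub>sect X U\<^esub>"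
  proof -
    interpret P: kalgebra "sect X (pts X)" K using X.alg by simp
    show ?thesis unfolding pc using oU openin_subset[OF oU] vK by (simp add: X.restr_simps)
  qed
  finally show ?thesis .
qed

text \<open>This brings restrictions to slices into the form of the sums in
  \<open>tensor_functional\<close>, with the functional \<open>value_at g V\<close>.\<close>

lemma slice_pull_sum:
  assumes S: "finite S" "S \<subseteq> carrier (sect X U)" and c: "c \<in> S \<rightarrow> carrier (sect (gspc G) V)"
  shows "slice_pull g U V (\<Oplus>\<^bsub>sect (pobj XG) (XG.box U V)\<^esub>a\<in>S. XG.inl U V a \<otimes>\<^bsub>sect (pobj XG) (XG.box U V)\<^esub> XG.inr U V (c a)) =
    (\<Oplus>\<^bsub>sect X U\<^esub>a\<in>S. value_at g V (c a) \<odot>\<^bsub>sect X U\<^esub> a)"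
proof -
  interpret B: kalgebra "sect (pobj XG) (XG.box U V)" K by (rule XG.Z.alg[OF oB])
  interpret C: kalgebra "sect X U" K by (rule X.alg[OF oU])
  interpret h: kalgebra_hom "sect (pobj XG) (XG.box U V)" "sect X U" K "slice_pull g U V"
    by unfold_locales (rule slice_pull_hom)
  have m: "(\<lambda>a. XG.inl U V a \<otimes>\<^bsub>sect (pobj XG) (XG.box U V)\<^esub> XG.inr U V (c a)) \<in> S \<rightarrow> carrier (sect (pobj XG) (XG.box U V))"
    using S c XG.inl_closed[OF oU oV] XG.inr_closed[OF oU oV] by (auto simp: Pi_iff subset_iff)
  show ?thesis unfolding h.hom_finsum[OF m] comp_def
  proof (rule C.finsum_cong')
    have vK: "value_at g V b \<in> K" if "b \<in> carrier (sect (gspc G) V)" for b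
      using alg_hom_closed[OF value_hom[OF oV gV] that] by simp
    show "(\<lambda>a. value_at g V (c a) \<odot>\<^bsub>sect X U\<^esub> a) \<in> S \<rightarrow> carrier (sect X U)"
      using S c vK by (auto simp: Pi_iff subset_iff)
    fix a assume "a \<in> S"
    then have a: "a \<in> carrier (sect X U)" "c a \<in> carrier (sect (gspc G) V)" using S c by auto
    then show "slice_pull g U V (XG.inl U V a \<otimes>\<^bsub>sect (pobj XG) (XG.box U V)\<^esub> XG.inr U V (c a)) = value_at g V (c a) \<odot>\<^bsub>sect X U\<^esub> a"
      using XG.inl_closed[OF oU oV a(1)] XG.inr_closed[OF oU oV a(2)] vK[OF a(2)]
      by (simp add: slice_pull_inl slice_pull_inr C.sm_mult2)
  qed simp
qed

text \<open>Where the denominator h is invertible on the slice, the slice stays inside D(h), so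
  fractions over D(h) may be pulled back there.\<close>

lemma slice_basic:
  assumes h: "h \<in> carrier (sect (pobj XG) (XG.box U V))"
  shows "basic X U (slice_pull g U V h) \<subseteq> pre X (slice g) (basic (pobj XG) (XG.box U V) h)"
proof
  fix x assume x: "x \<in> basic X U (slice_pull g U V h)"
  then have xU: "x \<in> U" by (rule subsetD[OF basic_subset])
  have "invertible_at X x (pre X (slice g) (XG.box U V)) (pull (slice g) (XG.box U V) h)"
    using x X.invertible_restr[OF s.openin_pre[OF oB] oU slice_box[OF oU gV] xU s.pull_closed[OF oB h]]
    unfolding in_basic_iff slice_pull_def by simp
  then have "x \<in> basic X (pre X (slice g) (XG.box U V)) (pull (slice g) (XG.box U V) h)" unfolding in_basic_iff .
  then show "x \<in> pre X (slice g) (basic (pobj XG) (XG.box U V) h)" unfolding s.pre_basic[OF oB h] .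
qed

lemma slice_pull_restr:
  assumes h: "h \<in> carrier (sect (pobj XG) (XG.box U V))" and N: "opn X N" "N \<subseteq> basic X U (slice_pull g U V h)"
    and s: "s \<in> carrier (sect (pobj XG) (XG.box U V))"
  defines "D \<equiv> basic (pobj XG) (XG.box U V) h"
  shows "restr X (pre X (slice g) D) N (pull (slice g) D (restr (pobj XG) (XG.box U V) D s)) =
    restr X U N (slice_pull g U V s)"
proof -
  have D: "opn (pobj XG) D" "D \<subseteq> XG.box U V" unfolding D_def by (rule XG.Z.openin_basic[OF oB h], rule basic_subset)
  have ND: "N \<subseteq> pre X (slice g) D" unfolding D_def using slice_basic[OF h] N(2) by blast
  have NU: "N \<subseteq> U" by (rule order_trans[OF N(2) basic_subset])
  have "restr X (pre X (slice g) D) N (pull (slice g) D (restr (pobj XG) (XG.box U V) D s)) =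
      restr X (pre X (slice g) (XG.box U V)) N (pull (slice g) (XG.box U V) s)"
    by (rule s.restr_pull[OF oB D N(1) ND s, symmetric])
  also have "\<dots> = restr X U N (slice_pull g U V s)" unfolding slice_pull_def
    by (rule X.restr_restr[OF s.openin_pre[OF oB] oU N(1) NU slice_box[OF oU gV] s.pull_closed[OF oB s], symmetric])
  finally show ?thesis .
qed

text \<open>The slice at g followed by A is the action of g, which fixes a. On the slice the
  pull-back of a along the action therefore looks like a itself.\<close>

lemma slice_pull_invariant:
  assumes W: "opn X W" "U \<subseteq> W" "pre X (rho g) W = W" and a: "a \<in> carrier (sect X W)" "pull (rho g) W a = a"
    and h: "h \<in> carrier (sect (pobj XG) (XG.box U V))" and N: "opn X N" "N \<subseteq> basic X U (slice_pull g U V h)"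
  defines "D \<equiv> basic (pobj XG) (XG.box U V) h"
  assumes DW: "D \<subseteq> pre (pobj XG) A W"
  shows "restr X (pre X (slice g) D) N (pull (slice g) D (restr (pobj XG) (pre (pobj XG) A W) D (pull A W a))) =
    restr X W N a"
proof -
  have D: "opn (pobj XG) D" "D \<subseteq> XG.box U V" unfolding D_def by (rule XG.Z.openin_basic[OF oB h], rule basic_subset)
  have ND: "N \<subseteq> pre X (slice g) D" unfolding D_def using slice_basic[OF h] N(2) by blast
  have "restr X (pre X (slice g) D) N (pull (slice g) D (restr (pobj XG) (pre (pobj XG) A W) D (pull A W a))) =
      restr X (pre X (slice g) (pre (pobj XG) A W)) N (pull (slice g) (pre (pobj XG) A W) (pull A W a))"
    by (rule s.restr_pull[OF A.openin_pre[OF W(1)] D(1) DW N(1) ND A.pull_closed[OF W(1) a(1)], symmetric])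
  also have "pull (slice g) (pre (pobj XG) A W) (pull A W a) = a"
    using a(2) unfolding rho_slice pull_mcomp .
  finally show ?thesis unfolding pre_slice W(3) .
qed

end

end

end

context kaction
begin

text \<open>The \<open>K\<close>-points on the flow of \<open>v\<close> through the unit element detect that the derivative of an
  invariant function vanishes. Near a point \<open>x\<close> one writes the function on \<open>X \<times> G\<close> as a fraction with
  numerator and denominator in a tensor product \<open>\<O>(U) \<otimes> \<O>(V)\<close>; all identities are
  obtained modulo the functions vanishing near \<open>x\<close>, which is why no uniform power of the denominator
  is needed.\<close>

theorem invariant_annihilated:
  assumes v: "vector_field K (gspc G) v" and lift: "vertical_lift K X (gspc G) XG v v'"
    and U: "opn X U" and sat: "\<And>g. g \<in> spt \<Longrightarrow> pre X (rho g) U = U"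
    and a: "a \<in> carrier (sect X U)" and inv: "\<And>g. g \<in> spt \<Longrightarrow> pull (rho g) U a = a"
  shows "pull (slice (gone G)) (pre (pobj XG) A U) (v' (pre (pobj XG) A U) (pull A U a)) = \<zero>\<^bsub>sect X U\<^esub>"
proof -
  let ?e = "gone G" and ?Z = "pobj XG" and ?AU = "pre (pobj XG) A U"
  note e = one_point
  interpret se: kmorphism K X ?Z "slice ?e" by (rule slice_props(1)[OF e])
  interpret ep: kmorphism K "spec_field K" "gspc G" ?e using e unfolding point_iff .
  have v': "vector_field K ?Z v'" using lift unfolding vertical_lift_def by blast
  have v'l: "v' (pre ?Z (prl XG) U) (pull (prl XG) U a) = \<zero>\<^bsub>sect ?Z (pre ?Z (prl XG) U)\<^esub>"
    if "opn X U" "a \<in> carrier (sect X U)" for U a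
    using lift that unfolding vertical_lift_def by blast
  have v'r: "v' (pre ?Z (prr XG) V) (pull (prr XG) V b) = pull (prr XG) V (v V b)"
    if "opn (gspc G) V" "b \<in> carrier (sect (gspc G) V)" for V b
    using lift that unfolding vertical_lift_def by blast
  note v'p = XG.Z.vector_field_props[OF v']
  have AU: "opn ?Z ?AU" using U by simp
  have preU: "pre X (slice ?e) ?AU = U" using pre_slice[OF e] sat[OF e] by simp
  have Aa: "pull A U a \<in> carrier (sect ?Z ?AU)" using U a by simp
  have vAa: "v' ?AU (pull A U a) \<in> carrier (sect ?Z ?AU)" by (rule v'p(2)[OF AU Aa])
  let ?y = "pull (slice ?e) ?AU (v' ?AU (pull A U a))"
  have yc: "?y \<in> carrier (sect X U)" using se.pull_closed[OF AU vAa] unfolding preU .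
  interpret CU: kalgebra "sect X U" K by (rule X.alg[OF U])
  show ?thesis
  proof (rule X.section_eqI[OF U yc CU.zero_closed])
    fix x assume x: "x \<in> U"
    then have xX: "x \<in> pts X" using openin_subset[OF U] by blast
    have "pmap ?e () \<in> pts (gspc G)" using ep.pmap_in by simp
    moreover have "\<exists>\<V>. \<Union>\<V> = pts (gspc G) \<and> (\<forall>V\<in>\<V>. affine_open (gspc G) V \<and> fin_gen_algebra K (sect (gspc G) V))"
      using G_props unfolding algebraic_scheme_def by blast
    ultimately obtain V where V: "affine_open (gspc G) V" and fg: "fin_gen_algebra K (sect (gspc G) V)"
      and eV: "pmap ?e () \<in> V" by blast
    from X.affine_nbhd[OF U x] obtain W where W: "affine_open X W" and xW: "x \<in> W" and WU: "W \<subseteq> U" by blast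
    note oW = X.affine_opn[OF W] and oV = G.affine_opn[OF V]
    let ?B = "XG.box W V"
    note B = XG.box_affine[OF W V]
    note oB = XG.openin_box[OF oW oV]
    interpret RB: kalgebra "sect ?Z ?B" K by (rule XG.Z.alg[OF oB])
    interpret CW: kalgebra "sect X W" K by (rule X.alg[OF oW])
    interpret CV: kalgebra "sect (gspc G) V" K by (rule G.alg[OF oV])
    let ?z = "pmap (slice ?e) x"
    have zB: "?z \<in> ?B" using slice_box[OF e oW eV] xW by (auto simp: pre_def)
    have zAU: "?z \<in> ?AU" using x preU by (auto simp: pre_def)
    \<comment> \<open>The point z is (x, e). The preimage of U under A need not contain a whole box
      around z; a basic open subset D(h) of the box fits inside it, at the price that functions on
      it are fractions.\<close>
    from XG.Z.affine_basis[OF B(1) AU zAU zB] obtain h where h: "h \<in> carrier (sect ?Z ?B)"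
      and zh: "?z \<in> basic ?Z ?B h" and DA: "basic ?Z ?B h \<subseteq> ?AU" by blast
    define D where "D = basic ?Z ?B h"
    have D: "opn ?Z D" "D \<subseteq> ?B" unfolding D_def by (rule XG.Z.openin_basic[OF oB h], rule basic_subset)
    have DAU: "D \<subseteq> ?AU" unfolding D_def by (rule DA)
    interpret RD: kalgebra "sect ?Z D" K by (rule XG.Z.alg[OF D(1)])
    interpret rD: kalgebra_hom "sect ?Z ?B" "sect ?Z D" K "restr ?Z ?B D" by (rule XG.Z.restr_hom[OF oB D])
    define s where "s = restr ?Z ?AU D (pull A U a)"
    have s: "s \<in> carrier (sect ?Z D)" unfolding s_def by (rule XG.Z.restr_closed[OF AU D(1) DAU Aa])
    define H where "H = restr ?Z ?B D h"
    have H: "H \<in> carrier (sect ?Z D)" unfolding H_def using h by simp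
    obtain F n where F: "F \<in> carrier (sect ?Z ?B)" and
      eF: "s \<otimes>\<^bsub>sect ?Z D\<^esub> (H [^]\<^bsub>sect ?Z D\<^esub> (n::nat)) = restr ?Z ?B D F"
      using XG.Z.affine_numerator[OF B(1) h s[unfolded D_def]] unfolding D_def H_def by blast
    define a0 where "a0 = restr X U W a"
    have a0: "a0 \<in> carrier (sect X W)" unfolding a0_def by (rule X.restr_closed[OF U oW WU a])
    define \<alpha> where "\<alpha> = XG.inl W V a0"
    have al: "\<alpha> \<in> carrier (sect ?Z ?B)" unfolding \<alpha>_def by (rule XG.inl_closed[OF oW oV a0])
    \<comment> \<open>On D(h) the quotient R / h^n is the difference between the pull-backs of a
      along the action and along the projection to X.\<close>
    define R where "R = F \<ominus>\<^bsub>sect ?Z ?B\<^esub> \<alpha> \<otimes>\<^bsub>sect ?Z ?B\<^esub> h [^]\<^bsub>sect ?Z ?B\<^esub> n"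
    have R: "R \<in> carrier (sect ?Z ?B)" unfolding R_def using F al h by simp

    \<comment> \<open>The sections whose germ at x is zero. The neighbourhood on which a slice of R
      vanishes depends on the group element, so no common neighbourhood is available, but these
      sections still form a K-subspace, which is all that \<open>tensor_functional\<close>
      requires.\<close>
    define N0 where "N0 = {y \<in> carrier (sect X W). \<exists>N. opn X N \<and> x \<in> N \<and> N \<subseteq> W \<and> restr X W N y = \<zero>\<^bsub>sect X N\<^esub>}"
    have N0_sub: "N0 \<subseteq> carrier (sect X W)" unfolding N0_def by blast
    have N0_zero: "\<zero>\<^bsub>sect X W\<^esub> \<in> N0" unfolding N0_def using oW xW by auto
    have N0_sm: "k \<odot>\<^bsub>sect X W\<^esub> y \<in> N0" if k: "k \<in> K" and y: "y \<in> N0" for k y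
    proof -
      from y obtain N where N: "opn X N" "x \<in> N" "N \<subseteq> W" "restr X W N y = \<zero>\<^bsub>sect X N\<^esub>" "y \<in> carrier (sect X W)"
        unfolding N0_def by blast
      interpret CN: kalgebra "sect X N" K by (rule X.alg[OF N(1)])
      have "restr X W N (k \<odot>\<^bsub>sect X W\<^esub> y) = \<zero>\<^bsub>sect X N\<^esub>" using N oW k by (simp add: X.restr_smult)
      then show ?thesis unfolding N0_def using N k by blast
    qed
    have N0_add: "y \<oplus>\<^bsub>sect X W\<^esub> y' \<in> N0" if y: "y \<in> N0" and y': "y' \<in> N0" for y y'
    proof -
      from y obtain N where N: "opn X N" "x \<in> N" "N \<subseteq> W" "restr X W N y = \<zero>\<^bsub>sect X N\<^esub>" "y \<in> carrier (sect X W)"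
        unfolding N0_def by blast
      from y' obtain N' where N': "opn X N'" "x \<in> N'" "N' \<subseteq> W" "restr X W N' y' = \<zero>\<^bsub>sect X N'\<^esub>" "y' \<in> carrier (sect X W)"
        unfolding N0_def by blast
      let ?M = "N \<inter> N'"
      have M: "opn X ?M" "x \<in> ?M" "?M \<subseteq> W" "?M \<subseteq> N" "?M \<subseteq> N'" using N N' by auto
      interpret CM: kalgebra "sect X ?M" K by (rule X.alg[OF M(1)])
      have "restr X W ?M y = restr X N ?M (restr X W N y)" "restr X W ?M y' = restr X N' ?M (restr X W N' y')"
        by (rule X.restr_restr[OF oW N(1) M(1) M(4) N(3) N(5), symmetric],
            rule X.restr_restr[OF oW N'(1) M(1) M(5) N'(3) N'(5), symmetric])
      then have "restr X W ?M y = \<zero>\<^bsub>sect X ?M\<^esub>" "restr X W ?M y' = \<zero>\<^bsub>sect X ?M\<^esub>"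
        using N N' M by (simp_all add: X.restr_zero)
      then have "restr X W ?M (y \<oplus>\<^bsub>sect X W\<^esub> y') = \<zero>\<^bsub>sect X ?M\<^esub>" using oW M N N' by (simp add: X.restr_add)
      then show ?thesis unfolding N0_def using M N N' by blast
    qed

    text \<open>Invariance of \<open>a\<close> under \<open>g\<close> means that \<open>R\<close> vanishes on the slice at \<open>g\<close> near \<open>x\<close>.\<close>
    have pulled: "restr X (pre X (slice g) D) N (pull (slice g) D (s \<ominus>\<^bsub>sect ?Z D\<^esub> restr ?Z ?B D \<alpha>)) = \<zero>\<^bsub>sect X N\<^esub>"
      if g: "g \<in> spt" and gV: "pmap g () \<in> V" and N: "opn X N" "N \<subseteq> basic X W (slice_pull g W V h)" for g N
    proof -
      interpret sg: kmorphism K X ?Z "slice g" by (rule slice_props(1)[OF g])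
      have ND: "N \<subseteq> pre X (slice g) D" unfolding D_def using slice_basic[OF g W V gV h] N(2) by blast
      have NW: "N \<subseteq> W" by (rule order_trans[OF N(2) basic_subset])
      interpret CN: kalgebra "sect X N" K by (rule X.alg[OF N(1)])
      interpret p: kalgebra_hom "sect ?Z D" "sect X (pre X (slice g) D)" K "pull (slice g) D" by (rule sg.pull_khom[OF D(1)])
      interpret q: kalgebra_hom "sect X (pre X (slice g) D)" "sect X N" K "restr X (pre X (slice g) D) N"
        by (rule X.restr_hom[OF sg.openin_pre[OF D(1)] N(1) ND])
      have 1: "restr X (pre X (slice g) D) N (pull (slice g) D s) = restr X U N a"
        unfolding s_def D_def
        by (rule slice_pull_invariant[OF g W V gV U WU sat[OF g] a inv[OF g] h N DA])
      have 2: "restr X (pre X (slice g) D) N (pull (slice g) D (restr ?Z ?B D \<alpha>)) = restr X W N a0"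
        unfolding D_def slice_pull_restr[OF g W V gV h N al] unfolding \<alpha>_def slice_pull_inl[OF g W V gV a0] ..
      have 3: "restr X W N a0 = restr X U N a" unfolding a0_def using U oW N(1) NW WU a by simp
      have "restr X U N a \<in> carrier (sect X N)" using U N(1) NW WU a by auto
      then show ?thesis using s al 1 2 3 by simp
    qed
    have eR: "restr ?Z ?B D R = (s \<ominus>\<^bsub>sect ?Z D\<^esub> restr ?Z ?B D \<alpha>) \<otimes>\<^bsub>sect ?Z D\<^esub> H [^]\<^bsub>sect ?Z D\<^esub> n"
    proof -
      have "restr ?Z ?B D R = s \<otimes>\<^bsub>sect ?Z D\<^esub> H [^]\<^bsub>sect ?Z D\<^esub> n \<ominus>\<^bsub>sect ?Z D\<^esub> restr ?Z ?B D \<alpha> \<otimes>\<^bsub>sect ?Z D\<^esub> H [^]\<^bsub>sect ?Z D\<^esub> n"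
        unfolding R_def eF using F al h by (simp add: rD.hom_pow H_def)
      then show ?thesis using s al H by (simp add: a_minus_def RD.l_distr RD.l_minus)
    qed
    have slice_R: "slice_pull g W V R \<in> N0"
      if g: "g \<in> spt" and gV: "pmap g () \<in> V" and gh: "invertible_at X x W (slice_pull g W V h)" for g
    proof -
      interpret sg: kmorphism K X ?Z "slice g" by (rule slice_props(1)[OF g])
      let ?N = "basic X W (slice_pull g W V h)"
      have hc: "slice_pull g W V h \<in> carrier (sect X W)" by (rule alg_hom_closed[OF slice_pull_hom[OF g W V gV] h])
      have N: "opn X ?N" "?N \<subseteq> ?N" by (rule X.openin_basic[OF oW hc], rule subset_refl)
      have ND: "?N \<subseteq> pre X (slice g) D" unfolding D_def by (rule slice_basic[OF g W V gV h])
      interpret CN: kalgebra "sect X ?N" K by (rule X.alg[OF N(1)])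
      interpret p: kalgebra_hom "sect ?Z D" "sect X (pre X (slice g) D)" K "pull (slice g) D" by (rule sg.pull_khom[OF D(1)])
      interpret q: kalgebra_hom "sect X (pre X (slice g) D)" "sect X ?N" K "restr X (pre X (slice g) D) ?N"
        by (rule X.restr_hom[OF sg.openin_pre[OF D(1)] N(1) ND])
      have sc: "s \<ominus>\<^bsub>sect ?Z D\<^esub> restr ?Z ?B D \<alpha> \<in> carrier (sect ?Z D)" using s al by simp
      have Hn: "H [^]\<^bsub>sect ?Z D\<^esub> n \<in> carrier (sect ?Z D)" using H by simp
      have "restr X W ?N (slice_pull g W V R) = restr X (pre X (slice g) D) ?N (pull (slice g) D (restr ?Z ?B D R))"
        unfolding D_def by (rule slice_pull_restr[OF g W V gV h N R, symmetric])
      also have "\<dots> = restr X (pre X (slice g) D) ?N (pull (slice g) D (s \<ominus>\<^bsub>sect ?Z D\<^esub> restr ?Z ?B D \<alpha>)) \<otimes>\<^bsub>sect X ?N\<^esub>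
          restr X (pre X (slice g) D) ?N (pull (slice g) D (H [^]\<^bsub>sect ?Z D\<^esub> n))"
        unfolding eR p.hom_mult[OF sc Hn] q.hom_mult[OF p.hom_closed[OF sc] p.hom_closed[OF Hn]] ..
      also have "\<dots> = \<zero>\<^bsub>sect X ?N\<^esub>" unfolding pulled[OF g gV N]
        by (rule CN.l_null[OF q.hom_closed[OF p.hom_closed[OF Hn]]])
      finally have "restr X W ?N (slice_pull g W V R) = \<zero>\<^bsub>sect X ?N\<^esub>" .
      moreover have "x \<in> ?N" using gh unfolding in_basic_iff .
      moreover have "slice_pull g W V R \<in> carrier (sect X W)" by (rule alg_hom_closed[OF slice_pull_hom[OF g W V gV] R])
      ultimately show ?thesis unfolding N0_def mem_Collect_eq
        by (intro conjI exI[of _ ?N] N(1) basic_subset)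
    qed

    interpret der: derivation_at_point "sect (gspc G) V" K "v V" "value_at ?e V"
    proof (intro derivation_at_point.intro derivation_at_point_axioms.intro)
      show "kalgebra (sect (gspc G) V) K" by (rule CV.kalgebra_axioms)
      show "linear_on K (sect (gspc G) V) (sect (gspc G) V) (v V)" by (rule G.vector_field_props(1)[OF v oV])
      show "alg_hom K (sect (gspc G) V) (kscalar K) (value_at ?e V)" by (rule value_hom[OF e oV eV])
    qed (rule G.vector_field_props(3)[OF v oV])
    obtain r :: real and \<Phi> where r: "0 < r"
      and Phi: "\<And>t. \<bar>t\<bar> < r \<Longrightarrow> alg_hom K (sect (gspc G) V) (kscalar K) (\<Phi> t)"
      and Phi0: "\<And>b. b \<in> carrier (sect (gspc G) V) \<Longrightarrow> \<Phi> 0 b = value_at ?e V b"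
      and Phic: "\<And>b. b \<in> carrier (sect (gspc G) V) \<Longrightarrow> (\<lambda>t. \<Phi> t b) \<midarrow>0\<rightarrow> value_at ?e V b"
      and Phid: "\<And>b \<delta>. b \<in> carrier (sect (gspc G) V) \<Longrightarrow> 0 < \<delta> \<Longrightarrow> (\<And>t. \<bar>t\<bar> < \<delta> \<Longrightarrow> \<Phi> t b = 0) \<Longrightarrow> value_at ?e V (v V b) = 0"
    proof (rule der.flow_ex[OF fg])
      fix r :: real and \<Phi> assume "0 < r" "\<And>t. \<bar>t\<bar> < r \<Longrightarrow> alg_hom K (sect (gspc G) V) (kscalar K) (\<Phi> t)"
        "\<And>b. b \<in> carrier (sect (gspc G) V) \<Longrightarrow> \<Phi> 0 b = value_at ?e V b"
        "\<And>b. b \<in> carrier (sect (gspc G) V) \<Longrightarrow> (\<lambda>t. \<Phi> t b) \<midarrow>0\<rightarrow> value_at ?e V b"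
        "\<And>b \<delta>. b \<in> carrier (sect (gspc G) V) \<Longrightarrow> 0 < \<delta> \<Longrightarrow> (\<And>t. \<bar>t\<bar> < \<delta> \<Longrightarrow> \<Phi> t b = 0) \<Longrightarrow> value_at ?e V (v V b) = 0"
      then show thesis by (rule that)
    qed
    \<comment> \<open>The homomorphism \<Phi> t is a K-point g_t of G lying in V.\<close>
    have point: "\<exists>g\<in>spt. pmap g () \<in> V \<and> (\<forall>b\<in>carrier (sect (gspc G) V). value_at g V b = \<Phi> t b)" if t: "\<bar>t\<bar> < r" for t
    proof -
      from G.rational_point_ex[OF V Phi[OF t]] obtain g where "g \<in> K_points K (gspc G)" "pmap g () \<in> V"
        "\<And>b. b \<in> carrier (sect (gspc G) V) \<Longrightarrow> pull g V b = \<Phi> t b" by blast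
      then show ?thesis unfolding value_at_def by blast
    qed
    have Phi_lin: "\<Phi> t \<in> carrier (sect (gspc G) V) \<rightarrow> K"
      "b \<in> carrier (sect (gspc G) V) \<Longrightarrow> b' \<in> carrier (sect (gspc G) V) \<Longrightarrow> \<Phi> t (b \<oplus>\<^bsub>sect (gspc G) V\<^esub> b') = \<Phi> t b + \<Phi> t b'"
      "k \<in> K \<Longrightarrow> b \<in> carrier (sect (gspc G) V) \<Longrightarrow> \<Phi> t (k \<odot>\<^bsub>sect (gspc G) V\<^esub> b) = k * \<Phi> t b"
      if t: "\<bar>t\<bar> < r" for t b b' k
      using Phi[OF t] by (auto simp: alg_hom_def ring_hom_def)
    have rep: "\<exists>S c. finite S \<and> S \<subseteq> carrier (sect X W) \<and> c \<in> S \<rightarrow> carrier (sect (gspc G) V) \<and>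
        y = (\<Oplus>\<^bsub>sect ?Z ?B\<^esub>a\<in>S. XG.inl W V a \<otimes>\<^bsub>sect ?Z ?B\<^esub> XG.inr W V (c a))" if "y \<in> carrier (sect ?Z ?B)" for y
    proof -
      have "\<forall>t\<in>carrier (sect ?Z ?B). \<exists>S \<subseteq> carrier (sect X W). finite S \<and>
        (\<exists>c \<in> S \<rightarrow> carrier (sect (gspc G) V). t = (\<Oplus>\<^bsub>sect ?Z ?B\<^esub>a\<in>S. XG.inl W V a \<otimes>\<^bsub>sect ?Z ?B\<^esub> XG.inr W V (c a)))"
        using B(2) unfolding is_tensor_product_def by blast
      from bspec[OF this that] show ?thesis by blast
    qed
    have sum_eq: "(\<Oplus>\<^bsub>sect X W\<^esub>a\<in>S. \<Phi> t (c a) \<odot>\<^bsub>sect X W\<^esub> a) = slice_pull g W V y"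
      if g: "g \<in> spt" "pmap g () \<in> V" and gt: "\<forall>b\<in>carrier (sect (gspc G) V). value_at g V b = \<Phi> t b" and t: "\<bar>t\<bar> < r"
      and S: "finite S" "S \<subseteq> carrier (sect X W)" "c \<in> S \<rightarrow> carrier (sect (gspc G) V)"
      and y: "y = (\<Oplus>\<^bsub>sect ?Z ?B\<^esub>a\<in>S. XG.inl W V a \<otimes>\<^bsub>sect ?Z ?B\<^esub> XG.inr W V (c a))" for g t S c y
      unfolding y slice_pull_sum[OF g(1) W V g(2) S]
      using S gt Phi_lin(1)[OF t] by (intro CW.finsum_cong') (auto simp: Pi_iff subset_iff)

    have eh: "invertible_at X x W (slice_pull ?e W V h)"
    proof -
      have "x \<in> pre X (slice ?e) ?B" using slice_box[OF e oW eV] xW by blast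
      then have "invertible_at X x (pre X (slice ?e) ?B) (pull (slice ?e) ?B h)"
        using se.pull_invertible[OF oB h] zh unfolding in_basic_iff by blast
      then show ?thesis unfolding slice_pull_def
        using X.invertible_restr[OF se.openin_pre[OF oB] oW slice_box[OF e oW eV] xW se.pull_closed[OF oB h]] by blast
    qed
    interpret Px: primeideal "pt_ideal X W x" "sect X W" by (rule X.affine_prime[OF W xW])
    have P_sub: "pt_ideal X W x \<subseteq> carrier (sect X W)" unfolding pt_ideal_def by blast
    have P_sm: "k \<odot>\<^bsub>sect X W\<^esub> y \<in> pt_ideal X W x" if "k \<in> K" "y \<in> pt_ideal X W x" for k y
    proof -
      have yc: "y \<in> carrier (sect X W)" using that(2) P_sub by blast
      have "(k \<odot>\<^bsub>sect X W\<^esub> \<one>\<^bsub>sect X W\<^esub>) \<otimes>\<^bsub>sect X W\<^esub> y \<in> pt_ideal X W x"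
        by (rule Px.I_l_closed[OF that(2)]) (use that in simp)
      then show ?thesis using CW.sm_eq_mult[OF that(1) yc] by simp
    qed
    have P_zero: "\<zero>\<^bsub>sect X W\<^esub> \<in> pt_ideal X W x" by (rule Px.zero_closed)
    have P_add: "y \<oplus>\<^bsub>sect X W\<^esub> y' \<in> pt_ideal X W x" if "y \<in> pt_ideal X W x" "y' \<in> pt_ideal X W x" for y y'
      using that by (rule Px.a_closed)
    have "\<exists>\<delta>>0. \<forall>t. \<bar>t\<bar> < \<delta> \<longrightarrow> \<bar>t\<bar> < r \<and>
        (\<forall>g\<in>spt. pmap g () \<in> V \<longrightarrow> (\<forall>b\<in>carrier (sect (gspc G) V). value_at g V b = \<Phi> t b) \<longrightarrow> invertible_at X x W (slice_pull g W V h))"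
    proof (rule ccontr)
      assume no: "\<not> ?thesis"
      from rep[OF h] obtain S c where S: "finite S" "S \<subseteq> carrier (sect X W)" "c \<in> S \<rightarrow> carrier (sect (gspc G) V)"
        and hS: "h = (\<Oplus>\<^bsub>sect ?Z ?B\<^esub>a\<in>S. XG.inl W V a \<otimes>\<^bsub>sect ?Z ?B\<^esub> XG.inr W V (c a))" by blast
      have "\<exists>t. \<bar>t\<bar> < min r (inverse (real (Suc m))) \<and> (\<Oplus>\<^bsub>sect X W\<^esub>a\<in>S. \<Phi> t (c a) \<odot>\<^bsub>sect X W\<^esub> a) \<in> pt_ideal X W x" for m
      proof -
        have "0 < min r (inverse (real (Suc m)))" using r by simp
        with no obtain t where t: "\<bar>t\<bar> < min r (inverse (real (Suc m)))" and
          t2: "\<not> (\<bar>t\<bar> < r \<and> (\<forall>g\<in>spt. pmap g () \<in> V \<longrightarrow> (\<forall>b\<in>carrier (sect (gspc G) V). value_at g V b = \<Phi> t b) \<longrightarrow> invertible_at X x W (slice_pull g W V h)))"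
          by blast
        have tr: "\<bar>t\<bar> < r" using t by simp
        with t2 obtain g where g: "g \<in> spt" "pmap g () \<in> V" "\<forall>b\<in>carrier (sect (gspc G) V). value_at g V b = \<Phi> t b"
          "\<not> invertible_at X x W (slice_pull g W V h)" by blast
        have "slice_pull g W V h \<in> pt_ideal X W x"
          using g(4) alg_hom_closed[OF slice_pull_hom[OF g(1) W V g(2)] h] unfolding pt_ideal_def by blast
        then show ?thesis using t sum_eq[OF g(1-3) tr S hS] by auto
      qed
      then obtain tt where tt: "\<And>m. \<bar>tt m\<bar> < min r (inverse (real (Suc m)))"
        and ttP: "\<And>m. (\<Oplus>\<^bsub>sect X W\<^esub>a\<in>S. \<Phi> (tt m) (c a) \<odot>\<^bsub>sect X W\<^esub> a) \<in> pt_ideal X W x" by metis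
      have ttr: "\<bar>tt m\<bar> < r" for m using tt[of m] by simp
      have lim: "tt \<longlonglongrightarrow> 0"
        using tt by (intro LIMSEQ_norm_0) (simp add: inverse_eq_divide)
      have "(\<Oplus>\<^bsub>sect X W\<^esub>a\<in>S. value_at ?e V (c a) \<odot>\<^bsub>sect X W\<^esub> a) \<in> pt_ideal X W x"
      \<comment> \<open>The functionals are indexed by the sequence, and \<nu> is evaluation at the
        unit element. A function vanishing along the whole sequence vanishes at the unit element by
        continuity of the flow.\<close>
      proof (rule tensor_functional[where I = UNIV and \<phi> = "\<lambda>m. \<Phi> (tt m)", OF CW.kalgebra_axioms CV.kalgebra_axioms P_sub P_sm P_zero P_add])
        fix b assume b: "b \<in> carrier (sect (gspc G) V)" and z: "\<And>m. m \<in> UNIV \<Longrightarrow> \<Phi> (tt m) b = 0"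
        have "isCont (\<lambda>t. \<Phi> t b) 0" using Phic[OF b] Phi0[OF b] by (simp add: isCont_def)
        then have "(\<lambda>m. \<Phi> (tt m) b) \<longlonglongrightarrow> \<Phi> 0 b" using lim by (rule isCont_tendsto_compose)
        then show "value_at ?e V b = 0" using z Phi0[OF b] by (simp add: LIMSEQ_const_iff)
      next
        show "value_at ?e V \<in> carrier (sect (gspc G) V) \<rightarrow> K" using der.e_closed by blast
      qed (use ttP Phi_lin[OF ttr] S der.e_add der.e_smult in \<open>auto simp: Pi_iff subset_iff\<close>)
      then have "slice_pull ?e W V h \<in> pt_ideal X W x"
        unfolding hS slice_pull_sum[OF e W V eV S] .
      then show False using eh unfolding pt_ideal_def by blast
    qed
    then obtain \<delta> where d: "0 < \<delta>" and dr: "\<And>t. \<bar>t\<bar> < \<delta> \<Longrightarrow> \<bar>t\<bar> < r"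
      and dg: "\<And>t g. \<bar>t\<bar> < \<delta> \<Longrightarrow> g \<in> spt \<Longrightarrow> pmap g () \<in> V \<Longrightarrow> \<forall>b\<in>carrier (sect (gspc G) V). value_at g V b = \<Phi> t b \<Longrightarrow>
        invertible_at X x W (slice_pull g W V h)" by blast

    from rep[OF R] obtain S c where S: "finite S" "S \<subseteq> carrier (sect X W)" "c \<in> S \<rightarrow> carrier (sect (gspc G) V)"
      and RS: "R = (\<Oplus>\<^bsub>sect ?Z ?B\<^esub>a\<in>S. XG.inl W V a \<otimes>\<^bsub>sect ?Z ?B\<^esub> XG.inr W V (c a))" by blast
    have "(\<Oplus>\<^bsub>sect X W\<^esub>a\<in>S. value_at ?e V (v V (c a)) \<odot>\<^bsub>sect X W\<^esub> a) \<in> N0"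
    \<comment> \<open>Now the functionals are all \<Phi> t with |t| < \<delta>, and \<nu> is the
      derivative along v at the unit element; separation is the last clause of
      \<open>flow_ex\<close>.\<close>
    proof (rule tensor_functional[where I = "{t. \<bar>t\<bar> < \<delta>}" and \<phi> = \<Phi> and \<nu> = "\<lambda>b. value_at ?e V (v V b)",
        OF CW.kalgebra_axioms CV.kalgebra_axioms N0_sub N0_sm N0_zero N0_add])
      fix b assume b: "b \<in> carrier (sect (gspc G) V)" and z: "\<And>t. t \<in> {t. \<bar>t\<bar> < \<delta>} \<Longrightarrow> \<Phi> t b = 0"
      then show "value_at ?e V (v V b) = 0" by (intro Phid[OF b d]) simp
    next
      fix t assume "t \<in> {t. \<bar>t\<bar> < \<delta>}"
      then have t: "\<bar>t\<bar> < \<delta>" by simp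
      from point[OF dr[OF t]] obtain g where g: "g \<in> spt" "pmap g () \<in> V" "\<forall>b\<in>carrier (sect (gspc G) V). value_at g V b = \<Phi> t b"
        by blast
      show "(\<Oplus>\<^bsub>sect X W\<^esub>a\<in>S. \<Phi> t (c a) \<odot>\<^bsub>sect X W\<^esub> a) \<in> N0"
        unfolding sum_eq[OF g dr[OF t] S RS] by (rule slice_R[OF g(1,2) dg[OF t g]])
    next
      show "(\<lambda>b. value_at ?e V (v V b)) \<in> carrier (sect (gspc G) V) \<rightarrow> K" by auto
    qed (use Phi_lin[OF dr] S in \<open>auto simp: Pi_iff subset_iff der.D_add der.e_add der.D_smult der.e_smult\<close>)
    also have "(\<Oplus>\<^bsub>sect X W\<^esub>a\<in>S. value_at ?e V (v V (c a)) \<odot>\<^bsub>sect X W\<^esub> a) = slice_pull ?e W V (v' ?B R)"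
    proof -
      \<comment> \<open>On the box the lifted field acts as id \<otimes> v, because it kills a
        \<otimes> 1 and sends 1 \<otimes> b to 1 \<otimes> v b. Composed with evaluation at the unit
        element this gives the sum just treated.\<close>
      have vl: "v' ?B (XG.inl W V a) = \<zero>\<^bsub>sect ?Z ?B\<^esub>" if a: "a \<in> carrier (sect X W)" for a
        unfolding XG.inl_def
        using v'p(4)[OF XG.l.openin_pre[OF oW] oB XG.box_subset(1) XG.l.pull_closed[OF oW a]] v'l[OF oW a]
          XG.Z.restr_zero[OF XG.l.openin_pre[OF oW] oB XG.box_subset(1)] by simp
      have vr: "v' ?B (XG.inr W V b) = XG.inr W V (v V b)" if b: "b \<in> carrier (sect (gspc G) V)" for b
        unfolding XG.inr_def
        using v'p(4)[OF XG.r.openin_pre[OF oV] oB XG.box_subset(2) XG.r.pull_closed[OF oV b]] v'r[OF oV b] by simp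
      have m: "(\<lambda>a. XG.inl W V a \<otimes>\<^bsub>sect ?Z ?B\<^esub> XG.inr W V (c a)) \<in> S \<rightarrow> carrier (sect ?Z ?B)"
        using S XG.inl_closed[OF oW oV] XG.inr_closed[OF oW oV] by (auto simp: Pi_iff subset_iff)
      have c': "(\<lambda>a. v V (c a)) \<in> S \<rightarrow> carrier (sect (gspc G) V)" using S by (auto simp: Pi_iff)
      have "v' ?B R = (\<Oplus>\<^bsub>sect ?Z ?B\<^esub>a\<in>S. v' ?B (XG.inl W V a \<otimes>\<^bsub>sect ?Z ?B\<^esub> XG.inr W V (c a)))"
        unfolding RS by (rule linear_on_finsum[OF RB.kalgebra_axioms RB.kalgebra_axioms v'p(1)[OF oB] S(1) m])
      also have "\<dots> = (\<Oplus>\<^bsub>sect ?Z ?B\<^esub>a\<in>S. XG.inl W V a \<otimes>\<^bsub>sect ?Z ?B\<^esub> XG.inr W V (v V (c a)))"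
      proof (rule RB.finsum_cong')
        show "(\<lambda>a. XG.inl W V a \<otimes>\<^bsub>sect ?Z ?B\<^esub> XG.inr W V (v V (c a))) \<in> S \<rightarrow> carrier (sect ?Z ?B)"
          using S c' XG.inl_closed[OF oW oV] XG.inr_closed[OF oW oV] by (auto simp: Pi_iff subset_iff)
        fix a assume "a \<in> S"
        then have a: "a \<in> carrier (sect X W)" "c a \<in> carrier (sect (gspc G) V)" using S by auto
        then show "v' ?B (XG.inl W V a \<otimes>\<^bsub>sect ?Z ?B\<^esub> XG.inr W V (c a)) = XG.inl W V a \<otimes>\<^bsub>sect ?Z ?B\<^esub> XG.inr W V (v V (c a))"
          using v'p(3)[OF oB XG.inl_closed[OF oW oV a(1)] XG.inr_closed[OF oW oV a(2)]] vl vr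
            XG.inl_closed[OF oW oV a(1)] XG.inr_closed[OF oW oV a(2)] XG.inr_closed[OF oW oV der.D_closed[OF a(2)]] by simp
      qed simp
      finally show ?thesis using slice_pull_sum[OF e W V eV S(1,2) c'] by simp
    qed
    finally have vR: "slice_pull ?e W V (v' ?B R) \<in> N0" .
    then obtain N1 where N1: "opn X N1" "x \<in> N1" "N1 \<subseteq> W" "restr X W N1 (slice_pull ?e W V (v' ?B R)) = \<zero>\<^bsub>sect X N1\<^esub>"
      unfolding N0_def by blast
    have hc: "slice_pull ?e W V h \<in> carrier (sect X W)" by (rule alg_hom_closed[OF slice_pull_hom[OF e W V eV] h])
    have vRc: "slice_pull ?e W V (v' ?B R) \<in> carrier (sect X W)"
      by (rule alg_hom_closed[OF slice_pull_hom[OF e W V eV] v'p(2)[OF oB R]])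
    define N where "N = N1 \<inter> basic X W (slice_pull ?e W V h)"
    have N: "opn X N" "N \<subseteq> basic X W (slice_pull ?e W V h)" "x \<in> N" "N \<subseteq> N1"
      unfolding N_def using N1 X.openin_basic[OF oW hc] eh by (auto simp: in_basic_iff)
    have NW: "N \<subseteq> W" using N(4) N1(3) by blast
    have ND: "N \<subseteq> pre X (slice ?e) D" unfolding D_def using slice_basic[OF e W V eV h] N(2) by blast
    interpret CN: kalgebra "sect X N" K by (rule X.alg[OF N(1)])
    interpret p: kalgebra_hom "sect ?Z D" "sect X (pre X (slice ?e) D)" K "pull (slice ?e) D" by (rule se.pull_khom[OF D(1)])
    interpret q: kalgebra_hom "sect X (pre X (slice ?e) D)" "sect X N" K "restr X (pre X (slice ?e) D) N"
      by (rule X.restr_hom[OF se.openin_pre[OF D(1)] N(1) ND])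
    let ?pb = "\<lambda>y. restr X (pre X (slice ?e) D) N (pull (slice ?e) D y)"
    let ?\<zeta> = "s \<ominus>\<^bsub>sect ?Z D\<^esub> restr ?Z ?B D \<alpha>" and ?Hn = "H [^]\<^bsub>sect ?Z D\<^esub> n"
    have z: "?\<zeta> \<in> carrier (sect ?Z D)" and Hn: "?Hn \<in> carrier (sect ?Z D)" using s al H by simp_all
    have vz: "v' D ?\<zeta> \<in> carrier (sect ?Z D)" and vHn: "v' D ?Hn \<in> carrier (sect ?Z D)"
      using v'p(2)[OF D(1)] z Hn by blast+
    \<comment> \<open>The product rule is applied to R = \<zeta> h^n. On the slice at the unit
      element \<zeta> itself is zero, so the term that differentiates h^n disappears and the unit
      h^n can be cancelled from the other.\<close>
    have "?pb (v' D (restr ?Z ?B D R)) = ?pb (v' D ?\<zeta> \<otimes>\<^bsub>sect ?Z D\<^esub> ?Hn \<oplus>\<^bsub>sect ?Z D\<^esub> ?\<zeta> \<otimes>\<^bsub>sect ?Z D\<^esub> v' D ?Hn)"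
      unfolding eR v'p(3)[OF D(1) z Hn] ..
    also have "\<dots> = ?pb (v' D ?\<zeta>) \<otimes>\<^bsub>sect X N\<^esub> ?pb ?Hn \<oplus>\<^bsub>sect X N\<^esub> ?pb ?\<zeta> \<otimes>\<^bsub>sect X N\<^esub> ?pb (v' D ?Hn)"
      using z Hn vz vHn by simp
    also have "?pb ?\<zeta> = \<zero>\<^bsub>sect X N\<^esub>" by (rule pulled[OF e eV N(1,2)])
    also have "v' D (restr ?Z ?B D R) = restr ?Z ?B D (v' ?B R)" by (rule v'p(4)[OF oB D R])
    also have "?pb (restr ?Z ?B D (v' ?B R)) = restr X W N (slice_pull ?e W V (v' ?B R))"
      unfolding D_def by (rule slice_pull_restr[OF e W V eV h N(1,2) v'p(2)[OF oB R]])
    also have "\<dots> = restr X N1 N (restr X W N1 (slice_pull ?e W V (v' ?B R)))"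
      by (rule X.restr_restr[OF oW N1(1) N(1,4) N1(3) vRc, symmetric])
    also have "\<dots> = \<zero>\<^bsub>sect X N\<^esub>" unfolding N1(4) by (rule X.restr_zero[OF N1(1) N(1,4)])
    finally have "?pb (v' D ?\<zeta>) \<otimes>\<^bsub>sect X N\<^esub> ?pb ?Hn = \<zero>\<^bsub>sect X N\<^esub>"
      using q.hom_closed[OF p.hom_closed[OF vz]] q.hom_closed[OF p.hom_closed[OF vHn]] q.hom_closed[OF p.hom_closed[OF Hn]] by simp
    moreover have "?Hn \<in> Units (sect ?Z D)"
      by (rule RD.unit_pow) (unfold H_def D_def, rule XG.Z.affine_basic_unit[OF B(1) h])
    then have "?pb ?Hn \<in> Units (sect X N)" by (intro q.hom_Units p.hom_Units)
    ultimately have lz: "?pb (v' D ?\<zeta>) = \<zero>\<^bsub>sect X N\<^esub>"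
      using CN.unit_cancel_zero q.hom_closed[OF p.hom_closed[OF vz]] by blast
    \<comment> \<open>The subtracted part of \<zeta> comes from X, where the lifted field is zero;
      what remains is the derivative of the pull-back of a along the action.\<close>
    have "v' D ?\<zeta> = restr ?Z ?AU D (v' ?AU (pull A U a))"
    proof -
      have rl: "restr ?Z ?B D \<alpha> \<in> carrier (sect ?Z D)" using al by simp
      have "v' D ?\<zeta> = v' D s \<ominus>\<^bsub>sect ?Z D\<^esub> v' D (restr ?Z ?B D \<alpha>)"
        by (rule linear_on_minus[OF RD.kalgebra_axioms RD.kalgebra_axioms v'p(1)[OF D(1)] s rl])
      also have "v' D (restr ?Z ?B D \<alpha>) = \<zero>\<^bsub>sect ?Z D\<^esub>"
      proof -
        have "v' ?B \<alpha> = \<zero>\<^bsub>sect ?Z ?B\<^esub>" unfolding \<alpha>_def XG.inl_def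
          using v'p(4)[OF XG.l.openin_pre[OF oW] oB XG.box_subset(1) XG.l.pull_closed[OF oW a0]] v'l[OF oW a0]
            XG.Z.restr_zero[OF XG.l.openin_pre[OF oW] oB XG.box_subset(1)] by simp
        then show ?thesis using v'p(4)[OF oB D al] by simp
      qed
      also have "v' D s = restr ?Z ?AU D (v' ?AU (pull A U a))" unfolding s_def by (rule v'p(4)[OF AU D(1) DAU Aa])
      finally show ?thesis using XG.Z.restr_closed[OF AU D(1) DAU vAa] by (simp add: a_minus_def)
    qed
    then have "restr X U N ?y = \<zero>\<^bsub>sect X N\<^esub>"
      using lz se.restr_pull[OF AU D(1) DAU N(1) ND vAa] unfolding preU by simp
    then show "\<exists>N. opn X N \<and> x \<in> N \<and> N \<subseteq> U \<and> restr X U N ?y = restr X U N \<zero>\<^bsub>sect X U\<^esub>"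
      using N NW WU X.restr_zero[OF U N(1)] by (intro exI[of _ N]) auto
  qed
qed

end

section \<open>Reduction of Poisson brackets\<close>

locale poisson_space = ksheaf K X for K and X :: "('p, 'd) kspace" +
  fixes q :: "'p set \<Rightarrow> 'd \<Rightarrow> 'd \<Rightarrow> 'd"
  assumes poisson: "poisson_bracket K X q"
begin

lemmas poisson_props = poisson[unfolded poisson_bracket_def biderivation_def]

lemma
  assumes U: "opn X U" and a: "a \<in> carrier (sect X U)"
  shows q_linear: "linear_on K (sect X U) (sect X U) (\<lambda>b. q U a b)" "linear_on K (sect X U) (sect X U) (\<lambda>b. q U b a)"
    and q_closed: "b \<in> carrier (sect X U) \<Longrightarrow> q U a b \<in> carrier (sect X U)"
    and q_leibniz: "b \<in> carrier (sect X U) \<Longrightarrow> c \<in> carrier (sect X U) \<Longrightarrow>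
      q U a (b \<otimes>\<^bsub>sect X U\<^esub> c) = (q U a b \<otimes>\<^bsub>sect X U\<^esub> c) \<oplus>\<^bsub>sect X U\<^esub> (b \<otimes>\<^bsub>sect X U\<^esub> q U a c)"
    and q_skew: "b \<in> carrier (sect X U) \<Longrightarrow> q U a b = \<ominus>\<^bsub>sect X U\<^esub> q U b a"
    and q_jacobi: "b \<in> carrier (sect X U) \<Longrightarrow> c \<in> carrier (sect X U) \<Longrightarrow>
      q U a (q U b c) \<oplus>\<^bsub>sect X U\<^esub> q U b (q U c a) \<oplus>\<^bsub>sect X U\<^esub> q U c (q U a b) = \<zero>\<^bsub>sect X U\<^esub>"
proof -
  have bi: "linear_on K (sect X U) (sect X U) (\<lambda>b. q U a b) \<and> linear_on K (sect X U) (sect X U) (\<lambda>b. q U b a) \<and>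
      (\<forall>b\<in>carrier (sect X U). \<forall>c\<in>carrier (sect X U).
         q U a (b \<otimes>\<^bsub>sect X U\<^esub> c) = (q U a b \<otimes>\<^bsub>sect X U\<^esub> c) \<oplus>\<^bsub>sect X U\<^esub> (b \<otimes>\<^bsub>sect X U\<^esub> q U a c) \<and>
         q U (b \<otimes>\<^bsub>sect X U\<^esub> c) a = (q U b a \<otimes>\<^bsub>sect X U\<^esub> c) \<oplus>\<^bsub>sect X U\<^esub> (b \<otimes>\<^bsub>sect X U\<^esub> q U c a))"
    using poisson_props[THEN conjunct1, THEN conjunct1] U a by blast
  show l: "linear_on K (sect X U) (sect X U) (\<lambda>b. q U a b)" "linear_on K (sect X U) (sect X U) (\<lambda>b. q U b a)"
    using bi by blast+
  show "b \<in> carrier (sect X U) \<Longrightarrow> q U a b \<in> carrier (sect X U)"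
    using l(1) unfolding linear_on_def by blast
  show "b \<in> carrier (sect X U) \<Longrightarrow> c \<in> carrier (sect X U) \<Longrightarrow>
      q U a (b \<otimes>\<^bsub>sect X U\<^esub> c) = (q U a b \<otimes>\<^bsub>sect X U\<^esub> c) \<oplus>\<^bsub>sect X U\<^esub> (b \<otimes>\<^bsub>sect X U\<^esub> q U a c)"
    using bi by blast
  show "b \<in> carrier (sect X U) \<Longrightarrow> q U a b = \<ominus>\<^bsub>sect X U\<^esub> q U b a"
    using poisson_props[THEN conjunct2] U a by blast
  show "b \<in> carrier (sect X U) \<Longrightarrow> c \<in> carrier (sect X U) \<Longrightarrow>
      q U a (q U b c) \<oplus>\<^bsub>sect X U\<^esub> q U b (q U c a) \<oplus>\<^bsub>sect X U\<^esub> q U c (q U a b) = \<zero>\<^bsub>sect X U\<^esub>"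
    using poisson_props[THEN conjunct2] U a by blast
qed

lemma q_restr: "opn X U \<Longrightarrow> opn X V \<Longrightarrow> V \<subseteq> U \<Longrightarrow> a \<in> carrier (sect X U) \<Longrightarrow> b \<in> carrier (sect X U) \<Longrightarrow>
    q V (restr X U V a) (restr X U V b) = restr X U V (q U a b)"
  using poisson_props[THEN conjunct1, THEN conjunct2] by blast

lemma q_add: "opn X U \<Longrightarrow> a \<in> carrier (sect X U) \<Longrightarrow> b \<in> carrier (sect X U) \<Longrightarrow> c \<in> carrier (sect X U) \<Longrightarrow>
    q U a (b \<oplus>\<^bsub>sect X U\<^esub> c) = q U a b \<oplus>\<^bsub>sect X U\<^esub> q U a c"
  using q_linear(1) unfolding linear_on_def by blast

lemma q_smult: "opn X U \<Longrightarrow> a \<in> carrier (sect X U) \<Longrightarrow> b \<in> carrier (sect X U) \<Longrightarrow> k \<in> K \<Longrightarrow>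
    q U a (k \<odot>\<^bsub>sect X U\<^esub> b) = k \<odot>\<^bsub>sect X U\<^esub> q U a b"
  using q_linear(1) unfolding linear_on_def by blast

end

text \<open>The part of the argument that does not see the group: \<B> plays the role of the
  saturated open sets and \<open>Inv U\<close> that of the invariant functions. The last assumption
  ranges over all open Z inside U, since ideal membership has to be used on open sets that are not
  saturated.\<close>

locale poisson_reduction = X: poisson_space K X q + Y: ksheaf K Y
  for K and X :: "('p, 'd) kspace" and q and Y :: "('p, 'k) kspace" +
  fixes I :: "'p set \<Rightarrow> 'd set" and \<rho> :: "'p set \<Rightarrow> 'd \<Rightarrow> 'k"
    and \<B> :: "'p set set" and Inv :: "'p set \<Rightarrow> 'd set"
  assumes closed: "closed_subscheme K X I Y \<rho>"
    and base_open: "U \<in> \<B> \<Longrightarrow> opn X U"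
    and base_Int: "U \<in> \<B> \<Longrightarrow> V \<in> \<B> \<Longrightarrow> U \<inter> V \<in> \<B>"
    and inv_sect: "U \<in> \<B> \<Longrightarrow> a \<in> Inv U \<Longrightarrow> a \<in> carrier (sect X U)"
    and inv_restr: "U \<in> \<B> \<Longrightarrow> V \<in> \<B> \<Longrightarrow> V \<subseteq> U \<Longrightarrow> a \<in> Inv U \<Longrightarrow> restr X U V a \<in> Inv V"
    and inv_add: "U \<in> \<B> \<Longrightarrow> a \<in> Inv U \<Longrightarrow> b \<in> Inv U \<Longrightarrow> a \<oplus>\<^bsub>sect X U\<^esub> b \<in> Inv U"
    and inv_mult: "U \<in> \<B> \<Longrightarrow> a \<in> Inv U \<Longrightarrow> b \<in> Inv U \<Longrightarrow> a \<otimes>\<^bsub>sect X U\<^esub> b \<in> Inv U"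
    and inv_smult: "U \<in> \<B> \<Longrightarrow> k \<in> K \<Longrightarrow> a \<in> Inv U \<Longrightarrow> k \<odot>\<^bsub>sect X U\<^esub> a \<in> Inv U"
    and inv_bracket: "U \<in> \<B> \<Longrightarrow> a \<in> Inv U \<Longrightarrow> b \<in> Inv U \<Longrightarrow> q U a b \<in> Inv U"
    and bracket_ideal: "U \<in> \<B> \<Longrightarrow> a \<in> Inv U \<Longrightarrow> opn X Z \<Longrightarrow> Z \<subseteq> U \<Longrightarrow> c \<in> I Z \<Longrightarrow> q Z (restr X U Z a) c \<in> I Z"
begin

lemmas closed_props = closed[unfolded closed_subscheme_def]

lemma openin_Y: "opn Y S \<Longrightarrow> \<exists>Z. opn X Z \<and> S = Z \<inter> pts Y"
proof -
  assume S: "opn Y S"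
  then obtain Z where Z: "opn X Z" "S = Z \<inter> {x \<in> pts X. \<forall>U. opn X U \<and> x \<in> U \<longrightarrow> (\<forall>a\<in>I U. \<not> invertible_at X x U a)}"
    using closed_props[THEN conjunct2, THEN conjunct1] by (auto simp: openin_subtopology)
  have "S \<subseteq> pts Y" by (rule openin_subset[OF S])
  moreover have "pts Y \<subseteq> {x \<in> pts X. \<forall>U. opn X U \<and> x \<in> U \<longrightarrow> (\<forall>a\<in>I U. \<not> invertible_at X x U a)}"
    using closed_props[THEN conjunct2, THEN conjunct1] by (auto simp: topspace_subtopology)
  ultimately have "S = Z \<inter> pts Y" using Z(2) by blast
  then show ?thesis using Z(1) by blast
qed

lemma pts_Y: "pts Y \<subseteq> pts X"
  using closed_props[THEN conjunct2, THEN conjunct1] by (auto simp: topspace_subtopology)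

lemma opn_Y_Int: "opn X U \<Longrightarrow> opn Y (U \<inter> pts Y)"
proof -
  assume U: "opn X U"
  let ?C = "{x \<in> pts X. \<forall>U. opn X U \<and> x \<in> U \<longrightarrow> (\<forall>a\<in>I U. \<not> invertible_at X x U a)}"
  have p: "ptop Y = subtopology (ptop X) ?C" by (rule closed_props[THEN conjunct2, THEN conjunct1])
  have "pts Y = pts X \<inter> ?C" by (subst p) (rule topspace_subtopology)
  then have "U \<inter> pts Y = U \<inter> ?C" using openin_subset[OF U] by blast
  then show "opn Y (U \<inter> pts Y)" unfolding p openin_subtopology using U by blast
qed

lemma rho_hom: "opn X U \<Longrightarrow> alg_hom K (sect X U) (sect Y (U \<inter> pts Y)) (\<rho> U)"
  by (rule closed_props[THEN conjunct2, THEN conjunct2, THEN conjunct1, rule_format])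

lemma rho_restr: "opn X U \<Longrightarrow> opn X V \<Longrightarrow> V \<subseteq> U \<Longrightarrow> a \<in> carrier (sect X U) \<Longrightarrow>
    \<rho> V (restr X U V a) = restr Y (U \<inter> pts Y) (V \<inter> pts Y) (\<rho> U a)"
  using closed_props[THEN conjunct2, THEN conjunct2, THEN conjunct2, THEN conjunct1] by blast

lemma ideal_iff: "opn X U \<Longrightarrow> a \<in> I U \<longleftrightarrow> a \<in> carrier (sect X U) \<and> \<rho> U a = \<zero>\<^bsub>sect Y (U \<inter> pts Y)\<^esub>"
  using closed_props by blast

text \<open>The restriction of a to an open subset S of Y that lies in U but need not be all of its
  intersection with Y.\<close>

definition img :: "'p set \<Rightarrow> 'p set \<Rightarrow> 'd \<Rightarrow> 'k" where
  "img U S a = restr Y (U \<inter> pts Y) S (\<rho> U a)"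

lemma img_hom:
  assumes "opn X U" "opn Y S" "S \<subseteq> U"
  shows "alg_hom K (sect X U) (sect Y S) (img U S)"
  using alg_hom_compose[OF rho_hom[OF assms(1)] Y.restr_alg_hom[OF opn_Y_Int[OF assms(1)] assms(2)]]
    openin_subset[OF assms(2)] assms(3) unfolding img_def by blast

lemma img_khom:
  assumes "opn X U" "opn Y S" "S \<subseteq> U"
  shows "kalgebra_hom (sect X U) (sect Y S) K (img U S)"
  using img_hom[OF assms] X.alg[OF assms(1)] Y.alg[OF assms(2)]
  by (simp add: kalgebra_hom_def kalgebra_hom_axioms_def)

lemma img_image:
  assumes U: "opn X U" "opn X U'" "U' \<subseteq> U" and S: "opn Y S" "S \<subseteq> U'" and a: "a \<in> carrier (sect X U)"
  shows "img U' S (restr X U U' a) = img U S a"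
proof -
  have "S \<subseteq> U' \<inter> pts Y" "U' \<inter> pts Y \<subseteq> U \<inter> pts Y" using openin_subset[OF S(1)] S(2) U(3) by blast+
  then show ?thesis unfolding img_def rho_restr[OF U a]
    by (rule Y.restr_restr[OF opn_Y_Int[OF U(1)] opn_Y_Int[OF U(2)] S(1) _ _ alg_hom_closed[OF rho_hom[OF U(1)] a]])
qed

lemma img_restr:
  assumes U: "opn X U" and S: "opn Y S" "S \<subseteq> U" "opn Y S'" "S' \<subseteq> S" and a: "a \<in> carrier (sect X U)"
  shows "restr Y S S' (img U S a) = img U S' a"
  unfolding img_def
  by (rule Y.restr_restr[OF opn_Y_Int[OF U] S(1,3,4) _ alg_hom_closed[OF rho_hom[OF U] a]])
    (use openin_subset[OF S(1)] S(2) in blast)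

text \<open>The difference b - c restricts to zero only on S, so it lies in the ideal only over an
  open set Z of X whose trace on Y is S. Such a Z exists by the subspace topology, and over it the
  bracket with a preserves the ideal.\<close>

lemma img_bracket_cong_right:
  assumes U: "U \<in> \<B>" and S: "opn Y S" "S \<subseteq> U" and abc: "a \<in> Inv U" "b \<in> Inv U" "c \<in> Inv U"
    and e: "img U S b = img U S c"
  shows "img U S (q U a b) = img U S (q U a c)"
proof -
  have oU: "opn X U" by (rule base_open[OF U])
  have cl: "a \<in> carrier (sect X U)" "b \<in> carrier (sect X U)" "c \<in> carrier (sect X U)" using abc by (blast intro: inv_sect[OF U])+
  obtain Z0 where Z0: "opn X Z0" "S = Z0 \<inter> pts Y" using openin_Y[OF S(1)] by blast
  define Z where "Z = Z0 \<inter> U"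
  have Z: "opn X Z" "Z \<subseteq> U" "Z \<inter> pts Y = S" unfolding Z_def using Z0 oU S(2) by auto
  have SZ: "S \<subseteq> Z" using Z(3) by blast
  interpret RZ: kalgebra "sect X Z" K by (rule X.alg[OF Z(1)])
  interpret RS: kalgebra "sect Y S" K by (rule Y.alg[OF S(1)])
  have iZ: "img Z S x = \<rho> Z x" if "x \<in> carrier (sect X Z)" for x
    unfolding img_def Z(3) using Y.restr_id[OF S(1)] alg_hom_closed[OF rho_hom[OF Z(1)] that] unfolding Z(3) by blast
  interpret f: kalgebra_hom "sect X Z" "sect Y S" K "img Z S" by (rule img_khom[OF Z(1) S(1) SZ])
  let ?r = "restr X U Z"
  have rc: "?r a \<in> carrier (sect X Z)" "?r b \<in> carrier (sect X Z)" "?r c \<in> carrier (sect X Z)"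
    using cl by (auto intro: X.restr_closed[OF oU Z(1,2)])
  have "img Z S (?r b) = img Z S (?r c)"
    using e img_image[OF oU Z(1,2) S(1) SZ] cl by simp
  then have "img Z S (?r b \<ominus>\<^bsub>sect X Z\<^esub> ?r c) = \<zero>\<^bsub>sect Y S\<^esub>"
    using rc by (simp add: RS.r_right_minus_eq)
  then have "?r b \<ominus>\<^bsub>sect X Z\<^esub> ?r c \<in> I Z"
    unfolding ideal_iff[OF Z(1)] Z(3) using rc iZ by simp
  then have "q Z (?r a) (?r b \<ominus>\<^bsub>sect X Z\<^esub> ?r c) \<in> I Z" by (rule bracket_ideal[OF U abc(1) Z(1,2)])
  also have "q Z (?r a) (?r b \<ominus>\<^bsub>sect X Z\<^esub> ?r c) = q Z (?r a) (?r b) \<ominus>\<^bsub>sect X Z\<^esub> q Z (?r a) (?r c)"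
    by (rule linear_on_minus[OF RZ.kalgebra_axioms RZ.kalgebra_axioms X.q_linear(1)[OF Z(1) rc(1)] rc(2,3)])
  finally have "img Z S (q Z (?r a) (?r b) \<ominus>\<^bsub>sect X Z\<^esub> q Z (?r a) (?r c)) = \<zero>\<^bsub>sect Y S\<^esub>"
    unfolding ideal_iff[OF Z(1)] Z(3) using iZ by auto
  then have "img Z S (q Z (?r a) (?r b)) = img Z S (q Z (?r a) (?r c))"
    using X.q_closed[OF Z(1) rc(1)] rc by (simp add: RS.r_right_minus_eq)
  then show ?thesis
    using X.q_restr[OF oU Z(1,2)] cl img_image[OF oU Z(1,2) S(1) SZ] X.q_closed[OF oU cl(1)] by simp
qed

text \<open>The arguments are exchanged one at a time, the first with the help of
  skew-symmetry.\<close>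

lemma img_bracket_cong:
  assumes U: "U \<in> \<B>" and S: "opn Y S" "S \<subseteq> U" and abc: "a \<in> Inv U" "a' \<in> Inv U" "b \<in> Inv U" "b' \<in> Inv U"
    and e: "img U S a = img U S a'" "img U S b = img U S b'"
  shows "img U S (q U a b) = img U S (q U a' b')"
proof -
  have oU: "opn X U" by (rule base_open[OF U])
  have cl: "a \<in> carrier (sect X U)" "a' \<in> carrier (sect X U)" "b \<in> carrier (sect X U)" "b' \<in> carrier (sect X U)"
    using abc by (blast intro: inv_sect[OF U])+
  interpret f: kalgebra_hom "sect X U" "sect Y S" K "img U S" by (rule img_khom[OF oU S])
  have "img U S (q U a b) = img U S (q U a b')" by (rule img_bracket_cong_right[OF U S abc(1,3,4) e(2)])
  also have "\<dots> = \<ominus>\<^bsub>sect Y S\<^esub> img U S (q U b' a)"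
    using X.q_skew[OF oU cl(1,4)] X.q_closed[OF oU cl(4,1)] by simp
  also have "img U S (q U b' a) = img U S (q U b' a')" by (rule img_bracket_cong_right[OF U S abc(4,1,2) e(1)])
  also have "\<ominus>\<^bsub>sect Y S\<^esub> img U S (q U b' a') = img U S (q U a' b')"
    using X.q_skew[OF oU cl(2,4)] X.q_closed[OF oU cl(4,2)] by simp
  finally show ?thesis .
qed

text \<open>The sets \<open>S\<close> are not required to be of the form \<open>U \<inter> Y\<close>: the quotient topology of \<open>Y\<close> might a priori be
  finer than the one induced from the quotient of \<open>X\<close>.\<close>

definition represents :: "'p set \<Rightarrow> 'k \<Rightarrow> 'p set \<Rightarrow> 'p set \<Rightarrow> 'd \<Rightarrow> bool" where
  "represents T s U S a \<longleftrightarrow> U \<in> \<B> \<and> a \<in> Inv U \<and> opn Y S \<and> S \<subseteq> T \<and> S \<subseteq> U \<and> restr Y T S s = img U S a"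

text \<open>Representatives are asked for around points of T on arbitrary open pieces S, whereas
  sections of the reduced space have them around orbits. The weaker condition is sufficient for
  constructing the bracket and for its identities.\<close>

definition locally_inv :: "'p set \<Rightarrow> 'k set" where
  "locally_inv T = {s \<in> carrier (sect Y T). \<forall>y\<in>T. \<exists>U S a. y \<in> S \<and> represents T s U S a}"

lemma represents_restr:
  assumes r: "represents T s U S a" and T: "opn Y T" "s \<in> carrier (sect Y T)"
    and U': "U' \<in> \<B>" "U' \<subseteq> U" and S': "opn Y S'" "S' \<subseteq> S" "S' \<subseteq> U'"
  shows "represents T s U' S' (restr X U U' a)"
proof -
  note r' = r[unfolded represents_def]
  have U: "U \<in> \<B>" and a: "a \<in> Inv U" and S: "opn Y S" "S \<subseteq> T" "S \<subseteq> U" using r' by auto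
  note ac = inv_sect[OF U a]
  have "restr Y T S' s = restr Y S S' (restr Y T S s)" by (rule Y.restr_restr[OF T(1) S(1) S'(1,2) S(2) T(2), symmetric])
  also have "\<dots> = img U S' a" using r' img_restr[OF base_open[OF U] S(1,3) S'(1,2) ac] by simp
  also have "\<dots> = img U' S' (restr X U U' a)"
    by (rule img_image[OF base_open[OF U] base_open[OF U'(1)] U'(2) S'(1,3) ac, symmetric])
  finally show ?thesis unfolding represents_def using U'(1) inv_restr[OF U U' a] S' S by auto
qed

lemma represents_join:
  assumes T: "opn Y T" and st: "s \<in> carrier (sect Y T)" "t \<in> carrier (sect Y T)"
    and r: "represents T s U S a" "represents T t U' S' b"
  shows "represents T s (U \<inter> U') (S \<inter> S') (restr X U (U \<inter> U') a)" "represents T t (U \<inter> U') (S \<inter> S') (restr X U' (U \<inter> U') b)"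
proof -
  have U: "U \<inter> U' \<in> \<B>" and S: "opn Y (S \<inter> S')" and sub: "S \<inter> S' \<subseteq> U \<inter> U'"
    using r base_Int unfolding represents_def by auto
  show "represents T s (U \<inter> U') (S \<inter> S') (restr X U (U \<inter> U') a)"
    by (rule represents_restr[OF r(1) T st(1) U Int_lower1 S Int_lower1 sub])
  show "represents T t (U \<inter> U') (S \<inter> S') (restr X U' (U \<inter> U') b)"
    by (rule represents_restr[OF r(2) T st(2) U Int_lower2 S Int_lower2 sub])
qed

lemma locally_inv_sect: "s \<in> locally_inv T \<Longrightarrow> s \<in> carrier (sect Y T)"
  unfolding locally_inv_def by blast

text \<open>Three sections, because the product rule and the Jacobi identity involve three. All are
  represented over the same U and on the same S, so that an identity of brackets can be
  transferred.\<close>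

lemma locally_inv_common3:
  assumes T: "opn Y T" and s: "s \<in> locally_inv T" "t \<in> locally_inv T" "u \<in> locally_inv T" and y: "y \<in> T"
  obtains U S a b c where "y \<in> S" "represents T s U S a" "represents T t U S b" "represents T u U S c"
proof -
  note sc = s[THEN locally_inv_sect]
  obtain U1 S1 a where 1: "y \<in> S1" "represents T s U1 S1 a" using s(1) y unfolding locally_inv_def by blast
  obtain U2 S2 b where 2: "y \<in> S2" "represents T t U2 S2 b" using s(2) y unfolding locally_inv_def by blast
  obtain U3 S3 c where 3: "y \<in> S3" "represents T u U3 S3 c" using s(3) y unfolding locally_inv_def by blast
  obtain a' b' where 12: "represents T s (U1 \<inter> U2) (S1 \<inter> S2) a'" "represents T t (U1 \<inter> U2) (S1 \<inter> S2) b'"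
    using represents_join[OF T sc(1,2) 1(2) 2(2)] by blast
  show thesis
  proof (rule that)
    show "y \<in> S1 \<inter> S2 \<inter> S3" using 1 2 3 by blast
    show "represents T s (U1 \<inter> U2 \<inter> U3) (S1 \<inter> S2 \<inter> S3) (restr X (U1 \<inter> U2) (U1 \<inter> U2 \<inter> U3) a')"
      by (rule represents_join(1)[OF T sc(1,3) 12(1) 3(2)])
    show "represents T t (U1 \<inter> U2 \<inter> U3) (S1 \<inter> S2 \<inter> S3) (restr X (U1 \<inter> U2) (U1 \<inter> U2 \<inter> U3) b')"
      by (rule represents_join(1)[OF T sc(2,3) 12(2) 3(2)])
    show "represents T u (U1 \<inter> U2 \<inter> U3) (S1 \<inter> S2 \<inter> S3) (restr X U3 (U1 \<inter> U2 \<inter> U3) c)"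
      by (rule represents_join(2)[OF T sc(1,3) 12(1) 3(2)])
  qed
qed

definition reduced :: "'p set \<Rightarrow> 'k \<Rightarrow> 'k \<Rightarrow> 'k" where
  "reduced T s t = (THE r. r \<in> carrier (sect Y T) \<and>
     (\<forall>U S a b. represents T s U S a \<and> represents T t U S b \<longrightarrow> restr Y T S r = img U S (q U a b)))"

text \<open>The local brackets are glued. On an overlap both pairs of representatives are restricted
  to the intersection of their domains; there they have equal images in Y, and so have their
  brackets by \<open>img_bracket_cong\<close>.\<close>

lemma reduced_ex1:
  assumes T: "opn Y T" and s: "s \<in> locally_inv T" "t \<in> locally_inv T"
  shows "\<exists>!r. r \<in> carrier (sect Y T) \<and>
    (\<forall>U S a b. represents T s U S a \<and> represents T t U S b \<longrightarrow> restr Y T S r = img U S (q U a b))"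
proof -
  note sc = s[THEN locally_inv_sect]
  define F where "F = {(S, img U S (q U a b)) | U S a b. represents T s U S a \<and> represents T t U S b}"
  have "\<exists>!r. r \<in> carrier (sect Y T) \<and> (\<forall>(S, \<sigma>)\<in>F. restr Y T S r = \<sigma>)"
  proof (rule Y.glue)
    fix S \<sigma> assume "(S, \<sigma>) \<in> F"
    then obtain U a b where r: "represents T s U S a" "represents T t U S b" and \<sigma>: "\<sigma> = img U S (q U a b)"
      unfolding F_def by blast
    have U: "U \<in> \<B>" and a: "a \<in> Inv U" and b: "b \<in> Inv U" and S: "opn Y S" "S \<subseteq> T" "S \<subseteq> U"
      using r unfolding represents_def by auto
    have "\<sigma> \<in> carrier (sect Y S)" unfolding \<sigma>
      by (rule alg_hom_closed[OF img_hom[OF base_open[OF U] S(1,3)] inv_sect[OF U inv_bracket[OF U a b]]])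
    then show "opn Y S \<and> S \<subseteq> T \<and> \<sigma> \<in> carrier (sect Y S)" using S by blast
  next
    fix y assume "y \<in> T"
    from locally_inv_common3[OF T s s(2) this] obtain U S a b where "y \<in> S" "represents T s U S a" "represents T t U S b" by metis
    then show "\<exists>(S, \<sigma>)\<in>F. y \<in> S" unfolding F_def by blast
  next
    fix S \<sigma> S' \<sigma>' y assume F: "(S, \<sigma>) \<in> F" "(S', \<sigma>') \<in> F" and y: "y \<in> S" "y \<in> S'"
    obtain U a b where r: "represents T s U S a" "represents T t U S b" and \<sigma>: "\<sigma> = img U S (q U a b)"
      using F(1) unfolding F_def by blast
    obtain U' a' b' where r': "represents T s U' S' a'" "represents T t U' S' b'" and \<sigma>': "\<sigma>' = img U' S' (q U' a' b')"
      using F(2) unfolding F_def by blast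
    let ?N = "S \<inter> S'" and ?M = "U \<inter> U'"
    have U: "U \<in> \<B>" and a: "a \<in> Inv U" and b: "b \<in> Inv U" and S: "opn Y S" "S \<subseteq> U"
      using r unfolding represents_def by auto
    have U': "U' \<in> \<B>" and a': "a' \<in> Inv U'" and b': "b' \<in> Inv U'" and S': "opn Y S'" "S' \<subseteq> U'"
      using r' unfolding represents_def by auto
    have M: "?M \<in> \<B>" by (rule base_Int[OF U U'])
    have N: "opn Y ?N" "?N \<subseteq> ?M" using S S' by auto
    have ra: "represents T s ?M ?N (restr X U ?M a)" "represents T s ?M ?N (restr X U' ?M a')"
      by (rule represents_join[OF T sc(1) sc(1) r(1) r'(1)])+
    have rb: "represents T t ?M ?N (restr X U ?M b)" "represents T t ?M ?N (restr X U' ?M b')"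
      by (rule represents_join[OF T sc(2) sc(2) r(2) r'(2)])+
    \<comment> \<open>Restriction in Y of a local bracket is the image of the bracket of the
      restricted representatives, which brings both sides to the common domain.\<close>
    have *: "restr Y S0 ?N (img U0 S0 (q U0 a0 b0)) = img ?M ?N (q ?M (restr X U0 ?M a0) (restr X U0 ?M b0))"
      if "U0 \<in> \<B>" "a0 \<in> Inv U0" "b0 \<in> Inv U0" "opn Y S0" "S0 \<subseteq> U0" "?N \<subseteq> S0" "?M \<subseteq> U0" for U0 S0 a0 b0
      using img_restr[OF base_open[OF that(1)] that(4,5) N(1) that(6) inv_sect[OF that(1) inv_bracket[OF that(1-3)]]]
        img_image[OF base_open[OF that(1)] base_open[OF M] that(7) N inv_sect[OF that(1) inv_bracket[OF that(1-3)]]]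
        X.q_restr[OF base_open[OF that(1)] base_open[OF M] that(7) inv_sect[OF that(1,2)] inv_sect[OF that(1,3)]] by simp
    have "img ?M ?N (q ?M (restr X U ?M a) (restr X U ?M b)) = img ?M ?N (q ?M (restr X U' ?M a') (restr X U' ?M b'))"
      using ra rb by (intro img_bracket_cong[OF M N]) (auto simp: represents_def)
    then have "restr Y S ?N \<sigma> = restr Y S' ?N \<sigma>'"
      unfolding \<sigma> \<sigma>' *[OF U a b S Int_lower1 Int_lower1] *[OF U' a' b' S' Int_lower2 Int_lower2] .
    then show "\<exists>N. opn Y N \<and> y \<in> N \<and> N \<subseteq> S \<and> N \<subseteq> S' \<and> restr Y S N \<sigma> = restr Y S' N \<sigma>'"
      using N y by (intro exI[of _ ?N]) auto
  qed
  moreover have "(\<forall>(S, \<sigma>)\<in>F. restr Y T S r = \<sigma>) \<longleftrightarrow>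
      (\<forall>U S a b. represents T s U S a \<and> represents T t U S b \<longrightarrow> restr Y T S r = img U S (q U a b))" for r
  proof (intro iffI allI impI)
    fix U S a b assume l: "\<forall>(S, \<sigma>)\<in>F. restr Y T S r = \<sigma>" and r: "represents T s U S a \<and> represents T t U S b"
    have "(S, img U S (q U a b)) \<in> F" unfolding F_def using r by blast
    from bspec[OF l this] show "restr Y T S r = img U S (q U a b)" by simp
  qed (auto simp: F_def)
  ultimately show ?thesis by simp
qed

lemma reduced_closed:
  assumes "opn Y T" "s \<in> locally_inv T" "t \<in> locally_inv T"
  shows "reduced T s t \<in> carrier (sect Y T)"
  using theI'[OF reduced_ex1[OF assms]] unfolding reduced_def by blast

lemma restr_reduced:
  assumes "opn Y T" "s \<in> locally_inv T" "t \<in> locally_inv T" "represents T s U S a" "represents T t U S b"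
  shows "restr Y T S (reduced T s t) = img U S (q U a b)"
  using theI'[OF reduced_ex1[OF assms(1-3)]] assms(4,5) unfolding reduced_def by blast

lemma represents_reduced:
  assumes T: "opn Y T" "s \<in> locally_inv T" "t \<in> locally_inv T" and r: "represents T s U S a" "represents T t U S b"
  shows "represents T (reduced T s t) U S (q U a b)"
  using restr_reduced[OF assms] r inv_bracket unfolding represents_def by simp

lemma locally_invI:
  assumes "s \<in> carrier (sect Y T)" "\<And>y. y \<in> T \<Longrightarrow> \<exists>U S a. y \<in> S \<and> represents T s U S a"
  shows "s \<in> locally_inv T"
  using assms unfolding locally_inv_def by blast

lemma locally_inv_reduced:
  assumes T: "opn Y T" "s \<in> locally_inv T" "t \<in> locally_inv T"
  shows "reduced T s t \<in> locally_inv T"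
proof (rule locally_invI[OF reduced_closed[OF T]])
  fix y assume "y \<in> T"
  from locally_inv_common3[OF T T(3) this] obtain U S a b where y: "y \<in> S" and r: "represents T s U S a" "represents T t U S b" by metis
  show "\<exists>U S a. y \<in> S \<and> represents T (reduced T s t) U S a" using y represents_reduced[OF T r] by blast
qed

lemma
  assumes T: "opn Y T" and st: "s \<in> carrier (sect Y T)" "t \<in> carrier (sect Y T)"
    and r: "represents T s U S a" "represents T t U S b"
  shows represents_add: "represents T (s \<oplus>\<^bsub>sect Y T\<^esub> t) U S (a \<oplus>\<^bsub>sect X U\<^esub> b)"
    and represents_mult: "represents T (s \<otimes>\<^bsub>sect Y T\<^esub> t) U S (a \<otimes>\<^bsub>sect X U\<^esub> b)"
    and represents_smult: "k \<in> K \<Longrightarrow> represents T (k \<odot>\<^bsub>sect Y T\<^esub> s) U S (k \<odot>\<^bsub>sect X U\<^esub> a)"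
proof -
  have U: "U \<in> \<B>" and a: "a \<in> Inv U" and b: "b \<in> Inv U" and S: "opn Y S" "S \<subseteq> T" "S \<subseteq> U"
    and e: "restr Y T S s = img U S a" "restr Y T S t = img U S b"
    using r unfolding represents_def by auto
  interpret f: kalgebra_hom "sect X U" "sect Y S" K "img U S" by (rule img_khom[OF base_open[OF U] S(1,3)])
  note ac = inv_sect[OF U a] and bc = inv_sect[OF U b]
  show "represents T (s \<oplus>\<^bsub>sect Y T\<^esub> t) U S (a \<oplus>\<^bsub>sect X U\<^esub> b)"
    using U inv_add[OF U a b] S e ac bc Y.restr_add[OF T S(1,2) st] unfolding represents_def by simp
  show "represents T (s \<otimes>\<^bsub>sect Y T\<^esub> t) U S (a \<otimes>\<^bsub>sect X U\<^esub> b)"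
    using U inv_mult[OF U a b] S e ac bc Y.restr_mult[OF T S(1,2) st] unfolding represents_def by simp
  show "represents T (k \<odot>\<^bsub>sect Y T\<^esub> s) U S (k \<odot>\<^bsub>sect X U\<^esub> a)" if k: "k \<in> K"
    using U inv_smult[OF U k a] S e ac Y.restr_smult[OF T S(1,2) k st(1)] k unfolding represents_def by simp
qed

lemma
  assumes T: "opn Y T" and s: "s \<in> locally_inv T" and t: "t \<in> locally_inv T"
  shows locally_inv_add: "s \<oplus>\<^bsub>sect Y T\<^esub> t \<in> locally_inv T"
    and locally_inv_mult: "s \<otimes>\<^bsub>sect Y T\<^esub> t \<in> locally_inv T"
    and locally_inv_smult: "k \<in> K \<Longrightarrow> k \<odot>\<^bsub>sect Y T\<^esub> s \<in> locally_inv T"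
proof -
  interpret RT: kalgebra "sect Y T" K by (rule Y.alg[OF T])
  note sc = locally_inv_sect[OF s] and tc = locally_inv_sect[OF t]
  have loc: "\<exists>U S a b. y \<in> S \<and> represents T s U S a \<and> represents T t U S b" if y: "y \<in> T" for y
    using locally_inv_common3[OF T s t t y] by metis
  show "s \<oplus>\<^bsub>sect Y T\<^esub> t \<in> locally_inv T"
    using loc represents_add[OF T sc tc] by (intro locally_invI) (use sc tc in simp, meson)
  show "s \<otimes>\<^bsub>sect Y T\<^esub> t \<in> locally_inv T"
    using loc represents_mult[OF T sc tc] by (intro locally_invI) (use sc tc in simp, meson)
  show "k \<odot>\<^bsub>sect Y T\<^esub> s \<in> locally_inv T" if k: "k \<in> K"
    using loc represents_smult[OF T sc tc _ _ k] by (intro locally_invI) (use sc k in simp, meson)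
qed

text \<open>The common scheme for all identities of the reduced bracket: on pieces where the
  sections have representatives, an identity is the image of the same identity for q.\<close>

lemma reduced_eqI:
  assumes T: "opn Y T" and s: "s \<in> locally_inv T" "t \<in> locally_inv T" "u \<in> locally_inv T"
    and lr: "l \<in> carrier (sect Y T)" "r \<in> carrier (sect Y T)"
    and eq: "\<And>U S a b c. opn X U \<Longrightarrow> opn Y S \<Longrightarrow> S \<subseteq> T \<Longrightarrow> S \<subseteq> U \<Longrightarrow> a \<in> carrier (sect X U) \<Longrightarrow>
      b \<in> carrier (sect X U) \<Longrightarrow> c \<in> carrier (sect X U) \<Longrightarrow> kalgebra_hom (sect X U) (sect Y S) K (img U S) \<Longrightarrow>
      represents T s U S a \<Longrightarrow> represents T t U S b \<Longrightarrow> represents T u U S c \<Longrightarrow> restr Y T S l = restr Y T S r"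
  shows "l = r"
proof (rule Y.section_eqI[OF T lr])
  fix y assume "y \<in> T"
  from locally_inv_common3[OF T s this] obtain U S a b c where y: "y \<in> S"
    and r: "represents T s U S a" "represents T t U S b" "represents T u U S c" by metis
  have U: "U \<in> \<B>" and S: "opn Y S" "S \<subseteq> T" "S \<subseteq> U" and i: "a \<in> Inv U" "b \<in> Inv U" "c \<in> Inv U"
    using r unfolding represents_def by auto
  have "restr Y T S l = restr Y T S r"
    by (rule eq[OF base_open[OF U] S inv_sect[OF U i(1)] inv_sect[OF U i(2)] inv_sect[OF U i(3)]
          img_khom[OF base_open[OF U] S(1,3)] r])
  then show "\<exists>V. opn Y V \<and> y \<in> V \<and> V \<subseteq> T \<and> restr Y T V l = restr Y T V r" using S y by blast
qed

context
  fixes T assumes T: "opn Y T"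
begin

interpretation RT: kalgebra "sect Y T" K by (rule Y.alg[OF T])

lemma reduced_add:
  assumes s: "s \<in> locally_inv T" and t: "t \<in> locally_inv T" and u: "u \<in> locally_inv T"
  shows "reduced T s (t \<oplus>\<^bsub>sect Y T\<^esub> u) = reduced T s t \<oplus>\<^bsub>sect Y T\<^esub> reduced T s u"
proof (rule reduced_eqI[OF T s t u])
  note sc = s[THEN locally_inv_sect] and tc = t[THEN locally_inv_sect] and uc = u[THEN locally_inv_sect]
  note tu = locally_inv_add[OF T t u]
  note st' = reduced_closed[OF T s t] and su' = reduced_closed[OF T s u]
  show "reduced T s (t \<oplus>\<^bsub>sect Y T\<^esub> u) \<in> carrier (sect Y T)" by (rule reduced_closed[OF T s tu])
  show "reduced T s t \<oplus>\<^bsub>sect Y T\<^esub> reduced T s u \<in> carrier (sect Y T)" using st' su' by simp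
  fix U S a b c assume U: "opn X U" and S: "opn Y S" "S \<subseteq> T" "S \<subseteq> U"
    and cl: "a \<in> carrier (sect X U)" "b \<in> carrier (sect X U)" "c \<in> carrier (sect X U)"
    and f: "kalgebra_hom (sect X U) (sect Y S) K (img U S)"
    and r: "represents T s U S a" "represents T t U S b" "represents T u U S c"
  interpret f: kalgebra_hom "sect X U" "sect Y S" K "img U S" by (rule f)
  show "restr Y T S (reduced T s (t \<oplus>\<^bsub>sect Y T\<^esub> u)) = restr Y T S (reduced T s t \<oplus>\<^bsub>sect Y T\<^esub> reduced T s u)"
    using restr_reduced[OF T s tu r(1) represents_add[OF T tc uc r(2,3)]] restr_reduced[OF T s t r(1,2)]
      restr_reduced[OF T s u r(1,3)] Y.restr_add[OF T S(1,2) st' su'] X.q_add[OF U cl]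
      X.q_closed[OF U cl(1,2)] X.q_closed[OF U cl(1,3)] by simp
qed

lemma reduced_smult:
  assumes s: "s \<in> locally_inv T" and t: "t \<in> locally_inv T" and k: "k \<in> K"
  shows "reduced T s (k \<odot>\<^bsub>sect Y T\<^esub> t) = k \<odot>\<^bsub>sect Y T\<^esub> reduced T s t"
proof (rule reduced_eqI[OF T s t t])
  note tc = t[THEN locally_inv_sect]
  note kt = locally_inv_smult[OF T t t k] and st' = reduced_closed[OF T s t]
  show "reduced T s (k \<odot>\<^bsub>sect Y T\<^esub> t) \<in> carrier (sect Y T)" by (rule reduced_closed[OF T s kt])
  show "k \<odot>\<^bsub>sect Y T\<^esub> reduced T s t \<in> carrier (sect Y T)" using st' k by simp
  fix U S a b c assume U: "opn X U" and S: "opn Y S" "S \<subseteq> T" "S \<subseteq> U"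
    and cl: "a \<in> carrier (sect X U)" "b \<in> carrier (sect X U)" "c \<in> carrier (sect X U)"
    and f: "kalgebra_hom (sect X U) (sect Y S) K (img U S)"
    and r: "represents T s U S a" "represents T t U S b" "represents T t U S c"
  interpret f: kalgebra_hom "sect X U" "sect Y S" K "img U S" by (rule f)
  show "restr Y T S (reduced T s (k \<odot>\<^bsub>sect Y T\<^esub> t)) = restr Y T S (k \<odot>\<^bsub>sect Y T\<^esub> reduced T s t)"
    using restr_reduced[OF T s kt r(1) represents_smult[OF T tc tc r(2,2) k]] restr_reduced[OF T s t r(1,2)]
      Y.restr_smult[OF T S(1,2) k st'] X.q_smult[OF U cl(1,2) k] X.q_closed[OF U cl(1,2)] k by simp
qed

lemma reduced_mult:
  assumes s: "s \<in> locally_inv T" and t: "t \<in> locally_inv T" and u: "u \<in> locally_inv T"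
  shows "reduced T s (t \<otimes>\<^bsub>sect Y T\<^esub> u) =
    (reduced T s t \<otimes>\<^bsub>sect Y T\<^esub> u) \<oplus>\<^bsub>sect Y T\<^esub> (t \<otimes>\<^bsub>sect Y T\<^esub> reduced T s u)"
proof (rule reduced_eqI[OF T s t u])
  note sc = s[THEN locally_inv_sect] and tc = t[THEN locally_inv_sect] and uc = u[THEN locally_inv_sect]
  note tu = locally_inv_mult[OF T t u]
  note st' = reduced_closed[OF T s t] and su' = reduced_closed[OF T s u]
  show "reduced T s (t \<otimes>\<^bsub>sect Y T\<^esub> u) \<in> carrier (sect Y T)" by (rule reduced_closed[OF T s tu])
  show "(reduced T s t \<otimes>\<^bsub>sect Y T\<^esub> u) \<oplus>\<^bsub>sect Y T\<^esub> (t \<otimes>\<^bsub>sect Y T\<^esub> reduced T s u) \<in> carrier (sect Y T)"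
    using st' su' tc uc by simp
  fix U S a b c assume U: "opn X U" and S: "opn Y S" "S \<subseteq> T" "S \<subseteq> U"
    and cl: "a \<in> carrier (sect X U)" "b \<in> carrier (sect X U)" "c \<in> carrier (sect X U)"
    and f: "kalgebra_hom (sect X U) (sect Y S) K (img U S)"
    and r: "represents T s U S a" "represents T t U S b" "represents T u U S c"
  interpret f: kalgebra_hom "sect X U" "sect Y S" K "img U S" by (rule f)
  have e: "restr Y T S t = img U S b" "restr Y T S u = img U S c" using r unfolding represents_def by auto
  show "restr Y T S (reduced T s (t \<otimes>\<^bsub>sect Y T\<^esub> u)) =
      restr Y T S ((reduced T s t \<otimes>\<^bsub>sect Y T\<^esub> u) \<oplus>\<^bsub>sect Y T\<^esub> (t \<otimes>\<^bsub>sect Y T\<^esub> reduced T s u))"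
    using restr_reduced[OF T s tu r(1) represents_mult[OF T tc uc r(2,3)]] restr_reduced[OF T s t r(1,2)]
      restr_reduced[OF T s u r(1,3)] X.q_leibniz[OF U cl]
      X.q_closed[OF U cl(1,2)] X.q_closed[OF U cl(1,3)] st' su' tc uc e cl by (simp add: Y.restr_add[OF T S(1,2)] Y.restr_mult[OF T S(1,2)])
qed

lemma reduced_skew:
  assumes s: "s \<in> locally_inv T" and t: "t \<in> locally_inv T"
  shows "reduced T s t = \<ominus>\<^bsub>sect Y T\<^esub> reduced T t s"
proof (rule reduced_eqI[OF T s t t])
  note st' = reduced_closed[OF T s t] and ts' = reduced_closed[OF T t s]
  show "reduced T s t \<in> carrier (sect Y T)" "\<ominus>\<^bsub>sect Y T\<^esub> reduced T t s \<in> carrier (sect Y T)" using st' ts' by simp_all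
  fix U S a b c assume U: "opn X U" and S: "opn Y S" "S \<subseteq> T" "S \<subseteq> U"
    and cl: "a \<in> carrier (sect X U)" "b \<in> carrier (sect X U)" "c \<in> carrier (sect X U)"
    and f: "kalgebra_hom (sect X U) (sect Y S) K (img U S)"
    and r: "represents T s U S a" "represents T t U S b" "represents T t U S c"
  interpret f: kalgebra_hom "sect X U" "sect Y S" K "img U S" by (rule f)
  show "restr Y T S (reduced T s t) = restr Y T S (\<ominus>\<^bsub>sect Y T\<^esub> reduced T t s)"
    using restr_reduced[OF T s t r(1,2)] restr_reduced[OF T t s r(2,1)] Y.restr_neg[OF T S(1,2) ts']
      X.q_skew[OF U cl(1,2)] X.q_closed[OF U cl(2,1)] by simp
qed

text \<open>Brackets of invariant functions are invariant, hence the inner brackets are again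
  represented, by the inner brackets of the representatives.\<close>

lemma reduced_jacobi:
  assumes s: "s \<in> locally_inv T" and t: "t \<in> locally_inv T" and u: "u \<in> locally_inv T"
  shows "reduced T s (reduced T t u) \<oplus>\<^bsub>sect Y T\<^esub> reduced T t (reduced T u s) \<oplus>\<^bsub>sect Y T\<^esub> reduced T u (reduced T s t) =
    \<zero>\<^bsub>sect Y T\<^esub>"
proof (rule reduced_eqI[OF T s t u])
  note i = locally_inv_reduced[OF T t u] locally_inv_reduced[OF T u s] locally_inv_reduced[OF T s t]
  note c = reduced_closed[OF T s i(1)] reduced_closed[OF T t i(2)] reduced_closed[OF T u i(3)]
  show "reduced T s (reduced T t u) \<oplus>\<^bsub>sect Y T\<^esub> reduced T t (reduced T u s) \<oplus>\<^bsub>sect Y T\<^esub> reduced T u (reduced T s t)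
      \<in> carrier (sect Y T)" using c by simp
  fix U S a b c' assume U: "opn X U" and S: "opn Y S" "S \<subseteq> T" "S \<subseteq> U"
    and cl: "a \<in> carrier (sect X U)" "b \<in> carrier (sect X U)" "c' \<in> carrier (sect X U)"
    and f: "kalgebra_hom (sect X U) (sect Y S) K (img U S)"
    and r: "represents T s U S a" "represents T t U S b" "represents T u U S c'"
  interpret f: kalgebra_hom "sect X U" "sect Y S" K "img U S" by (rule f)
  note rr = represents_reduced[OF T t u r(2,3)] represents_reduced[OF T u s r(3,1)] represents_reduced[OF T s t r(1,2)]
  note qc = X.q_closed[OF U cl(2,3)] X.q_closed[OF U cl(3,1)] X.q_closed[OF U cl(1,2)]
  note qq = X.q_closed[OF U cl(1) qc(1)] X.q_closed[OF U cl(2) qc(2)] X.q_closed[OF U cl(3) qc(3)]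
  have "restr Y T S (reduced T s (reduced T t u) \<oplus>\<^bsub>sect Y T\<^esub> reduced T t (reduced T u s) \<oplus>\<^bsub>sect Y T\<^esub> reduced T u (reduced T s t))
      = img U S (q U a (q U b c') \<oplus>\<^bsub>sect X U\<^esub> q U b (q U c' a) \<oplus>\<^bsub>sect X U\<^esub> q U c' (q U a b))"
    using restr_reduced[OF T s i(1) r(1) rr(1)] restr_reduced[OF T t i(2) r(2) rr(2)] restr_reduced[OF T u i(3) r(3) rr(3)]
      c qq by (simp add: Y.restr_add[OF T S(1,2)])
  also have "\<dots> = restr Y T S \<zero>\<^bsub>sect Y T\<^esub>" unfolding X.q_jacobi[OF U cl] Y.restr_zero[OF T S(1,2)] by simp
  finally show "restr Y T S (reduced T s (reduced T t u) \<oplus>\<^bsub>sect Y T\<^esub> reduced T t (reduced T u s) \<oplus>\<^bsub>sect Y T\<^esub> reduced T u (reduced T s t))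
      = restr Y T S \<zero>\<^bsub>sect Y T\<^esub>" .
qed simp

lemma represents_restr_section:
  assumes T': "opn Y T'" "T' \<subseteq> T" and s: "s \<in> carrier (sect Y T)" and r: "represents T s U S a"
  shows "represents T' (restr Y T T' s) U (S \<inter> T') a"
proof -
  have U: "U \<in> \<B>" and a: "a \<in> Inv U" and S: "opn Y S" "S \<subseteq> T" "S \<subseteq> U" "restr Y T S s = img U S a"
    using r unfolding represents_def by auto
  have N: "opn Y (S \<inter> T')" using S(1) T'(1) by auto
  have "restr Y T' (S \<inter> T') (restr Y T T' s) = restr Y S (S \<inter> T') (restr Y T S s)"
    using Y.restr_restr[OF T T'(1) N Int_lower2 T'(2) s] Y.restr_restr[OF T S(1) N Int_lower1 S(2) s] by simp
  also have "\<dots> = img U (S \<inter> T') a"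
    unfolding S(4) by (rule img_restr[OF base_open[OF U] S(1,3) N Int_lower1 inv_sect[OF U a]])
  finally show ?thesis unfolding represents_def using U a N S by auto
qed

lemma locally_inv_restr:
  assumes T': "opn Y T'" "T' \<subseteq> T" and s: "s \<in> locally_inv T"
  shows "restr Y T T' s \<in> locally_inv T'"
proof (rule locally_invI)
  note sc = locally_inv_sect[OF s]
  show "restr Y T T' s \<in> carrier (sect Y T')" by (rule Y.restr_closed[OF T T' sc])
  fix y assume y: "y \<in> T'"
  then obtain U S a where "y \<in> S" "represents T s U S a" using s T' unfolding locally_inv_def by blast
  then show "\<exists>U S a. y \<in> S \<and> represents T' (restr Y T T' s) U S a"
    using represents_restr_section[OF T' sc] y by blast
qed

lemma reduced_restr:
  assumes T': "opn Y T'" "T' \<subseteq> T" and s: "s \<in> locally_inv T" and t: "t \<in> locally_inv T"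
  shows "reduced T' (restr Y T T' s) (restr Y T T' t) = restr Y T T' (reduced T s t)"
proof (rule Y.section_eqI[OF T'(1)])
  note sc = locally_inv_sect[OF s] and tc = locally_inv_sect[OF t]
  note s' = locally_inv_restr[OF T' s] and t' = locally_inv_restr[OF T' t]
  note st = reduced_closed[OF T s t]
  show "reduced T' (restr Y T T' s) (restr Y T T' t) \<in> carrier (sect Y T')" by (rule reduced_closed[OF T'(1) s' t'])
  show "restr Y T T' (reduced T s t) \<in> carrier (sect Y T')" by (rule Y.restr_closed[OF T T' st])
  fix y assume y: "y \<in> T'"
  then have "y \<in> T" using T' by blast
  from locally_inv_common3[OF T s t t this] obtain U S a b where yS: "y \<in> S"
    and r: "represents T s U S a" "represents T t U S b" by metis
  have U: "U \<in> \<B>" and a: "a \<in> Inv U" and b: "b \<in> Inv U" and S: "opn Y S" "S \<subseteq> T" "S \<subseteq> U"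
    using r unfolding represents_def by auto
  have N: "opn Y (S \<inter> T')" using S(1) T'(1) by auto
  have "restr Y T' (S \<inter> T') (restr Y T T' (reduced T s t)) = restr Y S (S \<inter> T') (restr Y T S (reduced T s t))"
    using Y.restr_restr[OF T T'(1) N Int_lower2 T'(2) st] Y.restr_restr[OF T S(1) N Int_lower1 S(2) st] by simp
  also have "\<dots> = img U (S \<inter> T') (q U a b)" unfolding restr_reduced[OF T s t r]
    by (rule img_restr[OF base_open[OF U] S(1,3) N Int_lower1 inv_sect[OF U inv_bracket[OF U a b]]])
  also have "\<dots> = restr Y T' (S \<inter> T') (reduced T' (restr Y T T' s) (restr Y T T' t))"
    by (rule restr_reduced[OF T'(1) s' t' represents_restr_section[OF T' sc r(1)] represents_restr_section[OF T' tc r(2)], symmetric])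
  finally show "\<exists>V. opn Y V \<and> y \<in> V \<and> V \<subseteq> T' \<and> restr Y T' V (reduced T' (restr Y T T' s) (restr Y T T' t)) =
      restr Y T' V (restr Y T T' (reduced T s t))"
    using N y yS by (intro exI[of _ "S \<inter> T'"]) auto
qed

end

lemma represents_rho:
  assumes U: "U \<in> \<B>" and a: "a \<in> Inv U"
  shows "represents (U \<inter> pts Y) (\<rho> U a) U (U \<inter> pts Y) a"
  using assms opn_Y_Int[OF base_open[OF U]] unfolding represents_def img_def by blast

lemma locally_inv_rho:
  assumes U: "U \<in> \<B>" and a: "a \<in> Inv U"
  shows "\<rho> U a \<in> locally_inv (U \<inter> pts Y)"
  using represents_rho[OF assms] alg_hom_closed[OF rho_hom[OF base_open[OF U]] inv_sect[OF assms]]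
  by (intro locally_invI) blast+

lemma reduced_rho:
  assumes U: "U \<in> \<B>" and a: "a \<in> Inv U" and b: "b \<in> Inv U"
  shows "reduced (U \<inter> pts Y) (\<rho> U a) (\<rho> U b) = \<rho> U (q U a b)"
proof -
  have oY: "opn Y (U \<inter> pts Y)" by (rule opn_Y_Int[OF base_open[OF U]])
  note i = locally_inv_rho[OF U a] locally_inv_rho[OF U b]
  have "restr Y (U \<inter> pts Y) (U \<inter> pts Y) (reduced (U \<inter> pts Y) (\<rho> U a) (\<rho> U b)) = img U (U \<inter> pts Y) (q U a b)"
    by (rule restr_reduced[OF oY i represents_rho[OF U a] represents_rho[OF U b]])
  then show ?thesis
    using Y.restr_id[OF oY] reduced_closed[OF oY i] alg_hom_closed[OF rho_hom[OF base_open[OF U]] inv_sect[OF U inv_bracket[OF U a b]]]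
    unfolding img_def by simp
qed

end

section \<open>Hamiltonian reduction\<close>

lemma openin_quotient_topology:
  "openin (quotient_topology T \<pi>) W \<longleftrightarrow> W \<subseteq> \<pi> ` topspace T \<and> openin T {x \<in> topspace T. \<pi> x \<in> W}"
  unfolding quotient_topology_def topology_inverse'[OF istopology_quotient] ..

lemma topspace_quotient_topology: "topspace (quotient_topology T \<pi>) = \<pi> ` topspace T"
proof (rule subset_antisym)
  show "topspace (quotient_topology T \<pi>) \<subseteq> \<pi> ` topspace T"
    using openin_topspace[of "quotient_topology T \<pi>"] unfolding openin_quotient_topology by blast
  have "{x \<in> topspace T. \<pi> x \<in> \<pi> ` topspace T} = topspace T" by blast
  then have "openin (quotient_topology T \<pi>) (\<pi> ` topspace T)" unfolding openin_quotient_topology by simp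
  then show "\<pi> ` topspace T \<subseteq> topspace (quotient_topology T \<pi>)" by (rule openin_subset)
qed

locale hamiltonian_space = kaction K X G XG XGG A
  for K and X :: "('x, 'd) kspace" and G :: "('g, 'a, 'm, 'b, 'n, 'c) kgroup"
    and XG :: "('r, 'e, 'x, 'd, 'g, 'a) kprod" and XGG :: "('t, 'f, 'r, 'e, 'g, 'a) kprod"
    and A :: "('r, 'e, 'x, 'd) kmor" +
  fixes q :: "'x set \<Rightarrow> 'd \<Rightarrow> 'd \<Rightarrow> 'd" and V :: "('w, 'h) kspace"
    and \<iota> :: "('g set \<Rightarrow> 'a \<Rightarrow> 'a) \<Rightarrow> 'h" and J :: "('x, 'd, 'w, 'h) kmor"
  assumes bracket: "poisson_bracket K X q" and covariant: "covariant_bracket K X G XG A q"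
    and dual: "dual_space K (lie_algebra K G) V \<iota>" and J: "morphism K X V J"
    and hamiltonian: "hamiltonian_action K X G XG A q V \<iota> J"
begin

sublocale P: poisson_space K X q
  by (intro poisson_space.intro poisson_space_axioms.intro X.ksheaf_axioms bracket)

abbreviation "\<pi> \<equiv> orbit K X G XG A"

definition sat :: "'x set set \<Rightarrow> 'x set" where
  "sat W = {x \<in> pts X. \<pi> x \<in> W}"

text \<open>The preimages in X of the open sets of the orbit space.\<close>

definition saturated_opens :: "'x set set" where
  "saturated_opens = {sat W | W. opn X (sat W)}"

definition invariants :: "'x set \<Rightarrow> 'd set" where
  "invariants U = {a \<in> carrier (sect X U). \<forall>g\<in>spt. pull (rho g) U a = a}"

abbreviation moment :: "('g set \<Rightarrow> 'a \<Rightarrow> 'a) \<Rightarrow> 'd" where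
  "moment v \<equiv> component V \<iota> J v"

abbreviation "lie \<equiv> carrier (lie_algebra K G)"

abbreviation moments :: "'x set \<Rightarrow> 'd set" where
  "moments W \<equiv> (\<lambda>v. restr X (pts X) W (moment v)) ` lie"

lemma saturated_open: "U \<in> saturated_opens \<Longrightarrow> opn X U"
  unfolding saturated_opens_def by blast

lemma saturated_pre: "U \<in> saturated_opens \<Longrightarrow> g \<in> spt \<Longrightarrow> pre X (rho g) U = U"
  unfolding saturated_opens_def sat_def using pre_rho_saturated by blast

lemma saturated_Int: "U \<in> saturated_opens \<Longrightarrow> U' \<in> saturated_opens \<Longrightarrow> U \<inter> U' \<in> saturated_opens"
proof -
  assume "U \<in> saturated_opens" "U' \<in> saturated_opens"
  then obtain W W' where W: "U = sat W" "U' = sat W'" "opn X U" "opn X U'" unfolding saturated_opens_def by blast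
  have "U \<inter> U' = sat (W \<inter> W')" unfolding W(1,2) sat_def by blast
  moreover have "opn X (U \<inter> U')" using W(3,4) by (rule openin_Int)
  ultimately show "U \<inter> U' \<in> saturated_opens" unfolding saturated_opens_def by auto
qed

lemma invariants_sect: "a \<in> invariants U \<Longrightarrow> a \<in> carrier (sect X U)"
  unfolding invariants_def by blast

lemma pull_invariant: "a \<in> invariants U \<Longrightarrow> g \<in> spt \<Longrightarrow> pull (rho g) U a = a"
  unfolding invariants_def by blast

lemma invariantsI: "a \<in> carrier (sect X U) \<Longrightarrow> (\<And>g. g \<in> spt \<Longrightarrow> pull (rho g) U a = a) \<Longrightarrow> a \<in> invariants U"
  unfolding invariants_def by blast

lemma pull_rho_hom:
  assumes U: "U \<in> saturated_opens" and g: "g \<in> spt"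
  shows "kalgebra_hom (sect X U) (sect X U) K (pull (rho g) U)"
  using kmorphism.pull_khom[OF rho_mor[OF g] saturated_open[OF U]] unfolding saturated_pre[OF U g] .

lemma
  assumes U: "U \<in> saturated_opens" and a: "a \<in> invariants U"
  shows invariants_add: "b \<in> invariants U \<Longrightarrow> a \<oplus>\<^bsub>sect X U\<^esub> b \<in> invariants U"
    and invariants_mult: "b \<in> invariants U \<Longrightarrow> a \<otimes>\<^bsub>sect X U\<^esub> b \<in> invariants U"
    and invariants_smult: "k \<in> K \<Longrightarrow> k \<odot>\<^bsub>sect X U\<^esub> a \<in> invariants U"
    and invariants_bracket: "b \<in> invariants U \<Longrightarrow> q U a b \<in> invariants U"
    and invariants_restr: "U' \<in> saturated_opens \<Longrightarrow> U' \<subseteq> U \<Longrightarrow> restr X U U' a \<in> invariants U'"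
proof -
  have oU: "opn X U" by (rule saturated_open[OF U])
  interpret RU: kalgebra "sect X U" K by (rule X.alg[OF oU])
  note ac = invariants_sect[OF a]
  show "a \<oplus>\<^bsub>sect X U\<^esub> b \<in> invariants U" if b: "b \<in> invariants U"
  proof (rule invariantsI)
    note bc = invariants_sect[OF b]
    show "a \<oplus>\<^bsub>sect X U\<^esub> b \<in> carrier (sect X U)" using ac bc by simp
    fix g assume g: "g \<in> spt"
    interpret h: kalgebra_hom "sect X U" "sect X U" K "pull (rho g) U" by (rule pull_rho_hom[OF U g])
    show "pull (rho g) U (a \<oplus>\<^bsub>sect X U\<^esub> b) = a \<oplus>\<^bsub>sect X U\<^esub> b"
      using h.hom_add[OF ac bc] pull_invariant[OF a g] pull_invariant[OF b g] by simp
  qed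
  show "a \<otimes>\<^bsub>sect X U\<^esub> b \<in> invariants U" if b: "b \<in> invariants U"
  proof (rule invariantsI)
    note bc = invariants_sect[OF b]
    show "a \<otimes>\<^bsub>sect X U\<^esub> b \<in> carrier (sect X U)" using ac bc by simp
    fix g assume g: "g \<in> spt"
    interpret h: kalgebra_hom "sect X U" "sect X U" K "pull (rho g) U" by (rule pull_rho_hom[OF U g])
    show "pull (rho g) U (a \<otimes>\<^bsub>sect X U\<^esub> b) = a \<otimes>\<^bsub>sect X U\<^esub> b"
      using h.hom_mult[OF ac bc] pull_invariant[OF a g] pull_invariant[OF b g] by simp
  qed
  show "k \<odot>\<^bsub>sect X U\<^esub> a \<in> invariants U" if k: "k \<in> K"
  proof (rule invariantsI)
    show "k \<odot>\<^bsub>sect X U\<^esub> a \<in> carrier (sect X U)" using ac k by simp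
    fix g assume g: "g \<in> spt"
    interpret h: kalgebra_hom "sect X U" "sect X U" K "pull (rho g) U" by (rule pull_rho_hom[OF U g])
    show "pull (rho g) U (k \<odot>\<^bsub>sect X U\<^esub> a) = k \<odot>\<^bsub>sect X U\<^esub> a"
      using h.hom_smult[OF k ac] pull_invariant[OF a g] by simp
  qed
  show "q U a b \<in> invariants U" if b: "b \<in> invariants U"
  proof (rule invariantsI)
    note bc = invariants_sect[OF b]
    show "q U a b \<in> carrier (sect X U)" by (rule P.q_closed[OF oU ac bc])
    fix g assume g: "g \<in> spt"
    have "q (pre X (rho g) U) (pull (rho g) U a) (pull (rho g) U b) = pull (rho g) U (q U a b)"
      using covariant g oU ac bc unfolding covariant_bracket_def Let_def by blast
    then show "pull (rho g) U (q U a b) = q U a b"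
      using pull_invariant[OF a g] pull_invariant[OF b g] saturated_pre[OF U g] by simp
  qed
  show "restr X U U' a \<in> invariants U'" if U': "U' \<in> saturated_opens" "U' \<subseteq> U"
  proof (rule invariantsI)
    note oU' = saturated_open[OF U'(1)]
    show "restr X U U' a \<in> carrier (sect X U')" by (rule X.restr_closed[OF oU oU' U'(2) ac])
    fix g assume g: "g \<in> spt"
    show "pull (rho g) U' (restr X U U' a) = restr X U U' a"
      using kmorphism.pull_restr[OF rho_mor[OF g] oU oU' U'(2) ac] pull_invariant[OF a g]
        saturated_pre[OF U g] saturated_pre[OF U'(1) g] by simp
  qed
qed

lemma moment_sect:
  assumes v: "v \<in> lie"
  shows "moment v \<in> carrier (sect X (pts X))"
proof -
  have "sheaf_of_algebras K V" using dual unfolding dual_space_def scheme_def by blast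
  then have "ksheaf K V" by (intro ksheaf.intro gr)
  then interpret J: kmorphism K X V J by (rule kmorphismI[OF X.ksheaf_axioms _ J])
  have "\<iota> v \<in> carrier (sect V (pts V))"
    using dual[unfolded dual_space_def is_symmetric_algebra_def linear_on_def, THEN conjunct2, THEN conjunct2,
      THEN conjunct2, THEN conjunct1, THEN conjunct1] v by blast
  from J.pull_closed[OF openin_topspace this] show ?thesis unfolding component_def J.pre_pts .
qed

lemma moment_restr: "v \<in> lie \<Longrightarrow> opn X U \<Longrightarrow> restr X (pts X) U (moment v) \<in> carrier (sect X U)"
  using X.restr_closed[OF openin_topspace _ openin_subset moment_sect] by blast

text \<open>By the hamiltonian condition the bracket with a component of J is the derivative along
  the infinitesimal action, and this annihilates invariant functions.\<close>

lemma bracket_moment_invariant: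
  assumes v: "v \<in> lie" and U: "U \<in> saturated_opens" and a: "a \<in> invariants U"
  shows "q U (restr X (pts X) U (moment v)) a = \<zero>\<^bsub>sect X U\<^esub>"
proof -
  have oU: "opn X U" by (rule saturated_open[OF U])
  have "infinitesimal_action K X G XG A v (\<lambda>U a. q U (restr X (pts X) U (moment v)) a)"
    using hamiltonian v unfolding hamiltonian_action_def by blast
  then obtain v' where v': "vertical_lift K X (gspc G) XG v v'"
    and e: "q U (restr X (pts X) U (moment v)) a =
      pull (slice (gone G)) (pre (pobj XG) A U) (v' (pre (pobj XG) A U) (pull A U a))"
    unfolding infinitesimal_action_def slice_def using oU invariants_sect[OF a] by blast
  have "vector_field K (gspc G) v" using v unfolding lie_algebra_def by (simp add: Let_def)
  then show ?thesis unfolding e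
    using v' oU saturated_pre[OF U] invariants_sect[OF a] pull_invariant[OF a] by (rule invariant_annihilated)
qed

text \<open>The elements d of the ideal whose bracket with a stays in the ideal form an ideal
  themselves: for a product x d the product rule yields {a, x} d + x {a, d}, where the first term
  needs d and the second {a, d} in the ideal. This ideal contains the generators, whose bracket with
  a is zero.\<close>

lemma bracket_genideal:
  assumes U: "U \<in> saturated_opens" and a: "a \<in> invariants U" and W: "opn X W" "W \<subseteq> U"
    and c: "c \<in> genideal (sect X W) (moments W)"
  shows "q W (restr X U W a) c \<in> genideal (sect X W) (moments W)"
proof -
  have oU: "opn X U" by (rule saturated_open[OF U])
  interpret R: kalgebra "sect X W" K by (rule X.alg[OF W(1)])
  let ?a = "restr X U W a" and ?I = "genideal (sect X W) (moments W)"
  have ac: "?a \<in> carrier (sect X W)" by (rule X.restr_closed[OF oU W invariants_sect[OF a]])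
  have S: "moments W \<subseteq> carrier (sect X W)" using moment_restr[OF _ W(1)] by blast
  interpret I: ideal ?I "sect X W" by (rule R.genideal_ideal[OF S])
  define D where "D = {d \<in> ?I. q W ?a d \<in> ?I}"
  have D: "d \<in> carrier (sect X W)" "d \<in> ?I" "q W ?a d \<in> ?I" if "d \<in> D" for d
    using that I.a_subset unfolding D_def by blast+
  have DI: "d \<in> D" if "d \<in> ?I" "q W ?a d \<in> ?I" for d
    using that unfolding D_def by blast
  have zero: "q W ?a \<zero>\<^bsub>sect X W\<^esub> = \<zero>\<^bsub>sect X W\<^esub>"
    using P.q_smult[OF W(1) ac R.zero_closed, of 0] P.q_closed[OF W(1) ac R.zero_closed] by simp
  have add: "d \<oplus>\<^bsub>sect X W\<^esub> e \<in> D" if "d \<in> D" "e \<in> D" for d e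
    using D[OF that(1)] D[OF that(2)] P.q_add[OF W(1) ac] by (intro DI) (auto intro: I.a_closed)
  have mult: "x \<otimes>\<^bsub>sect X W\<^esub> d \<in> D" if "d \<in> D" "x \<in> carrier (sect X W)" for d x
    using D[OF that(1)] that(2) P.q_leibniz[OF W(1) ac that(2)] P.q_closed[OF W(1) ac that(2)]
    by (intro DI) (auto intro: I.a_closed I.I_l_closed)
  have minus: "\<ominus>\<^bsub>sect X W\<^esub> d \<in> D" if "d \<in> D" for d
  proof -
    have "(\<ominus>\<^bsub>sect X W\<^esub> \<one>\<^bsub>sect X W\<^esub>) \<otimes>\<^bsub>sect X W\<^esub> d \<in> D" using that by (rule mult) simp
    then show ?thesis using D(1)[OF that] by (simp add: R.l_minus)
  qed
  have "ideal D (sect X W)"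
  proof (rule idealI[OF R.ring_axioms])
    show "subgroup D (add_monoid (sect X W))"
    proof (rule R.add.subgroupI)
      show "D \<subseteq> carrier (sect X W)" using D(1) by blast
      show "D \<noteq> {}" using DI[OF I.zero_closed] zero I.zero_closed by auto
    qed (use add minus in auto)
    fix d x assume dx: "d \<in> D" "x \<in> carrier (sect X W)"
    show "x \<otimes>\<^bsub>sect X W\<^esub> d \<in> D" by (rule mult[OF dx])
    then show "d \<otimes>\<^bsub>sect X W\<^esub> x \<in> D" using R.m_comm[OF dx(2) D(1)[OF dx(1)]] by simp
  qed
  moreover have "moments W \<subseteq> D"
  proof
    fix m assume m: "m \<in> moments W"
    then obtain v where v: "v \<in> lie" and mv: "m = restr X (pts X) W (moment v)" by blast
    let ?m = "restr X (pts X) U (moment v)"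
    have mc: "?m \<in> carrier (sect X U)" by (rule moment_restr[OF v oU])
    have "m = restr X U W ?m" unfolding mv
      by (rule X.restr_restr[OF openin_topspace oU W(1,2) openin_subset[OF oU] moment_sect[OF v], symmetric])
    then have "q W m ?a = restr X U W (q U ?m a)" using P.q_restr[OF oU W mc invariants_sect[OF a]] by simp
    also have "\<dots> = \<zero>\<^bsub>sect X W\<^esub>" unfolding bracket_moment_invariant[OF v U a] by (rule X.restr_zero[OF oU W])
    finally have "q W m ?a = \<zero>\<^bsub>sect X W\<^esub>" .
    then have "q W ?a m = \<zero>\<^bsub>sect X W\<^esub>" using P.q_skew[OF W(1) ac] S m by auto
    then show "m \<in> D" using R.genideal_self[OF S] m I.zero_closed by (intro DI) auto
  qed
  ultimately have "?I \<subseteq> D" by (rule R.genideal_minimal)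
  then show ?thesis using c D(3) by blast
qed

text \<open>Membership in the ideal sheaf is local, so the claim is checked on the neighbourhoods on
  which c lies in the generated ideal; the bracket commutes with restriction.\<close>

lemma bracket_momentum_ideal:
  assumes U: "U \<in> saturated_opens" and a: "a \<in> invariants U" and Z: "opn X Z" "Z \<subseteq> U"
    and c: "c \<in> momentum_ideal X (lie_algebra K G) V \<iota> J Z"
  shows "q Z (restr X U Z a) c \<in> momentum_ideal X (lie_algebra K G) V \<iota> J Z"
proof -
  have oU: "opn X U" by (rule saturated_open[OF U])
  note ac = invariants_sect[OF a]
  have az: "restr X U Z a \<in> carrier (sect X Z)" by (rule X.restr_closed[OF oU Z ac])
  have cc: "c \<in> carrier (sect X Z)" using c unfolding momentum_ideal_def by blast
  show ?thesis unfolding momentum_ideal_def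
  proof (intro CollectI conjI ballI)
    show "q Z (restr X U Z a) c \<in> carrier (sect X Z)" by (rule P.q_closed[OF Z(1) az cc])
    fix x assume "x \<in> Z"
    then obtain W where W: "opn X W" "x \<in> W" "W \<subseteq> Z" "restr X Z W c \<in> genideal (sect X W) (moments W)"
      using c unfolding momentum_ideal_def by blast
    have WU: "W \<subseteq> U" using W(3) Z(2) by blast
    have "restr X Z W (q Z (restr X U Z a) c) = q W (restr X U W a) (restr X Z W c)"
      using P.q_restr[OF Z(1) W(1,3) az cc] X.restr_restr[OF oU Z(1) W(1,3) Z(2) ac] by simp
    also have "\<dots> \<in> genideal (sect X W) (moments W)" by (rule bracket_genideal[OF U a W(1) WU W(4)])
    finally show "\<exists>W. opn X W \<and> x \<in> W \<and> W \<subseteq> Z \<and> restr X Z W (q Z (restr X U Z a) c) \<in> genideal (sect X W) (moments W)"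
      using W by blast
  qed
qed

end

section \<open>The reduced bracket on Y/G\<close>

locale momentum_reduction = hamiltonian_space K X G XG XGG A q V \<iota> J
  for K and X :: "('x, 'd) kspace" and G :: "('g, 'a, 'm, 'b, 'n, 'c) kgroup"
    and XG :: "('r, 'e, 'x, 'd, 'g, 'a) kprod" and XGG :: "('t, 'f, 'r, 'e, 'g, 'a) kprod"
    and A :: "('r, 'e, 'x, 'd) kmor" and q and V :: "('w, 'h) kspace" and \<iota> and J +
  fixes Y :: "('x, 'k) kspace" and \<rho> :: "'x set \<Rightarrow> 'd \<Rightarrow> 'k"
  assumes zero_fibre: "closed_subscheme K X (momentum_ideal X (lie_algebra K G) V \<iota> J) Y \<rho>"
begin

sublocale red: poisson_reduction K X q Y "momentum_ideal X (lie_algebra K G) V \<iota> J" \<rho> saturated_opens invariants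
proof (intro poisson_reduction.intro poisson_reduction_axioms.intro)
  show "poisson_space K X q" by (rule P.poisson_space_axioms)
  show "ksheaf K Y" using zero_fibre unfolding closed_subscheme_def by (intro ksheaf.intro gr) blast
qed (rule zero_fibre saturated_open saturated_Int invariants_sect invariants_restr invariants_add invariants_mult
    invariants_smult invariants_bracket bracket_momentum_ideal; assumption)+

abbreviation "Q \<equiv> orbit_space K X G XG A"
abbreviation "R \<equiv> reduced_space K X G XG A Y \<rho>"

definition satY :: "'x set set \<Rightarrow> 'x set" where
  "satY W = {y \<in> pts Y. \<pi> y \<in> W}"

lemma satY_sat: "satY W = sat W \<inter> pts Y"
  using red.pts_Y unfolding satY_def sat_def by blast

lemma opn_Q: "opn Q N \<Longrightarrow> sat N \<in> saturated_opens"
  unfolding orbit_space_def Let_def saturated_opens_def sat_def by (auto simp: openin_quotient_topology)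

lemma opn_Q_Int: "opn Q N \<Longrightarrow> opn Q N' \<Longrightarrow> opn Q (N \<inter> N')"
  by (rule openin_Int)

lemma carrier_Q: "carrier (sect Q N) = invariants (sat N)"
  unfolding orbit_space_def Let_def invariants_def sat_def by simp

lemma pts_R: "pts R = \<pi> ` pts Y"
  unfolding reduced_space_def Let_def by (simp add: topspace_quotient_topology)

lemma opn_R: "opn R W \<Longrightarrow> opn Y (satY W)"
  unfolding reduced_space_def Let_def satY_def by (simp add: openin_quotient_topology)

lemma satY_mono: "W' \<subseteq> W \<Longrightarrow> satY W' \<subseteq> satY W"
  unfolding satY_def by blast

lemma sect_R_simps [simp]:
  "mult (sect R W) = mult (sect Y (satY W))" "add (sect R W) = add (sect Y (satY W))"
  "zero (sect R W) = zero (sect Y (satY W))" "smult (sect R W) = smult (sect Y (satY W))"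
  "restr R W W' = restr Y (satY W) (satY W')"
  unfolding reduced_space_def Let_def satY_def by simp_all

lemma carrier_R: "s \<in> carrier (sect R W) \<longleftrightarrow> s \<in> carrier (sect Y (satY W)) \<and>
   (\<forall>w\<in>W. \<exists>N a. opn Q N \<and> w \<in> N \<and> satY N \<subseteq> satY W \<and> a \<in> invariants (sat N) \<and>
      \<rho> (sat N) a = restr Y (satY W) (satY N) s)"
  unfolding carrier_Q[symmetric] unfolding reduced_space_def Let_def satY_def sat_def by simp

text \<open>Connects the condition in the definition of the reduced space with
  \<open>represents\<close>, for the piece S that is the full trace on Y of a saturated open
  set.\<close>

lemma represents_iff:
  assumes N: "opn Q N" and a: "a \<in> invariants (sat N)" and sub: "satY N \<subseteq> satY W"
  shows "red.represents (satY W) s (sat N) (satY N) a \<longleftrightarrow> \<rho> (sat N) a = restr Y (satY W) (satY N) s"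
proof -
  note U = opn_Q[OF N]
  have o: "opn Y (satY N)" unfolding satY_sat by (rule red.opn_Y_Int[OF saturated_open[OF U]])
  have "\<rho> (sat N) a \<in> carrier (sect Y (satY N))"
    unfolding satY_sat by (rule alg_hom_closed[OF red.rho_hom[OF saturated_open[OF U]] invariants_sect[OF a]])
  then have "red.img (sat N) (satY N) a = \<rho> (sat N) a"
    unfolding red.img_def satY_sat[symmetric] by (rule red.Y.restr_id[OF o])
  then show ?thesis unfolding red.represents_def using U a o sub satY_sat by auto
qed

lemma locally_inv_R:
  assumes "opn R W" and s: "s \<in> carrier (sect R W)"
  shows "s \<in> red.locally_inv (satY W)"
proof (rule red.locally_invI)
  show "s \<in> carrier (sect Y (satY W))" using s unfolding carrier_R by blast
  fix y assume y: "y \<in> satY W"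
  then have yw: "y \<in> pts Y" "\<pi> y \<in> W" unfolding satY_def by auto
  from yw(2) obtain N a where N: "opn Q N" "\<pi> y \<in> N" "satY N \<subseteq> satY W" "a \<in> invariants (sat N)"
    "\<rho> (sat N) a = restr Y (satY W) (satY N) s" using s unfolding carrier_R by blast
  have "red.represents (satY W) s (sat N) (satY N) a" using represents_iff[OF N(1,4,3)] N(5) by blast
  moreover have "y \<in> satY N" using yw(1) N(2) unfolding satY_def by blast
  ultimately show "\<exists>U S a. y \<in> S \<and> red.represents (satY W) s U S a" by blast
qed

text \<open>Here representatives near whole orbits are required. The two neighbourhoods of an orbit
  in X/G are intersected, and the bracket of the restricted representatives represents the reduced
  bracket on the trace of the intersection.\<close>

lemma reduced_R:
  assumes W: "opn R W" and s: "s \<in> carrier (sect R W)" and t: "t \<in> carrier (sect R W)"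
  shows "red.reduced (satY W) s t \<in> carrier (sect R W)"
  unfolding carrier_R
proof (intro conjI ballI)
  note oW = opn_R[OF W] and sl = locally_inv_R[OF W s] and tl = locally_inv_R[OF W t]
  note sc = red.locally_inv_sect[OF sl] and tc = red.locally_inv_sect[OF tl]
  show "red.reduced (satY W) s t \<in> carrier (sect Y (satY W))" by (rule red.reduced_closed[OF oW sl tl])
  fix w assume w: "w \<in> W"
  obtain N a where N: "opn Q N" "w \<in> N" "satY N \<subseteq> satY W" "a \<in> invariants (sat N)"
    "\<rho> (sat N) a = restr Y (satY W) (satY N) s" using s w unfolding carrier_R by blast
  obtain N' b where N': "opn Q N'" "w \<in> N'" "satY N' \<subseteq> satY W" "b \<in> invariants (sat N')"
    "\<rho> (sat N') b = restr Y (satY W) (satY N') t" using t w unfolding carrier_R by blast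
  have rs: "red.represents (satY W) s (sat N) (satY N) a" using represents_iff[OF N(1,4,3)] N(5) by blast
  have rt: "red.represents (satY W) t (sat N') (satY N') b" using represents_iff[OF N'(1,4,3)] N'(5) by blast
  let ?M = "N \<inter> N'"
  have M: "opn Q ?M" "sat ?M = sat N \<inter> sat N'" "satY ?M = satY N \<inter> satY N'"
    using opn_Q_Int[OF N(1) N'(1)] by (auto simp: sat_def satY_def)
  obtain a' b' where r: "red.represents (satY W) s (sat ?M) (satY ?M) a'" "red.represents (satY W) t (sat ?M) (satY ?M) b'"
    using red.represents_join[OF oW sc tc rs rt] unfolding M(2,3) by blast
  have rr: "red.represents (satY W) (red.reduced (satY W) s t) (sat ?M) (satY ?M) (q (sat ?M) a' b')"
    by (rule red.represents_reduced[OF oW sl tl r])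
  have inv: "q (sat ?M) a' b' \<in> invariants (sat ?M)" and sub: "satY ?M \<subseteq> satY W"
    using rr unfolding red.represents_def by auto
  show "\<exists>N a. opn Q N \<and> w \<in> N \<and> satY N \<subseteq> satY W \<and> a \<in> invariants (sat N) \<and>
      \<rho> (sat N) a = restr Y (satY W) (satY N) (red.reduced (satY W) s t)"
    using M(1) N(2) N'(2) sub inv rr represents_iff[OF M(1) inv sub] by blast
qed

abbreviation q_red :: "'x set set \<Rightarrow> 'k \<Rightarrow> 'k \<Rightarrow> 'k" where
  "q_red W \<equiv> red.reduced (satY W)"

text \<open>The negative in the record \<open>sect R W\<close> is a description over the carrier of
  that record, which is smaller than the one for Y. It agrees with the negative in Y because the
  reduced bracket with exchanged arguments lies in the smaller carrier.\<close>

lemma q_red_skew_R: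
  assumes W: "opn R W" and s: "s \<in> carrier (sect R W)" and t: "t \<in> carrier (sect R W)"
  shows "q_red W s t = \<ominus>\<^bsub>sect R W\<^esub> q_red W t s"
proof -
  note oW = opn_R[OF W] and sl = locally_inv_R[OF W s] and tl = locally_inv_R[OF W t]
  interpret RW: kalgebra "sect Y (satY W)" K by (rule red.Y.alg[OF oW])
  note st = red.reduced_closed[OF oW sl tl] and ts = red.reduced_closed[OF oW tl sl]
  have e: "q_red W s t = \<ominus>\<^bsub>sect Y (satY W)\<^esub> q_red W t s" by (rule red.reduced_skew[OF oW sl tl])
  have z: "q_red W t s \<oplus>\<^bsub>sect Y (satY W)\<^esub> q_red W s t = \<zero>\<^bsub>sect Y (satY W)\<^esub>"
    "q_red W s t \<oplus>\<^bsub>sect Y (satY W)\<^esub> q_red W t s = \<zero>\<^bsub>sect Y (satY W)\<^esub>"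
    unfolding e using ts by (simp_all add: RW.r_neg RW.l_neg)
  have "(THE r. r \<in> carrier (sect R W) \<and> q_red W t s \<oplus>\<^bsub>sect Y (satY W)\<^esub> r = \<zero>\<^bsub>sect Y (satY W)\<^esub> \<and>
      r \<oplus>\<^bsub>sect Y (satY W)\<^esub> q_red W t s = \<zero>\<^bsub>sect Y (satY W)\<^esub>) = q_red W s t"
  proof (rule the_equality)
    show "q_red W s t \<in> carrier (sect R W) \<and> q_red W t s \<oplus>\<^bsub>sect Y (satY W)\<^esub> q_red W s t = \<zero>\<^bsub>sect Y (satY W)\<^esub> \<and>
      q_red W s t \<oplus>\<^bsub>sect Y (satY W)\<^esub> q_red W t s = \<zero>\<^bsub>sect Y (satY W)\<^esub>" using z reduced_R[OF W s t] by blast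
    fix r assume r: "r \<in> carrier (sect R W) \<and> q_red W t s \<oplus>\<^bsub>sect Y (satY W)\<^esub> r = \<zero>\<^bsub>sect Y (satY W)\<^esub> \<and>
      r \<oplus>\<^bsub>sect Y (satY W)\<^esub> q_red W t s = \<zero>\<^bsub>sect Y (satY W)\<^esub>"
    then have rc: "r \<in> carrier (sect Y (satY W))" unfolding carrier_R by blast
    show "r = q_red W s t" using RW.minus_equality[OF _ ts rc] r e by simp
  qed
  then show ?thesis by (simp add: a_inv_def m_inv_def)
qed

lemma biderivation_q_red: "biderivation K R q_red"
  unfolding biderivation_def
proof (intro conjI allI ballI impI)
  fix W s assume W: "opn R W" and s: "s \<in> carrier (sect R W)"
  note oW = opn_R[OF W] and sl = locally_inv_R[OF W s]
  interpret RW: kalgebra "sect Y (satY W)" K by (rule red.Y.alg[OF oW])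
  have skew: "q_red W t s = \<ominus>\<^bsub>sect Y (satY W)\<^esub> q_red W s t" if "t \<in> red.locally_inv (satY W)" for t
    by (rule red.reduced_skew[OF oW that sl])
  have cl: "q_red W s t \<in> carrier (sect Y (satY W))" if "t \<in> red.locally_inv (satY W)" for t
    by (rule red.reduced_closed[OF oW sl that])
  show "linear_on K (sect R W) (sect R W) (\<lambda>t. q_red W s t)"
    unfolding linear_on_def sect_R_simps
    using reduced_R[OF W s] red.reduced_add[OF oW sl] red.reduced_smult[OF oW sl] locally_inv_R[OF W] by blast
  \<comment> \<open>The first argument is treated by skew-symmetry, with negatives taken in the full
    algebra of sections of Y, where the ring laws are known.\<close>
  show "linear_on K (sect R W) (sect R W) (\<lambda>t. q_red W t s)"
    unfolding linear_on_def sect_R_simps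
  proof (intro conjI ballI)
    show "(\<lambda>t. q_red W t s) \<in> carrier (sect R W) \<rightarrow> carrier (sect R W)" using reduced_R[OF W _ s] by blast
    fix t assume "t \<in> carrier (sect R W)"
    note t = locally_inv_R[OF W this]
    show "q_red W (t \<oplus>\<^bsub>sect Y (satY W)\<^esub> u) s = q_red W t s \<oplus>\<^bsub>sect Y (satY W)\<^esub> q_red W u s"
      if "u \<in> carrier (sect R W)" for u
      using skew[OF red.locally_inv_add[OF oW t]] skew[OF t] skew red.reduced_add[OF oW sl t] locally_inv_R[OF W that]
        cl[OF t] cl by (simp add: RW.minus_add)
    show "q_red W (k \<odot>\<^bsub>sect Y (satY W)\<^esub> t) s = k \<odot>\<^bsub>sect Y (satY W)\<^esub> q_red W t s" if "k \<in> K" for k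
      using skew[OF red.locally_inv_smult[OF oW t t that]] skew[OF t] red.reduced_smult[OF oW sl t that] cl[OF t] that
      by (simp add: RW.sm_uminus1[symmetric] RW.sm_assoc[symmetric] mult.commute)
  qed
  fix t u assume tu: "t \<in> carrier (sect R W)" "u \<in> carrier (sect R W)"
  note t = locally_inv_R[OF W tu(1)] and u = locally_inv_R[OF W tu(2)]
  note tc = red.locally_inv_sect[OF t] and uc = red.locally_inv_sect[OF u]
  show m: "q_red W s (t \<otimes>\<^bsub>sect R W\<^esub> u) = (q_red W s t \<otimes>\<^bsub>sect R W\<^esub> u) \<oplus>\<^bsub>sect R W\<^esub> (t \<otimes>\<^bsub>sect R W\<^esub> q_red W s u)"
    unfolding sect_R_simps by (rule red.reduced_mult[OF oW sl t u])
  show "q_red W (t \<otimes>\<^bsub>sect R W\<^esub> u) s = (q_red W t s \<otimes>\<^bsub>sect R W\<^esub> u) \<oplus>\<^bsub>sect R W\<^esub> (t \<otimes>\<^bsub>sect R W\<^esub> q_red W u s)"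
    using m skew[OF red.locally_inv_mult[OF oW t u]] skew[OF t] skew[OF u] cl[OF t] cl[OF u] tc uc
    by (simp add: RW.minus_add RW.l_minus RW.r_minus)
next
  fix W W' s t assume "opn R W \<and> opn R W' \<and> W' \<subseteq> W" and st: "s \<in> carrier (sect R W)" "t \<in> carrier (sect R W)"
  then have W: "opn R W" "opn R W'" "W' \<subseteq> W" by auto
  show "q_red W' (restr R W W' s) (restr R W W' t) = restr R W W' (q_red W s t)" unfolding sect_R_simps
    by (rule red.reduced_restr[OF opn_R[OF W(1)] opn_R[OF W(2)] satY_mono[OF W(3)] locally_inv_R[OF W(1) st(1)] locally_inv_R[OF W(1) st(2)]])
qed

lemma poisson_bracket_q_red: "poisson_bracket K R q_red"
  unfolding poisson_bracket_def
proof (intro conjI allI ballI impI)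
  fix W s t assume W: "opn R W" and st: "s \<in> carrier (sect R W)" "t \<in> carrier (sect R W)"
  show "q_red W s t = \<ominus>\<^bsub>sect R W\<^esub> q_red W t s" by (rule q_red_skew_R[OF W st])
  fix u assume u: "u \<in> carrier (sect R W)"
  show "q_red W s (q_red W t u) \<oplus>\<^bsub>sect R W\<^esub> q_red W t (q_red W u s) \<oplus>\<^bsub>sect R W\<^esub> q_red W u (q_red W s t) = \<zero>\<^bsub>sect R W\<^esub>"
    unfolding sect_R_simps
    by (rule red.reduced_jacobi[OF opn_R[OF W] locally_inv_R[OF W st(1)] locally_inv_R[OF W st(2)] locally_inv_R[OF W u]])
qed (rule biderivation_q_red)

text \<open>An open set W of X/G is cut down to the orbits that meet Y; its preimage in Y is then
  the trace on Y of the preimage of W in X.\<close>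

lemma q_red_rho:
  assumes W: "opn Q W" and a: "a \<in> carrier (sect Q W)" and b: "b \<in> carrier (sect Q W)"
  shows "q_red (W \<inter> pts R) (\<rho> (sat W) a) (\<rho> (sat W) b) = \<rho> (sat W) (q (sat W) a b)"
proof -
  have "satY (W \<inter> pts R) = sat W \<inter> pts Y"
    unfolding satY_sat[symmetric] pts_R satY_def by blast
  then show ?thesis using red.reduced_rho[OF opn_Q[OF W]] a b unfolding carrier_Q by simp
qed

end

theorem proposition1:
  fixes K :: "complex set"
    and X :: "('x, 'd) kspace"
    and q :: "'x set \<Rightarrow> 'd \<Rightarrow> 'd \<Rightarrow> 'd"
    and G :: "('g, 'a, 'm, 'b, 'n, 'c) kgroup"
    and XG :: "('r, 'e, 'x, 'd, 'g, 'a) kprod"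
    and XGG :: "('t, 'f, 'r, 'e, 'g, 'a) kprod"
    and A :: "('r, 'e, 'x, 'd) kmor"
    and V :: "('w, 'h) kspace"
    and \<iota> :: "('g set \<Rightarrow> 'a \<Rightarrow> 'a) \<Rightarrow> 'h"
    and J :: "('x, 'd, 'w, 'h) kmor"
    and Y :: "('x, 'k) kspace"
    and \<rho> :: "'x set \<Rightarrow> 'd \<Rightarrow> 'k"
  assumes "K = \<real> \<or> K = UNIV"
    and "algebraic_scheme K X"
    and "poisson_bracket K X q"
    and "algebraic_group K G"
    and "algebraic_action K X G XG XGG A"
    and "covariant_bracket K X G XG A q"
    and "dual_space K (lie_algebra K G) V \<iota>"
    and "morphism K X V J"
    and "equivariant_momentum K X G XG A V \<iota> J"
    and "hamiltonian_action K X G XG A q V \<iota> J"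
    and "closed_subscheme K X (momentum_ideal X (lie_algebra K G) V \<iota> J) Y \<rho>"
  shows "\<exists>q_red. biderivation K (reduced_space K X G XG A Y \<rho>) q_red \<and>
    (\<forall>W. opn (orbit_space K X G XG A) W \<longrightarrow>
      (\<forall>a \<in> carrier (sect (orbit_space K X G XG A) W).
       \<forall>b \<in> carrier (sect (orbit_space K X G XG A) W).
         let U = {x \<in> pts X. orbit K X G XG A x \<in> W};
             W\<^sub>Y = W \<inter> pts (reduced_space K X G XG A Y \<rho>)
         in q_red W\<^sub>Y (\<rho> U a) (\<rho> U b) = \<rho> U (q U a b))) \<and>
    poisson_bracket K (reduced_space K X G XG A Y \<rho>) q_red"
proof -
  interpret momentum_reduction K X G XG XGG A q V \<iota> J Y \<rho>
    by unfold_locales (fact assms)+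
  show ?thesis
    by (intro exI[of _ q_red] conjI biderivation_q_red poisson_bracket_q_red)
      (use q_red_rho in \<open>auto simp: Let_def sat_def\<close>)
qed

end
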